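(* Let $\alpha\in\mathbf{R}$ and $\beta<0$, and let $Z$ be either $\mathbf{R}$ or $\mathbf{T}$. There exists $C>0$ depending only on $\alpha,\beta$ (and unbounded as $\beta\to0$) such that the following holds. Let $u$ be a smooth solution on $[0,T]\times Z$ of $$\partial_tu-i\partial_x^2u=\alpha\,\partial_x\big[|u|^2u\big]+\beta\,\partial_x\big[\mathcal{H}(|u|^2)u\big],\qquad u(0,\cdot)=\phi.$$ If $Z=\mathbf{R}$, then for all $t\in[0,T]$, $$\int_0^t\big\|D_x^{\frac12}\partial_x(|u(t')|^2)\big\|_{L^2}^2\,dt'\le C\big(1+\|\phi\|_{L^2}^4\big)\|\phi_x\|_{L^2}^2\,e^{C(1+\|\phi\|_{L^2}^6)\|\phi\|_{L^2}^2},$$ $$\|u_x(t)\|_{L^2}^2\le C\big(1+\|\phi\|_{L^2}^8\big)\|\phi_x\|_{L^2}^2\,e^{C(1+\|\phi\|_{L^2}^6)\|\phi\|_{L^2}^2},$$ $$\|u(t)\|_{L^2}^2\ge\|\phi\|_{L^2}^2\exp\Big[-Ct^{1/2}\big(1+\|\phi\|_{L^2}^2\big)\|\phi_x\|_{L^2}\,e^{C(1+\|\phi\|_{L^2}^6)\|\phi\|_{L^2}^2}\Big].$$ If $Z=\mathbf{T}$, the same three estimates hold with $\|\phi_x\|_{L^2}$ replaced by $\|\phi\|_{H^1}$.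
   Context: $\mathbf{T}=\mathbf{R}/2\pi\mathbf{Z}$; $u$ is complex-valued; $\mathcal{H}$ is the Hilbert transformation on $Z$, i.e. the Fourier multiplier with symbol $-i\,\mathrm{sgn}(\xi)$ ($\mathrm{sgn}(0)=0$); $D_x=|\partial_x|=\mathcal{H}\partial_x$ is the Fourier multiplier with symbol $|\xi|$ and $D_x^{1/2}$ the one with symbol $|\xi|^{1/2}$. "Smooth solution" means $u\in C^\infty([0,T];H^\infty(Z))$, $H^\infty=\bigcap_sH^s$, satisfying the equation classically. *)

theory Defs
  imports "HOL-Analysis.Analysis"
begin

datatype domain = Line | Circle

text \<open>
  Functions on the circle R/2piZ are 2pi-periodic functions on the reals, integrated over
  one period. Frequencies range over the reals for the line and over the integers
  (embedded into the reals) for the circle. With the transform normalised as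
  (F f)(xi) = integral of f(x) exp(-i xi x) dx in both cases, Plancherel's identity and the
  inversion formula both carry the factor 1/(2 pi).
\<close>

fun function_on :: "domain \<Rightarrow> (real \<Rightarrow> complex) \<Rightarrow> bool" where
  "function_on Line f = True"
| "function_on Circle f = (\<forall>x. f (x + 2 * pi) = f x)"

fun space_measure :: "domain \<Rightarrow> real measure" where
  "space_measure Line = lborel"
| "space_measure Circle = restrict_space lborel {0..<2 * pi}"

fun freq_measure :: "domain \<Rightarrow> real measure" where
  "freq_measure Line = lborel"
| "freq_measure Circle = count_space \<int>"

definition square_integrable :: "real measure \<Rightarrow> (real \<Rightarrow> complex) \<Rightarrow> bool" where
  "square_integrable M f \<longleftrightarrow>
     f \<in> borel_measurable M \<and> integrable M (\<lambda>x. (cmod (f x))\<^sup>2)"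

definition L2 :: "domain \<Rightarrow> (real \<Rightarrow> complex) set" where
  "L2 Z = {f. function_on Z f \<and> square_integrable (space_measure Z) f}"

definition L2_norm :: "domain \<Rightarrow> (real \<Rightarrow> complex) \<Rightarrow> real" where
  "L2_norm Z f = sqrt (LINT x|space_measure Z. (cmod (f x))\<^sup>2)"

text \<open>
  On the line, a function in L2 need not be integrable, so its transform is the L2-limit of
  the transforms of its truncations to [-N, N]. It is determined up to a null set, and
  is used below only under integrals over the frequency.
\<close>

fun fourier :: "domain \<Rightarrow> (real \<Rightarrow> complex) \<Rightarrow> real \<Rightarrow> complex" where
  "fourier Line f = (SOME g. square_integrable lborel g \<and>
     ((\<lambda>N::real. \<integral>\<^sup>+\<xi>. ennreal ((cmod ((LINT x:{-N..N}|lborel. f x * cis (- (\<xi> * x))) - g \<xi>))\<^sup>2)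
        \<partial>lborel) \<longlongrightarrow> 0) at_top)"
| "fourier Circle f = (\<lambda>\<xi>. LINT x|space_measure Circle. f x * cis (- (\<xi> * x)))"

definition sobolev_norm :: "domain \<Rightarrow> real \<Rightarrow> (real \<Rightarrow> complex) \<Rightarrow> real" where
  "sobolev_norm Z s f =
     sqrt (1 / (2 * pi) * (LINT \<xi>|freq_measure Z. (1 + \<xi>\<^sup>2) powr s * (cmod (fourier Z f \<xi>))\<^sup>2))"

text \<open>The Sobolev space of order s, for s at least 0 (so that it is contained in L2).\<close>

definition sobolev :: "domain \<Rightarrow> real \<Rightarrow> (real \<Rightarrow> complex) set" where
  "sobolev Z s = {f \<in> L2 Z.
     integrable (freq_measure Z) (\<lambda>\<xi>. (1 + \<xi>\<^sup>2) powr s * (cmod (fourier Z f \<xi>))\<^sup>2)}"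

definition sobolev_inf :: "domain \<Rightarrow> (real \<Rightarrow> complex) set" where
  "sobolev_inf Z = (\<Inter>s\<in>{0..}. sobolev Z s)"

text \<open>
  For f in every Sobolev space and a symbol m of polynomial growth the integral (on the
  circle: the Fourier series) converges absolutely, and the formula yields the continuous
  representative of m(D) f.
\<close>

definition fourier_multiplier ::
    "domain \<Rightarrow> (real \<Rightarrow> complex) \<Rightarrow> (real \<Rightarrow> complex) \<Rightarrow> real \<Rightarrow> complex" where
  "fourier_multiplier Z m f x =
     1 / (2 * pi) * (LINT \<xi>|freq_measure Z. m \<xi> * fourier Z f \<xi> * cis (\<xi> * x))"

definition hilbert :: "domain \<Rightarrow> (real \<Rightarrow> complex) \<Rightarrow> real \<Rightarrow> complex" where
  "hilbert Z = fourier_multiplier Z (\<lambda>\<xi>. - \<i> * complex_of_real (sgn \<xi>))"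

definition D_half :: "domain \<Rightarrow> (real \<Rightarrow> complex) \<Rightarrow> real \<Rightarrow> complex" where
  "D_half Z = fourier_multiplier Z (\<lambda>\<xi>. complex_of_real (\<bar>\<xi>\<bar> powr (1/2)))"

definition dx :: "(real \<Rightarrow> complex) \<Rightarrow> real \<Rightarrow> complex" where
  "dx f x = vector_derivative f (at x)"

definition density_of :: "(real \<Rightarrow> complex) \<Rightarrow> real \<Rightarrow> complex" where
  "density_of f x = complex_of_real ((cmod (f x))\<^sup>2)"

text \<open>
  Infinitely differentiable maps from [0, T] into the intersection of all Sobolev spaces
  with its Frechet topology: v k is the k-th time derivative, the difference
  quotients converging in every Sobolev norm (one-sidedly at the end points).
\<close>

definition smooth_curve :: "domain \<Rightarrow> real \<Rightarrow> (real \<Rightarrow> real \<Rightarrow> complex) \<Rightarrow> bool" where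
  "smooth_curve Z T u \<longleftrightarrow> (\<exists>v :: nat \<Rightarrow> real \<Rightarrow> real \<Rightarrow> complex. v 0 = u \<and>
     (\<forall>k. \<forall>t\<in>{0..T}. v k t \<in> sobolev_inf Z \<and>
       (\<forall>s\<ge>0. ((\<lambda>t'. sobolev_norm Z s
            (\<lambda>x. (v k t' x - v k t x) / complex_of_real (t' - t) - v (Suc k) t x)) \<longlongrightarrow> 0)
          (at t within {0..T}))))"

text \<open>
  Requiring u t to be differentiable everywhere selects the smooth representative of its
  almost-everywhere class, for which the equation is then required pointwise.
\<close>

definition smooth_solution ::
    "domain \<Rightarrow> real \<Rightarrow> real \<Rightarrow> real \<Rightarrow> (real \<Rightarrow> complex) \<Rightarrow> (real \<Rightarrow> real \<Rightarrow> complex) \<Rightarrow> bool" where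
  "smooth_solution Z \<alpha> \<beta> T \<phi> u \<longleftrightarrow>
     smooth_curve Z T u \<and> u 0 = \<phi> \<and>
     (\<forall>t\<in>{0..T}. \<forall>x. u t differentiable (at x) \<and>
       (\<exists>ut uxx P Q.
          ((\<lambda>t'. u t' x) has_vector_derivative ut) (at t within {0..T}) \<and>
          (dx (u t) has_vector_derivative uxx) (at x) \<and>
          ((\<lambda>y. density_of (u t) y * u t y) has_vector_derivative P) (at x) \<and>
          ((\<lambda>y. hilbert Z (density_of (u t)) y * u t y) has_vector_derivative Q) (at x) \<and>
          ut - \<i> * uxx = complex_of_real \<alpha> * P + complex_of_real \<beta> * Q))"

definition data_norm :: "domain \<Rightarrow> (real \<Rightarrow> complex) \<Rightarrow> real" where
  "data_norm Z \<phi> = (case Z of Line \<Rightarrow> L2_norm Line (dx \<phi>) | Circle \<Rightarrow> sobolev_norm Circle 1 \<phi>)"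

end

theory Submission
  imports Defs
begin

text \<open>
  Write u = p + i q, rho = |u|^2, F = alpha rho + beta H(rho) and J = Im(conj(u) u_x). The equation reads
  u_t = i u_xx + (F u)_x, and it gives rho_t = -2 J_x + 2 F_x rho + F rho_x. Integrating,
  the mass M (the squared L2 norm of u) satisfies M' = beta hs(rho), where hs(f) is the square of the
  L2 norm of the half derivative of f; since beta < 0 the mass decreases, and its decrease pays for
  the time integral of hs(rho).

  The derivative of the L2 norm of u_x contains terms such as the integral of F_x |u_x|^2, which have
  no sign and are not controlled. They disappear in the gauged derivative w = u_x - (3/4) i F u:
  up to total derivatives
    d/dt |w|^2 = (beta/4) hs(rho_x) + 3 beta hs(J) + sextic + octic,
  where the last two are integrals of degree six and eight in u (lemma energy_identity).
  The first two terms are a second dissipation with the good sign. Every factor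
  of the sextic and octic terms is interpolated between the mass, the gauged energy E^2 = |w|^2
  (plus the mass, on the circle), hs(rho), hs(rho_x) and hs(J); Young's inequality with weights chosen so that exactly
  one factor hs(rho) is left over yields
    d/dt E^2 <= (beta/8) hs(rho_x) + K (1 + M)^3 E^2 hs(rho)
  (theorem energy_dissipation). Since beta hs(rho) = M', the function
  G = E^2 exp(K (1 + M_0)^3 M / |beta|) satisfies G' <= (beta/8) hs(rho_x). This bounds the time
  integral of hs(rho_x) and, because E and |u_x| are comparable with constants polynomial in the mass,
  also u_x. For the lower bound on the mass, hs(rho) <= 2 M hs(rho_x)^(1/2), so the logarithmic rate
  of decrease of M is at most 2 |beta| hs(rho_x)^(1/2), which is integrated in time by the Cauchy-Schwarz
  inequality (lemma dissipative_system_bounds).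

  The circle differs from the line by the zero frequency: homogeneous half-derivative norms do not
  see the mean of a function, so rho and J are split into mean and fluctuation.

  The first half of the text provides the analysis behind this computation, for both domains at
  once: the Plancherel theorem (on the circle by Weierstrass approximation, on the line by
  periodisation), Fourier inversion, a class SS of real smooth functions closed under products,
  derivatives and the Hilbert transform, and interpolation inequalities for half derivatives. The time
  derivatives are justified in the first-order Sobolev norm, in which products are continuous.
\<close>


section \<open>Square-integrable functions\<close>

text \<open>
  The optimal s is sqrt (B / A); the degenerate cases follow by letting s tend to 0 or infinity. In
  this form an inequality with a free scale, such as a splitting frequency, becomes a geometric
  mean.
\<close>

lemma le_sqrt_mult_of_scaling:
  fixes A B P :: real
  assumes "A \<ge> 0" "B \<ge> 0" and bound: "\<And>s. s > 0 \<Longrightarrow> 2 * P \<le> s * A + B / s"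
  shows "P \<le> sqrt A * sqrt B"
proof -
  consider "A = 0" | "B = 0" | "A > 0" "B > 0" using assms(1,2) by linarith
  then show ?thesis
  proof cases
    case 1
    have "P \<le> e" if "e > 0" for e
    proof -
      have "2 * P \<le> B / ((B + 1) / e)" using bound[of "(B + 1) / e"] 1 that assms by simp
      also have "\<dots> \<le> e" using that assms(2) by (simp add: field_simps)
      finally show ?thesis using that by simp
    qed
    then show ?thesis using 1 by (simp add: field_le_epsilon)
  next
    case 2
    have "P \<le> e" if "e > 0" for e
    proof -
      have "2 * P \<le> (e / (A + 1)) * A" using bound[of "e / (A + 1)"] 2 that assms by simp
      also have "\<dots> \<le> e" using that assms(1) by (simp add: field_simps)
      finally show ?thesis using that by simp
    qed
    then show ?thesis using 2 by (simp add: field_le_epsilon)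
  next
    case 3
    have "2 * P \<le> (sqrt B / sqrt A) * A + B / (sqrt B / sqrt A)"
      using bound[of "sqrt B / sqrt A"] 3 by simp
    also have "(sqrt B / sqrt A) * A = sqrt A * sqrt B"
      using 3 by (simp add: field_simps)
    also have "B / (sqrt B / sqrt A) = sqrt A * sqrt B"
      using 3 by (simp add: field_simps)
    finally show ?thesis by simp
  qed
qed

lemma integrable_mult_L2:
  fixes f g :: "'a \<Rightarrow> 'b::{real_normed_field,banach,second_countable_topology}"
  assumes [measurable]: "f \<in> borel_measurable M" "g \<in> borel_measurable M"
    and "integrable M (\<lambda>x. (norm (f x))\<^sup>2)" "integrable M (\<lambda>x. (norm (g x))\<^sup>2)"
  shows "integrable M (\<lambda>x. f x * g x)"
proof (rule Bochner_Integration.integrable_bound)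
  show "integrable M (\<lambda>x. (norm (f x))\<^sup>2 + (norm (g x))\<^sup>2)" using assms by simp
  show "AE x in M. norm (f x * g x) \<le> norm ((norm (f x))\<^sup>2 + (norm (g x))\<^sup>2)"
  proof (intro AE_I2)
    fix x
    have "norm (f x) * norm (g x) \<le> (norm (f x))\<^sup>2 + (norm (g x))\<^sup>2"
      using sum_squares_bound[of "norm (f x)" "norm (g x)"]
        mult_nonneg_nonneg[OF norm_ge_zero[of "f x"] norm_ge_zero[of "g x"]] by linarith
    then show "norm (f x * g x) \<le> norm ((norm (f x))\<^sup>2 + (norm (g x))\<^sup>2)"
      by (simp add: norm_mult)
  qed
qed measurable

lemma Cauchy_Schwarz_integral:
  fixes f g :: "'a \<Rightarrow> 'b::{real_normed_field,banach,second_countable_topology}"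
  assumes [measurable]: "f \<in> borel_measurable M" "g \<in> borel_measurable M"
    and f: "integrable M (\<lambda>x. (norm (f x))\<^sup>2)" and g: "integrable M (\<lambda>x. (norm (g x))\<^sup>2)"
  shows "(LINT x|M. norm (f x) * norm (g x)) \<le> sqrt (LINT x|M. (norm (f x))\<^sup>2) * sqrt (LINT x|M. (norm (g x))\<^sup>2)"
proof (rule le_sqrt_mult_of_scaling)
  fix s :: real assume s: "s > 0"
  have int: "integrable M (\<lambda>x. norm (f x) * norm (g x))"
    using integrable_norm[OF integrable_mult_L2[OF assms]] by (simp add: norm_mult)
  have "2 * (LINT x|M. norm (f x) * norm (g x)) = (LINT x|M. 2 * (norm (f x) * norm (g x)))"
    by simp
  also have "\<dots> \<le> (LINT x|M. s * (norm (f x))\<^sup>2 + (norm (g x))\<^sup>2 / s)"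
  proof (rule integral_mono)
    fix x
    have "0 \<le> (s * norm (f x) - norm (g x))\<^sup>2 / s" using s by simp
    also have "\<dots> = s * (norm (f x))\<^sup>2 + (norm (g x))\<^sup>2 / s - 2 * (norm (f x) * norm (g x))"
      using s by (simp add: power2_eq_square field_simps)
    finally show "2 * (norm (f x) * norm (g x)) \<le> s * (norm (f x))\<^sup>2 + (norm (g x))\<^sup>2 / s" by simp
  qed (use int f g in auto)
  also have "\<dots> = s * (LINT x|M. (norm (f x))\<^sup>2) + (LINT x|M. (norm (g x))\<^sup>2) / s"
    using f g by simp
  finally show "2 * (LINT x|M. norm (f x) * norm (g x)) \<le> s * (LINT x|M. (norm (f x))\<^sup>2) + (LINT x|M. (norm (g x))\<^sup>2) / s" .
qed auto

lemma norm_add_square_le: "(norm (a + b :: 'a::real_normed_vector))\<^sup>2 \<le> 2 * (norm a)\<^sup>2 + 2 * (norm b)\<^sup>2"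
proof -
  have "(norm (a + b))\<^sup>2 \<le> (norm a + norm b)\<^sup>2" by (intro power_mono norm_triangle_ineq) auto
  also have "\<dots> \<le> 2 * (norm a)\<^sup>2 + 2 * (norm b)\<^sup>2"
    using sum_squares_bound[of "norm a" "norm b"] by (simp add: power2_sum)
  finally show ?thesis .
qed

lemma square_integrable_add:
  assumes "square_integrable M f" "square_integrable M g"
  shows "square_integrable M (\<lambda>x. f x + g x)"
  unfolding square_integrable_def
proof
  have [measurable]: "f \<in> borel_measurable M" "g \<in> borel_measurable M"
    using assms by (auto simp: square_integrable_def)
  show "(\<lambda>x. f x + g x) \<in> borel_measurable M" by measurable
  show "integrable M (\<lambda>x. (cmod (f x + g x))\<^sup>2)"
  proof (rule Bochner_Integration.integrable_bound)
    show "integrable M (\<lambda>x. 2 * (cmod (f x))\<^sup>2 + 2 * (cmod (g x))\<^sup>2)"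
      using assms by (auto simp: square_integrable_def)
  qed (use norm_add_square_le in auto)
qed

lemma square_integrable_scale:
  assumes "square_integrable M f"
  shows "square_integrable M (\<lambda>x. c * f x)"
  using assms by (auto simp: square_integrable_def norm_mult power_mult_distrib)

lemma square_integrable_diff:
  assumes "square_integrable M f" "square_integrable M g"
  shows "square_integrable M (\<lambda>x. f x - g x)"
  using square_integrable_add[OF assms(1) square_integrable_scale[OF assms(2), of "-1"]] by simp

lemma square_integrable_bounded_mult:
  assumes "square_integrable M f" and [measurable]: "g \<in> borel_measurable M"
    and "\<And>x. cmod (g x) \<le> B"
  shows "square_integrable M (\<lambda>x. g x * f x)"
  unfolding square_integrable_def
proof
  have [measurable]: "f \<in> borel_measurable M"
    using assms by (auto simp: square_integrable_def)
  show "(\<lambda>x. g x * f x) \<in> borel_measurable M" by measurable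
  show "integrable M (\<lambda>x. (cmod (g x * f x))\<^sup>2)"
  proof (rule Bochner_Integration.integrable_bound)
    show "integrable M (\<lambda>x. B\<^sup>2 * (cmod (f x))\<^sup>2)"
      using assms by (auto simp: square_integrable_def)
    show "AE x in M. norm ((cmod (g x * f x))\<^sup>2) \<le> norm (B\<^sup>2 * (cmod (f x))\<^sup>2)"
      by (intro AE_I2) (auto simp: norm_mult power_mult_distrib intro!: mult_right_mono power_mono assms)
  qed auto
qed

section \<open>Trigonometric polynomials\<close>

inductive trig_poly :: "(real \<Rightarrow> complex) \<Rightarrow> bool" where
  monomial: "trig_poly (\<lambda>x. c * cis (of_int n * x))"
| add: "trig_poly f \<Longrightarrow> trig_poly g \<Longrightarrow> trig_poly (\<lambda>x. f x + g x)"

lemma trig_poly_const: "trig_poly (\<lambda>x. c)"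
  using trig_poly.monomial[of c 0] by simp

lemma trig_poly_mult:
  assumes "trig_poly f" "trig_poly g"
  shows "trig_poly (\<lambda>x. f x * g x)"
  using assms(1)
proof induction
  case (monomial c n)
  show ?case using assms(2)
  proof induction
    case (monomial d m)
    have "(\<lambda>x. c * cis (of_int n * x) * (d * cis (of_int m * x))) = (\<lambda>x. (c * d) * cis (of_int (n + m) * x))"
      by (auto simp: fun_eq_iff distrib_right cis_mult[symmetric])
    then show ?case using trig_poly.monomial by metis
  next
    case (add f g)
    then show ?case using trig_poly.add by (simp add: distrib_left)
  qed
next
  case (add f h)
  then show ?case using trig_poly.add by (simp add: distrib_right)
qed

text \<open>
  A linear function of the real and imaginary part of a point cis x of the circle is a combination
  of cis x and cis (-x).
\<close>

lemma trig_poly_of_real_polynomial: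
  assumes "real_polynomial_function p"
  shows "trig_poly (\<lambda>x. complex_of_real (p (cis x)))"
  using assms
proof induction
  case (linear f)
  then interpret bounded_linear f .
  have "complex_of_real (f (cis x)) =
     (of_real (f 1) / 2 - \<i> * of_real (f \<i>) / 2) * cis (of_int 1 * x)
     + (of_real (f 1) / 2 + \<i> * of_real (f \<i>) / 2) * cis (of_int (-1) * x)" for x
  proof -
    have "cis x = cos x *\<^sub>R 1 + sin x *\<^sub>R \<i>" by (simp add: complex_eq_iff)
    then have "f (cis x) = cos x * f 1 + sin x * f \<i>" by (simp add: add scaleR)
    then show ?thesis by (simp add: complex_eq_iff field_simps)
  qed
  then show ?case using trig_poly.intros by presburger
next
  case (const c)
  then show ?case using trig_poly_const by simp
next
  case (add f g)
  then show ?case using trig_poly.add by simp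
next
  case (mult f g)
  then show ?case using trig_poly_mult by simp
qed

text \<open>
  The Stone-Weierstrass theorem on the unit circle of the complex plane, where polynomials in the
  coordinates restrict to trigonometric polynomials.
\<close>

lemma trig_poly_approx_continuous:
  assumes "continuous_on (sphere 0 1) g" "e > 0"
  obtains P where "trig_poly P" "\<And>x. cmod (g (cis x) - P x) < e"
proof -
  obtain h where h: "polynomial_function h" "\<And>z. z \<in> sphere 0 1 \<Longrightarrow> cmod (g z - h z) < e"
    using Stone_Weierstrass_polynomial_function[OF _ assms] by auto
  have "real_polynomial_function (\<lambda>z. Re (h z))" "real_polynomial_function (\<lambda>z. Im (h z))"
    using h(1) bounded_linear_Re bounded_linear_Im unfolding polynomial_function_def o_def by auto
  then have "trig_poly (\<lambda>x. complex_of_real (Re (h (cis x))) + \<i> * complex_of_real (Im (h (cis x))))"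
    by (intro trig_poly.add trig_poly_mult[of "\<lambda>x. \<i>"] trig_poly_const) (use trig_poly_of_real_polynomial in auto)
  then have "trig_poly (\<lambda>x. h (cis x))" by (simp add: complex_eq[symmetric])
  then show ?thesis
    by (rule that) (use h(2) in \<open>simp add: norm_cis\<close>)
qed

lemma trig_poly_sum:
  assumes "trig_poly P"
  obtains A :: "int set" and c where "finite A" "\<And>x. P x = (\<Sum>n\<in>A. c n * cis (of_int n * x))"
proof -
  have "\<exists>(A :: int set) c. finite A \<and> (\<forall>x. P x = (\<Sum>n\<in>A. c n * cis (of_int n * x)))"
    using assms
  proof induction
    case (monomial c n)
    show ?case by (intro exI[of _ "{n}"] exI[of _ "\<lambda>_. c"]) auto
  next
    case (add f g)
    obtain A c where A: "finite A" "\<forall>x. f x = (\<Sum>n\<in>A. c n * cis (of_int n * x))" using add by blast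
    obtain B d where B: "finite B" "\<forall>x. g x = (\<Sum>n\<in>B. d n * cis (of_int n * x))" using add by blast
    let ?c = "\<lambda>n. (if n \<in> A then c n else 0) + (if n \<in> B then d n else 0)"
    have "f x + g x = (\<Sum>n\<in>A \<union> B. ?c n * cis (of_int n * x))" for x
    proof -
      have "f x = (\<Sum>n\<in>A \<union> B. (if n \<in> A then c n else 0) * cis (of_int n * x))"
        unfolding A(2)[rule_format] using A B by (intro sum.mono_neutral_cong_left) auto
      moreover have "g x = (\<Sum>n\<in>A \<union> B. (if n \<in> B then d n else 0) * cis (of_int n * x))"
        unfolding B(2)[rule_format] using A B by (intro sum.mono_neutral_cong_left) auto
      ultimately show ?thesis by (simp add: distrib_right sum.distrib)
    qed
    then show ?case using A(1) B(1) by (intro exI[of _ "A \<union> B"] exI[of _ ?c]) auto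
  qed
  then show ?thesis using that by blast
qed

section \<open>Parseval identity on the circle\<close>

abbreviation circle_measure :: "real measure" where
  "circle_measure \<equiv> restrict_space lborel {0..<2 * pi}"

lemma finite_circle_measure: "finite_measure circle_measure"
  by (rule finite_measureI) (simp add: space_restrict_space emeasure_restrict_space)

lemma measure_circle: "measure circle_measure (space circle_measure) = 2 * pi"
  by (simp add: space_restrict_space measure_restrict_space)

lemma integral_circle_measure:
  "(LINT x|circle_measure. f x) = (LINT x:{0..2*pi}|lborel. (f x :: 'a::{banach,second_countable_topology}))"
proof -
  have "(LINT x|circle_measure. f x) = (LINT x:{0..<2*pi}|lborel. f x)"
    by (subst integral_restrict_space) (auto simp: set_lebesgue_integral_def)
  also have "\<dots> = (LINT x:{0..2*pi}|lborel. f x)"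
    unfolding set_lebesgue_integral_def
  proof (rule integral_discrete_difference[where X="{2*pi}"])
  qed (auto simp: indicator_def)
  finally show ?thesis .
qed

lemma integral_cis_circle:
  assumes "n \<in> \<int>"
  shows "(LINT x|circle_measure. cis (n * x)) = (if n = 0 then 2 * pi else 0)"
proof (cases "n = 0")
  case True
  then show ?thesis using measure_circle by (simp add: scaleR_conv_of_real)
next
  case False
  have der: "((\<lambda>x. - (\<i> / n) * cis (n * x)) has_vector_derivative cis (n * x)) (at x within {0..2*pi})" for x
    unfolding cis.ctr has_vector_derivative_complex_iff
    using False by (auto intro!: derivative_eq_intros simp: field_simps)
  have "(LINT x:{0..2*pi}|lborel. cis (n * x)) = - (\<i> / n) * cis (n * (2 * pi)) - - (\<i> / n) * cis (n * 0)"
    unfolding set_lebesgue_integral_def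
    by (intro integral_FTC_atLeastAtMost der) (auto intro!: continuous_intros)
  also have "cis (n * (2 * pi)) = 1"
    using cis_multiple_2pi[OF assms] by (simp add: mult.commute)
  finally show ?thesis using False by (simp add: integral_circle_measure)
qed

lemma square_integrable_bounded:
  assumes "finite_measure M" and [measurable]: "f \<in> borel_measurable M" and "\<And>x. x \<in> space M \<Longrightarrow> cmod (f x) \<le> B"
  shows "square_integrable M f"
  unfolding square_integrable_def
proof
  show "integrable M (\<lambda>x. (cmod (f x))\<^sup>2)"
    using assms by (intro finite_measure.integrable_const_bound[where B="B\<^sup>2"]) (auto intro!: power_mono)
qed fact

lemma square_integrable_imp_integrable:
  assumes "finite_measure M" "square_integrable M f"
  shows "integrable M f"
proof -
  have "integrable M (\<lambda>x. 1 * f x)"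
    using assms finite_measure.integrable_const
    by (intro integrable_mult_L2) (auto simp: square_integrable_def)
  then show ?thesis by simp
qed

lemma cis_measurable[measurable]: "cis \<in> borel_measurable borel"
  by (intro borel_measurable_continuous_onI) (auto intro!: continuous_intros)

lemma borel_measurable_circle:
  "f \<in> borel_measurable borel \<Longrightarrow> f \<in> borel_measurable circle_measure"
  by (intro measurable_restrict_space1) simp

lemma square_integrable_cis_sum:
  "square_integrable circle_measure (\<lambda>x. \<Sum>n\<in>A. c n * cis (r n * x))"
proof (rule square_integrable_bounded[OF finite_circle_measure])
  show "(\<lambda>x. \<Sum>n\<in>A. c n * cis (r n * x)) \<in> borel_measurable circle_measure"
    by (intro borel_measurable_circle) measurable
  show "cmod (\<Sum>n\<in>A. c n * cis (r n * x)) \<le> (\<Sum>n\<in>A. cmod (c n))" for x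
    by (rule order_trans[OF norm_sum]) (auto simp: norm_mult)
qed

lemma fourier_circle_integrable:
  assumes "square_integrable circle_measure f"
  shows "integrable circle_measure (\<lambda>x. f x * cis (r * x))"
proof -
  have "integrable circle_measure (\<lambda>x. cis (r * x) * f x)"
    by (rule square_integrable_imp_integrable[OF finite_circle_measure])
       (rule square_integrable_bounded_mult[where B=1, OF assms], auto intro!: borel_measurable_circle)
  then show ?thesis by (simp add: mult.commute)
qed

lemma complex_mult_cnj_norm: "z * cnj z = of_real ((cmod z)\<^sup>2)"
  using complex_norm_square[of z] by simp

lemma norm_diff_square: "(cmod (a - b))\<^sup>2 = (cmod a)\<^sup>2 - 2 * Re (a * cnj b) + (cmod b)\<^sup>2"
  unfolding cmod_power2 by (simp add: power2_eq_square algebra_simps)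

lemma cis_sum_orthogonal:
  fixes A :: "int set"
  assumes "finite A"
  shows "(LINT x|circle_measure. (cmod (\<Sum>n\<in>A. c n * cis (of_int n * x)))\<^sup>2) = 2 * pi * (\<Sum>n\<in>A. (cmod (c n))\<^sup>2)"
proof -
  let ?M = circle_measure
  have int: "integrable ?M (\<lambda>x. cis (r * x))" for r
    by (rule square_integrable_imp_integrable[OF finite_circle_measure])
       (use square_integrable_cis_sum[of "\<lambda>_. 1" "\<lambda>_. r" "{0}"] in simp)
  have "complex_of_real (LINT x|?M. (cmod (\<Sum>n\<in>A. c n * cis (of_int n * x)))\<^sup>2)
     = (LINT x|?M. (\<Sum>n\<in>A. \<Sum>m\<in>A. c n * cnj (c m) * cis (of_int (n - m) * x)))"
    unfolding integral_complex_of_real[symmetric] complex_mult_cnj_norm[symmetric]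
    by (intro Bochner_Integration.integral_cong)
      (auto simp: sum_product cis_mult left_diff_distrib cis_cnj intro!: sum.cong)
  also have "\<dots> = (\<Sum>n\<in>A. \<Sum>m\<in>A. c n * cnj (c m) * (LINT x|?M. cis (of_int (n - m) * x)))"
    using int by (subst Bochner_Integration.integral_sum; (subst Bochner_Integration.integral_sum)?)
      (auto intro!: Bochner_Integration.integrable_sum simp del: of_int_diff)
  also have "\<dots> = (\<Sum>n\<in>A. \<Sum>m\<in>A. if m = n then c n * cnj (c m) * (2 * pi) else 0)"
    by (intro sum.cong refl) (auto simp: integral_cis_circle simp del: of_int_diff)
  also have "\<dots> = of_real (2 * pi * (\<Sum>n\<in>A. (cmod (c n))\<^sup>2))"
    using assms by (simp add: sum.delta sum_distrib_left complex_mult_cnj_norm mult.commute)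
  finally show ?thesis using of_real_eq_iff by blast
qed

text \<open>
  Completing the square in each coefficient. The choice c n = F n / (2 pi) makes the last sum vanish
  and gives Bessel's inequality; any other choice gives a lower bound for the sum of |F n|^2 in
  terms of the approximation error.
\<close>

lemma circle_approximation_error:
  fixes A :: "int set" and f :: "real \<Rightarrow> complex"
  assumes "finite A" and f: "square_integrable circle_measure f"
  defines "F \<equiv> \<lambda>n. LINT x|circle_measure. f x * cis (- (of_int n * x))"
  shows "(LINT x|circle_measure. (cmod (f x - (\<Sum>n\<in>A. c n * cis (of_int n * x))))\<^sup>2)
     = (LINT x|circle_measure. (cmod (f x))\<^sup>2) - (\<Sum>n\<in>A. (cmod (F n))\<^sup>2) / (2 * pi)
       + 2 * pi * (\<Sum>n\<in>A. (cmod (c n - F n / (2 * pi)))\<^sup>2)"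
proof -
  let ?M = circle_measure and ?P = "\<lambda>x. \<Sum>n\<in>A. c n * cis (of_int n * x)"
  have P: "square_integrable ?M ?P" using square_integrable_cis_sum[of c "\<lambda>n. of_int n" A] by simp
  have [measurable]: "f \<in> borel_measurable ?M" "?P \<in> borel_measurable ?M"
    using f P by (auto simp: square_integrable_def)
  have fP: "f x * cnj (?P x) = (\<Sum>n\<in>A. cnj (c n) * (f x * cis (- (of_int n * x))))" for x
    by (simp add: sum_distrib_left cis_cnj mult_ac)
  have intn: "integrable ?M (\<lambda>x. f x * cis (- (of_int n * x)))" for n
    using fourier_circle_integrable[OF f, of "- of_int n"] by simp
  have int: "integrable ?M (\<lambda>x. f x * cnj (?P x))"
    unfolding fP using intn by (intro Bochner_Integration.integrable_sum) auto
  define r where "r x = Re (f x * cnj (?P x))" for x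
  have r: "integrable ?M r" unfolding r_def using int by (rule integrable_Re)
  have "(LINT x|?M. (cmod (f x - ?P x))\<^sup>2)
     = (LINT x|?M. (cmod (f x))\<^sup>2) - 2 * (LINT x|?M. r x) + (LINT x|?M. (cmod (?P x))\<^sup>2)"
    unfolding norm_diff_square r_def[symmetric] using r f P
    by (simp add: square_integrable_def)
  also have "(LINT x|?M. r x) = Re (LINT x|?M. f x * cnj (?P x))"
    unfolding r_def using int by (rule integral_Re)
  also have "(LINT x|?M. f x * cnj (?P x)) = (\<Sum>n\<in>A. cnj (c n) * F n)"
    unfolding fP F_def using intn by (subst Bochner_Integration.integral_sum) auto
  also have "(LINT x|?M. (cmod (?P x))\<^sup>2) = 2 * pi * (\<Sum>n\<in>A. (cmod (c n))\<^sup>2)"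
    using cis_sum_orthogonal[OF assms(1)] .
  finally have "(LINT x|?M. (cmod (f x - ?P x))\<^sup>2) = (LINT x|?M. (cmod (f x))\<^sup>2)
     + (\<Sum>n\<in>A. 2 * pi * (cmod (c n))\<^sup>2 - 2 * Re (cnj (c n) * F n))"
    by (simp add: sum_subtractf sum_distrib_left)
  also have "(\<Sum>n\<in>A. 2 * pi * (cmod (c n))\<^sup>2 - 2 * Re (cnj (c n) * F n))
     = (\<Sum>n\<in>A. 2 * pi * (cmod (c n - F n / (2 * pi)))\<^sup>2 - (cmod (F n))\<^sup>2 / (2 * pi))"
    unfolding norm_diff_square
    by (intro sum.cong refl) (simp add: norm_divide power_divide power2_eq_square field_simps)
  finally show ?thesis by (simp add: sum_subtractf sum_distrib_left sum_divide_distrib)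
qed

text \<open>
  The angle Arg2pi jumps at 1. A factor vanishing there turns a bounded continuous function of the
  angle into a continuous function on the circle, and tends to 1 elsewhere as n grows.
\<close>

lemma continuous_on_sphere_cutoff:
  assumes k: "continuous_on UNIV k" "\<And>x. cmod (k x) \<le> B"
  shows "continuous_on (sphere 0 1) (\<lambda>z. complex_of_real (min 1 (real n * cmod (z - 1))) * k (Arg2pi z))"
  unfolding continuous_on_eq_continuous_within
proof
  fix z :: complex assume z: "z \<in> sphere 0 1"
  show "continuous (at z within sphere 0 1) (\<lambda>z. complex_of_real (min 1 (real n * cmod (z - 1))) * k (Arg2pi z))"
  proof (cases "z = 1")
    case True
    have "B \<ge> 0" using k(2)[of 0] norm_ge_zero order_trans by blast
    have "((\<lambda>z. complex_of_real (min 1 (real n * cmod (z - 1))) * k (Arg2pi z)) \<longlongrightarrow> 0) (at z within sphere 0 1)"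
    proof (rule Lim_null_comparison)
      show "\<forall>\<^sub>F w in at z within sphere 0 1. cmod (complex_of_real (min 1 (real n * cmod (w - 1))) * k (Arg2pi w)) \<le> real n * cmod (w - 1) * B"
        using k(2) \<open>B \<ge> 0\<close> by (intro always_eventually) (auto simp: norm_mult intro!: mult_mono)
      show "((\<lambda>w. real n * cmod (w - 1) * B) \<longlongrightarrow> 0) (at z within sphere 0 1)"
        using True by (auto intro!: tendsto_eq_intros)
    qed
    then show ?thesis using True by (simp add: continuous_within)
  next
    case False
    have "z \<notin> \<real>\<^sub>\<ge>\<^sub>0" using z False by (auto simp: nonneg_Reals_def)
    then have "continuous (at z) Arg2pi" by (rule continuous_at_Arg2pi)
    moreover have "continuous (at (Arg2pi z)) k" using k(1) by (simp add: continuous_on_eq_continuous_at)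
    ultimately have "continuous (at z) (\<lambda>z. k (Arg2pi z))" using continuous_at_compose[of z Arg2pi k] by (simp add: o_def)
    then have "continuous (at z) (\<lambda>z. complex_of_real (min 1 (real n * cmod (z - 1))) * k (Arg2pi z))"
      by (intro continuous_intros)
    then show ?thesis by (rule continuous_at_imp_continuous_at_within)
  qed
qed

definition trig_approximable :: "(real \<Rightarrow> complex) \<Rightarrow> bool" where
  "trig_approximable f \<longleftrightarrow> square_integrable circle_measure f \<and>
     (\<forall>e>0. \<exists>P. trig_poly P \<and> (LINT x|circle_measure. (cmod (f x - P x))\<^sup>2) < e)"

lemma square_integrable_trig_poly:
  assumes "trig_poly P" shows "square_integrable circle_measure P"
proof -
  obtain A c where "finite A" and P: "\<And>x. P x = (\<Sum>n\<in>A. c n * cis (of_int n * x))"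
    using trig_poly_sum[OF assms] by metis
  have "P = (\<lambda>x. \<Sum>n\<in>A. c n * cis (of_int n * x))" using P by auto
  then show ?thesis using square_integrable_cis_sum[of c of_int A] by simp
qed

lemma trig_approximable_closed:
  assumes f: "square_integrable circle_measure f"
    and g: "\<And>e. e > 0 \<Longrightarrow> \<exists>g. trig_approximable g \<and> (LINT x|circle_measure. (cmod (f x - g x))\<^sup>2) < e"
  shows "trig_approximable f"
  unfolding trig_approximable_def
proof (intro conjI allI impI f)
  fix e :: real assume e: "e > 0"
  obtain g where g: "trig_approximable g" "(LINT x|circle_measure. (cmod (f x - g x))\<^sup>2) < e / 4"
    using g[of "e/4"] e by auto
  obtain P where P: "trig_poly P" "(LINT x|circle_measure. (cmod (g x - P x))\<^sup>2) < e / 4"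
    using g(1) e unfolding trig_approximable_def by (meson divide_pos_pos zero_less_numeral)
  have sg: "square_integrable circle_measure g" using g(1) by (simp add: trig_approximable_def)
  note sP = square_integrable_trig_poly[OF P(1)]
  have "(LINT x|circle_measure. (cmod (f x - P x))\<^sup>2)
     \<le> (LINT x|circle_measure. 2 * (cmod (f x - g x))\<^sup>2 + 2 * (cmod (g x - P x))\<^sup>2)"
  proof (rule integral_mono)
    show "(cmod (f x - P x))\<^sup>2 \<le> 2 * (cmod (f x - g x))\<^sup>2 + 2 * (cmod (g x - P x))\<^sup>2" for x
      using norm_add_square_le[of "f x - g x" "g x - P x"] by simp
  qed (use square_integrable_diff f sg sP in \<open>auto simp: square_integrable_def\<close>)
  also have "\<dots> = 2 * (LINT x|circle_measure. (cmod (f x - g x))\<^sup>2) + 2 * (LINT x|circle_measure. (cmod (g x - P x))\<^sup>2)"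
    using square_integrable_diff[OF f sg] square_integrable_diff[OF sg sP] by (auto simp: square_integrable_def)
  also have "\<dots> < e" using g(2) P(2) by simp
  finally show "\<exists>P. trig_poly P \<and> (LINT x|circle_measure. (cmod (f x - P x))\<^sup>2) < e" using P(1) by blast
qed

lemma trig_approximable_continuous:
  assumes "continuous_on (sphere 0 1) g"
  shows "trig_approximable (\<lambda>x. g (cis x))"
  unfolding trig_approximable_def
proof (intro conjI allI impI)
  have cont: "continuous_on UNIV (\<lambda>x. g (cis x))"
    by (rule continuous_on_compose2[OF assms]) (auto intro!: continuous_intros)
  have "bounded (g ` sphere 0 1)"
    by (intro compact_imp_bounded compact_continuous_image assms) simp
  then obtain B where "\<And>z. z \<in> sphere 0 1 \<Longrightarrow> cmod (g z) \<le> B" unfolding bounded_iff by blast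
  then show *: "square_integrable circle_measure (\<lambda>x. g (cis x))"
    by (intro square_integrable_bounded[OF finite_circle_measure, of _ B]
        borel_measurable_circle borel_measurable_continuous_onI cont) auto
  fix e :: real assume e: "e > 0"
  define d where "d = sqrt (e / (4 * pi))"
  have d: "d > 0" using e by (simp add: d_def)
  obtain P where P: "trig_poly P" "\<And>x. cmod (g (cis x) - P x) < d"
    using trig_poly_approx_continuous[OF assms d] by blast
  have "(LINT x|circle_measure. (cmod (g (cis x) - P x))\<^sup>2) \<le> (LINT x|circle_measure. d\<^sup>2)"
  proof (rule integral_mono)
    show "(cmod (g (cis x) - P x))\<^sup>2 \<le> d\<^sup>2" for x
      using P(2)[of x] by (intro power_mono) auto
    show "integrable circle_measure (\<lambda>x. d\<^sup>2)" by (rule finite_measure.integrable_const[OF finite_circle_measure])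
  qed (use square_integrable_diff[OF * square_integrable_trig_poly[OF P(1)]] in \<open>auto simp: square_integrable_def\<close>)
  also have "\<dots> = e / 2" using e measure_circle by (simp add: d_def)
  also have "\<dots> < e" using e by simp
  finally show "\<exists>P. trig_poly P \<and> (LINT x|circle_measure. (cmod (g (cis x) - P x))\<^sup>2) < e" using P(1) by blast
qed

lemma trig_approximable_sequence:
  assumes f: "square_integrable circle_measure f" and g: "\<And>n. trig_approximable (g n)"
    and lim: "AE x in circle_measure. (\<lambda>n. g n x) \<longlonglongrightarrow> f x"
    and dom: "integrable circle_measure w" "\<And>n x. x \<in> space circle_measure \<Longrightarrow> (cmod (f x - g n x))\<^sup>2 \<le> w x"
  shows "trig_approximable f"
proof (rule trig_approximable_closed[OF f])
  fix e :: real assume e: "e > 0"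
  have [measurable]: "f \<in> borel_measurable circle_measure" "g n \<in> borel_measurable circle_measure" for n
    using f g by (auto simp: square_integrable_def trig_approximable_def)
  have "(\<lambda>n. LINT x|circle_measure. (cmod (f x - g n x))\<^sup>2) \<longlonglongrightarrow> (LINT x|circle_measure. 0)"
  proof (rule integral_dominated_convergence[OF _ _ dom(1)])
    show "AE x in circle_measure. (\<lambda>n. (cmod (f x - g n x))\<^sup>2) \<longlonglongrightarrow> 0"
      using lim
    proof eventually_elim
      case (elim x)
      have "(\<lambda>n. (cmod (f x - g n x))\<^sup>2) \<longlonglongrightarrow> (cmod (f x - f x))\<^sup>2"
        by (intro tendsto_intros elim)
      then show ?case by simp
    qed
  qed (use dom(2) in auto)
  then have "\<forall>\<^sub>F n in sequentially. (LINT x|circle_measure. (cmod (f x - g n x))\<^sup>2) < e"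
    using e by (simp add: order_tendsto_iff)
  then show "\<exists>g. trig_approximable g \<and> (LINT x|circle_measure. (cmod (f x - g x))\<^sup>2) < e"
    using g eventually_happens'[OF sequentially_bot] by blast
qed

text \<open>
  A measurable function is an almost everywhere limit of continuous ones. They are first cut off at
  the bound of f, so that dominated convergence applies, and then damped near the angle 0, so that
  they become continuous on the circle.
\<close>

lemma trig_approximable_bounded:
  assumes f: "f \<in> borel_measurable borel" and B: "\<And>x. cmod (f x) \<le> B"
  shows "trig_approximable f"
proof -
  have fM: "f \<in> borel_measurable circle_measure" using f by (intro measurable_restrict_space1) simp
  have "f \<in> borel_measurable lebesgue" using f by (simp add: borel_measurable_if_I measurable_completion)
  then have "f measurable_on UNIV" by (intro lebesgue_measurable_imp_measurable_on) auto
  then obtain N k where N: "negligible N" and k: "\<And>n. continuous_on UNIV (k n)"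
    and klim: "\<And>x. x \<notin> N \<Longrightarrow> (\<lambda>n. k n x) \<longlonglongrightarrow> f x"
    unfolding measurable_on_def by auto
  define B1 where "B1 = max B 1"
  have B1: "B1 \<ge> 1" "\<And>x. cmod (f x) \<le> B1" using B by (auto simp: B1_def intro: max.coboundedI1)
  \<comment> \<open>projection of the approximants onto the disc of radius B1, which contains the values of f\<close>
  define k' where "k' n x = k n x / of_real (max 1 (cmod (k n x) / B1))" for n x
  have k'cont: "continuous_on UNIV (k' n)" for n
  proof -
    have "complex_of_real (max 1 (cmod (k n x) / B1)) \<noteq> 0" for x
      unfolding of_real_eq_0_iff by (metis max.cobounded1 not_one_le_zero)
    moreover have "B1 \<noteq> 0" using B1(1) by auto
    ultimately show ?thesis unfolding k'_def by (intro continuous_intros k) blast+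
  qed
  have k'B: "cmod (k' n x) \<le> B1" for n x
  proof (cases "cmod (k n x) \<le> B1")
    case True
    have "cmod (k' n x) \<le> cmod (k n x) / 1"
      unfolding k'_def norm_divide by (intro divide_left_mono) auto
    then show ?thesis using True by simp
  next
    case False
    have B0: "B1 > 0" using B1(1) by linarith
    then have "max 1 (cmod (k n x) / B1) = cmod (k n x) / B1" using False by (simp add: max_def field_simps)
    then have "cmod (k' n x) = cmod (k n x) / (cmod (k n x) / B1)" using B0 by (simp add: k'_def norm_divide norm_mult)
    also have "\<dots> = B1" using False B0 by (cases "k n x = 0") auto
    finally show ?thesis by simp
  qed
  define g where "g n x = complex_of_real (min 1 (real n * cmod (cis x - 1))) * k' n (Arg2pi (cis x))" for n x
  have gB: "cmod (g n x) \<le> B1" for n x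
  proof -
    have "cmod (g n x) \<le> 1 * cmod (k' n (Arg2pi (cis x)))"
      unfolding g_def norm_mult by (intro mult_right_mono) auto
    then show ?thesis using k'B order_trans by fastforce
  qed
  have "AE x in lborel. x \<notin> N"
  proof -
    have "N \<in> null_sets lebesgue" using N by (simp add: negligible_iff_null_sets)
    then have "AE x in lebesgue. x \<notin> N" by (rule AE_not_in)
    then show ?thesis by (simp add: AE_completion_iff)
  qed
  moreover have "AE x in lborel. x \<noteq> (0::real)" by (rule AE_lborel_singleton)
  ultimately have "AE x in circle_measure. x \<notin> N \<and> x \<noteq> 0"
    by (subst AE_restrict_space_iff) auto
  then have lim: "AE x in circle_measure. (\<lambda>n. g n x) \<longlonglongrightarrow> f x"
  proof (rule AE_mp, intro AE_I2 impI)
    fix x assume x: "x \<in> space circle_measure" "x \<notin> N \<and> x \<noteq> 0"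
    then have x2: "0 < x" "x < 2 * pi" by (auto simp: space_restrict_space)
    have arg: "Arg2pi (cis x) = x" using x2 by (intro Arg2pi_unique[of 1]) (auto simp: cis_conv_exp)
    have "cis x \<noteq> 1"
    proof
      assume "cis x = 1"
      moreover have "Arg2pi 1 = 0" using Arg2pi_unique[of 1 0 1] by simp
      ultimately show False using arg x2 by simp
    qed
    then have "\<forall>\<^sub>F n in sequentially. min 1 (real n * cmod (cis x - 1)) = 1"
    proof -
      have "filterlim (\<lambda>n. real n * cmod (cis x - 1)) at_top sequentially"
        using \<open>cis x \<noteq> 1\<close> by (intro filterlim_at_top_mult_tendsto_pos[OF tendsto_const _ filterlim_real_sequentially]) auto
      then have "\<forall>\<^sub>F n in sequentially. real n * cmod (cis x - 1) \<ge> 1" by (simp add: filterlim_at_top)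
      then show ?thesis by eventually_elim auto
    qed
    then have ev: "\<forall>\<^sub>F n in sequentially. k' n x = g n x"
      by eventually_elim (simp add: g_def arg)
    have "(\<lambda>n. k' n x) \<longlonglongrightarrow> f x / of_real (max 1 (cmod (f x) / B1))"
      unfolding k'_def using x klim B1(1) by (intro tendsto_intros) (auto simp: max_def)
    also have "max 1 (cmod (f x) / B1) = 1" using B1(2)[of x] order_less_le_trans[OF zero_less_one B1(1)] by (simp add: max_def field_simps)
    finally have "(\<lambda>n. k' n x) \<longlonglongrightarrow> f x" by simp
    then show "(\<lambda>n. g n x) \<longlonglongrightarrow> f x" using tendsto_cong[OF ev] by simp
  qed
  show ?thesis
  proof (rule trig_approximable_sequence[OF _ _ lim])
    show "square_integrable circle_measure f"
      by (rule square_integrable_bounded[OF finite_circle_measure fM B])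
    show "trig_approximable (g n)" for n
      unfolding g_def
      by (rule trig_approximable_continuous[OF continuous_on_sphere_cutoff[OF k'cont k'B]])
    show "integrable circle_measure (\<lambda>x. (2 * B1)\<^sup>2)"
      by (rule finite_measure.integrable_const[OF finite_circle_measure])
    show "(cmod (f x - g n x))\<^sup>2 \<le> (2 * B1)\<^sup>2" for n x
    proof (intro power_mono)
      show "cmod (f x - g n x) \<le> 2 * B1"
        using norm_triangle_ineq4[of "f x" "g n x"] B1(2)[of x] gB[of n x] by linarith
    qed auto
  qed
qed

lemma trig_approximable_L2:
  assumes "square_integrable circle_measure f"
  shows "trig_approximable f"
proof -
  have [measurable]: "f \<in> borel_measurable circle_measure" using assms by (simp add: square_integrable_def)
  define f0 where "f0 x = (if x \<in> {0..<2*pi} then f x else 0)" for x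
  have f0: "f0 \<in> borel_measurable borel"
  proof -
    have "(\<lambda>x. indicator {0..<2*pi} x *\<^sub>R f x) \<in> borel_measurable lborel"
      using \<open>f \<in> borel_measurable circle_measure\<close> by (subst (asm) borel_measurable_restrict_space_iff) auto
    moreover have "(\<lambda>x. indicator {0..<2*pi} x *\<^sub>R f x) = f0" by (auto simp: f0_def indicator_def)
    ultimately show ?thesis by simp
  qed
  define g where "g n x = (if cmod (f0 x) \<le> real n then f0 x else 0)" for n x
  show ?thesis
  proof (rule trig_approximable_sequence[OF assms, of g])
    show "trig_approximable (g n)" for n
    proof (rule trig_approximable_bounded)
      show "g n \<in> borel_measurable borel" unfolding g_def using f0 by measurable
      show "cmod (g n x) \<le> real n" for x by (auto simp: g_def)
    qed
    show "AE x in circle_measure. (\<lambda>n. g n x) \<longlonglongrightarrow> f x"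
    proof (intro AE_I2 tendsto_eventually)
      fix x assume "x \<in> space circle_measure"
      then have f0: "f0 x = f x" by (auto simp: f0_def space_restrict_space)
      show "\<forall>\<^sub>F n in sequentially. g n x = f x"
        using eventually_ge_at_top[of "nat \<lceil>cmod (f x)\<rceil>"]
        by eventually_elim (auto simp: g_def f0 nat_le_iff ceiling_le_iff)
    qed
    show "integrable circle_measure (\<lambda>x. (cmod (f x))\<^sup>2)" using assms by (simp add: square_integrable_def)
    show "(cmod (f x - g n x))\<^sup>2 \<le> (cmod (f x))\<^sup>2" if "x \<in> space circle_measure" for n x
      using that by (auto simp: g_def f0_def space_restrict_space)
  qed
qed

text \<open>
  Bessel's inequality bounds the finite sums from above; approximation by trigonometric polynomials
  bounds them from below.
\<close>

theorem Parseval_circle: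
  assumes f: "square_integrable circle_measure f"
  defines "F \<equiv> \<lambda>n::int. LINT x|circle_measure. f x * cis (- (of_int n * x))"
  shows "((\<lambda>n. (cmod (F n))\<^sup>2) has_sum 2 * pi * (LINT x|circle_measure. (cmod (f x))\<^sup>2)) UNIV"
proof -
  let ?N = "LINT x|circle_measure. (cmod (f x))\<^sup>2"
  have upper: "(\<Sum>n\<in>A. (cmod (F n))\<^sup>2) \<le> 2 * pi * ?N" if "finite A" for A
  proof -
    have "0 \<le> (LINT x|circle_measure. (cmod (f x - (\<Sum>n\<in>A. F n / (2 * pi) * cis (of_int n * x))))\<^sup>2)" by simp
    then have "0 \<le> ?N - (\<Sum>n\<in>A. (cmod (F n))\<^sup>2) / (2 * pi)"
      unfolding circle_approximation_error[OF that f] by (simp add: F_def)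
    then show ?thesis by (simp add: field_simps)
  qed
  have lower: "\<exists>A. finite A \<and> 2 * pi * ?N < (\<Sum>n\<in>A. (cmod (F n))\<^sup>2) + e" if "e > 0" for e
  proof -
    have "e / (2 * pi) > 0" using that by simp
    then obtain P where P: "trig_poly P" "(LINT x|circle_measure. (cmod (f x - P x))\<^sup>2) < e / (2 * pi)"
      using trig_approximable_L2[OF f] unfolding trig_approximable_def by blast
    obtain A c where A: "finite A" and Pc: "\<And>x. P x = (\<Sum>n\<in>A. c n * cis (of_int n * x))"
      using trig_poly_sum[OF P(1)] by metis
    have "?N - (\<Sum>n\<in>A. (cmod (F n))\<^sup>2) / (2 * pi) \<le> (LINT x|circle_measure. (cmod (f x - P x))\<^sup>2)"
      unfolding Pc circle_approximation_error[OF A f] by (simp add: F_def sum_nonneg)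
    also note P(2)
    finally have "2 * pi * (?N - (\<Sum>n\<in>A. (cmod (F n))\<^sup>2) / (2 * pi)) < 2 * pi * (e / (2 * pi))"
      by (intro mult_strict_left_mono) auto
    then have "2 * pi * ?N < (\<Sum>n\<in>A. (cmod (F n))\<^sup>2) + e" by (simp add: right_diff_distrib)
    then show ?thesis using A by blast
  qed
  show ?thesis
    unfolding has_sum_def tendsto_iff
  proof (intro allI impI)
    fix e :: real assume "e > 0"
    then obtain A where A: "finite A" "2 * pi * ?N < (\<Sum>n\<in>A. (cmod (F n))\<^sup>2) + e" using lower by blast
    show "\<forall>\<^sub>F B in finite_subsets_at_top UNIV. dist (\<Sum>n\<in>B. (cmod (F n))\<^sup>2) (2 * pi * ?N) < e"
      unfolding eventually_finite_subsets_at_top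
    proof (intro exI[of _ A] conjI allI impI A)
      fix B :: "int set" assume B: "finite B \<and> A \<subseteq> B \<and> B \<subseteq> UNIV"
      then have "(\<Sum>n\<in>A. (cmod (F n))\<^sup>2) \<le> (\<Sum>n\<in>B. (cmod (F n))\<^sup>2)" by (intro sum_mono2) auto
      then show "dist (\<Sum>n\<in>B. (cmod (F n))\<^sup>2) (2 * pi * ?N) < e"
        using A(2) upper[of B] B by (auto simp: dist_real_def)
    qed auto
  qed
qed

lemma nn_integral_eq_has_sum:
  fixes f :: "'a \<Rightarrow> real"
  assumes "(f has_sum S) A" "\<And>x. f x \<ge> 0"
  shows "(\<integral>\<^sup>+x. ennreal (f x) \<partial>count_space A) = ennreal S"
proof -
  have "f summable_on A" using assms(1) by (auto simp: summable_on_def)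
  then have "(\<lambda>x. norm (f x)) summable_on A" using assms(2) by simp
  then have abs: "Infinite_Set_Sum.abs_summable_on f A" unfolding abs_summable_equivalent[symmetric] .
  then have "(\<integral>\<^sup>+x. ennreal (f x) \<partial>count_space A) = ennreal (infsetsum f A)"
    using assms(2) by (intro nn_integral_conv_infsetsum) auto
  also have "infsetsum f A = S"
    using infsetsum_infsum[OF abs] infsumI[OF assms(1)] by simp
  finally show ?thesis .
qed

lemma Parseval_circle_nn_integral:
  assumes f: "square_integrable circle_measure f"
  shows "(\<integral>\<^sup>+n. ennreal ((cmod (LINT x|circle_measure. f x * cis (- (of_int n * x))))\<^sup>2) \<partial>count_space (UNIV::int set))
     = ennreal (2 * pi * (LINT x|circle_measure. (cmod (f x))\<^sup>2))"
  by (rule nn_integral_eq_has_sum[OF Parseval_circle[OF f]]) simp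

section \<open>Completeness of L2\<close>

text \<open>
  The extended value allows Cauchy sequences and monotone limits to be handled before square
  integrability is known.
\<close>

definition nsq :: "'a measure \<Rightarrow> ('a \<Rightarrow> complex) \<Rightarrow> ennreal" where
  "nsq M f = (\<integral>\<^sup>+x. ennreal ((cmod (f x))\<^sup>2) \<partial>M)"

lemma nsq_add_le:
  assumes [measurable]: "f \<in> borel_measurable M" "g \<in> borel_measurable M"
  shows "nsq M (\<lambda>x. f x + g x) \<le> 2 * nsq M f + 2 * nsq M g"
proof -
  have "nsq M (\<lambda>x. f x + g x) \<le> (\<integral>\<^sup>+x. 2 * ennreal ((cmod (f x))\<^sup>2) + 2 * ennreal ((cmod (g x))\<^sup>2) \<partial>M)"
    unfolding nsq_def
  proof (rule nn_integral_mono)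
    fix x
    show "ennreal ((cmod (f x + g x))\<^sup>2) \<le> 2 * ennreal ((cmod (f x))\<^sup>2) + 2 * ennreal ((cmod (g x))\<^sup>2)"
    proof -
      have "2 * ennreal ((cmod (f x))\<^sup>2) + 2 * ennreal ((cmod (g x))\<^sup>2) = ennreal (2 * (cmod (f x))\<^sup>2 + 2 * (cmod (g x))\<^sup>2)"
        by (simp add: ennreal_mult')
      then show ?thesis using norm_add_square_le[of "f x" "g x"] by (simp add: ennreal_leI del: ennreal_plus)
    qed
  qed
  then show ?thesis by (simp add: nsq_def nn_integral_add nn_integral_cmult)
qed

lemma nsq_eq_integral:
  assumes "square_integrable M f"
  shows "nsq M f = ennreal (LINT x|M. (cmod (f x))\<^sup>2)"
  unfolding nsq_def using assms by (intro nn_integral_eq_integral) (auto simp: square_integrable_def)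

lemma square_integrableI_nsq:
  assumes "f \<in> borel_measurable M" "nsq M f < \<infinity>"
  shows "square_integrable M f"
  using assms unfolding square_integrable_def nsq_def
  by (auto intro!: integrableI_nonneg)

lemma nsq_zero_AE:
  assumes [measurable]: "f \<in> borel_measurable M" and "nsq M f = 0"
  shows "AE x in M. f x = 0"
proof -
  have "AE x in M. ennreal ((cmod (f x))\<^sup>2) = 0"
    using assms(2) unfolding nsq_def by (subst (asm) nn_integral_0_iff_AE) auto
  then show ?thesis by eventually_elim (simp add: ennreal_eq_0_iff)
qed

lemma nsq_minus_commute: "nsq M (\<lambda>x. f x - g x) = nsq M (\<lambda>x. g x - f x)"
  by (simp add: nsq_def norm_minus_commute)

lemma nsq_AE_limit_le:
  assumes [measurable]: "\<And>k. G k \<in> borel_measurable M"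
    and lim: "AE x in M. (\<lambda>k. G k x) \<longlonglongrightarrow> g x"
    and bound: "\<forall>\<^sub>F k in sequentially. nsq M (\<lambda>x. G k x - h x) \<le> C"
    and [measurable]: "h \<in> borel_measurable M"
  shows "nsq M (\<lambda>x. g x - h x) \<le> C"
proof -
  have "nsq M (\<lambda>x. g x - h x) = (\<integral>\<^sup>+x. liminf (\<lambda>k. ennreal ((cmod (G k x - h x))\<^sup>2)) \<partial>M)"
    unfolding nsq_def
  proof (rule nn_integral_cong_AE)
    show "AE x in M. ennreal ((cmod (g x - h x))\<^sup>2) = liminf (\<lambda>k. ennreal ((cmod (G k x - h x))\<^sup>2))"
      using lim
    proof eventually_elim
      case (elim x)
      have "(\<lambda>k. ennreal ((cmod (G k x - h x))\<^sup>2)) \<longlonglongrightarrow> ennreal ((cmod (g x - h x))\<^sup>2)"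
        by (intro tendsto_ennrealI tendsto_intros elim)
      then show ?case by (intro lim_imp_Liminf[symmetric]) auto
    qed
  qed
  also have "\<dots> \<le> liminf (\<lambda>k. nsq M (\<lambda>x. G k x - h x))"
    unfolding nsq_def by (rule nn_integral_liminf) measurable
  also have "\<dots> \<le> limsup (\<lambda>k. nsq M (\<lambda>x. G k x - h x))" by (intro Liminf_le_Limsup) auto
  also have "\<dots> \<le> C" using bound by (rule Limsup_bounded)
  finally show ?thesis .
qed

text \<open>
  Along a subsequence the squared increments are at most 4^(-k); summed with weights 2^k they are
  finite almost everywhere, so the increments themselves are dominated by a geometric series and the
  subsequence converges. Fatou's lemma transfers the Cauchy bound to the limit.
\<close>

lemma Riesz_Fischer:
  fixes G :: "nat \<Rightarrow> 'a \<Rightarrow> complex"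
  assumes [measurable]: "\<And>n. G n \<in> borel_measurable M"
    and e0: "e \<longlonglongrightarrow> 0"
    and cauchy: "\<And>n m. n \<le> m \<Longrightarrow> nsq M (\<lambda>x. G m x - G n x) \<le> ennreal (e n)"
  obtains g where "g \<in> borel_measurable M" "\<And>n. nsq M (\<lambda>x. g x - G n x) \<le> ennreal (e n)"
proof -
  have "\<exists>N. \<forall>n\<ge>N. e n \<le> (1/4)^k" for k
    using order_tendstoD(2)[OF e0, of "(1/4)^k"] by (auto simp: eventually_sequentially intro: less_imp_le)
  then obtain N where N: "\<And>k n. n \<ge> N k \<Longrightarrow> e n \<le> (1/4)^k" by metis
  \<comment> \<open>an increasing choice of indices beyond the thresholds N k\<close>
  define r where "r k = k + (\<Sum>i\<le>k. N i)" for k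
  have rN: "r k \<ge> N k" for k unfolding r_def by (simp add: trans_le_add2 member_le_sum)
  have rk: "r k \<ge> k" for k by (simp add: r_def)
  have rmono: "r k \<le> r (Suc k)" for k by (simp add: r_def)
  define d where "d k x = G (r (Suc k)) x - G (r k) x" for k x
  have [measurable]: "d k \<in> borel_measurable M" for k unfolding d_def by measurable
  have d: "nsq M (d k) \<le> ennreal ((1/4)^k)" for k
    using cauchy[OF rmono, of k] N[OF rN, of k] unfolding d_def by (meson ennreal_leI order_trans)
  have "(\<integral>\<^sup>+x. (\<Sum>k. ennreal (2^k * (cmod (d k x))\<^sup>2)) \<partial>M) = (\<Sum>k. \<integral>\<^sup>+x. ennreal (2^k * (cmod (d k x))\<^sup>2) \<partial>M)"
    by (rule nn_integral_suminf) measurable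
  also have "\<dots> = (\<Sum>k. ennreal (2^k) * nsq M (d k))"
    unfolding nsq_def by (intro suminf_cong) (simp add: ennreal_mult nn_integral_cmult)
  also have "\<dots> \<le> (\<Sum>k. ennreal ((1/2)^k))"
  proof (intro suminf_le)
    fix k
    have "ennreal (2^k) * nsq M (d k) \<le> ennreal (2^k) * ennreal ((1/4)^k)" by (intro mult_left_mono d) auto
    also have "\<dots> = ennreal ((1/2)^k)" by (simp add: ennreal_mult[symmetric] power_mult_distrib[symmetric])
    finally show "ennreal (2^k) * nsq M (d k) \<le> ennreal ((1/2)^k)" .
  qed auto
  also have "\<dots> = ennreal (\<Sum>k. (1/2)^k)" by (intro suminf_ennreal2 summable_geometric) auto
  also have "\<dots> < \<infinity>" by simp
  finally have "(\<integral>\<^sup>+x. (\<Sum>k. ennreal (2^k * (cmod (d k x))\<^sup>2)) \<partial>M) \<noteq> \<infinity>" by simp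
  then have "AE x in M. (\<Sum>k. ennreal (2^k * (cmod (d k x))\<^sup>2)) \<noteq> \<infinity>"
    by (intro nn_integral_PInf_AE) measurable
  then have lim: "AE x in M. (\<lambda>k. G (r k) x) \<longlonglongrightarrow> lim (\<lambda>k. G (r k) x)"
  proof eventually_elim
    case (elim x)
    then have "summable (\<lambda>k. 2^k * (cmod (d k x))\<^sup>2)" by (intro summable_suminf_not_top) auto
    then have "Bseq (\<lambda>k. 2^k * (cmod (d k x))\<^sup>2)"
      by (intro convergent_imp_Bseq) (auto simp: convergent_def dest: summable_LIMSEQ_zero)
    then obtain B where B: "B > 0" "\<And>k. 2^k * (cmod (d k x))\<^sup>2 \<le> B" by (auto simp: Bseq_def)
    have "cmod (d k x) \<le> sqrt B * (sqrt (1/2))^k" for k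
    proof (rule power2_le_imp_le)
      have "((sqrt (1/2))^k)\<^sup>2 = (1/2::real)^k"
      proof -
        have "((sqrt (1/2))^k)\<^sup>2 = ((sqrt (1/2))\<^sup>2)^k" by (simp add: power2_eq_square power_mult_distrib[symmetric])
        then show ?thesis by simp
      qed
      moreover have "(cmod (d k x))\<^sup>2 \<le> B * (1/2)^k"
        using B(2)[of k] by (simp add: power_one_over field_simps)
      ultimately show "(cmod (d k x))\<^sup>2 \<le> (sqrt B * (sqrt (1/2))^k)\<^sup>2"
        using B(1) by (simp only: power_mult_distrib) simp
    qed (use B in auto)
    note le = this
    have sm: "summable (\<lambda>k. sqrt B * (sqrt (1/2))^k)"
      by (intro summable_mult summable_geometric) (auto intro: real_less_lsqrt)
    have "summable (\<lambda>k. d k x)" by (rule summable_comparison_test'[OF sm, of 0]) (use le in auto)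
    then have "(\<lambda>m. \<Sum>k<m. d k x) \<longlonglongrightarrow> suminf (\<lambda>k. d k x)" by (rule summable_LIMSEQ)
    moreover have "(\<Sum>k<m. d k x) = G (r m) x - G (r 0) x" for m
      unfolding d_def by (induction m) auto
    ultimately have "(\<lambda>m. G (r m) x - G (r 0) x) \<longlonglongrightarrow> suminf (\<lambda>k. d k x)" by simp
    from tendsto_add[OF this tendsto_const[of "G (r 0) x"]]
    have "convergent (\<lambda>m. G (r m) x)" by (auto simp: convergent_def)
    then show ?case by (simp add: convergent_LIMSEQ_iff)
  qed
  show thesis
  proof
    show gm: "(\<lambda>x. lim (\<lambda>k. G (r k) x)) \<in> borel_measurable M" by (rule borel_measurable_lim_metric) measurable
    show "nsq M (\<lambda>x. lim (\<lambda>k. G (r k) x) - G n x) \<le> ennreal (e n)" for n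
    proof (rule nsq_AE_limit_le[OF _ lim])
      show "\<forall>\<^sub>F k in sequentially. nsq M (\<lambda>x. G (r k) x - G n x) \<le> ennreal (e n)"
        using eventually_ge_at_top[of n] by eventually_elim (rule cauchy, use rk le_trans in blast)
    qed auto
  qed
qed

section \<open>Plancherel theorem on the line\<close>

lemma nn_integral_periodise:
  fixes f :: "real \<Rightarrow> ennreal"
  assumes [measurable]: "f \<in> borel_measurable borel"
  shows "(\<integral>\<^sup>+x. f x \<partial>lborel) = (\<integral>\<^sup>+\<theta>. (\<integral>\<^sup>+n. f (of_int n + \<theta>) \<partial>count_space (UNIV::int set)) * indicator {0..<1} \<theta> \<partial>lborel)"
proof -
  have one: "(\<integral>\<^sup>+n. indicator {of_int n..<of_int n + 1} x \<partial>count_space (UNIV::int set)) = 1" for x :: real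
  proof -
    have "(\<integral>\<^sup>+n. indicator {of_int n..<of_int n + 1} x \<partial>count_space (UNIV::int set)) = (\<integral>\<^sup>+n. indicator {\<lfloor>x\<rfloor>} n \<partial>count_space (UNIV::int set))"
      by (intro nn_integral_cong) (auto simp: indicator_def floor_correct dest: floor_unique)
    then show ?thesis by simp
  qed
  have "(\<integral>\<^sup>+x. f x \<partial>lborel) = (\<integral>\<^sup>+x. (\<integral>\<^sup>+n. f x * indicator {of_int n..<of_int n + 1} x \<partial>count_space (UNIV::int set)) \<partial>lborel)"
    by (simp add: nn_integral_cmult one)
  also have "\<dots> = (\<integral>\<^sup>+n. (\<integral>\<^sup>+x. f x * indicator {of_int n..<of_int n + 1} x \<partial>lborel) \<partial>count_space (UNIV::int set))"
    by (rule nn_integral_count_space_nn_integral) auto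
  also have "\<dots> = (\<integral>\<^sup>+n. (\<integral>\<^sup>+\<theta>. f (of_int n + \<theta>) * indicator {0..<1} \<theta> \<partial>lborel) \<partial>count_space (UNIV::int set))"
  proof (rule nn_integral_cong)
    fix n :: int
    show "(\<integral>\<^sup>+x. f x * indicator {of_int n..<of_int n + 1} x \<partial>lborel) = (\<integral>\<^sup>+\<theta>. f (of_int n + \<theta>) * indicator {0..<1} \<theta> \<partial>lborel)"
      by (subst nn_integral_real_affine[where c=1 and t="of_int n"]) (auto intro!: nn_integral_cong simp: indicator_def)
  qed
  also have "\<dots> = (\<integral>\<^sup>+\<theta>. (\<integral>\<^sup>+n. f (of_int n + \<theta>) * indicator {0..<1} \<theta> \<partial>count_space (UNIV::int set)) \<partial>lborel)"
    by (rule nn_integral_count_space_nn_integral[symmetric]) auto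
  also have "\<dots> = (\<integral>\<^sup>+\<theta>. (\<integral>\<^sup>+n. f (of_int n + \<theta>) \<partial>count_space (UNIV::int set)) * indicator {0..<1} \<theta> \<partial>lborel)"
    by (simp add: nn_integral_multc)
  finally show ?thesis .
qed

definition ft :: "(real \<Rightarrow> complex) \<Rightarrow> real \<Rightarrow> complex" where
  "ft f \<xi> = (LINT x|lborel. f x * cis (- (\<xi> * x)))"

lemma ft_measurable[measurable]:
  assumes [measurable]: "f \<in> borel_measurable borel"
  shows "ft f \<in> borel_measurable borel"
  unfolding ft_def by measurable

text \<open>
  After rescaling the support to one period of the circle, the values of the transform of f on the
  integers shifted by \<theta> are, up to factors of constant modulus, the Fourier coefficients of f
  times the character cis (- \<theta> y). Parseval's identity holds for each shift, with a
  right-hand side that does not depend on it, and integrating over the shifts in [0, 1) recovers the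
  whole line.
\<close>

lemma Plancherel_compact:
  assumes f: "square_integrable lborel f" and N: "N > 0" and supp: "\<And>x. x \<notin> {-N..<N} \<Longrightarrow> f x = 0"
  shows "nsq lborel (ft f) = ennreal (2 * pi) * nsq lborel f"
proof -
  have [measurable]: "f \<in> borel_measurable borel" using f by (simp add: square_integrable_def)
  \<comment> \<open>the affine map y -> -N + L y sends one period onto the support of f\<close>
  define L where "L = N / pi"
  have L: "L > 0" using N by (simp add: L_def)
  have N2: "N = L * pi" by (simp add: L_def)
  define h where "h \<theta> y = f (- N + L * y) * cis (- (\<theta> * y))" for \<theta> y
  have [measurable]: "h \<theta> \<in> borel_measurable borel" for \<theta> unfolding h_def by measurable
  have supp2: "f (- N + L * y) = 0" if "y \<notin> {0..<2*pi}" for y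
  proof (rule supp)
    show "- N + L * y \<notin> {-N..<N}"
    proof
      assume "- N + L * y \<in> {-N..<N}"
      then have "0 \<le> L * y" "L * y < L * (2 * pi)" unfolding N2 by (auto simp: algebra_simps)
      then have "0 \<le> y" "y < 2 * pi" using L by (simp_all add: zero_le_mult_iff)
      then show False using that by simp
    qed
  qed
  have restrict: "(\<integral>\<^sup>+y. ennreal ((cmod (h \<theta> y))\<^sup>2) \<partial>circle_measure) = (\<integral>\<^sup>+y. ennreal ((cmod (f (- N + L * y)))\<^sup>2) \<partial>lborel)" for \<theta>
    by (subst nn_integral_restrict_space)
      (auto intro!: nn_integral_cong simp: h_def norm_mult supp2[simplified] indicator_def)
  have affine: "nsq lborel f = ennreal L * (\<integral>\<^sup>+y. ennreal ((cmod (f (- N + L * y)))\<^sup>2) \<partial>lborel)"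
    unfolding nsq_def using L by (subst nn_integral_real_affine[where c=L and t="-N"]) auto
  have fin: "nsq lborel f < \<infinity>" using nsq_eq_integral[OF f] by simp
  then have "(\<integral>\<^sup>+y. ennreal ((cmod (f (- N + L * y)))\<^sup>2) \<partial>lborel) < \<infinity>"
    unfolding affine using L by (auto simp: ennreal_mult_less_top less_top)
  then have hL2: "square_integrable circle_measure (h \<theta>)" for \<theta>
    by (intro square_integrableI_nsq borel_measurable_circle) (auto simp: nsq_def restrict)
  have ft_h: "ft f (1 / L * (of_int n + \<theta>)) = cis (N * (of_int n + \<theta>) / L) * of_real L * (LINT y|circle_measure. h \<theta> y * cis (- (of_int n * y)))" for n \<theta>
  proof -
    have "ft f (1 / L * (of_int n + \<theta>)) = L *\<^sub>R (LINT y|lborel. f (-N + L * y) * cis (- (1 / L * (of_int n + \<theta>) * (-N + L * y))))"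
      unfolding ft_def using L by (subst lborel_integral_real_affine[where c=L and t="-N"]) auto
    also have "(LINT y|lborel. f (-N + L * y) * cis (- (1 / L * (of_int n + \<theta>) * (-N + L * y))))
       = (LINT y|lborel. cis (N * (of_int n + \<theta>) / L) * (indicator {0..<2*pi} y *\<^sub>R (h \<theta> y * cis (- (of_int n * y)))))"
    proof (intro Bochner_Integration.integral_cong refl)
      fix y
      have "- (1 / L * (of_int n + \<theta>) * (-N + L * y)) = N * (of_int n + \<theta>) / L + (- (\<theta> * y) + - (of_int n * y))"
        using L by (simp add: field_simps)
      then show "f (-N + L * y) * cis (- (1 / L * (of_int n + \<theta>) * (-N + L * y))) = cis (N * (of_int n + \<theta>) / L) * (indicator {0..<2*pi} y *\<^sub>R (h \<theta> y * cis (- (of_int n * y))))"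
        using supp2[of y] by (simp only: cis_mult[symmetric]) (auto simp: h_def indicator_def)
    qed
    also have "\<dots> = cis (N * (of_int n + \<theta>) / L) * (LINT y|circle_measure. h \<theta> y * cis (- (of_int n * y)))"
      unfolding integral_mult_right_zero by (subst integral_restrict_space) auto
    finally show ?thesis by (simp add: scaleR_conv_of_real mult_ac)
  qed
  have "nsq lborel (ft f) = ennreal (1 / L) * (\<integral>\<^sup>+s. ennreal ((cmod (ft f (1 / L * s)))\<^sup>2) \<partial>lborel)"
    unfolding nsq_def using L by (subst nn_integral_real_affine[where c="1/L" and t=0]) auto
  also have "(\<integral>\<^sup>+s. ennreal ((cmod (ft f (1 / L * s)))\<^sup>2) \<partial>lborel)
     = (\<integral>\<^sup>+\<theta>. (\<integral>\<^sup>+n. ennreal ((cmod (ft f (1 / L * (of_int n + \<theta>))))\<^sup>2) \<partial>count_space (UNIV::int set)) * indicator {0..<1} \<theta> \<partial>lborel)"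
    by (rule nn_integral_periodise) measurable
  also have "\<dots> = (\<integral>\<^sup>+\<theta>. (ennreal (L\<^sup>2) * (ennreal (2 * pi) * (\<integral>\<^sup>+y. ennreal ((cmod (f (- N + L * y)))\<^sup>2) \<partial>lborel))) * indicator {0..<1::real} \<theta> \<partial>lborel)"
  proof (intro nn_integral_cong)
    fix \<theta>
    have "(\<integral>\<^sup>+n. ennreal ((cmod (ft f (1 / L * (of_int n + \<theta>))))\<^sup>2) \<partial>count_space (UNIV::int set))
      = (\<integral>\<^sup>+n. ennreal (L\<^sup>2) * ennreal ((cmod (LINT y|circle_measure. h \<theta> y * cis (- (of_int n * y))))\<^sup>2) \<partial>count_space (UNIV::int set))"
      unfolding ft_h by (intro nn_integral_cong) (simp add: norm_mult power_mult_distrib ennreal_mult)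
    also have "\<dots> = ennreal (L\<^sup>2) * ennreal (2 * pi * (LINT x|circle_measure. (cmod (h \<theta> x))\<^sup>2))"
      by (simp add: nn_integral_cmult Parseval_circle_nn_integral[OF hL2])
    also have "ennreal (2 * pi * (LINT x|circle_measure. (cmod (h \<theta> x))\<^sup>2)) = ennreal (2 * pi) * (\<integral>\<^sup>+y. ennreal ((cmod (f (- N + L * y)))\<^sup>2) \<partial>lborel)"
      using nsq_eq_integral[OF hL2, of \<theta>] by (simp add: ennreal_mult nsq_def restrict)
    finally show "(\<integral>\<^sup>+n. ennreal ((cmod (ft f (1 / L * (of_int n + \<theta>))))\<^sup>2) \<partial>count_space (UNIV::int set)) * indicator {0..<1} \<theta>
      = (ennreal (L\<^sup>2) * (ennreal (2 * pi) * (\<integral>\<^sup>+y. ennreal ((cmod (f (- N + L * y)))\<^sup>2) \<partial>lborel))) * indicator {0..<1} \<theta>" by simp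
  qed
  also have "\<dots> = ennreal (L\<^sup>2) * (ennreal (2 * pi) * (\<integral>\<^sup>+y. ennreal ((cmod (f (- N + L * y)))\<^sup>2) \<partial>lborel))"
    by (subst nn_integral_cmult_indicator) auto
  also have "ennreal (1 / L) * (ennreal (L\<^sup>2) * (ennreal (2 * pi) * (\<integral>\<^sup>+y. ennreal ((cmod (f (- N + L * y)))\<^sup>2) \<partial>lborel)))
      = ennreal (2 * pi) * ((ennreal (1 / L) * ennreal (L\<^sup>2)) * (\<integral>\<^sup>+y. ennreal ((cmod (f (- N + L * y)))\<^sup>2) \<partial>lborel))"
    by (simp only: mult_ac)
  also have "ennreal (1 / L) * ennreal (L\<^sup>2) = ennreal L"
    using L by (simp add: ennreal_mult[symmetric] power2_eq_square)
  finally show ?thesis by (simp add: affine)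
qed

declare fourier.simps(1) [simp del]

lemma cnj_measurable [measurable]: "cnj \<in> borel_measurable borel"
  by (intro borel_measurable_continuous_onI) (auto intro!: continuous_intros)

definition l2 :: "real measure \<Rightarrow> (real \<Rightarrow> complex) \<Rightarrow> real" where
  "l2 M f = sqrt (LINT x|M. (cmod (f x))\<^sup>2)"

lemma l2_nonneg [simp]: "l2 M f \<ge> 0"
  by (simp add: l2_def)

lemma l2_square: "(l2 M f)\<^sup>2 = (LINT x|M. (cmod (f x))\<^sup>2)"
  by (simp add: l2_def)

lemma nsq_eq_l2: "square_integrable M f \<Longrightarrow> nsq M f = ennreal ((l2 M f)\<^sup>2)"
  by (simp add: nsq_eq_integral l2_square)

lemma l2_scale: "l2 M (\<lambda>x. c * f x) = cmod c * l2 M f"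
  by (simp add: l2_def norm_mult power_mult_distrib real_sqrt_mult)

lemma l2_minus_commute: "l2 M (\<lambda>x. f x - g x) = l2 M (\<lambda>x. g x - f x)"
  by (simp add: l2_def norm_minus_commute)

lemma l2_cong_AE:
  assumes "AE x in M. f x = g x" and [measurable]: "f \<in> borel_measurable M" "g \<in> borel_measurable M"
  shows "l2 M f = l2 M g"
  unfolding l2_def by (intro arg_cong[where f=sqrt] integral_cong_AE) (use assms(1) in auto)

lemma integrable_mult_cnj:
  assumes "square_integrable M f" "square_integrable M g"
  shows "integrable M (\<lambda>x. f x * cnj (g x))"
  using assms
  by (intro integrable_mult_L2) (auto simp: square_integrable_def intro: measurable_compose[OF _ cnj_measurable])

lemma l2_Cauchy_Schwarz:
  assumes f: "square_integrable M f" and g: "square_integrable M g"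
  shows "cmod (LINT x|M. f x * cnj (g x)) \<le> l2 M f * l2 M g"
proof -
  have "cmod (LINT x|M. f x * cnj (g x)) \<le> (LINT x|M. norm (f x) * norm (g x))"
    using integral_norm_bound[of M "\<lambda>x. f x * cnj (g x)"] by (simp add: norm_mult)
  also have "\<dots> \<le> l2 M f * l2 M g"
    unfolding l2_def using f g by (intro Cauchy_Schwarz_integral) (auto simp: square_integrable_def)
  finally show ?thesis .
qed

lemma l2_add_square:
  assumes f: "square_integrable M f" and g: "square_integrable M g"
  shows "(l2 M (\<lambda>x. f x - g x))\<^sup>2 = (l2 M f)\<^sup>2 - 2 * Re (LINT x|M. f x * cnj (g x)) + (l2 M g)\<^sup>2"
proof -
  note int = integrable_mult_cnj[OF f g]
  define r where "r x = Re (f x * cnj (g x))" for x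
  have r: "integrable M r" unfolding r_def using int by (rule integrable_Re)
  have "Re (LINT x|M. f x * cnj (g x)) = (LINT x|M. r x)"
    unfolding r_def using int by (rule integral_Re[symmetric])
  then show ?thesis
    unfolding l2_square norm_diff_square r_def[symmetric] using r f g by (simp add: square_integrable_def)
qed

lemma l2_triangle_diff:
  assumes f: "square_integrable M f" and g: "square_integrable M g"
  shows "l2 M (\<lambda>x. f x - g x) \<le> l2 M f + l2 M g"
proof (rule power2_le_imp_le)
  have "\<bar>Re (LINT x|M. f x * cnj (g x))\<bar> \<le> l2 M f * l2 M g"
    using l2_Cauchy_Schwarz[OF f g] abs_Re_le_cmod order_trans by blast
  then show "(l2 M (\<lambda>x. f x - g x))\<^sup>2 \<le> (l2 M f + l2 M g)\<^sup>2"
    unfolding l2_add_square[OF f g] power2_sum by linarith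
qed simp

lemma l2_triangle:
  assumes f: "square_integrable M f" and g: "square_integrable M g"
  shows "l2 M (\<lambda>x. f x + g x) \<le> l2 M f + l2 M g"
  using l2_triangle_diff[OF f square_integrable_scale[OF g, of "-1"]] l2_scale[of M "-1" g] by simp

lemma l2_triangle_rev:
  assumes f: "square_integrable M f" and g: "square_integrable M g"
  shows "\<bar>l2 M f - l2 M g\<bar> \<le> l2 M (\<lambda>x. f x - g x)"
  using l2_triangle[OF square_integrable_diff[OF f g] g] l2_triangle[OF square_integrable_diff[OF g f] f]
    l2_minus_commute[of M f g] by simp

lemma l2_zero_AE:
  assumes f: "square_integrable M f" and "l2 M f \<le> 0"
  shows "AE x in M. f x = 0"
proof (rule nsq_zero_AE)
  have "l2 M f = 0" using assms(2) l2_nonneg[of M f] by linarith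
  then show "nsq M f = 0" using nsq_eq_l2[OF f] by simp
qed (use f in \<open>auto simp: square_integrable_def\<close>)

text \<open>
  Identities between L2 limits of truncated transforms are derived from this uniqueness of limits.
\<close>

lemma l2_eq_limit_AE:
  assumes f: "square_integrable M f" and g: "square_integrable M g" and G: "\<And>n. square_integrable M (G n)"
    and lim: "(\<lambda>n. l2 M (\<lambda>x. G n x - f x)) \<longlonglongrightarrow> 0" "(\<lambda>n. l2 M (\<lambda>x. G n x - g x)) \<longlonglongrightarrow> 0"
  shows "AE x in M. f x = g x"
proof -
  have "l2 M (\<lambda>x. f x - g x) \<le> l2 M (\<lambda>x. G n x - f x) + l2 M (\<lambda>x. G n x - g x)" for n
    using l2_triangle_diff[OF square_integrable_diff[OF G g] square_integrable_diff[OF G f], of n n] by (simp add: add.commute)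
  moreover have "(\<lambda>n. l2 M (\<lambda>x. G n x - f x) + l2 M (\<lambda>x. G n x - g x)) \<longlonglongrightarrow> 0 + 0"
    by (intro tendsto_add lim)
  ultimately have "l2 M (\<lambda>x. f x - g x) \<le> 0"
    by (metis (no_types, lifting) LIMSEQ_le_const add_0)
  then have "AE x in M. f x - g x = 0" by (rule l2_zero_AE[OF square_integrable_diff[OF f g]])
  then show ?thesis by simp
qed

definition trunc :: "real \<Rightarrow> (real \<Rightarrow> complex) \<Rightarrow> real \<Rightarrow> complex" where
  "trunc N f x = indicator {-N..N} x *\<^sub>R f x"

lemma trunc_measurable [measurable]: "f \<in> borel_measurable borel \<Longrightarrow> trunc N f \<in> borel_measurable borel"
  unfolding trunc_def by measurable

lemma cmod_trunc_le: "cmod (trunc N f x) \<le> cmod (f x)" "cmod (f x - trunc N f x) \<le> cmod (f x)"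
  by (auto simp: trunc_def indicator_def)

lemma square_integrable_le:
  assumes f: "square_integrable M f" and g: "g \<in> borel_measurable M" "\<And>x. cmod (g x) \<le> cmod (f x)"
  shows "square_integrable M g"
  unfolding square_integrable_def
proof
  have le: "\<And>x. (cmod (g x))\<^sup>2 \<le> (cmod (f x))\<^sup>2" using g(2) by (intro power_mono) auto
  show "integrable M (\<lambda>x. (cmod (g x))\<^sup>2)"
    by (rule Bochner_Integration.integrable_bound[where f="\<lambda>x. (cmod (f x))\<^sup>2"])
      (use f g(1) le in \<open>auto simp: square_integrable_def\<close>)
qed fact

lemma l2_mono:
  assumes f: "square_integrable M f" and g: "g \<in> borel_measurable M" "\<And>x. cmod (g x) \<le> cmod (f x)"
  shows "l2 M g \<le> l2 M f"
  unfolding l2_def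
proof (intro real_sqrt_le_mono integral_mono)
  show "\<And>x. (cmod (g x))\<^sup>2 \<le> (cmod (f x))\<^sup>2" using g(2) by (intro power_mono) auto
qed (use f square_integrable_le[OF assms] in \<open>auto simp: square_integrable_def\<close>)

lemma square_integrable_trunc: "square_integrable lborel f \<Longrightarrow> square_integrable lborel (trunc N f)"
  by (rule square_integrable_le[of lborel f]) (auto simp: square_integrable_def intro: cmod_trunc_le)

lemma integrable_trunc_cis:
  assumes "square_integrable lborel f"
  shows "integrable lborel (\<lambda>x. trunc N f x * cis (r * x))"
proof -
  have [measurable]: "f \<in> borel_measurable borel" using assms by (simp add: square_integrable_def)
  have "integrable lborel (\<lambda>x. (indicator {-N..N} x *\<^sub>R cis (r * x)) * f x)"
  proof (rule integrable_mult_L2)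
    have "integrable lborel (indicat_real {-N..N})"
      by (rule integrable_real_indicator) (auto simp: emeasure_lborel_Icc_eq)
    moreover have "(cmod (indicator {-N..N} x *\<^sub>R cis (r * x)))\<^sup>2 = indicat_real {-N..N} x" for x by (simp add: indicator_def)
    ultimately show "integrable lborel (\<lambda>x. (cmod (indicator {-N..N} x *\<^sub>R cis (r * x)))\<^sup>2)" by simp
  qed (use assms in \<open>auto simp: square_integrable_def\<close>)
  then show ?thesis by (simp add: trunc_def mult_ac)
qed

lemma ft_trunc_diff:
  assumes f: "square_integrable lborel f"
  shows "nsq lborel (\<lambda>\<xi>. ft (trunc N f) \<xi> - ft (trunc n f) \<xi>) = ennreal (2 * pi) * nsq lborel (\<lambda>x. trunc N f x - trunc n f x)"
proof -
  have "(\<lambda>\<xi>. ft (trunc N f) \<xi> - ft (trunc n f) \<xi>) = ft (\<lambda>x. trunc N f x - trunc n f x)"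
    unfolding ft_def using integrable_trunc_cis[OF f, of _ "- _"] by (simp add: left_diff_distrib)
  moreover have "nsq lborel (ft (\<lambda>x. trunc N f x - trunc n f x)) = ennreal (2 * pi) * nsq lborel (\<lambda>x. trunc N f x - trunc n f x)"
  proof (rule Plancherel_compact[where N="\<bar>N\<bar> + \<bar>n\<bar> + 1"])
    show "square_integrable lborel (\<lambda>x. trunc N f x - trunc n f x)"
      by (intro square_integrable_diff square_integrable_trunc f)
  qed (auto simp: trunc_def indicator_def)
  ultimately show ?thesis by simp
qed

lemma l2_ft_trunc_diff:
  assumes f: "square_integrable lborel f"
  shows "square_integrable lborel (\<lambda>\<xi>. ft (trunc N f) \<xi> - ft (trunc n f) \<xi>)"
    "l2 lborel (\<lambda>\<xi>. ft (trunc N f) \<xi> - ft (trunc n f) \<xi>) = sqrt (2 * pi) * l2 lborel (\<lambda>x. trunc N f x - trunc n f x)"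
proof -
  have [measurable]: "f \<in> borel_measurable borel" using f by (simp add: square_integrable_def)
  let ?d = "\<lambda>x. trunc N f x - trunc n f x" and ?F = "\<lambda>\<xi>. ft (trunc N f) \<xi> - ft (trunc n f) \<xi>"
  have d: "square_integrable lborel ?d" by (intro square_integrable_diff square_integrable_trunc f)
  have eq: "nsq lborel ?F = ennreal (2 * pi * (l2 lborel ?d)\<^sup>2)"
    unfolding ft_trunc_diff[OF f] nsq_eq_l2[OF d] by (simp add: ennreal_mult)
  show F: "square_integrable lborel ?F"
    by (rule square_integrableI_nsq) (simp_all add: eq)
  have "(l2 lborel ?F)\<^sup>2 = 2 * pi * (l2 lborel ?d)\<^sup>2"
    using eq unfolding nsq_eq_l2[OF F] by (subst (asm) ennreal_inj) auto
  also have "\<dots> = (sqrt (2 * pi) * l2 lborel ?d)\<^sup>2" by (simp add: power_mult_distrib)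
  finally show "l2 lborel ?F = sqrt (2 * pi) * l2 lborel ?d" by (simp add: power2_eq_iff_nonneg)
qed

lemma trunc_neg: "N < 0 \<Longrightarrow> trunc N f = (\<lambda>_. 0)"
  by (auto simp: trunc_def)

lemma ft_zero: "ft (\<lambda>_. 0) = (\<lambda>_. 0)"
  by (simp add: ft_def fun_eq_iff)

lemma l2_ft_trunc:
  assumes f: "square_integrable lborel f"
  shows "square_integrable lborel (ft (trunc N f))" "l2 lborel (ft (trunc N f)) = sqrt (2 * pi) * l2 lborel (trunc N f)"
  using l2_ft_trunc_diff[OF f, of N "-1"] by (simp_all add: trunc_neg ft_zero)

lemma l2_trunc_tendsto:
  assumes f: "square_integrable lborel f"
  shows "((\<lambda>N. l2 lborel (\<lambda>x. f x - trunc N f x)) \<longlongrightarrow> 0) at_top"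
proof -
  have [measurable]: "f \<in> borel_measurable borel" using f by (simp add: square_integrable_def)
  have "((\<lambda>N. LINT x|lborel. (cmod (f x - trunc N f x))\<^sup>2) \<longlongrightarrow> (LINT x|(lborel :: real measure). 0)) at_top"
  proof (rule integral_dominated_convergence_at_top[where w="\<lambda>x. (cmod (f x))\<^sup>2"])
    show "integrable lborel (\<lambda>x. (cmod (f x))\<^sup>2)" using f by (simp add: square_integrable_def)
    show "\<forall>\<^sub>F N in at_top. AE x in lborel. norm ((cmod (f x - trunc N f x))\<^sup>2) \<le> (cmod (f x))\<^sup>2"
      by (intro always_eventually allI AE_I2) (auto intro!: power_mono cmod_trunc_le)
    show "AE x in lborel. ((\<lambda>N. (cmod (f x - trunc N f x))\<^sup>2) \<longlongrightarrow> 0) at_top"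
    proof (intro AE_I2 tendsto_eventually)
      fix x :: real
      show "\<forall>\<^sub>F N in at_top. (cmod (f x - trunc N f x))\<^sup>2 = 0"
        using eventually_ge_at_top[of "\<bar>x\<bar>"] by eventually_elim (auto simp: trunc_def indicator_def)
    qed
  qed measurable
  then show ?thesis unfolding l2_def using tendsto_real_sqrt by fastforce
qed

text \<open>
  By the compactly supported case the transforms of the truncations form a Cauchy family, so a limit
  exists and the choice in the definition of the transform is one.
\<close>

lemma fourier_line_spec:
  assumes f: "square_integrable lborel f"
  shows "square_integrable lborel (fourier Line f)"
    "((\<lambda>N. l2 lborel (\<lambda>\<xi>. ft (trunc N f) \<xi> - fourier Line f \<xi>)) \<longlongrightarrow> 0) at_top"
proof -
  have [measurable]: "f \<in> borel_measurable borel" using f by (simp add: square_integrable_def)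
  define e where "e N = 2 * pi * (l2 lborel (\<lambda>x. f x - trunc N f x))\<^sup>2" for N
  have e0: "(e \<longlongrightarrow> 0) at_top"
    unfolding e_def using l2_trunc_tendsto[OF f] by (auto intro!: tendsto_eq_intros)
  have bound: "nsq lborel (\<lambda>\<xi>. ft (trunc N f) \<xi> - ft (trunc n f) \<xi>) \<le> ennreal (e n)" if "n \<le> N" for n N
  proof -
    have "l2 lborel (\<lambda>x. trunc N f x - trunc n f x) \<le> l2 lborel (\<lambda>x. f x - trunc n f x)"
      using that by (intro l2_mono square_integrable_diff square_integrable_trunc f) (auto simp: trunc_def indicator_def)
    then have "(l2 lborel (\<lambda>x. trunc N f x - trunc n f x))\<^sup>2 \<le> (l2 lborel (\<lambda>x. f x - trunc n f x))\<^sup>2"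
      by (intro power_mono) auto
    then show ?thesis
      unfolding ft_trunc_diff[OF f] nsq_eq_l2[OF square_integrable_diff[OF square_integrable_trunc[OF f] square_integrable_trunc[OF f]]] e_def
      by (subst ennreal_mult[symmetric]) (auto intro!: ennreal_leI)
  qed
  obtain g where gm: "g \<in> borel_measurable lborel"
    and g: "\<And>n::nat. nsq lborel (\<lambda>\<xi>. g \<xi> - ft (trunc (real n) f) \<xi>) \<le> ennreal (e (real n))"
  proof (rule Riesz_Fischer[of "\<lambda>n. ft (trunc (real n) f)" lborel "\<lambda>n. e (real n)"])
    show "(\<lambda>n. e (real n)) \<longlonglongrightarrow> 0"
      using filterlim_compose[OF e0 filterlim_real_sequentially] by simp
  qed (use bound in auto)
  have [measurable]: "g \<in> borel_measurable borel" using gm by simp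
  have "square_integrable lborel (\<lambda>\<xi>. g \<xi> - ft (trunc (real 0) f) \<xi>)"
    using g[of 0] by (intro square_integrableI_nsq) (auto intro: order_le_less_trans)
  from square_integrable_add[OF this l2_ft_trunc(1)[OF f, of "real 0"]]
  have gL2: "square_integrable lborel g" by simp
  have lim: "((\<lambda>N. nsq lborel (\<lambda>\<xi>. ft (trunc N f) \<xi> - g \<xi>)) \<longlongrightarrow> 0) at_top"
  proof (rule tendsto_sandwich[OF _ _ tendsto_const])
    show "\<forall>\<^sub>F N in at_top. nsq lborel (\<lambda>\<xi>. ft (trunc N f) \<xi> - g \<xi>) \<le> ennreal (4 * e (real (nat \<lfloor>N\<rfloor>)))"
      using eventually_ge_at_top[of 0]
    proof eventually_elim
      case (elim N)
      define n where "n = real (nat \<lfloor>N\<rfloor>)"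
      have n: "n \<le> N" using elim by (simp add: n_def)
      have "nsq lborel (\<lambda>\<xi>. (ft (trunc N f) \<xi> - ft (trunc n f) \<xi>) + (ft (trunc n f) \<xi> - g \<xi>))
         \<le> 2 * nsq lborel (\<lambda>\<xi>. ft (trunc N f) \<xi> - ft (trunc n f) \<xi>) + 2 * nsq lborel (\<lambda>\<xi>. ft (trunc n f) \<xi> - g \<xi>)"
        by (rule nsq_add_le) measurable
      also have "\<dots> \<le> 2 * ennreal (e n) + 2 * ennreal (e n)"
        using bound[OF n] g[of "nat \<lfloor>N\<rfloor>"] by (intro add_mono mult_left_mono) (auto simp: n_def nsq_minus_commute)
      also have "\<dots> = ennreal (4 * e n)"
      proof -
        have "e n \<ge> 0" by (simp add: e_def)
        have "2 * ennreal (e n) + 2 * ennreal (e n) = (2 + 2) * ennreal (e n)"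
          by (rule distrib_right[symmetric])
        also have "\<dots> = ennreal (4 * e n)" using \<open>e n \<ge> 0\<close> by (simp add: ennreal_mult')
        finally show ?thesis .
      qed
      finally show ?case by (simp add: n_def)
    qed
    have "filterlim (\<lambda>N::real. real (nat \<lfloor>N\<rfloor>)) at_top at_top"
    proof (rule filterlim_compose[OF filterlim_real_sequentially])
      show "filterlim (\<lambda>N::real. nat \<lfloor>N\<rfloor>) sequentially at_top"
        unfolding filterlim_at_top
      proof
        fix Z
        show "\<forall>\<^sub>F N::real in at_top. Z \<le> nat \<lfloor>N\<rfloor>"
          using eventually_ge_at_top[of "real Z"] by eventually_elim (rule le_nat_floor)
      qed
    qed
    from filterlim_compose[OF e0 this] have "((\<lambda>N::real. 4 * e (real (nat \<lfloor>N\<rfloor>))) \<longlongrightarrow> 4 * 0) at_top"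
      by (intro tendsto_intros)
    then show "((\<lambda>N::real. ennreal (4 * e (real (nat \<lfloor>N\<rfloor>)))) \<longlongrightarrow> 0) at_top"
      using tendsto_ennrealI by fastforce
  qed simp
  have tr: "(LINT x:{-N..N}|lborel. f x * cis (- (\<xi> * x))) = ft (trunc N f) \<xi>" for N \<xi>
    by (simp add: ft_def trunc_def set_lebesgue_integral_def)
  have "\<exists>g. square_integrable lborel g \<and> ((\<lambda>N. nsq lborel (\<lambda>\<xi>. ft (trunc N f) \<xi> - g \<xi>)) \<longlongrightarrow> 0) at_top"
    using gL2 lim by blast
  from someI_ex[OF this]
  have *: "square_integrable lborel (fourier Line f)"
    "((\<lambda>N. nsq lborel (\<lambda>\<xi>. ft (trunc N f) \<xi> - fourier Line f \<xi>)) \<longlongrightarrow> 0) at_top"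
    by (simp_all add: tr nsq_def fourier.simps(1))
  show "square_integrable lborel (fourier Line f)" by fact
  have "((\<lambda>N. ennreal ((l2 lborel (\<lambda>\<xi>. ft (trunc N f) \<xi> - fourier Line f \<xi>))\<^sup>2)) \<longlongrightarrow> ennreal 0) at_top"
    using *(2) by (simp add: nsq_eq_l2 square_integrable_diff l2_ft_trunc(1)[OF f] *(1))
  then have "((\<lambda>N. (l2 lborel (\<lambda>\<xi>. ft (trunc N f) \<xi> - fourier Line f \<xi>))\<^sup>2) \<longlongrightarrow> 0) at_top"
    by (subst (asm) tendsto_ennreal_iff) auto
  from tendsto_real_sqrt[OF this]
  show "((\<lambda>N. l2 lborel (\<lambda>\<xi>. ft (trunc N f) \<xi> - fourier Line f \<xi>)) \<longlongrightarrow> 0) at_top" by simp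
qed

lemma fourier_line_seq:
  assumes f: "square_integrable lborel f"
  shows "(\<lambda>n. l2 lborel (\<lambda>\<xi>. ft (trunc (real n) f) \<xi> - fourier Line f \<xi>)) \<longlonglongrightarrow> 0"
  using filterlim_compose[OF fourier_line_spec(2)[OF f] filterlim_real_sequentially] by simp

lemma l2_tendsto:
  assumes f: "square_integrable M f" and G: "\<And>n. square_integrable M (G n)"
    and lim: "(\<lambda>n::nat. l2 M (\<lambda>x. G n x - f x)) \<longlonglongrightarrow> 0"
  shows "(\<lambda>n. l2 M (G n)) \<longlonglongrightarrow> l2 M f"
proof -
  have "(\<lambda>n. l2 M (G n) - l2 M f) \<longlonglongrightarrow> 0"
  proof (rule Lim_null_comparison[OF _ lim])
    show "\<forall>\<^sub>F n in sequentially. norm (l2 M (G n) - l2 M f) \<le> l2 M (\<lambda>x. G n x - f x)"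
      using l2_triangle_rev[OF G f] by simp
  qed
  then show ?thesis by (simp add: LIM_zero_iff)
qed

lemma l2_trunc_seq:
  assumes f: "square_integrable lborel f"
  shows "(\<lambda>n. l2 lborel (trunc (real n) f)) \<longlonglongrightarrow> l2 lborel f"
  by (rule l2_tendsto[OF f square_integrable_trunc[OF f]])
    (use filterlim_compose[OF l2_trunc_tendsto[OF f] filterlim_real_sequentially] in \<open>simp add: l2_minus_commute\<close>)

lemma Plancherel_line:
  assumes f: "square_integrable lborel f"
  shows "l2 lborel (fourier Line f) = sqrt (2 * pi) * l2 lborel f"
proof (rule LIMSEQ_unique)
  show "(\<lambda>n. l2 lborel (ft (trunc (real n) f))) \<longlonglongrightarrow> l2 lborel (fourier Line f)"
    by (rule l2_tendsto[OF fourier_line_spec(1)[OF f] l2_ft_trunc(1)[OF f] fourier_line_seq[OF f]])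
  show "(\<lambda>n. l2 lborel (ft (trunc (real n) f))) \<longlonglongrightarrow> sqrt (2 * pi) * l2 lborel f"
    unfolding l2_ft_trunc(2)[OF f] by (intro tendsto_intros l2_trunc_seq[OF f])
qed

lemma fourier_line_linear:
  assumes f: "square_integrable lborel f" and g: "square_integrable lborel g"
  shows "AE \<xi> in lborel. fourier Line (\<lambda>x. a * f x + b * g x) \<xi> = a * fourier Line f \<xi> + b * fourier Line g \<xi>"
proof -
  let ?h = "\<lambda>x. a * f x + b * g x" and ?F = "\<lambda>\<xi>. a * fourier Line f \<xi> + b * fourier Line g \<xi>"
  have h: "square_integrable lborel ?h" by (intro square_integrable_add square_integrable_scale f g)
  note Ff = fourier_line_spec(1)[OF f] and Fg = fourier_line_spec(1)[OF g]
  have eq: "ft (trunc N ?h) \<xi> = a * ft (trunc N f) \<xi> + b * ft (trunc N g) \<xi>" for N \<xi>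
  proof -
    have "trunc N ?h x * cis (- (\<xi> * x)) = a * (trunc N f x * cis (- (\<xi> * x))) + b * (trunc N g x * cis (- (\<xi> * x)))" for x
      by (simp add: trunc_def algebra_simps)
    then show ?thesis unfolding ft_def
      using integrable_trunc_cis[OF f, of N "- \<xi>"] integrable_trunc_cis[OF g, of N "- \<xi>"] by simp
  qed
  show ?thesis
  proof (rule l2_eq_limit_AE[OF fourier_line_spec(1)[OF h] _ l2_ft_trunc(1)[OF h] fourier_line_seq[OF h]])
    show F: "square_integrable lborel ?F" by (intro square_integrable_add square_integrable_scale Ff Fg)
    have "(\<lambda>n. cmod a * l2 lborel (\<lambda>\<xi>. ft (trunc (real n) f) \<xi> - fourier Line f \<xi>) + cmod b * l2 lborel (\<lambda>\<xi>. ft (trunc (real n) g) \<xi> - fourier Line g \<xi>)) \<longlonglongrightarrow> 0"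
      using fourier_line_seq[OF f] fourier_line_seq[OF g] by (auto intro!: tendsto_eq_intros)
    then show "(\<lambda>n. l2 lborel (\<lambda>x. ft (trunc (real n) ?h) x - ?F x)) \<longlonglongrightarrow> 0"
    proof (rule Lim_null_comparison[rotated], intro always_eventually allI)
      fix n
      have "l2 lborel (\<lambda>x. a * (ft (trunc (real n) f) x - fourier Line f x) + b * (ft (trunc (real n) g) x - fourier Line g x))
         \<le> l2 lborel (\<lambda>x. a * (ft (trunc (real n) f) x - fourier Line f x)) + l2 lborel (\<lambda>x. b * (ft (trunc (real n) g) x - fourier Line g x))"
        by (intro l2_triangle square_integrable_scale square_integrable_diff l2_ft_trunc f g Ff Fg)
      moreover have "(\<lambda>x. a * (ft (trunc (real n) f) x - fourier Line f x) + b * (ft (trunc (real n) g) x - fourier Line g x)) = (\<lambda>x. ft (trunc (real n) ?h) x - ?F x)"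
        unfolding eq by (auto simp: algebra_simps)
      ultimately show "norm (l2 lborel (\<lambda>x. ft (trunc (real n) ?h) x - ?F x)) \<le> cmod a * l2 lborel (\<lambda>\<xi>. ft (trunc (real n) f) \<xi> - fourier Line f \<xi>) + cmod b * l2 lborel (\<lambda>\<xi>. ft (trunc (real n) g) \<xi> - fourier Line g \<xi>)"
        by (simp add: l2_scale)
    qed
  qed
qed

lemma ft_trunc_tendsto:
  assumes f: "integrable lborel f"
  shows "(\<lambda>n. ft (trunc (real n) f) \<xi>) \<longlonglongrightarrow> ft f \<xi>"
  unfolding ft_def
proof (rule integral_dominated_convergence[where w="\<lambda>x. norm (f x)"])
  show "AE x in lborel. (\<lambda>n. trunc (real n) f x * cis (- (\<xi> * x))) \<longlonglongrightarrow> f x * cis (- (\<xi> * x))"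
  proof (intro AE_I2 tendsto_eventually)
    fix x :: real
    show "\<forall>\<^sub>F n in sequentially. trunc (real n) f x * cis (- (\<xi> * x)) = f x * cis (- (\<xi> * x))"
      using eventually_ge_at_top[of "nat \<lceil>\<bar>x\<bar>\<rceil>"]
      by eventually_elim (auto simp: trunc_def indicator_def nat_le_iff ceiling_le_iff)
  qed
  show "AE x in lborel. norm (trunc (real n) f x * cis (- (\<xi> * x))) \<le> norm (f x)" for n
    using cmod_trunc_le(1) by (auto simp: norm_mult)
qed (use f borel_measurable_integrable[OF f] in \<open>auto simp: trunc_def\<close>)

lemma fourier_line_L1:
  assumes f: "square_integrable lborel f" and f1: "integrable lborel f"
  shows "AE \<xi> in lborel. fourier Line f \<xi> = ft f \<xi>"
proof -
  have [measurable]: "f \<in> borel_measurable borel" using f by (simp add: square_integrable_def)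
  have [measurable]: "fourier Line f \<in> borel_measurable borel" using fourier_line_spec(1)[OF f] by (simp add: square_integrable_def)
  have "nsq lborel (\<lambda>\<xi>. ft f \<xi> - fourier Line f \<xi>) \<le> ennreal e" if e: "e > 0" for e
  proof (rule nsq_AE_limit_le)
    show "AE \<xi> in lborel. (\<lambda>n. ft (trunc (real n) f) \<xi>) \<longlonglongrightarrow> ft f \<xi>" using ft_trunc_tendsto[OF f1] by simp
    have "(\<lambda>n. (l2 lborel (\<lambda>\<xi>. ft (trunc (real n) f) \<xi> - fourier Line f \<xi>))\<^sup>2) \<longlonglongrightarrow> 0\<^sup>2"
      by (intro tendsto_intros fourier_line_seq f)
    then have "\<forall>\<^sub>F n in sequentially. (l2 lborel (\<lambda>\<xi>. ft (trunc (real n) f) \<xi> - fourier Line f \<xi>))\<^sup>2 < e"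
      using e by (intro order_tendstoD) auto
    then show "\<forall>\<^sub>F n in sequentially. nsq lborel (\<lambda>\<xi>. ft (trunc (real n) f) \<xi> - fourier Line f \<xi>) \<le> ennreal e"
      by eventually_elim
        (simp add: nsq_eq_l2 square_integrable_diff l2_ft_trunc(1)[OF f] fourier_line_spec(1)[OF f] ennreal_leI)
  qed measurable
  then have "nsq lborel (\<lambda>\<xi>. ft f \<xi> - fourier Line f \<xi>) \<le> 0"
    using ennreal_le_epsilon[of 0] by simp
  then have "AE \<xi> in lborel. ft f \<xi> - fourier Line f \<xi> = 0" by (intro nsq_zero_AE) auto
  then show ?thesis by eventually_elim simp
qed

text \<open>
  The function k is the transform of g, reflected and scaled, so the norms of k and g are related by
  Plancherel. Fubini's theorem computes the inner product of g with the transforms of truncations of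
  k; in the limit it equals the square of the norm of g and of the transform of k alike, so the two
  functions have distance 0.
\<close>

lemma ft_inverse_line:
  assumes g: "square_integrable lborel g" and g1: "integrable lborel g"
  defines "k \<equiv> \<lambda>x. 1 / (2 * pi) * (LINT \<xi>|lborel. g \<xi> * cis (\<xi> * x))"
  shows "square_integrable lborel k" "AE \<xi> in lborel. fourier Line k \<xi> = g \<xi>"
proof -
  have [measurable]: "g \<in> borel_measurable borel" using g by (simp add: square_integrable_def)
  have k_ft: "k x = 1 / (2 * pi) * ft g (- x)" for x
    unfolding k_def ft_def by (intro arg_cong2[where f="(*)"] refl Bochner_Integration.integral_cong) (simp add: mult.commute)
  have [measurable]: "k \<in> borel_measurable borel" unfolding k_ft[abs_def] by measurable
  have ft_L2: "square_integrable lborel (ft g)" "l2 lborel (ft g) = sqrt (2 * pi) * l2 lborel g"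
  proof -
    have Fm: "fourier Line g \<in> borel_measurable lborel" using fourier_line_spec(1)[OF g] by (simp add: square_integrable_def)
    have nsq: "nsq lborel (ft g) = nsq lborel (fourier Line g)"
      unfolding nsq_def using fourier_line_L1[OF g g1] by (intro nn_integral_cong_AE) auto
    show "square_integrable lborel (ft g)"
      by (rule square_integrableI_nsq) (simp_all add: nsq nsq_eq_l2[OF fourier_line_spec(1)[OF g]])
    show "l2 lborel (ft g) = sqrt (2 * pi) * l2 lborel g"
      using l2_cong_AE[OF fourier_line_L1[OF g g1] Fm] Plancherel_line[OF g] by simp
  qed
  have refl: "nsq lborel (\<lambda>x. ft g (- x)) = nsq lborel (ft g)"
    unfolding nsq_def by (subst nn_integral_real_affine[where c="-1" and t=0, of "\<lambda>x. ennreal ((cmod (ft g x))\<^sup>2)"]) auto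
  have ftm: "square_integrable lborel (\<lambda>x. ft g (- x))"
    by (rule square_integrableI_nsq) (simp_all add: refl nsq_eq_l2[OF ft_L2(1)])
  show k: "square_integrable lborel k" unfolding k_ft[abs_def] by (rule square_integrable_scale[OF ftm])
  have "(l2 lborel (\<lambda>x. ft g (- x)))\<^sup>2 = (l2 lborel (ft g))\<^sup>2"
    using refl unfolding nsq_eq_l2[OF ftm] nsq_eq_l2[OF ft_L2(1)] by simp
  then have "l2 lborel (\<lambda>x. ft g (- x)) = l2 lborel (ft g)" by (simp add: power2_eq_iff_nonneg)
  then have l2k: "l2 lborel k = 1 / (2 * pi) * (sqrt (2 * pi) * l2 lborel g)"
    unfolding k_ft[abs_def] l2_scale ft_L2(2) by (simp add: norm_divide norm_mult)
  have gk: "(l2 lborel g)\<^sup>2 = 2 * pi * (l2 lborel k)\<^sup>2"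
    unfolding l2k by (simp add: power_mult_distrib power_divide) (simp add: power2_eq_square)
  have inner: "(LINT \<xi>|lborel. ft (trunc N k) \<xi> * cnj (g \<xi>)) = of_real (2 * pi * (l2 lborel (trunc N k))\<^sup>2)" for N
  proof -
    have kN: "integrable lborel (trunc N k)" using integrable_trunc_cis[OF k, of N 0] by simp
    have "(LINT \<xi>|lborel. ft (trunc N k) \<xi> * cnj (g \<xi>)) = (LINT \<xi>|lborel. LINT x|lborel. trunc N k x * cis (- (\<xi> * x)) * cnj (g \<xi>))"
      unfolding ft_def using integrable_trunc_cis[OF k, of N "- _"] by simp
    also have "\<dots> = (LINT x|lborel. LINT \<xi>|lborel. trunc N k x * cis (- (\<xi> * x)) * cnj (g \<xi>))"
    proof (rule lborel_pair.Fubini_integral)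
      have "integrable (lborel \<Otimes>\<^sub>M lborel) (\<lambda>(x, \<xi>). trunc N k x * cnj (g \<xi>))"
      proof (rule lborel_pair.Fubini_integrable)
        have "integrable lborel (\<lambda>x. norm (trunc N k x) * (LINT y|lborel. norm (g y)))" using kN by auto
        then show "integrable lborel (\<lambda>x. LINT y|lborel. norm (case (x, y) of (x, \<xi>) \<Rightarrow> trunc N k x * cnj (g \<xi>)))"
          by (simp add: norm_mult)
        show "AE x in lborel. integrable lborel (\<lambda>y. case (x, y) of (x, \<xi>) \<Rightarrow> trunc N k x * cnj (g \<xi>))"
          using g1 by (simp add: integrable_cnj)
      qed measurable
      then show "integrable (lborel \<Otimes>\<^sub>M lborel) (\<lambda>(x, y). trunc N k x * cis (- (y * x)) * cnj (g y))"
        by (rule Bochner_Integration.integrable_bound) (auto simp: norm_mult)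
    qed
    also have "\<dots> = (LINT x|lborel. of_real (2 * pi) * (of_real ((cmod (trunc N k x))\<^sup>2)))"
    proof (intro Bochner_Integration.integral_cong refl)
      fix x
      have "integrable lborel (\<lambda>\<xi>. g \<xi> * cis (\<xi> * x))"
        using g1 by (rule Bochner_Integration.integrable_bound) (auto simp: norm_mult)
      have "(LINT \<xi>|lborel. trunc N k x * cis (- (\<xi> * x)) * cnj (g \<xi>)) = (LINT \<xi>|lborel. trunc N k x * cnj (g \<xi> * cis (\<xi> * x)))"
        by (simp add: cis_cnj mult_ac)
      also have "\<dots> = trunc N k x * cnj (LINT \<xi>|lborel. g \<xi> * cis (\<xi> * x))"
        unfolding integral_mult_right_zero by (simp only: Bochner_Integration.integral_cnj)
      also have "\<dots> = trunc N k x * cnj (2 * pi * k x)" by (simp add: k_def)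
      also have "\<dots> = of_real (2 * pi) * (of_real ((cmod (trunc N k x))\<^sup>2))"
        unfolding complex_mult_cnj_norm[symmetric] by (auto simp: trunc_def indicator_def)
      finally show "(LINT \<xi>|lborel. trunc N k x * cis (- (\<xi> * x)) * cnj (g \<xi>)) = of_real (2 * pi) * (of_real ((cmod (trunc N k x))\<^sup>2))" .
    qed simp
    also have "\<dots> = of_real (2 * pi * (l2 lborel (trunc N k))\<^sup>2)"
      unfolding l2_square integral_mult_right_zero integral_complex_of_real by simp
    finally show ?thesis .
  qed
  have dist: "(l2 lborel (\<lambda>\<xi>. ft (trunc N k) \<xi> - g \<xi>))\<^sup>2 = (l2 lborel g)\<^sup>2 - 2 * pi * (l2 lborel (trunc N k))\<^sup>2" for N
    unfolding l2_add_square[OF l2_ft_trunc(1)[OF k] g] inner l2_ft_trunc(2)[OF k]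
    by (simp add: power_mult_distrib)
  have "(\<lambda>n. (l2 lborel (\<lambda>\<xi>. ft (trunc (real n) k) \<xi> - g \<xi>))\<^sup>2) \<longlonglongrightarrow> (l2 lborel g)\<^sup>2 - 2 * pi * (l2 lborel k)\<^sup>2"
    unfolding dist by (intro tendsto_intros l2_trunc_seq k)
  then have "(\<lambda>n. sqrt ((l2 lborel (\<lambda>\<xi>. ft (trunc (real n) k) \<xi> - g \<xi>))\<^sup>2)) \<longlonglongrightarrow> sqrt 0"
    unfolding gk by (intro tendsto_real_sqrt) simp
  then have "(\<lambda>n. l2 lborel (\<lambda>\<xi>. ft (trunc (real n) k) \<xi> - g \<xi>)) \<longlonglongrightarrow> 0" by simp
  then show "AE \<xi> in lborel. fourier Line k \<xi> = g \<xi>"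
    by (intro l2_eq_limit_AE[OF fourier_line_spec(1)[OF k] g l2_ft_trunc(1)[OF k] fourier_line_seq[OF k]])
qed

section \<open>Fourier inversion on both domains\<close>

lemma borel_measurable_space: "f \<in> borel_measurable borel \<Longrightarrow> f \<in> borel_measurable (space_measure Z)"
  by (cases Z) (auto intro: borel_measurable_circle)

lemma borel_measurable_freq: "f \<in> borel_measurable borel \<Longrightarrow> f \<in> borel_measurable (freq_measure Z)"
  by (cases Z) auto

lemma countable_Ints_real: "countable (\<int> :: real set)"
  by (simp add: Ints_def)

lemma sigma_finite_freq: "sigma_finite_measure (freq_measure Z)"
  by (cases Z) (auto intro!: lborel.sigma_finite_measure_axioms sigma_finite_measure_count_space_countable countable_Ints_real)

lemma L2_square_integrable: "f \<in> L2 Z \<Longrightarrow> square_integrable (space_measure Z) f"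
  by (simp add: L2_def)

lemma L2_add: "f \<in> L2 Z \<Longrightarrow> g \<in> L2 Z \<Longrightarrow> (\<lambda>x. a * f x + b * g x) \<in> L2 Z"
  by (cases Z) (auto simp: L2_def intro!: square_integrable_add square_integrable_scale)

lemma L2_diff: "f \<in> L2 Z \<Longrightarrow> g \<in> L2 Z \<Longrightarrow> (\<lambda>x. f x - g x) \<in> L2 Z"
  using L2_add[of f Z g 1 "-1"] by simp

lemma L2_norm_l2: "L2_norm Z f = l2 (space_measure Z) f"
  by (simp add: L2_norm_def l2_def)

lemma bij_int_Ints: "bij_betw (of_int :: int \<Rightarrow> real) UNIV \<int>"
  by (auto simp: bij_betw_def inj_on_def Ints_def)

lemma nsq_fourier_circle:
  assumes "square_integrable circle_measure f"
  shows "nsq (count_space \<int>) (fourier Circle f) = ennreal (2 * pi * (l2 circle_measure f)\<^sup>2)"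
  using Parseval_circle_nn_integral[OF assms]
    nn_integral_bij_count_space[OF bij_int_Ints, of "\<lambda>\<xi>. ennreal ((cmod (fourier Circle f \<xi>))\<^sup>2)"]
  by (simp add: nsq_def l2_square)

lemma fourier_square_integrable:
  assumes "f \<in> L2 Z"
  shows "square_integrable (freq_measure Z) (fourier Z f)"
proof (cases Z)
  case Line
  then show ?thesis using fourier_line_spec(1)[of f] assms by (simp add: L2_def)
next
  case Circle
  then show ?thesis using nsq_fourier_circle[of f] assms
    by (intro square_integrableI_nsq) (auto simp: L2_def simp del: fourier.simps)
qed

theorem Plancherel:
  assumes "f \<in> L2 Z"
  shows "l2 (freq_measure Z) (fourier Z f) = sqrt (2 * pi) * l2 (space_measure Z) f"
proof (cases Z)
  case Line
  then show ?thesis using Plancherel_line[of f] assms by (simp add: L2_def)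
next
  case Circle
  have "(l2 (count_space \<int>) (fourier Circle f))\<^sup>2 = 2 * pi * (l2 circle_measure f)\<^sup>2"
    using nsq_fourier_circle[of f] nsq_eq_l2[OF fourier_square_integrable[OF assms]] assms Circle
    by (simp add: L2_def del: fourier.simps)
  also have "\<dots> = (sqrt (2 * pi) * l2 circle_measure f)\<^sup>2" by (simp add: power_mult_distrib)
  finally show ?thesis using Circle by (simp add: power2_eq_iff_nonneg del: fourier.simps)
qed

lemma fourier_linear:
  assumes f: "f \<in> L2 Z" and g: "g \<in> L2 Z"
  shows "AE \<xi> in freq_measure Z. fourier Z (\<lambda>x. a * f x + b * g x) \<xi> = a * fourier Z f \<xi> + b * fourier Z g \<xi>"
proof (cases Z)
  case Line
  show ?thesis using fourier_line_linear[of f g a b] assms unfolding Line freq_measure.simps by (simp add: L2_def)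
next
  case Circle
  have "fourier Circle (\<lambda>x. a * f x + b * g x) \<xi> = a * fourier Circle f \<xi> + b * fourier Circle g \<xi>" for \<xi>
  proof -
    have "integrable circle_measure (\<lambda>x. f x * cis (- (\<xi> * x)))" "integrable circle_measure (\<lambda>x. g x * cis (- (\<xi> * x)))"
      using fourier_circle_integrable[of f "- \<xi>"] fourier_circle_integrable[of g "- \<xi>"] f g Circle by (auto simp: L2_def)
    then show ?thesis by (simp add: distrib_right mult.assoc)
  qed
  then show ?thesis using Circle by simp
qed

lemma fourier_L1:
  assumes "f \<in> L2 Z" "integrable (space_measure Z) f"
  shows "AE \<xi> in freq_measure Z. fourier Z f \<xi> = (LINT x|space_measure Z. f x * cis (- (\<xi> * x)))"
proof (cases Z)
  case Line
  show ?thesis using fourier_line_L1[of f] assms unfolding Line freq_measure.simps by (simp add: L2_def ft_def)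
qed auto

definition inv_ft :: "domain \<Rightarrow> (real \<Rightarrow> complex) \<Rightarrow> real \<Rightarrow> complex" where
  "inv_ft Z g x = 1 / (2 * pi) * (LINT \<xi>|freq_measure Z. g \<xi> * cis (\<xi> * x))"

lemma fourier_multiplier_inv_ft: "fourier_multiplier Z m f = inv_ft Z (\<lambda>\<xi>. m \<xi> * fourier Z f \<xi>)"
  by (simp add: fourier_multiplier_def inv_ft_def fun_eq_iff)

lemma integrable_mult_cis:
  assumes "integrable (freq_measure Z) g"
  shows "integrable (freq_measure Z) (\<lambda>\<xi>. g \<xi> * cis (\<xi> * x))"
proof -
  have "(\<lambda>\<xi>. cis (\<xi> * x)) \<in> borel_measurable (freq_measure Z)" by (rule borel_measurable_freq) measurable
  then show ?thesis
    by (intro Bochner_Integration.integrable_bound[OF assms] borel_measurable_times) (use assms in \<open>auto simp: norm_mult\<close>)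
qed

lemma cmod_inv_ft_le:
  assumes "integrable (freq_measure Z) g"
  shows "cmod (inv_ft Z g x) \<le> 1 / (2 * pi) * (LINT \<xi>|freq_measure Z. cmod (g \<xi>))"
proof -
  have "cmod (LINT \<xi>|freq_measure Z. g \<xi> * cis (\<xi> * x)) \<le> (LINT \<xi>|freq_measure Z. cmod (g \<xi>))"
    using integral_norm_bound[of "freq_measure Z" "\<lambda>\<xi>. g \<xi> * cis (\<xi> * x)"] by (simp add: norm_mult)
  then show ?thesis unfolding inv_ft_def norm_mult by (intro mult_mono) (auto simp: norm_divide)
qed

lemma inv_ft_continuous_sequentially:
  assumes g: "integrable (freq_measure Z) g" and X: "X \<longlonglongrightarrow> x"
  shows "(\<lambda>n. inv_ft Z g (X n)) \<longlonglongrightarrow> inv_ft Z g x"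
  unfolding inv_ft_def
proof (intro tendsto_mult_left integral_dominated_convergence[where w="\<lambda>\<xi>. cmod (g \<xi>)"])
  show "AE \<xi> in freq_measure Z. (\<lambda>n. g \<xi> * cis (\<xi> * X n)) \<longlonglongrightarrow> g \<xi> * cis (\<xi> * x)"
    by (intro AE_I2 tendsto_intros X)
qed (use g integrable_mult_cis[OF g] in \<open>auto simp: norm_mult\<close>)

lemma inv_ft_continuous:
  assumes g: "integrable (freq_measure Z) g"
  shows "continuous_on UNIV (inv_ft Z g)"
  unfolding continuous_on_def tendsto_at_iff_sequentially
  using inv_ft_continuous_sequentially[OF g] by (auto simp: o_def)

lemma cmod_cis_minus_1_le: "cmod (cis t - 1) \<le> \<bar>t\<bar>"
proof -
  have "cmod (cis t - 1) = 2 * \<bar>sin (t / 2)\<bar>" using dist_exp_i_1[of t] by (simp add: cis_conv_exp)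
  also have "\<dots> \<le> \<bar>t\<bar>" using abs_sin_x_le_abs_x[of "t/2"] by simp
  finally show ?thesis .
qed

text \<open>
  Differentiation under the integral sign, with the difference quotients of cis dominated by the
  frequency.
\<close>

lemma inv_ft_has_vector_derivative:
  assumes g: "integrable (freq_measure Z) g" and g1: "integrable (freq_measure Z) (\<lambda>\<xi>. \<i> * of_real \<xi> * g \<xi>)"
  shows "(inv_ft Z g has_vector_derivative inv_ft Z (\<lambda>\<xi>. \<i> * of_real \<xi> * g \<xi>) x) (at x)"
  unfolding has_vector_derivative_def has_derivative_at
proof (intro conjI bounded_linear_scaleR_left)
  let ?M = "freq_measure Z" and ?k = "inv_ft Z (\<lambda>\<xi>. \<i> * of_real \<xi> * g \<xi>) x"
  define R where "R \<xi> h = (cis (\<xi> * h) - 1 - h *\<^sub>R (\<i> * of_real \<xi>)) / of_real h" for \<xi> h :: real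
  have R_le: "cmod (R \<xi> h) \<le> 2 * \<bar>\<xi>\<bar>" for \<xi> h
  proof (cases "h = 0")
    case False
    have "cmod (cis (\<xi> * h) - 1 - h *\<^sub>R (\<i> * of_real \<xi>)) \<le> \<bar>\<xi> * h\<bar> + \<bar>h\<bar> * \<bar>\<xi>\<bar>"
      using cmod_cis_minus_1_le[of "\<xi> * h"] norm_triangle_ineq4[of "cis (\<xi> * h) - 1" "h *\<^sub>R (\<i> * of_real \<xi>)"]
      by (simp add: norm_mult)
    then show ?thesis using False by (simp add: R_def norm_divide abs_mult field_simps)
  qed (simp add: R_def)
  have R_lim: "((\<lambda>h. R \<xi> h) \<longlongrightarrow> 0) (at 0)" for \<xi>
  proof -
    have "((\<lambda>h. cis (\<xi> * h)) has_vector_derivative \<i> * of_real \<xi>) (at 0)"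
      unfolding cis.ctr has_vector_derivative_complex_iff by (auto intro!: derivative_eq_intros)
    then have "((\<lambda>h. norm (cis (\<xi> * h) - 1 - h *\<^sub>R (\<i> * of_real \<xi>)) / norm h) \<longlongrightarrow> 0) (at 0)"
      unfolding has_vector_derivative_def has_derivative_at by simp
    then have "((\<lambda>h. norm (R \<xi> h)) \<longlongrightarrow> 0) (at 0)" by (simp add: R_def norm_divide)
    then show ?thesis by (rule tendsto_norm_zero_cancel)
  qed
  have Rm: "(\<lambda>\<xi>. R \<xi> h) \<in> borel_measurable ?M" for h
    unfolding R_def by (rule borel_measurable_freq) measurable
  have gm: "g \<in> borel_measurable ?M" using g by simp
  have cm: "(\<lambda>\<xi>. cis (\<xi> * x)) \<in> borel_measurable ?M" by (rule borel_measurable_freq) measurable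
  have "norm (inv_ft Z g (x + h) - inv_ft Z g x - h *\<^sub>R ?k) / norm h
      = cmod (1 / (2 * pi) * (LINT \<xi>|?M. g \<xi> * cis (\<xi> * x) * R \<xi> h))" if "h \<noteq> 0" for h
  proof -
    have "h *\<^sub>R (LINT \<xi>|?M. g \<xi> * cis (\<xi> * x) * R \<xi> h)
        = (LINT \<xi>|?M. g \<xi> * cis (\<xi> * (x + h)) - g \<xi> * cis (\<xi> * x) - h *\<^sub>R (\<i> * of_real \<xi> * g \<xi> * cis (\<xi> * x)))"
      unfolding integral_scaleR_right[symmetric] using that
      by (intro Bochner_Integration.integral_cong refl)
        (simp add: R_def scaleR_conv_of_real distrib_left cis_mult[symmetric] field_simps)
    also have "\<dots> = (LINT \<xi>|?M. g \<xi> * cis (\<xi> * (x + h))) - (LINT \<xi>|?M. g \<xi> * cis (\<xi> * x))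
       - h *\<^sub>R (LINT \<xi>|?M. \<i> * of_real \<xi> * g \<xi> * cis (\<xi> * x))"
      using integrable_mult_cis[OF g, of "x + h"] integrable_mult_cis[OF g, of x] integrable_mult_cis[OF g1, of x]
      by simp
    finally have eq: "h *\<^sub>R (LINT \<xi>|?M. g \<xi> * cis (\<xi> * x) * R \<xi> h)
       = (LINT \<xi>|?M. g \<xi> * cis (\<xi> * (x + h))) - (LINT \<xi>|?M. g \<xi> * cis (\<xi> * x))
       - h *\<^sub>R (LINT \<xi>|?M. \<i> * of_real \<xi> * g \<xi> * cis (\<xi> * x))" .
    have "inv_ft Z g (x + h) - inv_ft Z g x - h *\<^sub>R ?k = 1 / (2 * pi) * (h *\<^sub>R (LINT \<xi>|?M. g \<xi> * cis (\<xi> * x) * R \<xi> h))"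
      unfolding eq inv_ft_def by (simp add: right_diff_distrib diff_divide_distrib)
    then have "inv_ft Z g (x + h) - inv_ft Z g x - h *\<^sub>R ?k = h *\<^sub>R (1 / (2 * pi) * (LINT \<xi>|?M. g \<xi> * cis (\<xi> * x) * R \<xi> h))"
      by simp
    then show ?thesis using that by simp
  qed
  then have ev: "\<forall>\<^sub>F h in at 0. norm (inv_ft Z g (x + h) - inv_ft Z g x - h *\<^sub>R ?k) / norm h
      = cmod (1 / (2 * pi) * (LINT \<xi>|?M. g \<xi> * cis (\<xi> * x) * R \<xi> h))"
    by (auto simp: eventually_at_filter)
  have "((\<lambda>h. LINT \<xi>|?M. g \<xi> * cis (\<xi> * x) * R \<xi> h) \<longlongrightarrow> 0) (at 0)"
    unfolding tendsto_at_iff_sequentially o_def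
  proof (intro allI impI)
    fix X :: "nat \<Rightarrow> real" assume X: "\<forall>i. X i \<in> UNIV - {0}" "X \<longlonglongrightarrow> 0"
    have "(\<lambda>n. LINT \<xi>|?M. g \<xi> * cis (\<xi> * x) * R \<xi> (X n)) \<longlonglongrightarrow> (LINT \<xi>|?M. 0)"
    proof (rule integral_dominated_convergence[where w="\<lambda>\<xi>. 2 * cmod (\<i> * of_real \<xi> * g \<xi>)"])
      show "AE \<xi> in ?M. (\<lambda>n. g \<xi> * cis (\<xi> * x) * R \<xi> (X n)) \<longlonglongrightarrow> 0"
      proof (intro AE_I2)
        fix \<xi>
        have "(\<lambda>n. R \<xi> (X n)) \<longlonglongrightarrow> 0"
          using R_lim[of \<xi>, unfolded tendsto_at_iff_sequentially o_def] X by blast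
        then show "(\<lambda>n. g \<xi> * cis (\<xi> * x) * R \<xi> (X n)) \<longlonglongrightarrow> 0" by (rule tendsto_mult_right_zero)
      qed
      show "AE \<xi> in ?M. norm (g \<xi> * cis (\<xi> * x) * R \<xi> (X n)) \<le> 2 * cmod (\<i> * of_real \<xi> * g \<xi>)" for n
      proof (intro AE_I2)
        fix \<xi>
        have "cmod (g \<xi>) * cmod (R \<xi> (X n)) \<le> cmod (g \<xi>) * (2 * \<bar>\<xi>\<bar>)" by (intro mult_left_mono R_le) auto
        then show "norm (g \<xi> * cis (\<xi> * x) * R \<xi> (X n)) \<le> 2 * cmod (\<i> * of_real \<xi> * g \<xi>)" by (simp add: norm_mult mult_ac)
      qed
    qed (use g1 gm cm Rm in auto)
    then show "(\<lambda>n. LINT \<xi>|?M. g \<xi> * cis (\<xi> * x) * R \<xi> (X n)) \<longlonglongrightarrow> 0" by simp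
  qed
  then have "((\<lambda>h. cmod (1 / (2 * pi) * (LINT \<xi>|?M. g \<xi> * cis (\<xi> * x) * R \<xi> h))) \<longlongrightarrow> 0) (at 0)"
    by (intro tendsto_norm_zero tendsto_mult_right_zero)
  then show "((\<lambda>h. norm (inv_ft Z g (x + h) - inv_ft Z g x - h *\<^sub>R ?k) / norm h) \<longlongrightarrow> 0) (at 0)"
    using tendsto_cong[OF ev] by simp
qed

lemma cis_add_period:
  assumes "n \<in> \<int>" shows "cis (n * (x + 2 * pi)) = cis (n * x)"
  using cis_multiple_2pi[OF assms] by (simp add: distrib_left cis_mult[symmetric] mult_ac)

lemma inv_ft_function_on: "function_on Z (inv_ft Z g)"
proof (cases Z)
  case Circle
  have "(LINT \<xi>|count_space \<int>. g \<xi> * cis (\<xi> * (x + 2 * pi))) = (LINT \<xi>|count_space \<int>. g \<xi> * cis (\<xi> * x))" for x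
    by (intro Bochner_Integration.integral_cong refl) (simp add: cis_add_period)
  then show ?thesis using Circle by (simp add: inv_ft_def)
qed simp

lemma fourier_inv_ft_circle:
  assumes g: "integrable (count_space \<int>) g" and n: "n \<in> \<int>"
  shows "fourier Circle (inv_ft Circle g) n = g n"
proof -
  interpret F: finite_measure circle_measure by (rule finite_circle_measure)
  interpret S: sigma_finite_measure "count_space \<int> :: real measure"
    using sigma_finite_freq[of Circle] by simp
  interpret pair_sigma_finite "count_space \<int> :: real measure" circle_measure ..
  let ?f = "\<lambda>(\<xi>, x). g \<xi> * cis (\<xi> * x) * cis (- (n * x))"
  have cm: "(\<lambda>x. g \<xi> * cis (\<xi> * x) * cis (- (n * x))) \<in> borel_measurable circle_measure" for \<xi>
    by (rule borel_measurable_circle) measurable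
  have meas: "?f \<in> borel_measurable (count_space \<int> \<Otimes>\<^sub>M circle_measure)"
    by (rule measurable_pair_measure_countable1[OF countable_Ints_real]) (use cm in simp)
  have int: "integrable (count_space \<int> \<Otimes>\<^sub>M circle_measure) ?f"
  proof (rule Fubini_integrable[OF meas])
    show "integrable (count_space \<int>) (\<lambda>\<xi>. LINT x|circle_measure. norm (?f (\<xi>, x)))"
      using g by (simp add: norm_mult)
    show "AE \<xi> in count_space \<int>. integrable circle_measure (\<lambda>x. ?f (\<xi>, x))"
    proof (intro AE_I2)
      fix \<xi>
      show "integrable circle_measure (\<lambda>x. ?f (\<xi>, x))"
        using cm by (intro F.integrable_const_bound[where B="cmod (g \<xi>)"]) (auto simp: norm_mult)
    qed
  qed
  have "fourier Circle (inv_ft Circle g) n = (LINT x|circle_measure. 1 / (2 * pi) * (LINT \<xi>|count_space \<int>. g \<xi> * cis (\<xi> * x) * cis (- (n * x))))"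
    by (simp add: inv_ft_def)
  also have "\<dots> = 1 / (2 * pi) * (LINT x|circle_measure. LINT \<xi>|count_space \<int>. g \<xi> * cis (\<xi> * x) * cis (- (n * x)))"
    by (simp only: integral_mult_right_zero)
  also have "(LINT x|circle_measure. LINT \<xi>|count_space \<int>. g \<xi> * cis (\<xi> * x) * cis (- (n * x)))
     = (LINT \<xi>|count_space \<int>. LINT x|circle_measure. g \<xi> * cis (\<xi> * x) * cis (- (n * x)))"
    using Fubini_integral[OF int] by simp
  also have "\<dots> = (LINT \<xi>|count_space \<int>. indicat_real {n} \<xi> *\<^sub>R (2 * pi * g n))"
  proof (intro Bochner_Integration.integral_cong refl)
    fix \<xi> :: real assume "\<xi> \<in> space (count_space \<int>)"
    then have "\<xi> - n \<in> \<int>" using n by simp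
    have "(LINT x|circle_measure. g \<xi> * cis (\<xi> * x) * cis (- (n * x))) = (LINT x|circle_measure. g \<xi> * cis ((\<xi> - n) * x))"
      by (intro Bochner_Integration.integral_cong refl) (simp add: cis_mult left_diff_distrib)
    also have "\<dots> = g \<xi> * (if \<xi> - n = 0 then 2 * pi else 0)"
      using integral_cis_circle[OF \<open>\<xi> - n \<in> \<int>\<close>] by simp
    finally show "(LINT x|circle_measure. g \<xi> * cis (\<xi> * x) * cis (- (n * x))) = indicat_real {n} \<xi> *\<^sub>R (2 * pi * g n)"
      by (auto simp: indicator_def)
  qed
  also have "\<dots> = 2 * pi * g n" using n by (subst integral_scaleR_left) auto
  finally show ?thesis by simp
qed

theorem fourier_inversion:
  assumes g: "integrable (freq_measure Z) g" "square_integrable (freq_measure Z) g"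
  shows inv_ft_L2: "inv_ft Z g \<in> L2 Z" and fourier_inv_ft: "AE \<xi> in freq_measure Z. fourier Z (inv_ft Z g) \<xi> = g \<xi>"
proof -
  have "inv_ft Z g \<in> L2 Z \<and> (AE \<xi> in freq_measure Z. fourier Z (inv_ft Z g) \<xi> = g \<xi>)"
  proof (cases Z)
    case Line
    have "inv_ft Line g = (\<lambda>x. 1 / (2 * pi) * (LINT \<xi>|lborel. g \<xi> * cis (\<xi> * x)))"
      by (simp add: inv_ft_def fun_eq_iff)
    then show ?thesis using ft_inverse_line[of g] g unfolding Line freq_measure.simps by (simp add: L2_def)
  next
    case Circle
    have "square_integrable circle_measure (inv_ft Z g)"
      by (rule square_integrable_bounded[OF finite_circle_measure _ cmod_inv_ft_le[OF g(1)]])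
        (intro borel_measurable_circle borel_measurable_continuous_onI inv_ft_continuous g)
    then have "inv_ft Z g \<in> L2 Z" using inv_ft_function_on[of Z g] Circle by (simp add: L2_def)
    moreover have "AE \<xi> in freq_measure Z. fourier Z (inv_ft Z g) \<xi> = g \<xi>"
      unfolding Circle freq_measure.simps
      by (intro AE_I2 fourier_inv_ft_circle) (use g Circle in auto)
    ultimately show ?thesis by blast
  qed
  then show "inv_ft Z g \<in> L2 Z" "AE \<xi> in freq_measure Z. fourier Z (inv_ft Z g) \<xi> = g \<xi>" by auto
qed

lemma fourier_cong_AE:
  assumes f: "f \<in> L2 Z" and g: "g \<in> L2 Z" and eq: "AE x in space_measure Z. f x = g x"
  shows "AE \<xi> in freq_measure Z. fourier Z f \<xi> = fourier Z g \<xi>"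
proof -
  note d = L2_diff[OF f g]
  have "l2 (space_measure Z) (\<lambda>x. f x - g x) = l2 (space_measure Z) (\<lambda>x. 0)"
    by (rule l2_cong_AE) (use eq L2_square_integrable[OF d] in \<open>auto simp: square_integrable_def\<close>)
  then have "l2 (freq_measure Z) (fourier Z (\<lambda>x. f x - g x)) = 0"
    unfolding Plancherel[OF d] by (simp add: l2_def)
  then have "AE \<xi> in freq_measure Z. fourier Z (\<lambda>x. f x - g x) \<xi> = 0"
    by (intro l2_zero_AE fourier_square_integrable[OF d]) simp
  then show ?thesis using fourier_linear[OF f g, of 1 "-1"] by eventually_elim simp
qed

lemma fourier_injective:
  assumes f: "f \<in> L2 Z" and g: "g \<in> L2 Z" and eq: "AE \<xi> in freq_measure Z. fourier Z f \<xi> = fourier Z g \<xi>"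
  shows "AE x in space_measure Z. f x = g x"
proof -
  note d = L2_diff[OF f g]
  have "AE \<xi> in freq_measure Z. fourier Z (\<lambda>x. f x - g x) \<xi> = 0"
    using eq fourier_linear[OF f g, of 1 "-1"] by eventually_elim simp
  then have "l2 (freq_measure Z) (fourier Z (\<lambda>x. f x - g x)) = l2 (freq_measure Z) (\<lambda>_. 0)"
    by (rule l2_cong_AE) (use fourier_square_integrable[OF d] in \<open>auto simp: square_integrable_def\<close>)
  then have "l2 (space_measure Z) (\<lambda>x. f x - g x) = 0"
    using Plancherel[OF d] by (simp add: l2_def)
  then have "AE x in space_measure Z. f x - g x = 0"
    by (intro l2_zero_AE L2_square_integrable[OF d]) simp
  then show ?thesis by simp
qed

lemma Re_inner_l2:
  assumes "square_integrable M f" "square_integrable M g"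
  shows "Re (LINT x|M. f x * cnj (g x)) = ((l2 M f)\<^sup>2 + (l2 M g)\<^sup>2 - (l2 M (\<lambda>x. f x - g x))\<^sup>2) / 2"
  using l2_add_square[OF assms] by simp

lemma Parseval_Re:
  assumes f: "f \<in> L2 Z" and g: "g \<in> L2 Z"
  shows "Re (LINT \<xi>|freq_measure Z. fourier Z f \<xi> * cnj (fourier Z g \<xi>)) = 2 * pi * Re (LINT x|space_measure Z. f x * cnj (g x))"
proof -
  note Ff = fourier_square_integrable[OF f] and Fg = fourier_square_integrable[OF g]
  note d = L2_diff[OF f g]
  have "l2 (freq_measure Z) (\<lambda>\<xi>. fourier Z f \<xi> - fourier Z g \<xi>) = l2 (freq_measure Z) (fourier Z (\<lambda>x. f x - g x))"
  proof (rule l2_cong_AE)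
    show "AE \<xi> in freq_measure Z. fourier Z f \<xi> - fourier Z g \<xi> = fourier Z (\<lambda>x. f x - g x) \<xi>"
      using fourier_linear[OF f g, of 1 "-1"] by eventually_elim simp
  qed (use square_integrable_diff[OF Ff Fg] fourier_square_integrable[OF d] in \<open>auto simp: square_integrable_def\<close>)
  then show ?thesis
    unfolding Re_inner_l2[OF Ff Fg] Re_inner_l2[OF L2_square_integrable[OF f] L2_square_integrable[OF g]]
      Plancherel[OF d] Plancherel[OF f] Plancherel[OF g]
    by (simp add: Plancherel[OF d] power_mult_distrib algebra_simps)
qed

lemma periodic_shift:
  fixes f :: "real \<Rightarrow> 'a"
  assumes "\<And>x. f (x + 2 * pi) = f x"
  shows "f (x + 2 * pi * of_int n) = f x"
proof (induction n arbitrary: x rule: int_induct[where k=0])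
  case (step1 i)
  then show ?case using assms[of "x + 2 * pi * of_int i"] by (simp add: algebra_simps)
next
  case (step2 i)
  then show ?case using assms[of "x + 2 * pi * of_int (i - 1)"] by (simp add: algebra_simps)
qed simp

lemma periodic_reduce:
  obtains y where "y \<in> {0..<2 * pi}" "\<And>f :: real \<Rightarrow> 'a. (\<And>x. f (x + 2 * pi) = f x) \<Longrightarrow> f x = f y"
proof
  let ?y = "x + 2 * pi * of_int (- \<lfloor>x / (2 * pi)\<rfloor>)"
  have "of_int \<lfloor>x / (2 * pi)\<rfloor> \<le> x / (2 * pi)" "x / (2 * pi) < of_int \<lfloor>x / (2 * pi)\<rfloor> + 1"
    by linarith+
  then have "of_int \<lfloor>x / (2 * pi)\<rfloor> * (2 * pi) \<le> x" "x < (of_int \<lfloor>x / (2 * pi)\<rfloor> + 1) * (2 * pi)"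
    by (simp_all only: pos_le_divide_eq pos_divide_less_eq pi_gt_zero zero_less_mult_iff zero_less_numeral simp_thms)
  then show "?y \<in> {0..<2 * pi}" by (simp add: algebra_simps)
  show "f x = f ?y" if "\<And>x. f (x + 2 * pi) = f x" for f :: "real \<Rightarrow> 'a"
    using periodic_shift[of f x "- \<lfloor>x / (2 * pi)\<rfloor>", OF that] by simp
qed

lemma AE_lborel_open_zero:
  fixes f :: "real \<Rightarrow> complex"
  assumes "continuous_on UNIV f" "open S" "AE x in lborel. x \<in> S \<longrightarrow> f x = 0"
  shows "\<forall>x\<in>S. f x = 0"
proof (rule ccontr)
  assume "\<not> ?thesis"
  then have ne: "{x \<in> S. f x \<noteq> 0} \<noteq> {}" by auto
  have "open (f -` (- {0}))" by (intro open_vimage assms) auto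
  then have op: "open (S \<inter> f -` (- {0}))" using assms(2) by blast
  have eq: "{x \<in> S. f x \<noteq> 0} = S \<inter> f -` (- {0})" by auto
  have sets: "{x \<in> S. f x \<noteq> 0} \<in> sets lborel" unfolding eq using op by simp
  have "AE x in lborel. x \<notin> {x \<in> S. f x \<noteq> 0}" using assms(3) by eventually_elim auto
  then have "{x \<in> S. f x \<noteq> 0} \<in> null_sets lborel" using AE_iff_null_sets[OF sets] by blast
  then have "negligible {x \<in> S. f x \<noteq> 0}" by (simp add: negligible_iff_null_sets null_sets_completionI)
  then show False using open_not_negligible[OF op] ne unfolding eq by blast
qed

text \<open>
  A nonempty open set has positive measure; on the circle the end point 0 of the period is reached
  by continuity from the right.
\<close>

lemma continuous_AE_zero:
  assumes cont: "continuous_on UNIV f" and per: "function_on Z f" and zero: "AE x in space_measure Z. f x = 0"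
  shows "f x = 0"
proof (cases Z)
  case Line
  have "AE x in lborel. x \<in> UNIV \<longrightarrow> f x = 0" using zero unfolding Line space_measure.simps by simp
  from AE_lborel_open_zero[OF cont open_UNIV this] show ?thesis by blast
next
  case Circle
  have "AE x in lborel. x \<in> {0..<2*pi} \<longrightarrow> f x = 0"
    using zero unfolding Circle space_measure.simps by (subst (asm) AE_restrict_space_iff) auto
  then have "AE x in lborel. x \<in> {0<..<2*pi} \<longrightarrow> f x = 0" by eventually_elim auto
  then have *: "\<forall>x\<in>{0<..<2*pi}. f x = 0" by (intro AE_lborel_open_zero[OF cont]) auto
  have "f 0 = 0"
  proof -
    have "(f \<longlongrightarrow> f 0) (at_right 0)"
      using cont by (auto simp: continuous_on_def intro: tendsto_within_subset)
    moreover have "(f \<longlongrightarrow> 0) (at_right 0)"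
      by (intro tendsto_eventually) (use * in \<open>auto simp: eventually_at_right_field intro!: exI[of _ "2*pi"]\<close>)
    ultimately show ?thesis by (intro tendsto_unique) auto
  qed
  obtain y where y: "y \<in> {0..<2 * pi}" "f x = f y"
    using periodic_reduce[of x] per Circle by (metis function_on.simps(2))
  then show ?thesis using * \<open>f 0 = 0\<close> by (cases "y = 0") auto
qed

text \<open>
  For continuous functions the inversion formula holds at every point, because two continuous
  functions that agree almost everywhere agree. This turns the L2 information about a solution into
  pointwise information.
\<close>

lemma inv_ft_fourier:
  assumes f: "f \<in> L2 Z" and cont: "continuous_on UNIV f" and int: "integrable (freq_measure Z) (fourier Z f)"
  shows "inv_ft Z (fourier Z f) = f"
proof
  fix x
  note inv = fourier_inversion[OF int fourier_square_integrable[OF f]]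
  have "AE x in space_measure Z. inv_ft Z (fourier Z f) x = f x"
    by (rule fourier_injective[OF inv(1) f inv(2)])
  then have "inv_ft Z (fourier Z f) x - f x = 0"
    using L2_diff[OF inv(1) f] cont inv_ft_continuous[OF int]
    by (intro continuous_AE_zero[where Z=Z]) (auto intro!: continuous_intros simp: L2_def)
  then show "inv_ft Z (fourier Z f) x = f x" by simp
qed

section \<open>Real smooth functions with square-integrable derivatives\<close>

definition space_int :: "domain \<Rightarrow> (real \<Rightarrow> real) \<Rightarrow> real" where
  "space_int Z f = (LINT x|space_measure Z. f x)"

definition tame :: "domain \<Rightarrow> (real \<Rightarrow> real) \<Rightarrow> bool" where
  "tame Z f \<longleftrightarrow> continuous_on UNIV f \<and> (\<exists>B. \<forall>x. \<bar>f x\<bar> \<le> B) \<and> (Z = Circle \<longrightarrow> (\<forall>x. f (x + 2 * pi) = f x))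
     \<and> integrable (space_measure Z) (\<lambda>x. (f x)\<^sup>2)"

primrec smooth_ord :: "domain \<Rightarrow> nat \<Rightarrow> (real \<Rightarrow> real) \<Rightarrow> bool" where
  "smooth_ord Z 0 f = tame Z f"
| "smooth_ord Z (Suc k) f = (tame Z f \<and> (\<forall>x. f differentiable (at x)) \<and> smooth_ord Z k (deriv f))"

text \<open>
  On the line such functions and all their derivatives are bounded and square integrable; on the
  circle they are the smooth periodic functions. The class contains, after modification on null
  sets, the real and imaginary parts of the functions in the intersection of all Sobolev spaces.
  Boundedness is built in so that closure under products needs no embedding theorem.
\<close>

definition SS :: "domain \<Rightarrow> (real \<Rightarrow> real) \<Rightarrow> bool" where
  "SS Z f \<longleftrightarrow> (\<forall>k. smooth_ord Z k f)"

lemma smooth_ord_tame: "smooth_ord Z k f \<Longrightarrow> tame Z f"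
  by (cases k) auto

lemma smooth_ord_mono: "smooth_ord Z (Suc k) f \<Longrightarrow> smooth_ord Z k f"
  by (induction k arbitrary: f) auto

lemma SS_tame: "SS Z f \<Longrightarrow> tame Z f"
  unfolding SS_def using smooth_ord_tame by blast

lemma SS_deriv: "SS Z f \<Longrightarrow> SS Z (deriv f)"
  unfolding SS_def by (metis smooth_ord.simps(2))

lemma SS_differentiable: "SS Z f \<Longrightarrow> f differentiable (at x)"
  unfolding SS_def by (metis smooth_ord.simps(2))

lemma differentiable_real_DERIV: "f differentiable (at x) \<Longrightarrow> (f has_real_derivative deriv f x) (at x)"
  using DERIV_deriv_iff_real_differentiable by blast

lemma SS_DERIV: "SS Z f \<Longrightarrow> (f has_real_derivative deriv f x) (at x)"
  by (intro differentiable_real_DERIV SS_differentiable)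

lemma tame_continuous: "tame Z f \<Longrightarrow> continuous_on UNIV f" by (simp add: tame_def)
lemma tame_square_integrable: "tame Z f \<Longrightarrow> integrable (space_measure Z) (\<lambda>x. (f x)\<^sup>2)" by (simp add: tame_def)
lemma tame_borel: "tame Z f \<Longrightarrow> f \<in> borel_measurable borel"
  by (intro borel_measurable_continuous_onI tame_continuous)
lemma tame_measurable: "tame Z f \<Longrightarrow> f \<in> borel_measurable (space_measure Z)"
  by (intro borel_measurable_space tame_borel)

lemma tame_integrable_mult:
  assumes "tame Z f" "tame Z g"
  shows "integrable (space_measure Z) (\<lambda>x. f x * g x)"
  using assms tame_square_integrable by (intro integrable_mult_L2) (auto intro: tame_measurable)

lemma tame_add:
  assumes f: "tame Z f" and g: "tame Z g"
  shows "tame Z (\<lambda>x. f x + g x)"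
proof -
  obtain A where "\<And>x. \<bar>f x\<bar> \<le> A" using f by (auto simp: tame_def)
  moreover obtain B where "\<And>x. \<bar>g x\<bar> \<le> B" using g by (auto simp: tame_def)
  ultimately have "\<bar>f x + g x\<bar> \<le> A + B" for x by (meson abs_triangle_ineq add_mono order_trans)
  moreover have "integrable (space_measure Z) (\<lambda>x. (f x + g x)\<^sup>2)"
    using tame_integrable_mult[OF f g] f g by (simp add: power2_sum tame_def mult.assoc)
  moreover have "continuous_on UNIV (\<lambda>x. f x + g x)" using f g by (auto simp: tame_def intro!: continuous_intros)
  ultimately show ?thesis using f g by (auto simp: tame_def)
qed

lemma tame_mult:
  assumes f: "tame Z f" and g: "tame Z g"
  shows "tame Z (\<lambda>x. f x * g x)"
proof -
  obtain A where A: "\<And>x. \<bar>f x\<bar> \<le> A" using f by (auto simp: tame_def)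
  obtain B where B: "\<And>x. \<bar>g x\<bar> \<le> B" using g by (auto simp: tame_def)
  have "\<bar>f x * g x\<bar> \<le> A * B" for x
    unfolding abs_mult using A[of x] B[of x] by (intro mult_mono) auto
  moreover have "integrable (space_measure Z) (\<lambda>x. (f x * g x)\<^sup>2)"
  proof (rule Bochner_Integration.integrable_bound)
    show "integrable (space_measure Z) (\<lambda>x. A\<^sup>2 * (g x)\<^sup>2)" using g by (simp add: tame_def)
    show "(\<lambda>x. (f x * g x)\<^sup>2) \<in> borel_measurable (space_measure Z)"
      using tame_measurable[OF f] tame_measurable[OF g] by measurable
    have "(f x)\<^sup>2 \<le> A\<^sup>2" for x using A[of x] by (metis abs_ge_zero power2_abs power_mono)
    then show "AE x in space_measure Z. norm ((f x * g x)\<^sup>2) \<le> norm (A\<^sup>2 * (g x)\<^sup>2)"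
      by (intro AE_I2) (auto simp: power_mult_distrib intro!: mult_right_mono)
  qed
  moreover have "continuous_on UNIV (\<lambda>x. f x * g x)" using f g by (auto simp: tame_def intro!: continuous_intros)
  ultimately show ?thesis using f g by (auto simp: tame_def)
qed

lemma tame_scale:
  assumes f: "tame Z f"
  shows "tame Z (\<lambda>x. c * f x)"
proof -
  obtain A where A: "\<And>x. \<bar>f x\<bar> \<le> A" using f by (auto simp: tame_def)
  have "\<bar>c * f x\<bar> \<le> \<bar>c\<bar> * A" for x
    unfolding abs_mult using A[of x] by (intro mult_left_mono) auto
  then show ?thesis using f by (auto simp: tame_def power_mult_distrib intro!: continuous_intros)
qed

lemma deriv_add_fun:
  assumes "\<And>x. f differentiable (at x)" "\<And>x. g differentiable (at x)"
  shows "deriv (\<lambda>x. f x + g x) = (\<lambda>x. deriv f x + deriv g (x::real) :: real)"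
  by (intro ext DERIV_imp_deriv DERIV_add differentiable_real_DERIV assms)

lemma deriv_scale_fun:
  assumes "\<And>x. f differentiable (at x)"
  shows "deriv (\<lambda>x. c * f x) = (\<lambda>x. c * deriv f (x::real) :: real)"
  by (intro ext DERIV_imp_deriv DERIV_cmult differentiable_real_DERIV assms)

lemma deriv_mult_fun:
  assumes "\<And>x. f differentiable (at x)" "\<And>x. g differentiable (at x)"
  shows "deriv (\<lambda>x. f x * g x) = (\<lambda>x. deriv f x * g x + f x * deriv g (x::real) :: real)"
proof
  fix x
  have "((\<lambda>x. f x * g x) has_real_derivative deriv f x * g x + deriv g x * f x) (at x)"
    by (intro DERIV_mult differentiable_real_DERIV assms)
  then show "deriv (\<lambda>x. f x * g x) x = deriv f x * g x + f x * deriv g x"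
    by (simp add: DERIV_imp_deriv mult.commute)
qed

lemma smooth_ord_add: "smooth_ord Z k f \<Longrightarrow> smooth_ord Z k g \<Longrightarrow> smooth_ord Z k (\<lambda>x. f x + g x)"
proof (induction k arbitrary: f g)
  case (Suc k)
  then show ?case by (auto simp: tame_add deriv_add_fun)
qed (simp add: tame_add)

lemma smooth_ord_scale: "smooth_ord Z k f \<Longrightarrow> smooth_ord Z k (\<lambda>x. c * f x)"
proof (induction k arbitrary: f)
  case (Suc k)
  then show ?case by (auto simp: tame_scale deriv_scale_fun)
qed (simp add: tame_scale)

lemma smooth_ord_mult: "smooth_ord Z k f \<Longrightarrow> smooth_ord Z k g \<Longrightarrow> smooth_ord Z k (\<lambda>x. f x * g x)"
proof (induction k arbitrary: f g)
  case (Suc k)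
  then have "smooth_ord Z k (\<lambda>x. deriv f x * g x + f x * deriv g x)"
    by (intro smooth_ord_add Suc.IH) (auto simp: smooth_ord_mono)
  then show ?case using Suc.prems by (simp add: tame_mult deriv_mult_fun)
qed (simp add: tame_mult)

lemma SS_add: "SS Z f \<Longrightarrow> SS Z g \<Longrightarrow> SS Z (\<lambda>x. f x + g x)"
  by (simp add: SS_def smooth_ord_add)
lemma SS_scale: "SS Z f \<Longrightarrow> SS Z (\<lambda>x. c * f x)"
  by (simp add: SS_def smooth_ord_scale)
lemma SS_mult: "SS Z f \<Longrightarrow> SS Z g \<Longrightarrow> SS Z (\<lambda>x. f x * g x)"
  by (simp add: SS_def smooth_ord_mult)
lemma SS_minus: "SS Z f \<Longrightarrow> SS Z (\<lambda>x. - f x)"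
  using SS_scale[of Z f "-1"] by simp
lemma SS_diff: "SS Z f \<Longrightarrow> SS Z g \<Longrightarrow> SS Z (\<lambda>x. f x - g x)"
  using SS_add[OF _ SS_minus] by fastforce
lemma SS_power: "SS Z f \<Longrightarrow> SS Z (\<lambda>x. f x ^ Suc n)"
  by (induction n) (auto intro: SS_mult)
lemma SS_square: "SS Z f \<Longrightarrow> SS Z (\<lambda>x. (f x)\<^sup>2)"
  using SS_power[of Z f 1] by (simp add: numeral_2_eq_2)

lemma SS_const_circle: "SS Circle (\<lambda>x. c)"
proof -
  have tame: "tame Circle (\<lambda>x. c)" for c :: real
    using finite_measure.integrable_const[OF finite_circle_measure] by (auto simp: tame_def)
  have "smooth_ord Circle k (\<lambda>x. c)" for k and c :: real
    by (induction k arbitrary: c) (auto simp: tame)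
  then show ?thesis by (simp add: SS_def)
qed

lemmas SS_intros = SS_add SS_diff SS_scale SS_mult SS_minus SS_square SS_deriv

lemma SS_integrable_mult: "SS Z f \<Longrightarrow> SS Z g \<Longrightarrow> integrable (space_measure Z) (\<lambda>x. f x * g x)"
  by (intro tame_integrable_mult SS_tame)

lemma SS_measurable: "SS Z f \<Longrightarrow> f \<in> borel_measurable (space_measure Z)"
  by (intro tame_measurable SS_tame)

abbreviation cs :: "(real \<Rightarrow> real) \<Rightarrow> real \<Rightarrow> complex" where
  "cs f \<equiv> \<lambda>x. complex_of_real (f x)"

lemma tame_cs_L2: "tame Z f \<Longrightarrow> cs f \<in> L2 Z"
  using tame_measurable[of Z f] by (cases Z) (auto simp: L2_def square_integrable_def tame_def)

lemma SS_cs_L2: "SS Z f \<Longrightarrow> cs f \<in> L2 Z"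
  by (intro tame_cs_L2 SS_tame)

section \<open>Sobolev embedding in one dimension\<close>

lemma interval_difference_bound:
  fixes X X' :: "real \<Rightarrow> real"
  assumes der: "\<And>x. (X has_real_derivative X' x) (at x)" and cont: "continuous_on UNIV X'"
    and "a \<le> x" "x \<le> b" "a \<le> y" "y \<le> b"
  shows "\<bar>X x - X y\<bar> \<le> (LINT t:{a..b}|lborel. \<bar>X' t\<bar>)"
proof -
  have *: "\<bar>X v - X u\<bar> \<le> (LINT t:{a..b}|lborel. \<bar>X' t\<bar>)" if "a \<le> u" "u \<le> v" "v \<le> b" for u v
  proof -
    have "X v - X u = (LINT t:{u..v}|lborel. X' t)"
      unfolding set_lebesgue_integral_def using that
      by (intro integral_FTC_atLeastAtMost[symmetric])
        (auto intro: has_vector_derivative_at_within der[unfolded has_real_derivative_iff_has_vector_derivative] continuous_on_subset[OF cont])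
    also have "\<bar>\<dots>\<bar> \<le> (LINT t:{u..v}|lborel. \<bar>X' t\<bar>)"
      using integral_norm_bound[of lborel "\<lambda>t. indicator {u..v} t *\<^sub>R X' t"]
      by (simp add: set_lebesgue_integral_def abs_mult)
    also have "\<dots> \<le> (LINT t:{a..b}|lborel. \<bar>X' t\<bar>)"
      unfolding set_lebesgue_integral_def using that
      by (intro integral_mono borel_integrable_compact continuous_on_subset[OF cont] continuous_intros)
        (auto simp: indicator_def)
    finally show ?thesis .
  qed
  show ?thesis
    using *[of x y] *[of y x] assms(3-6) by (cases "x \<le> y") (auto simp: abs_minus_commute)
qed

text \<open>
  On an interval of length at least 1 the mean value of |X| is at most its integral, and X differs
  from some value not exceeding that mean by at most the integral of |X'|.
\<close>

lemma interval_sup_bound: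
  fixes X X' :: "real \<Rightarrow> real"
  assumes der: "\<And>x. (X has_real_derivative X' x) (at x)" and cont: "continuous_on UNIV X'"
    and ab: "a + 1 \<le> b" and x: "a \<le> x" "x \<le> b"
  shows "\<bar>X x\<bar> \<le> (LINT t:{a..b}|lborel. \<bar>X t\<bar>) + (LINT t:{a..b}|lborel. \<bar>X' t\<bar>)"
proof -
  define K where "K = (LINT t:{a..b}|lborel. \<bar>X' t\<bar>)"
  have contX: "continuous_on UNIV X" using der DERIV_isCont by (auto simp: continuous_on_eq_continuous_at)
  have K: "\<bar>X x\<bar> - K \<le> \<bar>X y\<bar>" if "y \<in> {a..b}" for y
    using interval_difference_bound[OF der cont, of a x b y] x that by (auto simp: K_def)
  show ?thesis
  proof (cases "\<bar>X x\<bar> - K \<ge> 0")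
    case True
    have "\<bar>X x\<bar> - K \<le> (b - a) * (\<bar>X x\<bar> - K)" using ab True by (simp add: mult_le_cancel_right1)
    also have "\<dots> = (LINT t:{a..b}|lborel. (\<bar>X x\<bar> - K))"
      using ab by (simp add: set_lebesgue_integral_def)
    also have "\<dots> \<le> (LINT t:{a..b}|lborel. \<bar>X t\<bar>)"
      unfolding set_lebesgue_integral_def
      by (intro integral_mono borel_integrable_compact continuous_on_subset[OF contX] continuous_intros)
        (use K in \<open>auto simp: indicator_def\<close>)
    finally show ?thesis unfolding K_def by simp
  next
    case False
    moreover have "0 \<le> (LINT t:{a..b}|lborel. \<bar>X t\<bar>)"
      unfolding set_lebesgue_integral_def by (intro integral_nonneg_AE AE_I2) auto
    ultimately show ?thesis unfolding K_def by linarith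
  qed
qed

lemma integrable_tail_tendsto:
  fixes X :: "real \<Rightarrow> real"
  assumes "integrable lborel X" and S: "\<And>t. \<forall>\<^sub>F n in sequentially. t \<notin> S n" and [measurable]: "\<And>n. S n \<in> sets borel"
  shows "(\<lambda>n. LINT t:S n|lborel. \<bar>X t\<bar>) \<longlonglongrightarrow> 0"
proof -
  have "(\<lambda>n. LINT t|lborel. indicator (S n) t *\<^sub>R \<bar>X t\<bar>) \<longlonglongrightarrow> (LINT t|(lborel :: real measure). 0)"
  proof (rule integral_dominated_convergence[where w="\<lambda>t. \<bar>X t\<bar>"])
    show "AE t in lborel. (\<lambda>n. indicator (S n) t *\<^sub>R \<bar>X t\<bar>) \<longlonglongrightarrow> 0"
    proof (intro AE_I2 tendsto_eventually)
      fix t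
      show "\<forall>\<^sub>F n in sequentially. indicator (S n) t *\<^sub>R \<bar>X t\<bar> = 0"
        using S[of t] by eventually_elim simp
    qed
  qed (use assms borel_measurable_integrable[OF assms(1)] in \<open>auto simp: indicator_def\<close>)
  then show ?thesis by (simp add: set_lebesgue_integral_def)
qed

text \<open>
  Applied to the tails [n, n+1], the previous bound is controlled by integrals that vanish as n
  grows.
\<close>

lemma line_decay:
  fixes X X' :: "real \<Rightarrow> real"
  assumes der: "\<And>x. (X has_real_derivative X' x) (at x)" and cont: "continuous_on UNIV X'"
    and int: "integrable lborel X" "integrable lborel X'"
  shows "(\<lambda>n. X (real n)) \<longlonglongrightarrow> 0" "(\<lambda>n. X (- real n)) \<longlonglongrightarrow> 0"
proof -
  have ev: "\<forall>\<^sub>F n in sequentially. t \<notin> {real n..real n + 1}" "\<forall>\<^sub>F n in sequentially. t \<notin> {- real n - 1..- real n}" for t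
    using eventually_gt_at_top[of "nat \<lceil>\<bar>t\<bar>\<rceil>"]
    by (eventually_elim, auto simp: nat_less_iff ceiling_less_iff)+
  have "(\<lambda>n. (LINT t:{real n..real n + 1}|lborel. \<bar>X t\<bar>) + (LINT t:{real n..real n + 1}|lborel. \<bar>X' t\<bar>)) \<longlonglongrightarrow> 0"
    by (rule tendsto_eq_rhs[OF tendsto_add[OF integrable_tail_tendsto integrable_tail_tendsto]]) (use int ev in auto)
  then show "(\<lambda>n. X (real n)) \<longlonglongrightarrow> 0"
    by (rule Lim_null_comparison[rotated]) (auto intro!: always_eventually interval_sup_bound[OF der cont])
  have "(\<lambda>n. (LINT t:{- real n - 1..- real n}|lborel. \<bar>X t\<bar>) + (LINT t:{- real n - 1..- real n}|lborel. \<bar>X' t\<bar>)) \<longlonglongrightarrow> 0"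
    by (rule tendsto_eq_rhs[OF tendsto_add[OF integrable_tail_tendsto integrable_tail_tendsto]]) (use int ev in auto)
  then show "(\<lambda>n. X (- real n)) \<longlonglongrightarrow> 0"
    by (rule Lim_null_comparison[rotated]) (auto intro!: always_eventually interval_sup_bound[OF der cont])
qed

lemma space_int_circle: "space_int Circle f = (LINT t:{0..2*pi}|lborel. f t)"
  by (simp add: space_int_def integral_circle_measure)

lemma space_int_deriv_zero:
  assumes der: "\<And>x. (X has_real_derivative X' x) (at x)" and cont: "continuous_on UNIV X'"
    and int: "integrable (space_measure Z) X" "integrable (space_measure Z) X'"
    and per: "Z = Circle \<Longrightarrow> X (2 * pi) = X 0"
  shows "space_int Z X' = 0"
proof (cases Z)
  case Line
  have F: "X (real n) - X (- real n) = (LINT t:{- real n..real n}|lborel. X' t)" for n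
    unfolding set_lebesgue_integral_def
    by (intro integral_FTC_atLeastAtMost[symmetric])
      (auto intro: has_vector_derivative_at_within der[unfolded has_real_derivative_iff_has_vector_derivative] continuous_on_subset[OF cont])
  have "(\<lambda>n. LINT t|lborel. indicator {- real n..real n} t *\<^sub>R X' t) \<longlonglongrightarrow> (LINT t|lborel. X' t)"
  proof (rule integral_dominated_convergence[where w="\<lambda>t. \<bar>X' t\<bar>"])
    show "AE t in lborel. (\<lambda>n. indicator {- real n..real n} t *\<^sub>R X' t) \<longlonglongrightarrow> X' t"
    proof (intro AE_I2 tendsto_eventually)
      fix t
      show "\<forall>\<^sub>F n in sequentially. indicator {- real n..real n} t *\<^sub>R X' t = X' t"
        using eventually_ge_at_top[of "nat \<lceil>\<bar>t\<bar>\<rceil>"]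
        by eventually_elim (auto simp: indicator_def nat_le_iff ceiling_le_iff)
    qed
  qed (use int Line borel_measurable_integrable[OF int(2)] in \<open>auto simp: indicator_def\<close>)
  then have "(\<lambda>n. X (real n) - X (- real n)) \<longlonglongrightarrow> space_int Z X'"
    unfolding F set_lebesgue_integral_def space_int_def Line by simp
  moreover have "(\<lambda>n. X (real n) - X (- real n)) \<longlonglongrightarrow> 0 - 0"
    using line_decay[OF der cont] int Line by (intro tendsto_diff) auto
  ultimately show ?thesis using LIMSEQ_unique by fastforce
next
  case Circle
  have "space_int Circle X' = X (2 * pi) - X 0"
    unfolding space_int_circle set_lebesgue_integral_def
    by (intro integral_FTC_atLeastAtMost)
      (auto intro: has_vector_derivative_at_within der[unfolded has_real_derivative_iff_has_vector_derivative] continuous_on_subset[OF cont])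
  then show ?thesis using per Circle by simp
qed

lemma set_int_le_space_int:
  assumes "integrable lborel X"
  shows "(LINT t:{a..b}|lborel. \<bar>X t\<bar>) \<le> space_int Line (\<lambda>t. \<bar>X t\<bar>)"
  unfolding space_int_def set_lebesgue_integral_def space_measure.simps
  using integrable_mult_indicator[of "{a..b}" lborel "\<lambda>t. \<bar>X t\<bar>"] assms
  by (intro integral_mono) (auto simp: indicator_def)

lemma sup_le_L1:
  assumes der: "\<And>x. (X has_real_derivative X' x) (at x)" and cont: "continuous_on UNIV X'"
    and int: "integrable (space_measure Z) X" "integrable (space_measure Z) X'"
    and per: "Z = Circle \<Longrightarrow> (\<And>x. X (x + 2 * pi) = X x)"
  shows "\<bar>X x\<bar> \<le> space_int Z (\<lambda>x. \<bar>X x\<bar>) + space_int Z (\<lambda>x. \<bar>X' x\<bar>)"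
proof (cases Z)
  case Line
  have "\<bar>X x\<bar> \<le> (LINT t:{x..x+1}|lborel. \<bar>X t\<bar>) + (LINT t:{x..x+1}|lborel. \<bar>X' t\<bar>)"
    by (rule interval_sup_bound[OF der cont]) auto
  also have "\<dots> \<le> space_int Z (\<lambda>x. \<bar>X x\<bar>) + space_int Z (\<lambda>x. \<bar>X' x\<bar>)"
    unfolding Line using int Line by (intro add_mono set_int_le_space_int) auto
  finally show ?thesis .
next
  case Circle
  obtain y where y: "y \<in> {0..<2*pi}" "X x = X y"
    using periodic_reduce[of x] per Circle by metis
  have "\<bar>X y\<bar> \<le> (LINT t:{0..2*pi}|lborel. \<bar>X t\<bar>) + (LINT t:{0..2*pi}|lborel. \<bar>X' t\<bar>)"
    using y pi_gt3 by (intro interval_sup_bound[OF der cont]) auto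
  then show ?thesis using y Circle by (simp add: space_int_circle)
qed

text \<open>
  The zero on the circle, or the decay at infinity on the line, serves as the reference value.
\<close>

lemma sup_le_L1_deriv:
  assumes der: "\<And>x. (X has_real_derivative X' x) (at x)" and cont: "continuous_on UNIV X'"
    and int: "integrable (space_measure Z) X" "integrable (space_measure Z) X'"
    and per: "Z = Circle \<Longrightarrow> (\<And>x. X (x + 2 * pi) = X x)" and zero: "Z = Circle \<Longrightarrow> \<exists>x. X x = 0"
  shows "\<bar>X x\<bar> \<le> space_int Z (\<lambda>x. \<bar>X' x\<bar>)"
proof (cases Z)
  case Line
  have "\<bar>X x - X (real n)\<bar> \<le> space_int Z (\<lambda>x. \<bar>X' x\<bar>)" for n
  proof -
    have "\<bar>X x - X (real n)\<bar> \<le> (LINT t:{min x n..max x n}|lborel. \<bar>X' t\<bar>)"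
      by (rule interval_difference_bound[OF der cont]) auto
    also have "\<dots> \<le> space_int Z (\<lambda>x. \<bar>X' x\<bar>)"
      unfolding Line using int Line by (intro set_int_le_space_int) auto
    finally show ?thesis .
  qed
  moreover have "(\<lambda>n. \<bar>X x - X (real n)\<bar>) \<longlonglongrightarrow> \<bar>X x - 0\<bar>"
    using line_decay[OF der cont] int Line by (intro tendsto_intros) auto
  ultimately show ?thesis by (intro LIMSEQ_le_const2) auto
next
  case Circle
  obtain x0 where "X x0 = 0" using zero Circle by blast
  then obtain y0 where y0: "y0 \<in> {0..<2*pi}" "X y0 = 0"
    using periodic_reduce[of x0] per Circle by metis
  obtain y where y: "y \<in> {0..<2*pi}" "X x = X y"
    using periodic_reduce[of x] per Circle by metis
  have "\<bar>X y - X y0\<bar> \<le> (LINT t:{0..2*pi}|lborel. \<bar>X' t\<bar>)"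
    using y y0 by (intro interval_difference_bound[OF der cont]) auto
  then show ?thesis using y y0 Circle by (simp add: space_int_circle)
qed

lemma SS_periodic: "SS Circle f \<Longrightarrow> f (x + 2 * pi) = f x"
  using SS_tame[of Circle f] by (simp add: tame_def)

lemma SS_continuous: "SS Z f \<Longrightarrow> continuous_on UNIV f"
  by (intro tame_continuous SS_tame)

lemma SS_int_deriv_zero:
  assumes "SS Z f" "integrable (space_measure Z) f" "integrable (space_measure Z) (deriv f)"
  shows "space_int Z (deriv f) = 0"
  by (rule space_int_deriv_zero[OF SS_DERIV[OF assms(1)] SS_continuous[OF SS_deriv[OF assms(1)]] assms(2,3)])
    (use SS_periodic[of f 0] assms(1) in auto)

lemma deriv_SS_mult:
  assumes "SS Z f" "SS Z g"
  shows "deriv (\<lambda>x. f x * g x) = (\<lambda>x. deriv f x * g x + f x * deriv g x)"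
  by (rule deriv_mult_fun) (use SS_differentiable assms in auto)

lemma deriv_SS_add:
  assumes "SS Z f" "SS Z g"
  shows "deriv (\<lambda>x. f x + g x) = (\<lambda>x. deriv f x + deriv g x)"
  by (rule deriv_add_fun) (use SS_differentiable assms in auto)

lemma deriv_SS_scale:
  assumes "SS Z f"
  shows "deriv (\<lambda>x. c * f x) = (\<lambda>x. c * deriv f x)"
  by (rule deriv_scale_fun) (use SS_differentiable assms in auto)

lemma deriv_SS_diff:
  assumes "SS Z f" "SS Z g"
  shows "deriv (\<lambda>x. f x - g x) = (\<lambda>x. deriv f x - deriv g x)"
  using deriv_SS_add[OF assms(1) SS_minus[OF assms(2)]] deriv_SS_scale[OF assms(2), of "-1"] by simp

lemma SS_int_by_parts:
  assumes f: "SS Z f" and g: "SS Z g"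
  shows "space_int Z (\<lambda>x. deriv f x * g x) = - space_int Z (\<lambda>x. f x * deriv g x)"
proof -
  have int: "integrable (space_measure Z) (\<lambda>x. deriv f x * g x)" "integrable (space_measure Z) (\<lambda>x. f x * deriv g x)"
    using f g by (auto intro: SS_integrable_mult SS_deriv)
  have "space_int Z (deriv (\<lambda>x. f x * g x)) = 0"
    by (rule SS_int_deriv_zero[OF SS_mult[OF f g] SS_integrable_mult[OF f g]])
      (unfold deriv_SS_mult[OF f g], use int in simp)
  then show ?thesis using int by (simp add: deriv_SS_mult[OF f g] space_int_def)
qed

section \<open>Fourier transform of a derivative\<close>

lemma integral_deriv_cis:
  fixes f :: "real \<Rightarrow> real"
  assumes f: "SS Z f" and ab: "a \<le> b"
  shows "(LINT t:{a..b}|lborel. cs (deriv f) t * cis (- (\<xi> * t)))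
    = f b * cis (- (\<xi> * b)) - f a * cis (- (\<xi> * a)) + \<i> * of_real \<xi> * (LINT t:{a..b}|lborel. cs f t * cis (- (\<xi> * t)))"
proof -
  have c: "continuous_on S f" "continuous_on S (deriv f)" for S
    using SS_continuous[OF f] SS_continuous[OF SS_deriv[OF f]] continuous_on_subset by blast+
  have cisd: "((\<lambda>t. cis (- (\<xi> * t))) has_vector_derivative - (\<i> * of_real \<xi>) * cis (- (\<xi> * t))) (at t within S)" for t S
    unfolding cis.ctr has_vector_derivative_complex_iff by (auto intro!: derivative_eq_intros)
  have fd: "((\<lambda>t. complex_of_real (f t)) has_vector_derivative complex_of_real (deriv f t)) (at t within S)" for t S
    by (rule has_vector_derivative_of_real, rule has_field_derivative_at_within, rule SS_DERIV[OF f])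
  have der: "((\<lambda>t. cs f t * cis (- (\<xi> * t))) has_vector_derivative
      (cs (deriv f) t * cis (- (\<xi> * t)) - \<i> * of_real \<xi> * (cs f t * cis (- (\<xi> * t))))) (at t within S)" for t S
    by (rule has_vector_derivative_eq_rhs[OF has_vector_derivative_mult[OF fd cisd]]) (simp add: algebra_simps)
  have int: "set_integrable lborel {a..b} (\<lambda>t. cs (deriv f) t * cis (- (\<xi> * t)))"
    "set_integrable lborel {a..b} (\<lambda>t. cs f t * cis (- (\<xi> * t)))"
    unfolding set_integrable_def by (intro borel_integrable_compact continuous_intros c; simp)+
  have "(LINT t:{a..b}|lborel. cs (deriv f) t * cis (- (\<xi> * t)) - \<i> * of_real \<xi> * (cs f t * cis (- (\<xi> * t))))
     = cs f b * cis (- (\<xi> * b)) - cs f a * cis (- (\<xi> * a))"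
    unfolding set_lebesgue_integral_def using ab
    by (intro integral_FTC_atLeastAtMost der continuous_intros c)
  moreover have "(LINT t:{a..b}|lborel. cs (deriv f) t * cis (- (\<xi> * t)) - \<i> * of_real \<xi> * (cs f t * cis (- (\<xi> * t))))
     = (LINT t:{a..b}|lborel. cs (deriv f) t * cis (- (\<xi> * t))) - \<i> * of_real \<xi> * (LINT t:{a..b}|lborel. cs f t * cis (- (\<xi> * t)))"
    using int by (subst set_integral_diff) auto
  ultimately show ?thesis by (simp add: diff_eq_eq)
qed

lemma nn_integral_weight_line: "(\<integral>\<^sup>+\<xi>. ennreal (1 / (1 + \<xi>\<^sup>2)) \<partial>lborel) < \<infinity>"
proof -
  have half: "(\<integral>\<^sup>+\<xi>. ennreal (1 / (1 + \<xi>\<^sup>2)) * indicator {0..} \<xi> \<partial>lborel) = ennreal (pi / 2 - arctan 0)"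
  proof (rule nn_integral_FTC_atLeast)
    show "DERIV arctan x :> 1 / (1 + x\<^sup>2)" for x using DERIV_arctan[of x] by (simp add: divide_inverse)
  qed (use tendsto_arctan_at_top in auto)
  have half2: "(\<integral>\<^sup>+\<xi>. ennreal (1 / (1 + \<xi>\<^sup>2)) * indicator {..0} \<xi> \<partial>lborel) = ennreal (pi / 2 - arctan 0)"
    unfolding half[symmetric]
    by (subst nn_integral_real_affine[where c="-1" and t=0]) (auto intro!: nn_integral_cong simp: indicator_def)
  have "(\<integral>\<^sup>+\<xi>. ennreal (1 / (1 + \<xi>\<^sup>2)) \<partial>lborel)
      \<le> (\<integral>\<^sup>+\<xi>. ennreal (1 / (1 + \<xi>\<^sup>2)) * indicator {0..} \<xi> + ennreal (1 / (1 + \<xi>\<^sup>2)) * indicator {..0} \<xi> \<partial>lborel)"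
    by (intro nn_integral_mono) (auto simp: indicator_def)
  also have "\<dots> < \<infinity>" by (subst nn_integral_add) (auto simp: half half2)
  finally show ?thesis .
qed

lemma nn_integral_weight_circle: "(\<integral>\<^sup>+\<xi>. ennreal (1 / (1 + \<xi>\<^sup>2)) \<partial>count_space (\<int> :: real set)) < \<infinity>"
proof -
  have "(\<integral>\<^sup>+\<xi>. ennreal (1 / (1 + \<xi>\<^sup>2)) \<partial>count_space (\<int> :: real set)) = (\<integral>\<^sup>+n. ennreal (1 / (1 + (of_int n)\<^sup>2)) \<partial>count_space (UNIV :: int set))"
    using nn_integral_bij_count_space[OF bij_int_Ints, of "\<lambda>\<xi>. ennreal (1 / (1 + \<xi>\<^sup>2))"] by simp
  also have "\<dots> = (\<integral>\<^sup>+\<theta>. (\<integral>\<^sup>+n. ennreal (1 / (1 + (of_int n)\<^sup>2)) \<partial>count_space (UNIV :: int set)) * indicator {0..<1::real} \<theta> \<partial>lborel)"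
    by (subst nn_integral_cmult_indicator) auto
  also have "\<dots> \<le> (\<integral>\<^sup>+\<theta>. (\<integral>\<^sup>+n. ennreal (3 / (1 + (of_int n + \<theta>)\<^sup>2)) \<partial>count_space (UNIV :: int set)) * indicator {0..<1::real} \<theta> \<partial>lborel)"
  proof (rule nn_integral_mono)
    fix \<theta> :: real
    have "ennreal (1 / (1 + (of_int n)\<^sup>2)) \<le> ennreal (3 / (1 + (of_int n + \<theta>)\<^sup>2))" if "0 \<le> \<theta>" "\<theta> < 1" for n :: int
    proof (rule ennreal_leI)
      have "\<theta>\<^sup>2 \<le> 1" using that by (simp add: power_le_one)
      have aux: "a \<le> 2 * b + 2 * c \<Longrightarrow> c \<le> 1 \<Longrightarrow> 0 \<le> b \<Longrightarrow> 1 + a \<le> 3 * (1 + b)" for a b c :: real by simp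
      have "1 + (of_int n + \<theta>)\<^sup>2 \<le> 3 * (1 + (of_int n)\<^sup>2)"
        by (rule aux[OF norm_add_square_le[of "of_int n :: real" \<theta>, unfolded real_norm_def power2_abs] \<open>\<theta>\<^sup>2 \<le> 1\<close>]) simp
      moreover have "1 + (of_int n)\<^sup>2 > (0::real)" "1 + (of_int n + \<theta>)\<^sup>2 > 0" by (auto intro: add_pos_nonneg)
      ultimately show "1 / (1 + (of_int n)\<^sup>2) \<le> 3 / (1 + (of_int n + \<theta>)\<^sup>2)" by (simp add: field_simps)
    qed
    then show "(\<integral>\<^sup>+n. ennreal (1 / (1 + (of_int n)\<^sup>2)) \<partial>count_space (UNIV :: int set)) * indicator {0..<1} \<theta>
      \<le> (\<integral>\<^sup>+n. ennreal (3 / (1 + (of_int n + \<theta>)\<^sup>2)) \<partial>count_space (UNIV :: int set)) * indicator {0..<1} \<theta>"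
      by (auto simp: indicator_def intro!: nn_integral_mono)
  qed
  also have "\<dots> = (\<integral>\<^sup>+\<xi>. ennreal (3 / (1 + \<xi>\<^sup>2)) \<partial>lborel)"
    by (rule nn_integral_periodise[symmetric]) measurable
  also have "\<dots> = 3 * (\<integral>\<^sup>+\<xi>. ennreal (1 / (1 + \<xi>\<^sup>2)) \<partial>lborel)"
    by (subst nn_integral_cmult[symmetric]) (auto intro!: nn_integral_cong simp: ennreal_mult'[symmetric] ennreal_numeral[symmetric] simp del: ennreal_numeral)
  also have "\<dots> < \<infinity>" using nn_integral_weight_line by (simp add: ennreal_mult_less_top)
  finally show ?thesis .
qed

text \<open>
  With the Cauchy-Schwarz inequality, square integrability of g and of \<xi> g makes g integrable;
  this is where dimension one enters.
\<close>

lemma integrable_weight: "integrable (freq_measure Z) (\<lambda>\<xi>. 1 / (1 + \<xi>\<^sup>2))"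
proof (rule integrableI_nonneg)
  show "(\<lambda>\<xi>. 1 / (1 + \<xi>\<^sup>2)) \<in> borel_measurable (freq_measure Z)" by (rule borel_measurable_freq) measurable
  show "(\<integral>\<^sup>+\<xi>. ennreal (1 / (1 + \<xi>\<^sup>2)) \<partial>freq_measure Z) < \<infinity>"
    using nn_integral_weight_line nn_integral_weight_circle by (cases Z) auto
qed auto

lemma SS_line_decay:
  assumes f: "SS Line f"
  shows "(\<lambda>n. f (real n)) \<longlonglongrightarrow> 0" "(\<lambda>n. f (- real n)) \<longlonglongrightarrow> 0"
proof -
  note d = SS_DERIV[OF SS_mult[OF f f]] and c = SS_continuous[OF SS_deriv[OF SS_mult[OF f f]]]
  have "integrable lborel (\<lambda>x. f x * f x)" "integrable lborel (deriv (\<lambda>x. f x * f x))"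
    using SS_integrable_mult[OF f f] SS_integrable_mult[OF SS_deriv[OF f] f] SS_integrable_mult[OF f SS_deriv[OF f]]
    by (auto simp: deriv_SS_mult[OF f f])
  note l = line_decay[OF d c this]
  show "(\<lambda>n. f (real n)) \<longlonglongrightarrow> 0" "(\<lambda>n. f (- real n)) \<longlonglongrightarrow> 0"
    using tendsto_real_sqrt[OF l(1)] tendsto_real_sqrt[OF l(2)] by (auto simp: tendsto_rabs_zero_iff)
qed

text \<open>
  Integration by parts on [-n, n] leaves boundary terms f(n) cis (- n \<xi>) and f(-n) cis (n
  \<xi>), which tend to 0 uniformly but are not square integrable in the frequency, and a factor
  \<xi>, which is unbounded. Multiplying by w = 1 / (1 + \<xi>^2) removes both difficulties: all
  terms converge in L2, and w has no zeros.
\<close>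

lemma fourier_deriv_line:
  assumes f: "SS Line f"
  shows "AE \<xi> in lborel. fourier Line (cs (deriv f)) \<xi> = \<i> * of_real \<xi> * fourier Line (cs f) \<xi>"
proof -
  define w where "w \<xi> = complex_of_real (1 / (1 + \<xi>\<^sup>2))" for \<xi> :: real
  have [measurable]: "w \<in> borel_measurable borel" unfolding w_def by measurable
  have pos: "1 + \<xi>\<^sup>2 > 0" for \<xi> :: real by (auto intro: add_pos_nonneg)
  have cmod_w: "cmod (w \<xi>) = 1 / (1 + \<xi>\<^sup>2)" for \<xi> unfolding w_def norm_of_real using pos[of \<xi>] by simp
  have w1: "cmod (w \<xi>) \<le> 1" for \<xi> using pos[of \<xi>] by (simp add: cmod_w)
  have w2: "cmod (\<i> * of_real \<xi> * w \<xi>) \<le> 1" for \<xi>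
  proof -
    have "\<bar>\<xi>\<bar> \<le> 1 + \<xi>\<^sup>2" using sum_squares_bound[of "\<bar>\<xi>\<bar>" 1] by simp
    then show ?thesis using pos[of \<xi>] by (simp add: norm_mult cmod_w)
  qed
  have wL2: "square_integrable lborel w"
    unfolding square_integrable_def
  proof
    show "integrable lborel (\<lambda>\<xi>. (cmod (w \<xi>))\<^sup>2)"
    proof (rule Bochner_Integration.integrable_bound)
      show "integrable lborel (\<lambda>\<xi>. cmod (w \<xi>))" using integrable_weight[of Line] by (simp add: cmod_w)
      show "AE \<xi> in lborel. norm ((cmod (w \<xi>))\<^sup>2) \<le> norm (cmod (w \<xi>))"
        by (intro AE_I2) (simp add: power2_eq_square mult_left_le[OF w1 norm_ge_zero])
    qed measurable
  qed simp
  have L2: "square_integrable lborel (cs f)" "square_integrable lborel (cs (deriv f))"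
    using L2_square_integrable[OF SS_cs_L2[OF f]] L2_square_integrable[OF SS_cs_L2[OF SS_deriv[OF f]]] by auto
  define A where "A n = ft (trunc (real n) (cs (deriv f)))" for n
  define B where "B n = ft (trunc (real n) (cs f))" for n
  let ?F = "fourier Line (cs f)" and ?F' = "fourier Line (cs (deriv f))"
  have A: "square_integrable lborel (A n)" and B: "square_integrable lborel (B n)" for n
    unfolding A_def B_def by (intro l2_ft_trunc L2)+
  note F = fourier_line_spec(1)[OF L2(1)] and F' = fourier_line_spec(1)[OF L2(2)]
  have AB: "A n \<xi> = f n * cis (- (\<xi> * n)) - f (- real n) * cis (\<xi> * n) + \<i> * of_real \<xi> * B n \<xi>" for n \<xi>
    using integral_deriv_cis[OF f, of "- real n" "real n" \<xi>] by (simp add: A_def B_def ft_def trunc_def set_lebesgue_integral_def)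
  have m1: "square_integrable lborel g \<Longrightarrow> square_integrable lborel (\<lambda>\<xi>. w \<xi> * g \<xi>)" for g
    by (rule square_integrable_bounded_mult[OF _ _ w1]) auto
  have m2: "square_integrable lborel g \<Longrightarrow> square_integrable lborel (\<lambda>\<xi>. \<i> * of_real \<xi> * w \<xi> * g \<xi>)" for g
    by (rule square_integrable_bounded_mult[OF _ _ w2]) auto
  have "AE \<xi> in lborel. w \<xi> * ?F' \<xi> = \<i> * of_real \<xi> * w \<xi> * ?F \<xi>"
  proof (rule l2_eq_limit_AE[where G="\<lambda>n \<xi>. w \<xi> * A n \<xi>"])
    show "(\<lambda>n. l2 lborel (\<lambda>x. w x * A n x - w x * ?F' x)) \<longlonglongrightarrow> 0"
    proof (rule Lim_null_comparison[OF _ fourier_line_seq[OF L2(2)]], intro always_eventually allI)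
      fix n
      have "l2 lborel (\<lambda>x. w x * A n x - w x * ?F' x) \<le> l2 lborel (\<lambda>x. A n x - ?F' x)"
      proof (rule l2_mono[OF square_integrable_diff[OF A F']])
        show "cmod (w x * A n x - w x * ?F' x) \<le> cmod (A n x - ?F' x)" for x
          unfolding right_diff_distrib[symmetric] norm_mult by (rule mult_left_le_one_le[OF norm_ge_zero norm_ge_zero w1])
      qed (use A[of n] F' in \<open>auto simp: square_integrable_def\<close>)
      then show "norm (l2 lborel (\<lambda>x. w x * A n x - w x * ?F' x)) \<le> l2 lborel (\<lambda>\<xi>. ft (trunc (real n) (cs (deriv f))) \<xi> - ?F' \<xi>)"
        by (simp add: A_def)
    qed
    have lim: "(\<lambda>n. (\<bar>f (real n)\<bar> + \<bar>f (- real n)\<bar>) * l2 lborel w + l2 lborel (\<lambda>\<xi>. B n \<xi> - ?F \<xi>)) \<longlonglongrightarrow> 0"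
      using SS_line_decay[OF f] fourier_line_seq[OF L2(1)] unfolding B_def by (auto intro!: tendsto_eq_intros)
    show "(\<lambda>n. l2 lborel (\<lambda>x. w x * A n x - \<i> * of_real x * w x * ?F x)) \<longlonglongrightarrow> 0"
    proof (rule Lim_null_comparison[OF _ lim], intro always_eventually allI)
      fix n
      let ?b = "\<lambda>\<xi>. f n * cis (- (\<xi> * n)) - f (- real n) * cis (\<xi> * n)"
      have b: "cmod (?b \<xi> * w \<xi>) \<le> cmod (of_real (\<bar>f (real n)\<bar> + \<bar>f (- real n)\<bar>) * w \<xi>)" for \<xi>
        unfolding norm_mult
        by (intro mult_right_mono order_trans[OF norm_triangle_ineq4]) (auto simp: norm_mult simp flip: of_real_add)
      have bL2: "square_integrable lborel (\<lambda>\<xi>. ?b \<xi> * w \<xi>)"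
        by (rule square_integrable_le[OF square_integrable_scale[OF wL2] _ b]) measurable
      have "(\<lambda>x. w x * A n x - \<i> * of_real x * w x * ?F x) = (\<lambda>x. ?b x * w x + \<i> * of_real x * w x * (B n x - ?F x))"
        unfolding AB by (auto simp: algebra_simps)
      then have "l2 lborel (\<lambda>x. w x * A n x - \<i> * of_real x * w x * ?F x)
         \<le> l2 lborel (\<lambda>x. ?b x * w x) + l2 lborel (\<lambda>x. \<i> * of_real x * w x * (B n x - ?F x))"
        using l2_triangle[OF bL2 m2[OF square_integrable_diff[OF B F]]] by simp
      also have "l2 lborel (\<lambda>x. ?b x * w x) \<le> l2 lborel (\<lambda>\<xi>. of_real (\<bar>f (real n)\<bar> + \<bar>f (- real n)\<bar>) * w \<xi>)"
        by (rule l2_mono[OF square_integrable_scale[OF wL2] _ b]) measurable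
      also have "\<dots> = (\<bar>f (real n)\<bar> + \<bar>f (- real n)\<bar>) * l2 lborel w" unfolding l2_scale by (simp flip: of_real_add)
      also have "l2 lborel (\<lambda>x. \<i> * of_real x * w x * (B n x - ?F x)) \<le> l2 lborel (\<lambda>\<xi>. B n \<xi> - ?F \<xi>)"
      proof (rule l2_mono[OF square_integrable_diff[OF B F]])
        show "cmod (\<i> * of_real x * w x * (B n x - ?F x)) \<le> cmod (B n x - ?F x)" for x
          unfolding norm_mult[of _ "B n x - ?F x"] by (rule mult_left_le_one_le[OF norm_ge_zero norm_ge_zero w2])
      qed (use m2[OF square_integrable_diff[OF B F]] in \<open>auto simp: square_integrable_def\<close>)
      finally show "norm (l2 lborel (\<lambda>x. w x * A n x - \<i> * of_real x * w x * ?F x)) \<le> (\<bar>f (real n)\<bar> + \<bar>f (- real n)\<bar>) * l2 lborel w + l2 lborel (\<lambda>\<xi>. B n \<xi> - ?F \<xi>)"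
        by simp
    qed
  qed (intro m1 m2 A F F')+
  then show ?thesis
  proof eventually_elim
    case (elim \<xi>)
    have "w \<xi> \<noteq> 0" using cmod_w[of \<xi>] pos[of \<xi>] by auto
    then show ?case using elim by (simp add: mult_ac)
  qed
qed

lemma fourier_deriv:
  assumes f: "SS Z f"
  shows "AE \<xi> in freq_measure Z. fourier Z (cs (deriv f)) \<xi> = \<i> * of_real \<xi> * fourier Z (cs f) \<xi>"
proof (cases Z)
  case Line
  show ?thesis using fourier_deriv_line f unfolding Line freq_measure.simps by blast
next
  case Circle
  have "fourier Circle (cs (deriv f)) \<xi> = \<i> * of_real \<xi> * fourier Circle (cs f) \<xi>" if "\<xi> \<in> \<int>" for \<xi>
  proof -
    have "f (2 * pi) = f 0" using SS_periodic[of f 0] f Circle by simp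
    moreover have "cis (- (\<xi> * (2 * pi))) = 1"
      using cis_multiple_2pi[of "- \<xi>"] that by (simp add: mult.commute)
    ultimately show ?thesis
      using integral_deriv_cis[OF f, of 0 "2 * pi" \<xi>] by (simp add: integral_circle_measure)
  qed
  then show ?thesis unfolding Circle freq_measure.simps by (intro AE_I2) (simp del: fourier.simps)
qed

section \<open>Rapidly decaying transforms\<close>

text \<open>
  These are the transforms of the elements of all Sobolev spaces; multipliers of polynomial growth
  act on them.
\<close>

definition rapid :: "domain \<Rightarrow> (real \<Rightarrow> complex) \<Rightarrow> bool" where
  "rapid Z g \<longleftrightarrow> g \<in> borel_measurable (freq_measure Z) \<and>
     (\<forall>k. integrable (freq_measure Z) (\<lambda>\<xi>. (1 + \<xi>\<^sup>2) ^ k * (cmod (g \<xi>))\<^sup>2))"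

lemma one_plus_square_pos [simp]: "1 + \<xi>\<^sup>2 > (0::real)" "1 + \<xi>\<^sup>2 \<noteq> 0" "1 + \<xi>\<^sup>2 \<ge> 0" "1 + \<xi>\<^sup>2 \<ge> 1"
proof -
  show "1 + \<xi>\<^sup>2 > 0" by (auto intro: add_pos_nonneg)
  then show "1 + \<xi>\<^sup>2 \<noteq> 0" "1 + \<xi>\<^sup>2 \<ge> 0" by linarith+
qed simp

lemma rapid_measurable: "rapid Z g \<Longrightarrow> g \<in> borel_measurable (freq_measure Z)"
  by (simp add: rapid_def)

lemma rapid_square_integrable: "rapid Z g \<Longrightarrow> square_integrable (freq_measure Z) g"
  unfolding rapid_def square_integrable_def by (auto dest: spec[of _ 0])

lemma freq_poly_measurable: "(\<lambda>\<xi>. (1 + \<xi>\<^sup>2) ^ k) \<in> borel_measurable (freq_measure Z)"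
  by (rule borel_measurable_freq) measurable

lemma rapid_mult:
  assumes g: "rapid Z g" and m: "m \<in> borel_measurable (freq_measure Z)" "\<And>\<xi>. cmod (m \<xi>) \<le> (1 + \<xi>\<^sup>2) ^ j"
  shows "rapid Z (\<lambda>\<xi>. m \<xi> * g \<xi>)"
  unfolding rapid_def
proof (intro conjI allI)
  note gm = rapid_measurable[OF g]
  show mg: "(\<lambda>\<xi>. m \<xi> * g \<xi>) \<in> borel_measurable (freq_measure Z)"
    using gm m(1) by measurable
  fix k
  show "integrable (freq_measure Z) (\<lambda>\<xi>. (1 + \<xi>\<^sup>2) ^ k * (cmod (m \<xi> * g \<xi>))\<^sup>2)"
  proof (rule Bochner_Integration.integrable_bound)
    show "integrable (freq_measure Z) (\<lambda>\<xi>. (1 + \<xi>\<^sup>2) ^ (k + 2 * j) * (cmod (g \<xi>))\<^sup>2)"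
      using g by (simp add: rapid_def)
    show "AE \<xi> in freq_measure Z. norm ((1 + \<xi>\<^sup>2) ^ k * (cmod (m \<xi> * g \<xi>))\<^sup>2) \<le> norm ((1 + \<xi>\<^sup>2) ^ (k + 2 * j) * (cmod (g \<xi>))\<^sup>2)"
    proof (intro AE_I2)
      fix \<xi>
      have "(cmod (m \<xi>))\<^sup>2 \<le> ((1 + \<xi>\<^sup>2) ^ j)\<^sup>2" by (intro power_mono m) auto
      then have "(1 + \<xi>\<^sup>2) ^ k * (cmod (m \<xi>))\<^sup>2 \<le> (1 + \<xi>\<^sup>2) ^ (k + 2 * j)"
        by (simp add: power_add power_mult[symmetric] mult.commute[of 2 j] mult_left_mono)
      then show "norm ((1 + \<xi>\<^sup>2) ^ k * (cmod (m \<xi> * g \<xi>))\<^sup>2) \<le> norm ((1 + \<xi>\<^sup>2) ^ (k + 2 * j) * (cmod (g \<xi>))\<^sup>2)"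
        by (simp add: norm_mult power_mult_distrib mult.assoc[symmetric] mult_right_mono abs_mult)
    qed
    show "(\<lambda>\<xi>. (1 + \<xi>\<^sup>2) ^ k * (cmod (m \<xi> * g \<xi>))\<^sup>2) \<in> borel_measurable (freq_measure Z)"
      using mg freq_poly_measurable[of k Z] by measurable
  qed
qed

lemma rapid_mult_borel:
  assumes "rapid Z g" "m \<in> borel_measurable borel" "\<And>\<xi>. cmod (m \<xi>) \<le> (1 + \<xi>\<^sup>2) ^ j"
  shows "rapid Z (\<lambda>\<xi>. m \<xi> * g \<xi>)"
  by (rule rapid_mult[OF assms(1) borel_measurable_freq[OF assms(2)] assms(3)])

lemma abs_le_one_plus_square: "\<bar>\<xi>\<bar> \<le> 1 + (\<xi>::real)\<^sup>2"
  using sum_squares_bound[of "\<bar>\<xi>\<bar>" 1] by simp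

lemma rapid_times_freq: "rapid Z g \<Longrightarrow> rapid Z (\<lambda>\<xi>. \<i> * of_real \<xi> * g \<xi>)"
  by (rule rapid_mult_borel[where j=1]) (auto simp: norm_mult abs_le_one_plus_square)

lemma rapid_sgn: "rapid Z g \<Longrightarrow> rapid Z (\<lambda>\<xi>. - \<i> * of_real (sgn \<xi>) * g \<xi>)"
  by (rule rapid_mult_borel[where j=0]) (auto simp: norm_mult abs_sgn_eq)

lemma rapid_cmod_integrable_bound:
  assumes g: "rapid Z g"
  shows "integrable (freq_measure Z) g"
    "LINT \<xi>|freq_measure Z. cmod (g \<xi>) \<le> sqrt (LINT \<xi>|freq_measure Z. 1 / (1 + \<xi>\<^sup>2)) * sqrt (LINT \<xi>|freq_measure Z. (1 + \<xi>\<^sup>2) * (cmod (g \<xi>))\<^sup>2)"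
proof -
  let ?M = "freq_measure Z"
  note gm = rapid_measurable[OF g]
  have m: "(\<lambda>\<xi>. 1 / sqrt (1 + \<xi>\<^sup>2)) \<in> borel_measurable ?M" "(\<lambda>\<xi>. sqrt (1 + \<xi>\<^sup>2)) \<in> borel_measurable ?M"
    by (rule borel_measurable_freq; measurable)+
  have m2: "(\<lambda>\<xi>. sqrt (1 + \<xi>\<^sup>2) * cmod (g \<xi>)) \<in> borel_measurable ?M" using gm m(2) by measurable
  have sq: "(norm (1 / sqrt (1 + \<xi>\<^sup>2)))\<^sup>2 = 1 / (1 + \<xi>\<^sup>2)" "(norm (sqrt (1 + \<xi>\<^sup>2) * cmod (g \<xi>)))\<^sup>2 = (1 + \<xi>\<^sup>2) * (cmod (g \<xi>))\<^sup>2" for \<xi>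
    by (simp_all add: power_divide power_mult_distrib)
  have eq: "1 / sqrt (1 + \<xi>\<^sup>2) * (sqrt (1 + \<xi>\<^sup>2) * cmod (g \<xi>)) = cmod (g \<xi>)" for \<xi>
    using one_plus_square_pos(2)[of \<xi>] by simp
  have i1: "integrable ?M (\<lambda>\<xi>. (1 + \<xi>\<^sup>2) * (cmod (g \<xi>))\<^sup>2)"
    using g unfolding rapid_def by (metis (no_types, lifting) ext power_one_right)
  have "integrable ?M (\<lambda>\<xi>. 1 / sqrt (1 + \<xi>\<^sup>2) * (sqrt (1 + \<xi>\<^sup>2) * cmod (g \<xi>)))"
    by (rule integrable_mult_L2[OF m(1) m2]) (simp_all only: sq integrable_weight i1)
  then have "integrable ?M (\<lambda>\<xi>. cmod (g \<xi>))" by (simp only: eq)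
  then show "integrable ?M g" using gm by (subst (asm) integrable_norm_iff)
  have "(LINT \<xi>|?M. norm (1 / sqrt (1 + \<xi>\<^sup>2)) * norm (sqrt (1 + \<xi>\<^sup>2) * cmod (g \<xi>))) \<le>
     sqrt (LINT \<xi>|?M. (norm (1 / sqrt (1 + \<xi>\<^sup>2)))\<^sup>2) * sqrt (LINT \<xi>|?M. (norm (sqrt (1 + \<xi>\<^sup>2) * cmod (g \<xi>)))\<^sup>2)"
    by (rule Cauchy_Schwarz_integral[OF m(1) m2]) (simp_all only: sq integrable_weight i1)
  moreover have "norm (1 / sqrt (1 + \<xi>\<^sup>2)) * norm (sqrt (1 + \<xi>\<^sup>2) * cmod (g \<xi>)) = cmod (g \<xi>)" for \<xi>
    using one_plus_square_pos(2)[of \<xi>] by (simp add: abs_mult)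
  ultimately show "LINT \<xi>|?M. cmod (g \<xi>) \<le> sqrt (LINT \<xi>|?M. 1 / (1 + \<xi>\<^sup>2)) * sqrt (LINT \<xi>|?M. (1 + \<xi>\<^sup>2) * (cmod (g \<xi>))\<^sup>2)"
    by (simp only: sq)
qed

lemmas rapid_integrable = rapid_cmod_integrable_bound(1)

lemma rapid_fourier_inversion:
  assumes "rapid Z g"
  shows "inv_ft Z g \<in> L2 Z" "AE \<xi> in freq_measure Z. fourier Z (inv_ft Z g) \<xi> = g \<xi>"
  using fourier_inversion[OF rapid_integrable[OF assms] rapid_square_integrable[OF assms]] by auto

lemma rapid_inv_ft_derivative:
  assumes "rapid Z g"
  shows "(inv_ft Z g has_vector_derivative inv_ft Z (\<lambda>\<xi>. \<i> * of_real \<xi> * g \<xi>) x) (at x)"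
  by (intro inv_ft_has_vector_derivative rapid_integrable rapid_times_freq assms)

lemma rapid_Re_derivative:
  assumes "rapid Z g"
  shows "((\<lambda>x. Re (inv_ft Z g x)) has_real_derivative Re (inv_ft Z (\<lambda>\<xi>. \<i> * of_real \<xi> * g \<xi>) x)) (at x)"
  using rapid_inv_ft_derivative[OF assms, of x]
  unfolding has_vector_derivative_complex_iff has_real_derivative_iff_has_vector_derivative by simp

lemma rapid_Re_tame:
  assumes g: "rapid Z g"
  shows "tame Z (\<lambda>x. Re (inv_ft Z g x))"
proof -
  have cont: "continuous_on UNIV (inv_ft Z g)" by (intro inv_ft_continuous rapid_integrable g)
  have L2: "square_integrable (space_measure Z) (inv_ft Z g)"
    by (intro L2_square_integrable rapid_fourier_inversion g)
  have "\<bar>Re (inv_ft Z g x)\<bar> \<le> 1 / (2 * pi) * (LINT \<xi>|freq_measure Z. cmod (g \<xi>))" for x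
    using cmod_inv_ft_le[OF rapid_integrable[OF g]] abs_Re_le_cmod order_trans by blast
  moreover have "integrable (space_measure Z) (\<lambda>x. (Re (inv_ft Z g x))\<^sup>2)"
  proof (rule Bochner_Integration.integrable_bound)
    show "integrable (space_measure Z) (\<lambda>x. (cmod (inv_ft Z g x))\<^sup>2)" using L2 by (simp add: square_integrable_def)
    have [measurable]: "inv_ft Z g \<in> borel_measurable (space_measure Z)" using L2 by (simp add: square_integrable_def)
    show "(\<lambda>x. (Re (inv_ft Z g x))\<^sup>2) \<in> borel_measurable (space_measure Z)" by measurable
  qed (simp add: cmod_power2)
  moreover have "Re (inv_ft Z g (x + 2 * pi)) = Re (inv_ft Z g x)" if "Z = Circle" for x
    using inv_ft_function_on[of Z g] that by simp
  ultimately show ?thesis unfolding tame_def using cont by (auto intro!: continuous_intros)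
qed

lemma deriv_rapid_Re:
  assumes g: "rapid Z g"
  shows "deriv (\<lambda>x. Re (inv_ft Z g x)) = (\<lambda>x. Re (inv_ft Z (\<lambda>\<xi>. \<i> * of_real \<xi> * g \<xi>) x))"
  by (intro ext DERIV_imp_deriv rapid_Re_derivative g)

text \<open>
  Each derivative multiplies the transform by the frequency, which preserves rapid decay, and a
  function with rapidly decaying transform is bounded, continuous and square integrable.
\<close>

lemma rapid_Re_SS:
  assumes "rapid Z g"
  shows "SS Z (\<lambda>x. Re (inv_ft Z g x))"
  unfolding SS_def
proof
  fix k
  show "smooth_ord Z k (\<lambda>x. Re (inv_ft Z g x))" using assms
  proof (induction k arbitrary: g)
    case (Suc k)
    have "(\<lambda>x. Re (inv_ft Z g x)) differentiable (at x)" for x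
      using rapid_Re_derivative[OF Suc.prems] real_differentiable_def by blast
    then show ?case using rapid_Re_tame[OF Suc.prems] Suc.IH[OF rapid_times_freq[OF Suc.prems]]
      by (simp add: deriv_rapid_Re[OF Suc.prems])
  qed (simp add: rapid_Re_tame)
qed

lemma inv_ft_cong_AE:
  assumes "AE \<xi> in freq_measure Z. g \<xi> = h \<xi>" "g \<in> borel_measurable (freq_measure Z)" "h \<in> borel_measurable (freq_measure Z)"
  shows "inv_ft Z g = inv_ft Z h"
proof
  fix x
  have cm: "(\<lambda>\<xi>. cis (\<xi> * x)) \<in> borel_measurable (freq_measure Z)" by (rule borel_measurable_freq) measurable
  have "(LINT \<xi>|freq_measure Z. g \<xi> * cis (\<xi> * x)) = (LINT \<xi>|freq_measure Z. h \<xi> * cis (\<xi> * x))"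
    by (rule integral_cong_AE) (use assms cm in auto)
  then show "inv_ft Z g x = inv_ft Z h x" by (simp add: inv_ft_def)
qed

lemma fourier_measurable: "f \<in> L2 Z \<Longrightarrow> fourier Z f \<in> borel_measurable (freq_measure Z)"
  using fourier_square_integrable by (auto simp: square_integrable_def)

lemma one_plus_power_le: "(1 + a) ^ k \<le> 2 ^ k * (1 + a ^ k)" if "a \<ge> 0" for a :: real
proof (cases "a \<le> 1")
  case True
  have "(1 + a) ^ k \<le> 2 ^ k" using True that by (intro power_mono) auto
  also have "\<dots> \<le> 2 ^ k * (1 + a ^ k)" using that by simp
  finally show ?thesis .
next
  case False
  have "(1 + a) ^ k \<le> (2 * a) ^ k" using False that by (intro power_mono) auto
  also have "\<dots> \<le> 2 ^ k * (1 + a ^ k)" using that by (simp add: power_mult_distrib)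
  finally show ?thesis .
qed

lemma SS_iter_deriv: "SS Z f \<Longrightarrow> SS Z ((deriv ^^ k) f)"
  by (induction k) (auto intro: SS_deriv)

lemma fourier_iter_deriv:
  assumes f: "SS Z f"
  shows "AE \<xi> in freq_measure Z. fourier Z (cs ((deriv ^^ k) f)) \<xi> = (\<i> * of_real \<xi>) ^ k * fourier Z (cs f) \<xi>"
proof (induction k)
  case (Suc k)
  show ?case using fourier_deriv[OF SS_iter_deriv[OF f, of k]] Suc by eventually_elim simp
qed simp

text \<open>
  The k-th derivative is square integrable, so the transform is square integrable against the weight
  \<xi>^(2k).
\<close>

lemma SS_rapid:
  assumes f: "SS Z f"
  shows "rapid Z (fourier Z (cs f))"
  unfolding rapid_def
proof (intro conjI allI)
  let ?M = "freq_measure Z" and ?F = "fourier Z (cs f)"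
  show Fm: "?F \<in> borel_measurable ?M" by (intro fourier_measurable SS_cs_L2 f)
  fix k
  have F2: "integrable ?M (\<lambda>\<xi>. (cmod (?F \<xi>))\<^sup>2)"
    using fourier_square_integrable[OF SS_cs_L2[OF f]] by (simp add: square_integrable_def)
  have pm: "(\<lambda>\<xi>. \<xi> ^ (2 * k)) \<in> borel_measurable ?M" by (rule borel_measurable_freq) measurable
  have "integrable ?M (\<lambda>\<xi>. (cmod (fourier Z (cs ((deriv ^^ k) f)) \<xi>))\<^sup>2)"
    using fourier_square_integrable[OF SS_cs_L2[OF SS_iter_deriv[OF f]]] by (simp add: square_integrable_def)
  also have "?this \<longleftrightarrow> integrable ?M (\<lambda>\<xi>. \<xi> ^ (2 * k) * (cmod (?F \<xi>))\<^sup>2)"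
  proof (rule integrable_cong_AE)
    show "AE \<xi> in ?M. (cmod (fourier Z (cs ((deriv ^^ k) f)) \<xi>))\<^sup>2 = \<xi> ^ (2 * k) * (cmod (?F \<xi>))\<^sup>2"
      using fourier_iter_deriv[OF f, of k]
    proof eventually_elim
      case (elim \<xi>)
      have "(\<bar>\<xi>\<bar> ^ k)\<^sup>2 = \<xi> ^ (2 * k)" by (metis power_even_abs even_mult_iff even_numeral power_mult mult.commute)
      then show ?case unfolding elim by (simp add: norm_mult norm_power power_mult_distrib)
    qed
  qed (use Fm pm fourier_measurable[OF SS_cs_L2[OF SS_iter_deriv[OF f]]] in measurable)
  finally have Fk: "integrable ?M (\<lambda>\<xi>. \<xi> ^ (2 * k) * (cmod (?F \<xi>))\<^sup>2)" .
  show "integrable ?M (\<lambda>\<xi>. (1 + \<xi>\<^sup>2) ^ k * (cmod (?F \<xi>))\<^sup>2)"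
  proof (rule Bochner_Integration.integrable_bound)
    show "integrable ?M (\<lambda>\<xi>. 2 ^ k * ((cmod (?F \<xi>))\<^sup>2 + \<xi> ^ (2 * k) * (cmod (?F \<xi>))\<^sup>2))" using F2 Fk by simp
    show "(\<lambda>\<xi>. (1 + \<xi>\<^sup>2) ^ k * (cmod (?F \<xi>))\<^sup>2) \<in> borel_measurable ?M"
      using Fm freq_poly_measurable[of k Z] by measurable
    show "AE \<xi> in ?M. norm ((1 + \<xi>\<^sup>2) ^ k * (cmod (?F \<xi>))\<^sup>2) \<le> norm (2 ^ k * ((cmod (?F \<xi>))\<^sup>2 + \<xi> ^ (2 * k) * (cmod (?F \<xi>))\<^sup>2))"
    proof (intro AE_I2)
      fix \<xi>
      have "(1 + \<xi>\<^sup>2) ^ k * (cmod (?F \<xi>))\<^sup>2 \<le> 2 ^ k * (1 + (\<xi>\<^sup>2) ^ k) * (cmod (?F \<xi>))\<^sup>2"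
        by (intro mult_right_mono one_plus_power_le) auto
      then show "norm ((1 + \<xi>\<^sup>2) ^ k * (cmod (?F \<xi>))\<^sup>2) \<le> norm (2 ^ k * ((cmod (?F \<xi>))\<^sup>2 + \<xi> ^ (2 * k) * (cmod (?F \<xi>))\<^sup>2))"
        by (simp add: power_mult[symmetric] abs_mult distrib_right mult.assoc)
    qed
  qed
qed

lemma SS_inv_ft_fourier:
  assumes f: "SS Z f"
  shows "inv_ft Z (fourier Z (cs f)) = cs f"
  by (intro inv_ft_fourier SS_cs_L2 rapid_integrable SS_rapid f)
    (use SS_continuous[OF f] in \<open>auto intro!: continuous_intros\<close>)

section \<open>The Hilbert transform on real functions\<close>

lemma integral_freq_reflect:
  fixes g :: "real \<Rightarrow> complex"
  shows "(LINT \<xi>|freq_measure Z. g (- \<xi>)) = (LINT \<xi>|freq_measure Z. g \<xi>)"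
proof (cases Z)
  case Line
  then show ?thesis using lborel_integral_real_affine[of "-1" g 0] by simp
next
  case Circle
  have "bij_betw uminus (\<int> :: real set) \<int>" by (rule bij_betw_byWitness[where f'=uminus]) auto
  from integral_bij_count_space[OF this, of g] Circle show ?thesis by simp
qed

text \<open>
  The truncated transforms have the symmetry pointwise, and it passes to the L2 limit because
  reflection and conjugation preserve the norm.
\<close>

lemma fourier_conj_symmetric:
  assumes f: "tame Z f"
  shows "AE \<xi> in freq_measure Z. cnj (fourier Z (cs f) (- \<xi>)) = fourier Z (cs f) \<xi>"
proof (cases Z)
  case Circle
  have "cnj (fourier Circle (cs f) (- \<xi>)) = fourier Circle (cs f) \<xi>" for \<xi>
  proof -
    have "cnj (LINT x|circle_measure. cs f x * cis (- (- \<xi> * x))) = (LINT x|circle_measure. cnj (cs f x * cis (- (- \<xi> * x))))"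
      by (rule Bochner_Integration.integral_cnj[symmetric])
    also have "\<dots> = (LINT x|circle_measure. cs f x * cis (- (\<xi> * x)))"
      by (intro Bochner_Integration.integral_cong refl) (simp add: cis_cnj)
    finally show ?thesis by simp
  qed
  then show ?thesis unfolding Circle by (simp del: fourier.simps)
next
  case Line
  let ?F = "fourier Line (cs f)"
  have L2: "square_integrable lborel (cs f)"
    using L2_square_integrable[OF tame_cs_L2[OF f]] Line by simp
  note F = fourier_line_spec(1)[OF L2]
  have [measurable]: "?F \<in> borel_measurable borel" using F by (simp add: square_integrable_def)
  have nsq_refl: "nsq lborel (\<lambda>\<xi>. cnj (h (- \<xi>))) = nsq lborel h" if [measurable]: "h \<in> borel_measurable borel" for h :: "real \<Rightarrow> complex"
    unfolding nsq_def by (subst nn_integral_real_affine[where c="-1" and t=0, of "\<lambda>x. ennreal ((cmod (h x))\<^sup>2)"]) auto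
  have sq_refl: "square_integrable lborel (\<lambda>\<xi>. cnj (h (- \<xi>)))" if "square_integrable lborel h" for h
  proof (rule square_integrableI_nsq)
    have [measurable]: "h \<in> borel_measurable borel" using that by (simp add: square_integrable_def)
    show "(\<lambda>\<xi>. cnj (h (- \<xi>))) \<in> borel_measurable lborel" by measurable
    show "nsq lborel (\<lambda>\<xi>. cnj (h (- \<xi>))) < \<infinity>" by (simp add: nsq_refl nsq_eq_l2[OF that])
  qed
  have l2_refl: "l2 lborel (\<lambda>\<xi>. cnj (h (- \<xi>))) = l2 lborel h" if "square_integrable lborel h" for h
  proof -
    have "h \<in> borel_measurable borel" using that by (simp add: square_integrable_def)
    then have "(l2 lborel (\<lambda>\<xi>. cnj (h (- \<xi>))))\<^sup>2 = (l2 lborel h)\<^sup>2"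
      using nsq_refl[of h] unfolding nsq_eq_l2[OF that] nsq_eq_l2[OF sq_refl[OF that]] by simp
    then show ?thesis by (simp add: power2_eq_iff_nonneg)
  qed
  let ?G = "\<lambda>n. ft (trunc (real n) (cs f))"
  have G: "square_integrable lborel (?G n)" for n by (rule l2_ft_trunc[OF L2])
  have Gs: "cnj (?G n (- \<xi>)) = ?G n \<xi>" for n \<xi>
  proof -
    have "cnj (?G n (- \<xi>)) = (LINT x|lborel. cnj (trunc (real n) (cs f) x * cis (- (- \<xi> * x))))"
      unfolding ft_def by (rule Bochner_Integration.integral_cnj[symmetric])
    also have "\<dots> = ?G n \<xi>"
      unfolding ft_def by (intro Bochner_Integration.integral_cong refl) (simp add: cis_cnj trunc_def)
    finally show ?thesis .
  qed
  have "AE \<xi> in lborel. cnj (?F (- \<xi>)) = ?F \<xi>"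
  proof (rule l2_eq_limit_AE[OF sq_refl[OF F] F G _ fourier_line_seq[OF L2]])
    have "l2 lborel (\<lambda>x. ?G n x - cnj (?F (- x))) = l2 lborel (\<lambda>\<xi>. ?G n \<xi> - ?F \<xi>)" for n
      using l2_refl[OF square_integrable_diff[OF G F], of n] by (simp add: Gs)
    then show "(\<lambda>n. l2 lborel (\<lambda>x. ?G n x - cnj (?F (- x)))) \<longlonglongrightarrow> 0" using fourier_line_seq[OF L2] by simp
  qed
  then show ?thesis unfolding Line freq_measure.simps .
qed

definition Hil :: "domain \<Rightarrow> (real \<Rightarrow> real) \<Rightarrow> real \<Rightarrow> real" where
  "Hil Z f x = Re (hilbert Z (cs f) x)"

lemma hilbert_inv_ft: "hilbert Z f = inv_ft Z (\<lambda>\<xi>. - \<i> * of_real (sgn \<xi>) * fourier Z f \<xi>)"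
  by (simp add: hilbert_def fourier_multiplier_inv_ft)

text \<open>
  The symbol is odd and imaginary, hence it preserves the symmetry of transforms of real functions.
\<close>

lemma hilbert_real:
  assumes f: "SS Z f"
  shows "hilbert Z (cs f) = cs (Hil Z f)"
proof
  fix x
  let ?F = "fourier Z (cs f)" and ?m = "\<lambda>\<xi>. - \<i> * of_real (sgn \<xi>)"
  note R = rapid_sgn[OF SS_rapid[OF f]]
  have "cnj (LINT \<xi>|freq_measure Z. ?m \<xi> * ?F \<xi> * cis (\<xi> * x)) = (LINT \<xi>|freq_measure Z. cnj (?m \<xi> * ?F \<xi> * cis (\<xi> * x)))"
    by (rule Bochner_Integration.integral_cnj[symmetric])
  also have "\<dots> = (LINT \<xi>|freq_measure Z. cnj (?m (- \<xi>) * ?F (- \<xi>) * cis (- \<xi> * x)))"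
    by (rule integral_freq_reflect[symmetric])
  also have "\<dots> = (LINT \<xi>|freq_measure Z. ?m \<xi> * ?F \<xi> * cis (\<xi> * x))"
  proof (rule Bochner_Integration.integral_cong_AE)
    have cm: "(\<lambda>\<xi>. cis (\<xi> * x)) \<in> borel_measurable (freq_measure Z)" by (rule borel_measurable_freq) measurable
    show m: "(\<lambda>\<xi>. ?m \<xi> * ?F \<xi> * cis (\<xi> * x)) \<in> borel_measurable (freq_measure Z)"
      using rapid_measurable[OF R] cm by measurable
    show "AE \<xi> in freq_measure Z. cnj (?m (- \<xi>) * ?F (- \<xi>) * cis (- \<xi> * x)) = ?m \<xi> * ?F \<xi> * cis (\<xi> * x)"
      using fourier_conj_symmetric[OF SS_tame[OF f]] by eventually_elim (simp add: cis_cnj sgn_minus)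
    show "(\<lambda>\<xi>. cnj (?m (- \<xi>) * ?F (- \<xi>) * cis (- \<xi> * x))) \<in> borel_measurable (freq_measure Z)"
    proof (cases Z)
      case Line
      have [measurable]: "fourier Line (cs f) \<in> borel_measurable borel"
        using fourier_measurable[OF SS_cs_L2[OF f]] Line by simp
      show ?thesis unfolding Line freq_measure.simps by measurable
    qed simp
  qed
  finally have "cnj (hilbert Z (cs f) x) = hilbert Z (cs f) x"
    unfolding hilbert_inv_ft inv_ft_def by simp
  then show "hilbert Z (cs f) x = cs (Hil Z f) x"
    by (simp add: Hil_def complex_eq_iff)
qed

lemma SS_Hil: "SS Z f \<Longrightarrow> SS Z (Hil Z f)"
  unfolding Hil_def[abs_def] hilbert_inv_ft by (intro rapid_Re_SS rapid_sgn SS_rapid)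

lemma fourier_Hil:
  assumes f: "SS Z f"
  shows "AE \<xi> in freq_measure Z. fourier Z (cs (Hil Z f)) \<xi> = - \<i> * of_real (sgn \<xi>) * fourier Z (cs f) \<xi>"
  using rapid_fourier_inversion(2)[OF rapid_sgn[OF SS_rapid[OF f]]] unfolding hilbert_real[OF f, symmetric] hilbert_inv_ft .

lemma SS_eqI:
  assumes f: "SS Z f" and g: "SS Z g" and eq: "AE \<xi> in freq_measure Z. fourier Z (cs f) \<xi> = fourier Z (cs g) \<xi>"
  shows "f = g"
proof -
  have "cs f = cs g"
    using inv_ft_cong_AE[OF eq fourier_measurable[OF SS_cs_L2[OF f]] fourier_measurable[OF SS_cs_L2[OF g]]]
      SS_inv_ft_fourier[OF f] SS_inv_ft_fourier[OF g] by simp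
  then show ?thesis by (simp add: fun_eq_iff)
qed

lemma deriv_Hil:
  assumes f: "SS Z f"
  shows "deriv (Hil Z f) = Hil Z (deriv f)"
proof (rule SS_eqI)
  show "AE \<xi> in freq_measure Z. fourier Z (cs (deriv (Hil Z f))) \<xi> = fourier Z (cs (Hil Z (deriv f))) \<xi>"
    using fourier_deriv[OF SS_Hil[OF f]] fourier_Hil[OF f] fourier_Hil[OF SS_deriv[OF f]] fourier_deriv[OF f]
    by eventually_elim simp
qed (intro SS_deriv SS_Hil f)+

lemma fourier_SS_linear:
  assumes "SS Z f" "SS Z g"
  shows "AE \<xi> in freq_measure Z. fourier Z (cs (\<lambda>x. a * f x + b * g x)) \<xi> = of_real a * fourier Z (cs f) \<xi> + of_real b * fourier Z (cs g) \<xi>"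
  using fourier_linear[OF SS_cs_L2[OF assms(1)] SS_cs_L2[OF assms(2)], of "of_real a" "of_real b"] by simp

lemma Hil_linear:
  assumes f: "SS Z f" and g: "SS Z g"
  shows "Hil Z (\<lambda>x. a * f x + b * g x) = (\<lambda>x. a * Hil Z f x + b * Hil Z g x)"
proof (rule SS_eqI)
  show "AE \<xi> in freq_measure Z. fourier Z (cs (Hil Z (\<lambda>x. a * f x + b * g x))) \<xi> = fourier Z (cs (\<lambda>x. a * Hil Z f x + b * Hil Z g x)) \<xi>"
    using fourier_Hil[OF SS_add[OF SS_scale[OF f, of a] SS_scale[OF g, of b]]] fourier_SS_linear[OF f g, of a b]
      fourier_SS_linear[OF SS_Hil[OF f] SS_Hil[OF g], of a b] fourier_Hil[OF f] fourier_Hil[OF g]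
  proof eventually_elim
    case (elim \<xi>)
    show ?case unfolding elim(1) elim(2) elim(3) elim(4) elim(5) by (simp add: algebra_simps)
  qed
qed (intro SS_add SS_scale SS_Hil f g)+

lemma Hil_const_circle: "Hil Circle (\<lambda>x. c) = (\<lambda>x. 0)"
proof (rule SS_eqI[OF SS_Hil[OF SS_const_circle] SS_const_circle])
  have "fourier Circle (cs (\<lambda>x. a)) \<xi> = of_real a * (if \<xi> = 0 then 2 * pi else 0)" if "\<xi> \<in> \<int>" for \<xi> a
    using integral_cis_circle[of "- \<xi>"] that by simp
  note F = this
  have F0: "fourier Circle (\<lambda>x. 0) \<xi> = 0" for \<xi> by simp
  show "AE \<xi> in freq_measure Circle. fourier Circle (cs (Hil Circle (\<lambda>x. c))) \<xi> = fourier Circle (cs (\<lambda>x. 0)) \<xi>"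
    using fourier_Hil[OF SS_const_circle[of c]] unfolding freq_measure.simps AE_count_space
    by (simp add: F F0 del: fourier.simps)
qed

lemma Parseval_SS:
  assumes f: "SS Z f" and g: "SS Z g"
  shows "space_int Z (\<lambda>x. f x * g x) = 1 / (2 * pi) * Re (LINT \<xi>|freq_measure Z. fourier Z (cs f) \<xi> * cnj (fourier Z (cs g) \<xi>))"
proof -
  have "Re (LINT x|space_measure Z. cs f x * cnj (cs g x)) = space_int Z (\<lambda>x. f x * g x)"
    unfolding complex_cnj_complex_of_real of_real_mult[symmetric] integral_complex_of_real space_int_def by simp
  then show ?thesis using Parseval_Re[OF SS_cs_L2[OF f] SS_cs_L2[OF g]] by simp
qed

text \<open>
  The symbol -i sgn \<xi> is imaginary.
\<close>

lemma Hil_antisym: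
  assumes f: "SS Z f" and g: "SS Z g"
  shows "space_int Z (\<lambda>x. Hil Z f x * g x) = - space_int Z (\<lambda>x. f x * Hil Z g x)"
proof -
  have fm: "fourier Z (cs h) \<in> borel_measurable (freq_measure Z)" if "SS Z h" for h
    using fourier_measurable[OF SS_cs_L2[OF that]] .
  have cm: "(\<lambda>\<xi>. cnj (fourier Z (cs h) \<xi>)) \<in> borel_measurable (freq_measure Z)" if "SS Z h" for h
    using measurable_compose[OF fm[OF that] cnj_measurable] .
  have "(LINT \<xi>|freq_measure Z. fourier Z (cs (Hil Z f)) \<xi> * cnj (fourier Z (cs g) \<xi>))
     = (LINT \<xi>|freq_measure Z. - (fourier Z (cs f) \<xi> * cnj (fourier Z (cs (Hil Z g)) \<xi>)))"
  proof (rule integral_cong_AE)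
    show "AE \<xi> in freq_measure Z. fourier Z (cs (Hil Z f)) \<xi> * cnj (fourier Z (cs g) \<xi>) = - (fourier Z (cs f) \<xi> * cnj (fourier Z (cs (Hil Z g)) \<xi>))"
      using fourier_Hil[OF f] fourier_Hil[OF g] by eventually_elim (simp add: algebra_simps)
  qed (intro borel_measurable_times borel_measurable_uminus fm cm SS_Hil f g)+
  then show ?thesis unfolding Parseval_SS[OF SS_Hil[OF f] g] Parseval_SS[OF f SS_Hil[OF g]] by simp
qed

lemma space_int_l2: "tame Z f \<Longrightarrow> space_int Z (\<lambda>x. (f x)\<^sup>2) = (l2 (space_measure Z) (cs f))\<^sup>2"
  by (simp add: l2_square space_int_def)

lemma Plancherel_SS:
  assumes f: "SS Z f"
  shows "space_int Z (\<lambda>x. (f x)\<^sup>2) = 1 / (2 * pi) * (LINT \<xi>|freq_measure Z. (cmod (fourier Z (cs f) \<xi>))\<^sup>2)"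
  using Plancherel[OF SS_cs_L2[OF f]] unfolding space_int_l2[OF SS_tame[OF f]] l2_square[symmetric]
  by (simp add: power_mult_distrib)

lemma Hil_norm_le:
  assumes f: "SS Z f"
  shows "space_int Z (\<lambda>x. (Hil Z f x)\<^sup>2) \<le> space_int Z (\<lambda>x. (f x)\<^sup>2)"
proof -
  have "(LINT \<xi>|freq_measure Z. (cmod (fourier Z (cs (Hil Z f)) \<xi>))\<^sup>2) \<le> (LINT \<xi>|freq_measure Z. (cmod (fourier Z (cs f) \<xi>))\<^sup>2)"
  proof (rule integral_mono_AE)
    show "AE \<xi> in freq_measure Z. (cmod (fourier Z (cs (Hil Z f)) \<xi>))\<^sup>2 \<le> (cmod (fourier Z (cs f) \<xi>))\<^sup>2"
      using fourier_Hil[OF f] by eventually_elim (auto simp: norm_mult abs_sgn_eq)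
  qed (use fourier_square_integrable[OF SS_cs_L2[OF f]] fourier_square_integrable[OF SS_cs_L2[OF SS_Hil[OF f]]] in \<open>auto simp: square_integrable_def\<close>)
  then show ?thesis unfolding Plancherel_SS[OF f] Plancherel_SS[OF SS_Hil[OF f]] by (simp add: divide_right_mono)
qed

section \<open>The half-derivative norm\<close>

definition nrm :: "domain \<Rightarrow> (real \<Rightarrow> real) \<Rightarrow> real" where
  "nrm Z f = sqrt (space_int Z (\<lambda>x. (f x)\<^sup>2))"

text \<open>
  The square of the homogeneous Sobolev norm of order 1/2, because Hil composed with the derivative
  has symbol |\<xi>|; D_half_norm makes the link to the half derivative. In this form it appears
  when the equation is tested.
\<close>

definition hs :: "domain \<Rightarrow> (real \<Rightarrow> real) \<Rightarrow> real" where
  "hs Z f = space_int Z (\<lambda>x. f x * Hil Z (deriv f) x)"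

text \<open>
  The value 0 on the line, where constants are not square integrable, makes the formulas with
  fluctuations f - smean uniform in the domain.
\<close>

definition smean :: "domain \<Rightarrow> (real \<Rightarrow> real) \<Rightarrow> real" where
  "smean Z f = (case Z of Line \<Rightarrow> 0 | Circle \<Rightarrow> space_int Circle f / (2 * pi))"

lemma space_int_nonneg: "(\<And>x. f x \<ge> 0) \<Longrightarrow> space_int Z f \<ge> 0"
  unfolding space_int_def by (rule integral_nonneg_AE) simp

lemma nrm_nonneg [simp]: "nrm Z f \<ge> 0"
  unfolding nrm_def by (simp add: space_int_nonneg)

lemma nrm_square: "(nrm Z f)\<^sup>2 = space_int Z (\<lambda>x. (f x)\<^sup>2)"
  unfolding nrm_def by (simp add: space_int_nonneg)

lemma SS_Cauchy_Schwarz: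
  assumes f: "SS Z f" and g: "SS Z g"
  shows "space_int Z (\<lambda>x. \<bar>f x * g x\<bar>) \<le> nrm Z f * nrm Z g"
  using Cauchy_Schwarz_integral[OF SS_measurable[OF f] SS_measurable[OF g]]
    tame_square_integrable[OF SS_tame[OF f]] tame_square_integrable[OF SS_tame[OF g]]
  by (simp add: space_int_def nrm_def abs_mult)

lemma SS_abs_int_le: "\<bar>space_int Z f\<bar> \<le> space_int Z (\<lambda>x. \<bar>f x\<bar>)"
  unfolding space_int_def using integral_norm_bound[of "space_measure Z" f] by simp

lemma SS_Cauchy_Schwarz':
  assumes f: "SS Z f" and g: "SS Z g"
  shows "\<bar>space_int Z (\<lambda>x. f x * g x)\<bar> \<le> nrm Z f * nrm Z g"
  by (rule order_trans[OF SS_abs_int_le SS_Cauchy_Schwarz[OF assms]])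

lemma SS_fourier_measurable: "SS Z f \<Longrightarrow> fourier Z (cs f) \<in> borel_measurable (freq_measure Z)"
  by (intro fourier_measurable SS_cs_L2)

lemma freq_abs_measurable: "(\<lambda>\<xi>. \<bar>\<xi>\<bar>) \<in> borel_measurable (freq_measure Z)"
  by (rule borel_measurable_freq) measurable

lemma SS_freq_integrable:
  assumes f: "SS Z f"
  shows "integrable (freq_measure Z) (\<lambda>\<xi>. \<bar>\<xi>\<bar> * (cmod (fourier Z (cs f) \<xi>))\<^sup>2)"
proof (rule Bochner_Integration.integrable_bound)
  have "integrable (freq_measure Z) (\<lambda>\<xi>. (1 + \<xi>\<^sup>2) ^ 1 * (cmod (fourier Z (cs f) \<xi>))\<^sup>2)"
    using SS_rapid[OF f] unfolding rapid_def by blast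
  then show "integrable (freq_measure Z) (\<lambda>\<xi>. (1 + \<xi>\<^sup>2) * (cmod (fourier Z (cs f) \<xi>))\<^sup>2)" by simp
  show "(\<lambda>\<xi>. \<bar>\<xi>\<bar> * (cmod (fourier Z (cs f) \<xi>))\<^sup>2) \<in> borel_measurable (freq_measure Z)"
    using SS_fourier_measurable[OF f] freq_abs_measurable by measurable
  show "AE \<xi> in freq_measure Z. norm (\<bar>\<xi>\<bar> * (cmod (fourier Z (cs f) \<xi>))\<^sup>2) \<le> norm ((1 + \<xi>\<^sup>2) * (cmod (fourier Z (cs f) \<xi>))\<^sup>2)"
    by (intro AE_I2) (auto simp: abs_mult intro!: mult_right_mono abs_le_one_plus_square)
qed

lemma hs_fourier:
  assumes f: "SS Z f"
  shows "hs Z f = 1 / (2 * pi) * (LINT \<xi>|freq_measure Z. \<bar>\<xi>\<bar> * (cmod (fourier Z (cs f) \<xi>))\<^sup>2)"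
proof -
  let ?F = "fourier Z (cs f)" and ?G = "fourier Z (cs (Hil Z (deriv f)))"
  note g = SS_Hil[OF SS_deriv[OF f]]
  have "(LINT \<xi>|freq_measure Z. ?F \<xi> * cnj (?G \<xi>)) = (LINT \<xi>|freq_measure Z. of_real (\<bar>\<xi>\<bar> * (cmod (?F \<xi>))\<^sup>2))"
  proof (rule integral_cong_AE)
    show "AE \<xi> in freq_measure Z. ?F \<xi> * cnj (?G \<xi>) = of_real (\<bar>\<xi>\<bar> * (cmod (?F \<xi>))\<^sup>2)"
      using fourier_Hil[OF SS_deriv[OF f]] fourier_deriv[OF f]
    proof eventually_elim
      case (elim \<xi>)
      have "?G \<xi> = of_real \<bar>\<xi>\<bar> * ?F \<xi>"
        unfolding elim by (simp add: abs_sgn[of \<xi>] mult_ac)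
      then show ?case using complex_mult_cnj_norm[of "?F \<xi>"] by (simp add: mult_ac)
    qed
    show "(\<lambda>\<xi>. ?F \<xi> * cnj (?G \<xi>)) \<in> borel_measurable (freq_measure Z)"
      by (intro borel_measurable_times SS_fourier_measurable f measurable_compose[OF _ cnj_measurable] g)
    show "(\<lambda>\<xi>. complex_of_real (\<bar>\<xi>\<bar> * (cmod (?F \<xi>))\<^sup>2)) \<in> borel_measurable (freq_measure Z)"
      by (rule measurable_compose[OF borel_measurable_integrable[OF SS_freq_integrable[OF f]] borel_measurable_of_real])
  qed
  then show ?thesis
    unfolding hs_def Parseval_SS[OF f g] integral_complex_of_real by simp
qed

lemma hs_nonneg: "SS Z f \<Longrightarrow> hs Z f \<ge> 0"
  by (simp add: hs_fourier)

text \<open>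
  One derivative of a product is shared as two half derivatives: this lets an integral with a single
  derivative be estimated by half-derivative norms of both factors.
\<close>

lemma half_norm_duality:
  assumes f: "SS Z f" and g: "SS Z g" and k: "SS Z k"
    and bound: "AE \<xi> in freq_measure Z. cmod (fourier Z (cs k) \<xi>) \<le> \<bar>\<xi>\<bar> * cmod (fourier Z (cs g) \<xi>)"
  shows "\<bar>space_int Z (\<lambda>x. f x * k x)\<bar> \<le> sqrt (hs Z f) * sqrt (hs Z g)"
proof -
  let ?M = "freq_measure Z" and ?F = "fourier Z (cs f)" and ?G = "fourier Z (cs g)" and ?K = "fourier Z (cs k)"
  let ?a = "\<lambda>\<xi>. sqrt \<bar>\<xi>\<bar> * cmod (?F \<xi>)" and ?b = "\<lambda>\<xi>. sqrt \<bar>\<xi>\<bar> * cmod (?G \<xi>)"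
  have sm: "(\<lambda>\<xi>. sqrt \<bar>\<xi>\<bar>) \<in> borel_measurable ?M" by (rule borel_measurable_freq) measurable
  have am: "?a \<in> borel_measurable ?M" "?b \<in> borel_measurable ?M"
    using sm SS_fourier_measurable[OF f] SS_fourier_measurable[OF g] by measurable
  have a2: "(norm (?a \<xi>))\<^sup>2 = \<bar>\<xi>\<bar> * (cmod (?F \<xi>))\<^sup>2" "(norm (?b \<xi>))\<^sup>2 = \<bar>\<xi>\<bar> * (cmod (?G \<xi>))\<^sup>2" for \<xi>
    by (simp_all add: power_mult_distrib)
  have ai: "integrable ?M (\<lambda>\<xi>. (norm (?a \<xi>))\<^sup>2)" "integrable ?M (\<lambda>\<xi>. (norm (?b \<xi>))\<^sup>2)"
    unfolding a2 using SS_freq_integrable f g by auto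
  have abi: "integrable ?M (\<lambda>\<xi>. norm (?a \<xi>) * norm (?b \<xi>))"
    using integrable_norm[OF integrable_mult_L2[OF am ai]] by (simp add: abs_mult)
  have "\<bar>Re (LINT \<xi>|?M. ?F \<xi> * cnj (?K \<xi>))\<bar> \<le> (LINT \<xi>|?M. cmod (?F \<xi>) * cmod (?K \<xi>))"
    using abs_Re_le_cmod[of "LINT \<xi>|?M. ?F \<xi> * cnj (?K \<xi>)"] integral_norm_bound[of ?M "\<lambda>\<xi>. ?F \<xi> * cnj (?K \<xi>)"]
    by (simp add: norm_mult)
  also have "\<dots> \<le> (LINT \<xi>|?M. norm (?a \<xi>) * norm (?b \<xi>))"
  proof (rule integral_mono_AE[OF _ abi])
    show "integrable ?M (\<lambda>\<xi>. cmod (?F \<xi>) * cmod (?K \<xi>))"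
      using integrable_norm[OF integrable_mult_cnj[OF fourier_square_integrable[OF SS_cs_L2[OF f]] fourier_square_integrable[OF SS_cs_L2[OF k]]]]
      by (simp add: norm_mult)
    show "AE \<xi> in ?M. cmod (?F \<xi>) * cmod (?K \<xi>) \<le> norm (?a \<xi>) * norm (?b \<xi>)"
      using bound
    proof eventually_elim
      case (elim \<xi>)
      have "norm (?a \<xi>) * norm (?b \<xi>) = (sqrt \<bar>\<xi>\<bar> * sqrt \<bar>\<xi>\<bar>) * (cmod (?F \<xi>) * cmod (?G \<xi>))"
        by (simp add: abs_mult)
      also have "\<dots> = cmod (?F \<xi>) * (\<bar>\<xi>\<bar> * cmod (?G \<xi>))" by simp
      finally have eq: "norm (?a \<xi>) * norm (?b \<xi>) = cmod (?F \<xi>) * (\<bar>\<xi>\<bar> * cmod (?G \<xi>))" .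
      show ?case unfolding eq by (rule mult_left_mono[OF elim norm_ge_zero])
    qed
  qed
  also have "\<dots> \<le> sqrt (LINT \<xi>|?M. (norm (?a \<xi>))\<^sup>2) * sqrt (LINT \<xi>|?M. (norm (?b \<xi>))\<^sup>2)"
    by (rule Cauchy_Schwarz_integral[OF am ai])
  also have "\<dots> = 2 * pi * (sqrt (hs Z f) * sqrt (hs Z g))"
  proof -
    have "2 * pi * (sqrt (c * X) * sqrt (c * Y)) = (2 * pi * \<bar>c\<bar>) * (sqrt X * sqrt Y)" for c X Y
      unfolding real_sqrt_mult real_sqrt_mult_self[symmetric] by (simp only: mult_ac)
    from this[of "1 / (2 * pi)"] show ?thesis unfolding a2 hs_fourier[OF f] hs_fourier[OF g] by simp
  qed
  finally show ?thesis unfolding Parseval_SS[OF f k] by (simp add: abs_mult field_simps)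
qed

lemma half_norm_duality_deriv:
  assumes f: "SS Z f" and g: "SS Z g"
  shows "\<bar>space_int Z (\<lambda>x. f x * deriv g x)\<bar> \<le> sqrt (hs Z f) * sqrt (hs Z g)"
proof (rule half_norm_duality[OF f g SS_deriv[OF g]])
  show "AE \<xi> in freq_measure Z. cmod (fourier Z (cs (deriv g)) \<xi>) \<le> \<bar>\<xi>\<bar> * cmod (fourier Z (cs g) \<xi>)"
    using fourier_deriv[OF g] by eventually_elim (simp add: norm_mult)
qed

lemma half_norm_duality_Hil:
  assumes f: "SS Z f" and g: "SS Z g"
  shows "\<bar>space_int Z (\<lambda>x. f x * Hil Z (deriv g) x)\<bar> \<le> sqrt (hs Z f) * sqrt (hs Z g)"
proof (rule half_norm_duality[OF f g SS_Hil[OF SS_deriv[OF g]]])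
  show "AE \<xi> in freq_measure Z. cmod (fourier Z (cs (Hil Z (deriv g))) \<xi>) \<le> \<bar>\<xi>\<bar> * cmod (fourier Z (cs g) \<xi>)"
    using fourier_Hil[OF SS_deriv[OF g]] fourier_deriv[OF g]
    by eventually_elim (auto simp: norm_mult abs_sgn_eq mult_left_le_one_le)
qed

lemma nrm_deriv_le:
  assumes f: "SS Z f"
  shows "(nrm Z (deriv f))\<^sup>2 \<le> sqrt (hs Z f) * sqrt (hs Z (deriv f))"
proof -
  have "(nrm Z (deriv f))\<^sup>2 = - space_int Z (\<lambda>x. f x * deriv (deriv f) x)"
    unfolding nrm_square using SS_int_by_parts[OF f SS_deriv[OF f]] by (simp add: power2_eq_square)
  also have "\<dots> \<le> sqrt (hs Z f) * sqrt (hs Z (deriv f))"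
    using half_norm_duality_deriv[OF f SS_deriv[OF f]] by linarith
  finally show ?thesis .
qed

section \<open>Fluctuations around the mean\<close>

lemma SS_fluct: "SS Z f \<Longrightarrow> SS Z (\<lambda>x. f x - smean Z f)"
  by (cases Z) (auto simp: smean_def intro: SS_diff SS_const_circle)

lemma deriv_fluct: "SS Z f \<Longrightarrow> deriv (\<lambda>x. f x - c) = deriv f"
  using SS_DERIV by (intro ext DERIV_imp_deriv) (auto intro!: derivative_eq_intros)

lemma fourier_fluct:
  assumes f: "SS Z f"
  shows "AE \<xi> in freq_measure Z. fourier Z (cs (\<lambda>x. f x - smean Z f)) \<xi> = (if \<xi> = 0 then 0 else fourier Z (cs f) \<xi>)"
proof (cases Z)
  case Line
  have "AE \<xi> in lborel. \<xi> \<noteq> (0::real)" by (rule AE_lborel_singleton)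
  then show ?thesis unfolding Line freq_measure.simps smean_def by eventually_elim simp
next
  case Circle
  have int: "integrable circle_measure (cs f)"
    using square_integrable_imp_integrable[OF finite_circle_measure] L2_square_integrable[OF SS_cs_L2[OF f]] Circle by simp
  have f1: "fourier Circle (\<lambda>x. 1) \<xi> = (if \<xi> = 0 then 2 * pi else 0)" if "\<xi> \<in> \<int>" for \<xi>
    using integral_cis_circle[of "- \<xi>"] that by simp
  have f0: "fourier Circle (cs f) 0 = of_real (space_int Circle f)"
    by (simp add: space_int_def)
  have "fourier Circle (cs (\<lambda>x. f x - smean Circle f)) \<xi> = (if \<xi> = 0 then 0 else fourier Circle (cs f) \<xi>)" if "\<xi> \<in> \<int>" for \<xi>
  proof -
    have "fourier Circle (cs (\<lambda>x. 1 * f x + (- smean Circle f) * 1)) \<xi> = fourier Circle (cs f) \<xi> - of_real (smean Circle f) * fourier Circle (\<lambda>x. 1) \<xi>"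
      using fourier_SS_linear[of Circle f "\<lambda>x. 1" 1 "- smean Circle f"] f Circle SS_const_circle[of 1] that
      unfolding freq_measure.simps AE_count_space by (simp del: fourier.simps)
    then show ?thesis using that f1[OF that] f0 by (simp add: smean_def del: fourier.simps)
  qed
  then show ?thesis unfolding Circle freq_measure.simps AE_count_space by blast
qed

lemma hs_fluct: "SS Z f \<Longrightarrow> hs Z (\<lambda>x. f x - smean Z f) = hs Z f"
proof -
  assume f: "SS Z f"
  have "(LINT \<xi>|freq_measure Z. \<bar>\<xi>\<bar> * (cmod (fourier Z (cs (\<lambda>x. f x - smean Z f)) \<xi>))\<^sup>2) = (LINT \<xi>|freq_measure Z. \<bar>\<xi>\<bar> * (cmod (fourier Z (cs f) \<xi>))\<^sup>2)"
  proof (rule integral_cong_AE)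
    show "AE \<xi> in freq_measure Z. \<bar>\<xi>\<bar> * (cmod (fourier Z (cs (\<lambda>x. f x - smean Z f)) \<xi>))\<^sup>2 = \<bar>\<xi>\<bar> * (cmod (fourier Z (cs f) \<xi>))\<^sup>2"
      using fourier_fluct[OF f] by eventually_elim auto
  qed (use SS_freq_integrable[OF f] SS_freq_integrable[OF SS_fluct[OF f]] in auto)
  then show ?thesis by (simp add: hs_fourier f SS_fluct)
qed

lemma Hil_fluct:
  assumes f: "SS Z f"
  shows "Hil Z (\<lambda>x. f x - smean Z f) = Hil Z f"
proof (rule SS_eqI[OF SS_Hil[OF SS_fluct[OF f]] SS_Hil[OF f]])
  show "AE \<xi> in freq_measure Z. fourier Z (cs (Hil Z (\<lambda>x. f x - smean Z f))) \<xi> = fourier Z (cs (Hil Z f)) \<xi>"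
    using fourier_Hil[OF f] fourier_Hil[OF SS_fluct[OF f]] fourier_fluct[OF f] by eventually_elim auto
qed

lemma nrm_fluct_le:
  assumes f: "SS Z f"
  shows "nrm Z (\<lambda>x. f x - smean Z f) \<le> nrm Z f"
proof (rule power2_le_imp_le)
  have "(LINT \<xi>|freq_measure Z. (cmod (fourier Z (cs (\<lambda>x. f x - smean Z f)) \<xi>))\<^sup>2) \<le> (LINT \<xi>|freq_measure Z. (cmod (fourier Z (cs f) \<xi>))\<^sup>2)"
  proof (rule integral_mono_AE)
    show "AE \<xi> in freq_measure Z. (cmod (fourier Z (cs (\<lambda>x. f x - smean Z f)) \<xi>))\<^sup>2 \<le> (cmod (fourier Z (cs f) \<xi>))\<^sup>2"
      using fourier_fluct[OF f] by eventually_elim auto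
  qed (use fourier_square_integrable[OF SS_cs_L2[OF f]] fourier_square_integrable[OF SS_cs_L2[OF SS_fluct[OF f]]] in \<open>auto simp: square_integrable_def\<close>)
  then show "(nrm Z (\<lambda>x. f x - smean Z f))\<^sup>2 \<le> (nrm Z f)\<^sup>2"
    by (simp add: nrm_square Plancherel_SS[OF SS_fluct[OF f]] Plancherel_SS[OF f] divide_right_mono)
qed simp

text \<open>
  Frequency 0 is left out: on the circle it has mass 1 however small R is, which would spoil the
  linear bound on the measure of the set.
\<close>

definition low_freq :: "domain \<Rightarrow> real \<Rightarrow> real set" where
  "low_freq Z R = {\<xi> \<in> space (freq_measure Z). \<xi> \<noteq> 0 \<and> \<bar>\<xi>\<bar> \<le> R}"

lemma low_freq_sets: "low_freq Z R \<in> sets (freq_measure Z)"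
  by (cases Z) (auto simp: low_freq_def)

lemma emeasure_low_freq:
  assumes "R > 0"
  shows "emeasure (freq_measure Z) (low_freq Z R) \<le> ennreal (2 * R)"
proof (cases Z)
  case Line
  have "emeasure lborel (low_freq Line R) \<le> emeasure lborel {-R..R}"
    by (intro emeasure_mono) (auto simp: low_freq_def)
  also have "\<dots> = ennreal (2 * R)" using assms by simp
  finally show ?thesis using Line by simp
next
  case Circle
  let ?k = "\<lfloor>R\<rfloor>"
  have k: "?k \<ge> 0" using assms by simp
  have eq: "low_freq Circle R = of_int ` ({-?k..?k} - {0})"
  proof (intro equalityI subsetI)
    fix \<xi> assume "\<xi> \<in> low_freq Circle R"
    then obtain n where n: "\<xi> = of_int n" "n \<noteq> 0" "\<bar>of_int n\<bar> \<le> R" by (auto simp: low_freq_def elim: Ints_cases)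
    then have "n \<le> ?k" "- n \<le> ?k" by (auto simp: le_floor_iff)
    then show "\<xi> \<in> of_int ` ({-?k..?k} - {0})" using n by auto
  next
    fix \<xi> :: real assume "\<xi> \<in> of_int ` ({-?k..?k} - {0})"
    then obtain n where "\<xi> = of_int n" "n \<in> {-?k..?k} - {0}" by blast
    then have n: "\<xi> = of_int n" "n \<noteq> 0" "n \<le> ?k" "- n \<le> ?k" by auto
    then have "of_int n \<le> R" "of_int (- n) \<le> R" unfolding le_floor_iff by auto
    then show "\<xi> \<in> low_freq Circle R" using n by (auto simp: low_freq_def)
  qed
  have "card (low_freq Circle R) = card ({-?k..?k} - {0})"
    unfolding eq by (rule card_image) (auto simp: inj_on_def)
  also have "\<dots> = nat (2 * ?k)" using k by (subst card_Diff_singleton) (auto simp: nat_diff_distrib)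
  finally have "emeasure (count_space \<int>) (low_freq Circle R) = of_nat (nat (2 * ?k))"
    using emeasure_count_space_finite[of "low_freq Circle R" "\<int> :: real set"] finite_imageI[of "{-?k..?k} - {0}" real_of_int]
    unfolding eq[symmetric] by (auto simp: low_freq_def)
  also have "\<dots> = ennreal (real (nat (2 * ?k)))" by (simp add: ennreal_of_nat_eq_real_of_nat)
  also have "\<dots> \<le> ennreal (2 * R)" using k by (intro ennreal_leI) simp
  finally show ?thesis using Circle by simp
qed

lemma low_freq_integral:
  assumes "R > 0"
  shows "integrable (freq_measure Z) (indicat_real (low_freq Z R))"
    "(LINT \<xi>|freq_measure Z. indicat_real (low_freq Z R) \<xi>) \<le> 2 * R"
proof -
  have fin: "emeasure (freq_measure Z) (low_freq Z R) < \<infinity>"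
    using emeasure_low_freq[OF assms, of Z] by (auto intro: order_le_less_trans)
  then show "integrable (freq_measure Z) (indicat_real (low_freq Z R))"
    by (intro integrable_real_indicator low_freq_sets)
  have "low_freq Z R \<inter> space (freq_measure Z) = low_freq Z R" by (auto simp: low_freq_def)
  then have "(LINT \<xi>|freq_measure Z. indicat_real (low_freq Z R) \<xi>) = measure (freq_measure Z) (low_freq Z R)" by simp
  also have "\<dots> \<le> 2 * R"
    using emeasure_low_freq[OF assms, of Z] assms unfolding measure_def by (intro enn2real_leI) auto
  finally show "(LINT \<xi>|freq_measure Z. indicat_real (low_freq Z R) \<xi>) \<le> 2 * R" .
qed

lemma fourier_le_L1:
  assumes f: "SS Z f" and int: "integrable (space_measure Z) f"
  shows "AE \<xi> in freq_measure Z. cmod (fourier Z (cs f) \<xi>) \<le> space_int Z (\<lambda>x. \<bar>f x\<bar>)"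
proof -
  have "integrable (space_measure Z) (cs f)" using int by simp
  from fourier_L1[OF SS_cs_L2[OF f] this] show ?thesis
  proof eventually_elim
    case (elim \<xi>)
    show ?case unfolding elim space_int_def
      using integral_norm_bound[of "space_measure Z" "\<lambda>x. cs f x * cis (- (\<xi> * x))"] by (simp add: norm_mult)
  qed
qed

lemma interpolation_from_pointwise:
  fixes A B P :: real
  assumes "A \<ge> 0" "B \<ge> 0" "\<And>s. s > 0 \<Longrightarrow> 2 * pi * P \<le> s * (2 * A\<^sup>2) + 2 * pi * B / s"
  shows "P \<le> 2 * A * sqrt B"
proof -
  have "pi * P \<le> sqrt (2 * A\<^sup>2) * sqrt (2 * pi * B)"
    using assms by (intro le_sqrt_mult_of_scaling) (auto simp: mult.assoc)
  also have "\<dots> = 2 * A * (sqrt pi * sqrt B)" using assms(1) by (simp add: real_sqrt_mult)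
  also have "\<dots> \<le> 2 * A * (pi * sqrt B)"
  proof (intro mult_left_mono mult_right_mono)
    have "sqrt pi \<le> sqrt pi * sqrt pi" using pi_gt3 by (intro mult_le_cancel_left1[THEN iffD2]) (auto)
    then show "sqrt pi \<le> pi" by simp
  qed (use assms in auto)
  finally have "pi * P \<le> pi * (2 * A * sqrt B)" by (simp add: mult_ac)
  then show ?thesis using pi_gt_zero mult_le_cancel_left_pos by blast
qed

text \<open>
  Frequencies up to s are estimated by the L1 norm, since the transform is at most that and the set
  has measure at most 2 s; higher frequencies by hs(f) / s. The scale s is then optimised. The zero
  frequency is exactly what subtracting the mean removes.
\<close>

lemma fluct_interpolation:
  assumes f: "SS Z f" and int: "integrable (space_measure Z) f"
  shows "(nrm Z (\<lambda>x. f x - smean Z f))\<^sup>2 \<le> 2 * space_int Z (\<lambda>x. \<bar>f x\<bar>) * sqrt (hs Z f)"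
proof (rule interpolation_from_pointwise[OF space_int_nonneg hs_nonneg[OF f]])
  let ?M = "freq_measure Z" and ?F = "fourier Z (cs f)" and ?A = "space_int Z (\<lambda>x. \<bar>f x\<bar>)"
  fix s :: real assume s: "s > 0"
  have "2 * pi * (nrm Z (\<lambda>x. f x - smean Z f))\<^sup>2 = (LINT \<xi>|?M. (cmod (fourier Z (cs (\<lambda>x. f x - smean Z f)) \<xi>))\<^sup>2)"
    by (simp add: nrm_square Plancherel_SS[OF SS_fluct[OF f]])
  also have "\<dots> \<le> (LINT \<xi>|?M. indicat_real (low_freq Z s) \<xi> * ?A\<^sup>2 + (\<bar>\<xi>\<bar> * (cmod (?F \<xi>))\<^sup>2) / s)"
  proof (rule integral_mono_AE)
    show "integrable ?M (\<lambda>\<xi>. indicat_real (low_freq Z s) \<xi> * ?A\<^sup>2 + (\<bar>\<xi>\<bar> * (cmod (?F \<xi>))\<^sup>2) / s)"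
      using low_freq_integral(1)[OF s] SS_freq_integrable[OF f] by auto
    have sp: "AE \<xi> in ?M. \<xi> \<in> space ?M" by (rule AE_space)
    show "AE \<xi> in ?M. (cmod (fourier Z (cs (\<lambda>x. f x - smean Z f)) \<xi>))\<^sup>2 \<le> indicat_real (low_freq Z s) \<xi> * ?A\<^sup>2 + (\<bar>\<xi>\<bar> * (cmod (?F \<xi>))\<^sup>2) / s"
      using fourier_fluct[OF f] fourier_le_L1[OF f int] sp
    proof eventually_elim
      case (elim \<xi>)
      consider "\<xi> = 0" | "\<xi> \<in> low_freq Z s" | "\<bar>\<xi>\<bar> > s" using elim(3) by (force simp: low_freq_def)
      then show ?case
      proof cases
        case 2
        have "(cmod (?F \<xi>))\<^sup>2 \<le> ?A\<^sup>2" using elim(2) by (intro power_mono) auto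
        then show ?thesis using elim(1) 2 s by (simp add: low_freq_def add_increasing2)
      next
        case 3
        have "s * (cmod (?F \<xi>))\<^sup>2 \<le> \<bar>\<xi>\<bar> * (cmod (?F \<xi>))\<^sup>2" using 3 by (intro mult_right_mono) auto
        then have "(cmod (?F \<xi>))\<^sup>2 \<le> (\<bar>\<xi>\<bar> * (cmod (?F \<xi>))\<^sup>2) / s" using s by (simp add: field_simps)
        then show ?thesis using elim(1) 3 s by (auto simp: add_increasing)
      qed (use elim(1) s in simp)
    qed
  qed (use fourier_square_integrable[OF SS_cs_L2[OF SS_fluct[OF f]]] in \<open>auto simp: square_integrable_def\<close>)
  also have "\<dots> = (LINT \<xi>|?M. indicat_real (low_freq Z s) \<xi>) * ?A\<^sup>2 + (LINT \<xi>|?M. \<bar>\<xi>\<bar> * (cmod (?F \<xi>))\<^sup>2) / s"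
    using low_freq_integral(1)[OF s, of Z] SS_freq_integrable[OF f] by (subst Bochner_Integration.integral_add) auto
  also have "\<dots> \<le> (2 * s) * ?A\<^sup>2 + (2 * pi * hs Z f) / s"
    using low_freq_integral(2)[OF s] s by (intro add_mono mult_right_mono) (auto simp: hs_fourier[OF f])
  finally show "2 * pi * (nrm Z (\<lambda>x. f x - smean Z f))\<^sup>2 \<le> s * (2 * ?A\<^sup>2) + 2 * pi * hs Z f / s" by (simp add: mult_ac)
qed auto

text \<open>
  The splitting of frequencies of fluct_interpolation, one half derivative higher; s is here the
  square of the splitting frequency.
\<close>

lemma half_norm_interpolation:
  assumes f: "SS Z f" and int: "integrable (space_measure Z) f"
  shows "hs Z f \<le> 2 * space_int Z (\<lambda>x. \<bar>f x\<bar>) * sqrt (hs Z (deriv f))"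
proof (rule interpolation_from_pointwise[OF space_int_nonneg hs_nonneg[OF SS_deriv[OF f]]])
  let ?M = "freq_measure Z" and ?F = "fourier Z (cs f)" and ?G = "fourier Z (cs (deriv f))" and ?A = "space_int Z (\<lambda>x. \<bar>f x\<bar>)"
  fix s :: real assume s: "s > 0"
  define R where "R = sqrt s"
  have R: "R > 0" "R\<^sup>2 = s" using s by (auto simp: R_def)
  have "2 * pi * hs Z f = (LINT \<xi>|?M. \<bar>\<xi>\<bar> * (cmod (?F \<xi>))\<^sup>2)" by (simp add: hs_fourier[OF f])
  also have "\<dots> \<le> (LINT \<xi>|?M. indicat_real (low_freq Z R) \<xi> * (R * ?A\<^sup>2) + (\<bar>\<xi>\<bar> * (cmod (?G \<xi>))\<^sup>2) / s)"
  proof (rule integral_mono_AE[OF SS_freq_integrable[OF f]])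
    show "integrable ?M (\<lambda>\<xi>. indicat_real (low_freq Z R) \<xi> * (R * ?A\<^sup>2) + (\<bar>\<xi>\<bar> * (cmod (?G \<xi>))\<^sup>2) / s)"
      using low_freq_integral(1)[OF R(1)] SS_freq_integrable[OF SS_deriv[OF f]] by auto
    have sp: "AE \<xi> in ?M. \<xi> \<in> space ?M" by (rule AE_space)
    show "AE \<xi> in ?M. \<bar>\<xi>\<bar> * (cmod (?F \<xi>))\<^sup>2 \<le> indicat_real (low_freq Z R) \<xi> * (R * ?A\<^sup>2) + (\<bar>\<xi>\<bar> * (cmod (?G \<xi>))\<^sup>2) / s"
      using fourier_deriv[OF f] fourier_le_L1[OF f int] sp
    proof eventually_elim
      case (elim \<xi>)
      consider "\<xi> = 0" | "\<xi> \<in> low_freq Z R" | "\<bar>\<xi>\<bar> > R" using elim(3) by (force simp: low_freq_def)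
      then show ?case
      proof cases
        case 2
        have "\<bar>\<xi>\<bar> * (cmod (?F \<xi>))\<^sup>2 \<le> R * ?A\<^sup>2" using elim(2) 2 by (intro mult_mono power_mono) (auto simp: low_freq_def)
        then show ?thesis using 2 s by (simp add: add_increasing2)
      next
        case 3
        have "R\<^sup>2 \<le> \<bar>\<xi>\<bar>\<^sup>2" using 3 R by (intro power_mono) auto
        then have "s * (\<bar>\<xi>\<bar> * (cmod (?F \<xi>))\<^sup>2) \<le> \<xi>\<^sup>2 * (\<bar>\<xi>\<bar> * (cmod (?F \<xi>))\<^sup>2)" unfolding R(2) by (intro mult_right_mono) auto
        also have "\<dots> = \<bar>\<xi>\<bar> * (cmod (?G \<xi>))\<^sup>2" unfolding elim(1) by (simp add: norm_mult power_mult_distrib)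
        finally have "\<bar>\<xi>\<bar> * (cmod (?F \<xi>))\<^sup>2 \<le> (\<bar>\<xi>\<bar> * (cmod (?G \<xi>))\<^sup>2) / s" using s by (simp add: field_simps)
        then show ?thesis using R by (auto simp: add_increasing)
      qed (use s R in simp)
    qed
  qed
  also have "\<dots> = (LINT \<xi>|?M. indicat_real (low_freq Z R) \<xi>) * (R * ?A\<^sup>2) + (LINT \<xi>|?M. \<bar>\<xi>\<bar> * (cmod (?G \<xi>))\<^sup>2) / s"
    using low_freq_integral(1)[OF R(1), of Z] SS_freq_integrable[OF SS_deriv[OF f]] by (subst Bochner_Integration.integral_add) auto
  also have "\<dots> \<le> (2 * R) * (R * ?A\<^sup>2) + (2 * pi * hs Z (deriv f)) / s"
    using low_freq_integral(2)[OF R(1)] R s by (intro add_mono mult_right_mono) (auto simp: hs_fourier[OF SS_deriv[OF f]])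
  also have "(2 * R) * (R * ?A\<^sup>2) = s * (2 * ?A\<^sup>2)" using R(2) by (simp add: power2_eq_square mult_ac)
  finally show "2 * pi * hs Z f \<le> s * (2 * ?A\<^sup>2) + 2 * pi * hs Z (deriv f) / s" .
qed auto

text \<open>
  The nonzero frequencies of the circle have modulus at least 1.
\<close>

lemma fluct_le_half_norm_circle:
  assumes f: "SS Circle f"
  shows "(nrm Circle (\<lambda>x. f x - smean Circle f))\<^sup>2 \<le> hs Circle f"
proof -
  have "(LINT \<xi>|count_space \<int>. (cmod (fourier Circle (cs (\<lambda>x. f x - smean Circle f)) \<xi>))\<^sup>2) \<le> (LINT \<xi>|count_space \<int>. \<bar>\<xi>\<bar> * (cmod (fourier Circle (cs f) \<xi>))\<^sup>2)"
  proof (rule integral_mono_AE)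
    show "AE \<xi> in count_space \<int>. (cmod (fourier Circle (cs (\<lambda>x. f x - smean Circle f)) \<xi>))\<^sup>2 \<le> \<bar>\<xi>\<bar> * (cmod (fourier Circle (cs f) \<xi>))\<^sup>2"
      using fourier_fluct[OF f] AE_space unfolding freq_measure.simps
    proof eventually_elim
      case (elim \<xi>)
      have "1 * (cmod (fourier Circle (cs f) \<xi>))\<^sup>2 \<le> \<bar>\<xi>\<bar> * (cmod (fourier Circle (cs f) \<xi>))\<^sup>2" if "\<xi> \<noteq> 0"
        using Ints_nonzero_abs_ge1[OF _ that] elim(2) by (intro mult_right_mono) auto
      then show ?case using elim(1) by (simp del: fourier.simps)
    qed
  qed (use SS_freq_integrable[OF f] fourier_square_integrable[OF SS_cs_L2[OF SS_fluct[OF f]]] in \<open>simp_all add: square_integrable_def del: fourier.simps\<close>)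
  then show ?thesis
    by (simp add: nrm_square Plancherel_SS[OF SS_fluct[OF f]] hs_fourier[OF f] divide_right_mono del: fourier.simps)
qed

lemma fluct_has_zero:
  assumes f: "SS Circle f"
  shows "\<exists>x. f x - smean Circle f = 0"
proof -
  let ?g = "\<lambda>x. f x - smean Circle f"
  have cont: "continuous_on {0..2*pi} ?g" using SS_continuous[OF SS_fluct[OF f]] continuous_on_subset by blast
  obtain G where G: "\<And>x. x \<in> {0..2*pi} \<Longrightarrow> (G has_vector_derivative ?g x) (at x within {0..2*pi})"
    using antiderivative_continuous[OF cont] by blast
  have "integrable circle_measure f"
    using square_integrable_imp_integrable[OF finite_circle_measure L2_square_integrable[OF SS_cs_L2[OF f], unfolded space_measure.simps]]
    by (simp only: complex_of_real_integrable_eq)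
  moreover have "(LINT x|circle_measure. smean Circle f) = 2 * pi * smean Circle f"
    using measure_circle by simp
  ultimately have "space_int Circle ?g = space_int Circle f - 2 * pi * smean Circle f"
    unfolding space_int_def space_measure.simps
    by (subst Bochner_Integration.integral_diff) (use finite_measure.integrable_const[OF finite_circle_measure] in auto)
  then have "space_int Circle ?g = 0" by (simp add: smean_def)
  moreover have "space_int Circle ?g = G (2 * pi) - G 0"
    unfolding space_int_circle set_lebesgue_integral_def
    by (intro integral_FTC_atLeastAtMost G cont) auto
  ultimately have eq: "G 0 = G (2 * pi)" by simp
  have "\<exists>z. 0 < z \<and> z < 2 * pi \<and> (\<lambda>v. v * ?g z) = (\<lambda>v. 0)"
  proof (rule Rolle_deriv[of 0 "2 * pi" G, OF _ eq])
    show "continuous_on {0..2*pi} G"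
      unfolding continuous_on_eq_continuous_within using has_vector_derivative_continuous[OF G] by blast
    show "(G has_derivative (\<lambda>v. v * ?g x)) (at x)" if "0 < x" "x < 2 * pi" for x
    proof -
      have "(G has_vector_derivative ?g x) (at x)"
        using G[of x] that at_within_Icc_at[of 0 x "2*pi"] by simp
      then show ?thesis by (simp add: has_vector_derivative_def)
    qed
  qed auto
  then obtain z where "\<forall>v. v * ?g z = 0" by (metis (mono_tags, lifting))
  then show ?thesis by (metis mult_1)
qed

text \<open>
  The square of the fluctuation has derivative 2 (f - mean) f', and it vanishes somewhere (on the
  circle) or at infinity (on the line).
\<close>

lemma fluct_sup_bound:
  assumes f: "SS Z f"
  shows "(f x - smean Z f)\<^sup>2 \<le> 2 * (nrm Z (\<lambda>x. f x - smean Z f) * nrm Z (deriv f))"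
proof -
  let ?g = "\<lambda>x. f x - smean Z f"
  note g = SS_fluct[OF f]
  have d: "deriv (\<lambda>x. ?g x * ?g x) = (\<lambda>x. 2 * (?g x * deriv f x))"
    unfolding deriv_SS_mult[OF g g] deriv_fluct[OF f] by (auto simp: algebra_simps)
  have "\<bar>?g x * ?g x\<bar> \<le> space_int Z (\<lambda>x. \<bar>deriv (\<lambda>x. ?g x * ?g x) x\<bar>)"
  proof (rule sup_le_L1_deriv[OF SS_DERIV[OF SS_mult[OF g g]] SS_continuous[OF SS_deriv[OF SS_mult[OF g g]]]])
    show "integrable (space_measure Z) (\<lambda>x. ?g x * ?g x)" by (rule SS_integrable_mult[OF g g])
    show "integrable (space_measure Z) (deriv (\<lambda>x. ?g x * ?g x))"
      unfolding d using SS_integrable_mult[OF g SS_deriv[OF f]] by simp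
    show "?g (x + 2 * pi) * ?g (x + 2 * pi) = ?g x * ?g x" if "Z = Circle" for x
      using SS_periodic[of f] f that by auto
    show "\<exists>x. ?g x * ?g x = 0" if "Z = Circle" using fluct_has_zero f that by auto
  qed
  also have "\<dots> = 2 * space_int Z (\<lambda>x. \<bar>?g x * deriv f x\<bar>)"
    unfolding d space_int_def by (simp add: abs_mult)
  also have "\<dots> \<le> 2 * (nrm Z ?g * nrm Z (deriv f))"
    using SS_Cauchy_Schwarz[OF g SS_deriv[OF f]] by simp
  finally show ?thesis by (simp add: power2_eq_square)
qed

lemma D_half_norm:
  assumes f: "SS Z f"
  shows "(L2_norm Z (D_half Z (cs f)))\<^sup>2 = hs Z f"
proof -
  let ?g = "\<lambda>\<xi>. complex_of_real (\<bar>\<xi>\<bar> powr (1/2)) * fourier Z (cs f) \<xi>"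
  have R: "rapid Z ?g"
  proof (rule rapid_mult_borel[OF SS_rapid[OF f], where j=1])
    show "cmod (complex_of_real (\<bar>\<xi>\<bar> powr (1/2))) \<le> (1 + \<xi>\<^sup>2) ^ 1" for \<xi>
    proof -
      have "\<bar>\<xi>\<bar> powr (1/2) = sqrt \<bar>\<xi>\<bar>" by (simp add: powr_half_sqrt)
      also have "\<dots> \<le> 1 + \<bar>\<xi>\<bar>\<^sup>2"
      proof (rule real_le_lsqrt)
        have "\<bar>\<xi>\<bar> \<le> 1 + \<bar>\<xi>\<bar>\<^sup>2" using abs_le_one_plus_square[of "\<bar>\<xi>\<bar>"] by simp
        also have "\<dots> \<le> (1 + \<bar>\<xi>\<bar>\<^sup>2)\<^sup>2" using one_plus_square_pos(4)[of "\<bar>\<xi>\<bar>"] self_le_power[of "1 + \<bar>\<xi>\<bar>\<^sup>2" 2] by simp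
        finally show "\<bar>\<xi>\<bar> \<le> (1 + \<bar>\<xi>\<bar>\<^sup>2)\<^sup>2" .
      qed auto
      finally show ?thesis by simp
    qed
  qed measurable
  note inv = rapid_fourier_inversion[OF R]
  have D: "D_half Z (cs f) = inv_ft Z ?g" by (simp add: D_half_def fourier_multiplier_inv_ft)
  have "2 * pi * (l2 (space_measure Z) (inv_ft Z ?g))\<^sup>2 = (l2 (freq_measure Z) (fourier Z (inv_ft Z ?g)))\<^sup>2"
    unfolding Plancherel[OF inv(1)] by (simp add: power_mult_distrib)
  also have "l2 (freq_measure Z) (fourier Z (inv_ft Z ?g)) = l2 (freq_measure Z) ?g"
    by (rule l2_cong_AE[OF inv(2) fourier_measurable[OF inv(1)] rapid_measurable[OF R]])
  also have "(l2 (freq_measure Z) ?g)\<^sup>2 = (LINT \<xi>|freq_measure Z. \<bar>\<xi>\<bar> * (cmod (fourier Z (cs f) \<xi>))\<^sup>2)"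
    unfolding l2_square
    by (intro Bochner_Integration.integral_cong refl) (simp add: norm_mult power_mult_distrib powr_half_sqrt)
  finally show ?thesis unfolding D L2_norm_l2 hs_fourier[OF f] by (simp add: field_simps)
qed

section \<open>The gauged energy and its time derivative\<close>

text \<open>
  Products of two functions in SS belong to this class, on which integrals of derivatives vanish.
\<close>

definition SS1 :: "domain \<Rightarrow> (real \<Rightarrow> real) \<Rightarrow> bool" where
  "SS1 Z f \<longleftrightarrow> SS Z f \<and> integrable (space_measure Z) f \<and> integrable (space_measure Z) (deriv f)"

lemma SS1_mult: "SS Z f \<Longrightarrow> SS Z g \<Longrightarrow> SS1 Z (\<lambda>x. f x * g x)"
  unfolding SS1_def by (auto simp: deriv_SS_mult intro!: SS_mult SS_integrable_mult SS_deriv Bochner_Integration.integrable_add)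

lemma SS1_add: "SS1 Z f \<Longrightarrow> SS1 Z g \<Longrightarrow> SS1 Z (\<lambda>x. f x + g x)"
  unfolding SS1_def by (auto simp: deriv_SS_add intro!: SS_add)

lemma SS1_scale: "SS1 Z f \<Longrightarrow> SS1 Z (\<lambda>x. c * f x)"
  unfolding SS1_def by (auto simp: deriv_SS_scale intro!: SS_scale)

lemma SS1_diff: "SS1 Z f \<Longrightarrow> SS1 Z g \<Longrightarrow> SS1 Z (\<lambda>x. f x - g x)"
  unfolding SS1_def by (auto simp: deriv_SS_diff intro!: SS_diff)

lemma SS1_int_deriv: "SS1 Z f \<Longrightarrow> space_int Z (deriv f) = 0"
  unfolding SS1_def by (auto intro: SS_int_deriv_zero)

definition ip :: "domain \<Rightarrow> (real \<Rightarrow> real) \<Rightarrow> (real \<Rightarrow> real) \<Rightarrow> real" where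
  "ip Z f g = space_int Z (\<lambda>x. f x * g x)"

lemma ip_commute: "ip Z f g = ip Z g f"
  by (simp add: ip_def mult.commute)

lemma ip_add_left: "SS Z f \<Longrightarrow> SS Z g \<Longrightarrow> SS Z h \<Longrightarrow> ip Z (\<lambda>x. f x + g x) h = ip Z f h + ip Z g h"
  unfolding ip_def space_int_def using SS_integrable_mult[of Z f h] SS_integrable_mult[of Z g h] by (simp add: distrib_right)

lemma ip_scale_left: "ip Z (\<lambda>x. c * f x) h = c * ip Z f h"
  unfolding ip_def space_int_def by (simp add: mult.assoc)

lemma ip_add_right: "SS Z f \<Longrightarrow> SS Z g \<Longrightarrow> SS Z h \<Longrightarrow> ip Z h (\<lambda>x. f x + g x) = ip Z h f + ip Z h g"
  using ip_add_left[of Z f g h] by (simp add: ip_commute)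

lemma ip_scale_right: "ip Z h (\<lambda>x. c * f x) = c * ip Z h f"
  using ip_scale_left[of Z c f h] by (simp add: ip_commute)

lemma ip_by_parts: "SS Z f \<Longrightarrow> SS Z g \<Longrightarrow> ip Z (deriv f) g = - ip Z f (deriv g)"
  unfolding ip_def by (rule SS_int_by_parts)

lemma ip_deriv_self: "SS Z f \<Longrightarrow> ip Z (deriv f) f = 0"
  using ip_by_parts[of Z f f] ip_commute[of Z "deriv f" f] by simp

lemma ip_Hil: "SS Z f \<Longrightarrow> SS Z g \<Longrightarrow> ip Z (Hil Z f) g = - ip Z f (Hil Z g)"
  unfolding ip_def by (rule Hil_antisym)

lemma ip_le: "SS Z f \<Longrightarrow> SS Z g \<Longrightarrow> \<bar>ip Z f g\<bar> \<le> nrm Z f * nrm Z g"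
  unfolding ip_def by (rule SS_Cauchy_Schwarz')

lemma hs_ip: "hs Z f = ip Z f (Hil Z (deriv f))"
  by (simp add: hs_def ip_def)

definition Aop :: "domain \<Rightarrow> real \<Rightarrow> real \<Rightarrow> (real \<Rightarrow> real) \<Rightarrow> real \<Rightarrow> real" where
  "Aop Z al be f x = al * f x + be * Hil Z f x"

lemma SS_Aop: "SS Z f \<Longrightarrow> SS Z (Aop Z al be f)"
  unfolding Aop_def[abs_def] by (intro SS_add SS_scale SS_Hil)

lemma deriv_Aop:
  assumes f: "SS Z f"
  shows "deriv (Aop Z al be f) = Aop Z al be (deriv f)"
  unfolding Aop_def[abs_def] deriv_SS_add[OF SS_scale[OF f] SS_scale[OF SS_Hil[OF f]]]
    deriv_SS_scale[OF f] deriv_SS_scale[OF SS_Hil[OF f]] deriv_Hil[OF f] ..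

lemma Aop_linear:
  assumes "SS Z f" "SS Z g"
  shows "Aop Z al be (\<lambda>x. c * f x + d * g x) = (\<lambda>x. c * Aop Z al be f x + d * Aop Z al be g x)"
  unfolding Aop_def[abs_def] Hil_linear[OF assms] by (auto simp: algebra_simps)

lemma ip_Aop_right:
  assumes "SS Z f" "SS Z g"
  shows "ip Z f (Aop Z al be g) = al * ip Z f g + be * ip Z f (Hil Z g)"
  unfolding Aop_def[abs_def] ip_add_right[OF SS_scale[OF assms(2)] SS_scale[OF SS_Hil[OF assms(2)]] assms(1)] ip_scale_right ..

text \<open>
  The Hilbert transform is antisymmetric, so the adjoint has the opposite sign of be.
\<close>

lemma ip_Aop:
  assumes f: "SS Z f" and g: "SS Z g"
  shows "ip Z f (Aop Z al be g) = ip Z (Aop Z al (- be) f) g"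
  unfolding ip_Aop_right[OF f g] ip_commute[of Z "Aop Z al (- be) f" g] ip_Aop_right[OF g f]
  using ip_Hil[OF f g] by (simp add: ip_commute)

lemma ip_Aop_deriv_self: "SS Z f \<Longrightarrow> ip Z f (Aop Z al be (deriv f)) = be * hs Z f"
  unfolding Aop_def[abs_def] hs_ip using ip_deriv_self[of Z f] ip_commute[of Z f "deriv f"]
  by (simp add: ip_add_right[OF SS_scale SS_scale[OF SS_Hil]] SS_deriv ip_scale_right)

lemma fourier_Aop_le:
  assumes f: "SS Z f"
  shows "AE \<xi> in freq_measure Z. cmod (fourier Z (cs (Aop Z al be f)) \<xi>) \<le> (\<bar>al\<bar> + \<bar>be\<bar>) * cmod (fourier Z (cs f) \<xi>)"
  using fourier_SS_linear[OF f SS_Hil[OF f], of al be] fourier_Hil[OF f]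
proof eventually_elim
  case (elim \<xi>)
  have "cmod (fourier Z (cs (Aop Z al be f)) \<xi>) = cmod (of_real al * fourier Z (cs f) \<xi> + of_real be * (- \<i> * of_real (sgn \<xi>) * fourier Z (cs f) \<xi>))"
    unfolding Aop_def[abs_def] elim ..
  also have "\<dots> \<le> \<bar>al\<bar> * cmod (fourier Z (cs f) \<xi>) + \<bar>be\<bar> * (\<bar>sgn \<xi>\<bar> * cmod (fourier Z (cs f) \<xi>))"
    by (rule order_trans[OF norm_triangle_ineq]) (simp add: norm_mult)
  also have "\<dots> \<le> (\<bar>al\<bar> + \<bar>be\<bar>) * cmod (fourier Z (cs f) \<xi>)"
    unfolding distrib_right by (intro add_mono mult_left_mono order.refl) (auto simp: abs_sgn_eq)
  finally show ?case .
qed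

lemma nrm_Aop_le:
  assumes f: "SS Z f"
  shows "nrm Z (Aop Z al be f) \<le> (\<bar>al\<bar> + \<bar>be\<bar>) * nrm Z f"
proof (rule power2_le_imp_le)
  have "(LINT \<xi>|freq_measure Z. (cmod (fourier Z (cs (Aop Z al be f)) \<xi>))\<^sup>2) \<le> (LINT \<xi>|freq_measure Z. (\<bar>al\<bar> + \<bar>be\<bar>)\<^sup>2 * (cmod (fourier Z (cs f) \<xi>))\<^sup>2)"
  proof (rule integral_mono_AE)
    show "AE \<xi> in freq_measure Z. (cmod (fourier Z (cs (Aop Z al be f)) \<xi>))\<^sup>2 \<le> (\<bar>al\<bar> + \<bar>be\<bar>)\<^sup>2 * (cmod (fourier Z (cs f) \<xi>))\<^sup>2"
      using fourier_Aop_le[OF f] unfolding power_mult_distrib[symmetric] by eventually_elim (intro power_mono, auto)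
  qed (use fourier_square_integrable[OF SS_cs_L2[OF f]] fourier_square_integrable[OF SS_cs_L2[OF SS_Aop[OF f]]] in \<open>auto simp: square_integrable_def\<close>)
  then show "(nrm Z (Aop Z al be f))\<^sup>2 \<le> ((\<bar>al\<bar> + \<bar>be\<bar>) * nrm Z f)\<^sup>2"
    by (simp add: nrm_square power_mult_distrib Plancherel_SS[OF f] Plancherel_SS[OF SS_Aop[OF f]] divide_right_mono)
qed simp

lemma hs_Aop_le:
  assumes f: "SS Z f"
  shows "sqrt (hs Z (Aop Z al be f)) \<le> (\<bar>al\<bar> + \<bar>be\<bar>) * sqrt (hs Z f)"
proof (rule real_le_lsqrt)
  have "(LINT \<xi>|freq_measure Z. \<bar>\<xi>\<bar> * (cmod (fourier Z (cs (Aop Z al be f)) \<xi>))\<^sup>2) \<le> (LINT \<xi>|freq_measure Z. (\<bar>al\<bar> + \<bar>be\<bar>)\<^sup>2 * (\<bar>\<xi>\<bar> * (cmod (fourier Z (cs f) \<xi>))\<^sup>2))"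
  proof (rule integral_mono_AE[OF SS_freq_integrable[OF SS_Aop[OF f]]])
    show "AE \<xi> in freq_measure Z. \<bar>\<xi>\<bar> * (cmod (fourier Z (cs (Aop Z al be f)) \<xi>))\<^sup>2 \<le> (\<bar>al\<bar> + \<bar>be\<bar>)\<^sup>2 * (\<bar>\<xi>\<bar> * (cmod (fourier Z (cs f) \<xi>))\<^sup>2)"
      using fourier_Aop_le[OF f, of al be]
    proof eventually_elim
      case (elim \<xi>)
      have "(cmod (fourier Z (cs (Aop Z al be f)) \<xi>))\<^sup>2 \<le> ((\<bar>al\<bar> + \<bar>be\<bar>) * cmod (fourier Z (cs f) \<xi>))\<^sup>2"
        using elim by (intro power_mono) auto
      then have "\<bar>\<xi>\<bar> * (cmod (fourier Z (cs (Aop Z al be f)) \<xi>))\<^sup>2 \<le> \<bar>\<xi>\<bar> * ((\<bar>al\<bar> + \<bar>be\<bar>) * cmod (fourier Z (cs f) \<xi>))\<^sup>2"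
        by (rule mult_left_mono) simp
      then show ?case by (simp add: power_mult_distrib mult_ac)
    qed
  qed (use SS_freq_integrable[OF f] in simp)
  then have "hs Z (Aop Z al be f) \<le> (\<bar>al\<bar> + \<bar>be\<bar>)\<^sup>2 * hs Z f"
    by (simp add: hs_fourier[OF f] hs_fourier[OF SS_Aop[OF f]] divide_right_mono)
  then show "hs Z (Aop Z al be f) \<le> ((\<bar>al\<bar> + \<bar>be\<bar>) * sqrt (hs Z f))\<^sup>2"
    using hs_nonneg[OF f] by (simp add: power_mult_distrib)
qed (use hs_nonneg[OF f] hs_nonneg[OF SS_Aop[OF f]] in auto)

text \<open>
  A state u = p + i q at a fixed time. The names ending in t are what the equation prescribes for
  the time derivatives of the corresponding quantities, expressed through p and q alone; that
  solutions have these time derivatives is shown later. The pair w1, w2 is the real and imaginary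
  part of u_x - (3/4) i F u, and Y collects the part of the time derivative of rho of degree four.
\<close>

locale profile =
  fixes Z :: domain and al be :: real and p q :: "real \<Rightarrow> real"
  assumes p: "SS Z p" and q: "SS Z q"
begin

definition rho :: "real \<Rightarrow> real" where "rho x = p x * p x + q x * q x"
definition F :: "real \<Rightarrow> real" where "F = Aop Z al be rho"
definition J :: "real \<Rightarrow> real" where "J x = p x * deriv q x - q x * deriv p x"
definition Y :: "real \<Rightarrow> real" where "Y x = 2 * (deriv F x * rho x) + F x * deriv rho x"
definition w1 :: "real \<Rightarrow> real" where "w1 x = deriv p x + 3/4 * (F x * q x)"
definition w2 :: "real \<Rightarrow> real" where "w2 x = deriv q x - 3/4 * (F x * p x)"
definition pt :: "real \<Rightarrow> real" where "pt x = - deriv (deriv q) x + (deriv F x * p x + F x * deriv p x)"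
definition qt :: "real \<Rightarrow> real" where "qt x = deriv (deriv p) x + (deriv F x * q x + F x * deriv q x)"
definition rt :: "real \<Rightarrow> real" where "rt x = 2 * (p x * pt x + q x * qt x)"
definition Ft :: "real \<Rightarrow> real" where "Ft = Aop Z al be rt"
definition w1t :: "real \<Rightarrow> real" where "w1t x = deriv pt x + 3/4 * (Ft x * q x + F x * qt x)"
definition w2t :: "real \<Rightarrow> real" where "w2t x = deriv qt x - 3/4 * (Ft x * p x + F x * pt x)"

definition sextic :: real where
  "sextic = 3/4 * ip Z (\<lambda>x. F x * deriv F x) J + 9/4 * ip Z (deriv (\<lambda>x. F x * rho x)) (Aop Z al be J) - 3/2 * ip Z Y (Aop Z al (- be) J)"
definition octic :: real where
  "octic = 9/8 * ip Z (\<lambda>x. F x * rho x) (Aop Z al be Y) + 9/16 * ip Z (\<lambda>x. F x * F x) Y"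

lemma SS_rho: "SS Z rho" unfolding rho_def[abs_def] by (intro SS_intros p q)
lemma SS_F: "SS Z F" unfolding F_def by (intro SS_Aop SS_rho)
lemma SS_J: "SS Z J" unfolding J_def[abs_def] by (intro SS_intros p q)
lemma SS_Y: "SS Z Y" unfolding Y_def[abs_def] by (intro SS_intros SS_F SS_rho)
lemma SS_w1: "SS Z w1" unfolding w1_def[abs_def] by (intro SS_intros SS_F p q)
lemma SS_w2: "SS Z w2" unfolding w2_def[abs_def] by (intro SS_intros SS_F p q)
lemma SS_pt: "SS Z pt" unfolding pt_def[abs_def] by (intro SS_intros SS_F p q)
lemma SS_qt: "SS Z qt" unfolding qt_def[abs_def] by (intro SS_intros SS_F p q)
lemma SS_rt: "SS Z rt" unfolding rt_def[abs_def] by (intro SS_intros SS_pt SS_qt p q)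
lemma SS_Ft: "SS Z Ft" unfolding Ft_def by (intro SS_Aop SS_rt)

lemmas SS_profile = p q SS_rho SS_F SS_J SS_Y SS_w1 SS_w2 SS_pt SS_qt SS_rt SS_Ft

lemma DERIVs:
  "(p has_real_derivative deriv p x) (at x)" "(deriv p has_real_derivative deriv (deriv p) x) (at x)"
  "(deriv (deriv p) has_real_derivative deriv (deriv (deriv p)) x) (at x)"
  "(q has_real_derivative deriv q x) (at x)" "(deriv q has_real_derivative deriv (deriv q) x) (at x)"
  "(deriv (deriv q) has_real_derivative deriv (deriv (deriv q)) x) (at x)"
  "(F has_real_derivative deriv F x) (at x)" "(deriv F has_real_derivative deriv (deriv F) x) (at x)"
  by (rule SS_DERIV[OF p] SS_DERIV[OF SS_deriv[OF p]] SS_DERIV[OF SS_deriv[OF SS_deriv[OF p]]]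
      SS_DERIV[OF q] SS_DERIV[OF SS_deriv[OF q]] SS_DERIV[OF SS_deriv[OF SS_deriv[OF q]]]
      SS_DERIV[OF SS_F] SS_DERIV[OF SS_deriv[OF SS_F]])+

lemma deriv_rho: "deriv rho = (\<lambda>x. 2 * (p x * deriv p x + q x * deriv q x))"
  unfolding rho_def[abs_def]
  by (intro ext DERIV_imp_deriv) (auto intro!: derivative_eq_intros DERIVs simp: algebra_simps)

lemma deriv_deriv_rho: "deriv (deriv rho) = (\<lambda>x. 2 * (deriv p x * deriv p x + p x * deriv (deriv p) x + deriv q x * deriv q x + q x * deriv (deriv q) x))"
  unfolding deriv_rho
  by (intro ext DERIV_imp_deriv) (auto intro!: derivative_eq_intros DERIVs simp: algebra_simps)

lemma deriv_J: "deriv J = (\<lambda>x. p x * deriv (deriv q) x - q x * deriv (deriv p) x)"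
  unfolding J_def[abs_def]
  by (intro ext DERIV_imp_deriv) (auto intro!: derivative_eq_intros DERIVs simp: algebra_simps)

lemma deriv_pt: "deriv pt = (\<lambda>x. - deriv (deriv (deriv q)) x + deriv (deriv F) x * p x + 2 * (deriv F x * deriv p x) + F x * deriv (deriv p) x)"
  unfolding pt_def[abs_def]
  by (intro ext DERIV_imp_deriv) (auto intro!: derivative_eq_intros DERIVs simp: algebra_simps)

lemma deriv_qt: "deriv qt = (\<lambda>x. deriv (deriv (deriv p)) x + deriv (deriv F) x * q x + 2 * (deriv F x * deriv q x) + F x * deriv (deriv q) x)"
  unfolding qt_def[abs_def]
  by (intro ext DERIV_imp_deriv) (auto intro!: derivative_eq_intros DERIVs simp: algebra_simps)

lemma rt_eq: "rt = (\<lambda>x. - 2 * deriv J x + 1 * Y x)"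
  unfolding rt_def[abs_def] deriv_J Y_def[abs_def] pt_def[abs_def] qt_def[abs_def] deriv_rho
  unfolding rho_def by (auto simp: fun_eq_iff algebra_simps)

text \<open>
  The integral of F rho_x is that of be H(rho) rho_x, because rho rho_x is a derivative, and the
  integral of F_x rho is its negative.
\<close>

lemma int_Y: "space_int Z Y = be * hs Z rho"
proof -
  have "space_int Z Y = 2 * ip Z (deriv F) rho + ip Z F (deriv rho)"
    unfolding Y_def[abs_def] ip_def space_int_def
    using SS_integrable_mult[OF SS_deriv[OF SS_F] SS_rho] SS_integrable_mult[OF SS_F SS_deriv[OF SS_rho]] by simp
  also have "\<dots> = ip Z (deriv F) rho" using ip_by_parts[OF SS_F SS_rho] by simp
  also have "\<dots> = be * hs Z rho"
    unfolding F_def deriv_Aop[OF SS_rho] ip_commute[of Z _ rho] by (rule ip_Aop_deriv_self[OF SS_rho])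
  finally show ?thesis .
qed

lemma SS1_rt: "integrable (space_measure Z) rt" "integrable (space_measure Z) Y"
proof -
  show Y: "integrable (space_measure Z) Y"
    unfolding Y_def[abs_def] using SS_integrable_mult[OF SS_deriv[OF SS_F] SS_rho] SS_integrable_mult[OF SS_F SS_deriv[OF SS_rho]] by simp
  show "integrable (space_measure Z) rt"
    unfolding rt_def[abs_def] using SS_integrable_mult[OF p SS_pt] SS_integrable_mult[OF q SS_qt] by simp
qed

lemma SS1_J: "SS1 Z J"
  unfolding J_def[abs_def] by (intro SS1_diff SS1_mult SS_deriv p q)

lemma SS1_rho: "SS1 Z rho"
  unfolding rho_def[abs_def] by (intro SS1_add SS1_mult p q)

lemma mass_identity: "space_int Z rt = be * hs Z rho"
proof -
  have "space_int Z rt = - 2 * space_int Z (deriv J) + space_int Z Y"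
    unfolding rt_eq space_int_def using SS1_J SS1_rt(2) by (simp add: SS1_def)
  then show ?thesis using SS1_int_deriv[OF SS1_J] int_Y by simp
qed

text \<open>
  The factor 3/4 in the gauge is the value at which the terms F_x |u_x|^2 and F u_x u_xx combine
  into a total derivative, leaving (1/4) F_xx rho_x and the term in J, and nothing else of that
  order.
\<close>

lemma energy_density_identity:
  "2 * (w1 x * w1t x + w2 x * w2t x) =
     deriv (\<lambda>x. 2 * (deriv q x * deriv (deriv p) x - deriv p x * deriv (deriv q) x)
       + 4 * (F x * (deriv p x * deriv p x + deriv q x * deriv q x))
       - 3/4 * (F x * deriv (deriv rho) x - deriv F x * deriv rho x)
       - 3/2 * ((F x * F x) * J x)) x
     + 1/4 * (deriv (deriv F) x * deriv rho x) - 3/2 * ((F x * deriv F x) * J x) - 3/2 * (J x * Ft x)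
     + 9/8 * ((F x * rho x) * Ft x) + 9/16 * ((F x * F x) * rt x)"
proof -
  let ?X = "\<lambda>x. 2 * (deriv q x * deriv (deriv p) x - deriv p x * deriv (deriv q) x)
       + 4 * (F x * (deriv p x * deriv p x + deriv q x * deriv q x))
       - 3/4 * (F x * deriv (deriv rho) x - deriv F x * deriv rho x)
       - 3/2 * ((F x * F x) * J x)"
  let ?p1 = "deriv p x" and ?p2 = "deriv (deriv p) x" and ?p3 = "deriv (deriv (deriv p)) x"
  let ?q1 = "deriv q x" and ?q2 = "deriv (deriv q) x" and ?q3 = "deriv (deriv (deriv q)) x"
  let ?F1 = "deriv F x" and ?F2 = "deriv (deriv F) x"
  have "(?X has_real_derivative
      2 * (?q1 * ?p3 - ?p1 * ?q3)
      + 4 * (?F1 * (?p1 * ?p1 + ?q1 * ?q1) + F x * (2 * ?p1 * ?p2 + 2 * ?q1 * ?q2))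
      - 3/4 * (F x * (2 * (3 * ?p1 * ?p2 + p x * ?p3 + 3 * ?q1 * ?q2 + q x * ?q3)) - ?F2 * (2 * (p x * ?p1 + q x * ?q1)))
      - 3/2 * (2 * F x * ?F1 * (p x * ?q1 - q x * ?p1) + F x * F x * (p x * ?q2 - q x * ?p2))) (at x)"
    unfolding deriv_deriv_rho unfolding deriv_rho J_def
    by (auto intro!: derivative_eq_intros DERIVs) (simp add: algebra_simps add_divide_distrib diff_divide_distrib)
  then have "deriv ?X x = 2 * (?q1 * ?p3 - ?p1 * ?q3)
      + 4 * (?F1 * (?p1 * ?p1 + ?q1 * ?q1) + F x * (2 * ?p1 * ?p2 + 2 * ?q1 * ?q2))
      - 3/4 * (F x * (2 * (3 * ?p1 * ?p2 + p x * ?p3 + 3 * ?q1 * ?q2 + q x * ?q3)) - ?F2 * (2 * (p x * ?p1 + q x * ?q1)))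
      - 3/2 * (2 * F x * ?F1 * (p x * ?q1 - q x * ?p1) + F x * F x * (p x * ?q2 - q x * ?p2))"
    by (rule DERIV_imp_deriv)
  then show ?thesis
    unfolding w1_def w2_def w1t_def w2t_def deriv_pt deriv_qt rt_def deriv_rho
    unfolding pt_def qt_def unfolding J_def rho_def
    by (simp add: field_simps)
qed

text \<open>
  Of the terms remaining in energy_density_identity, F_xx rho_x gives hs(rho_x), and in J F_t the
  part -2 J_x of rho_t gives hs(J); both come with the sign of be. All others are of degree six or
  eight.
\<close>

lemma energy_identity:
  "2 * space_int Z (\<lambda>x. w1 x * w1t x + w2 x * w2t x) = 1/4 * be * hs Z (deriv rho) + 3 * be * hs Z J + sextic + octic"
proof -
  let ?X = "\<lambda>x. 2 * (deriv q x * deriv (deriv p) x - deriv p x * deriv (deriv q) x)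
       + 4 * (F x * (deriv p x * deriv p x + deriv q x * deriv q x))
       - 3/4 * (F x * deriv (deriv rho) x - deriv F x * deriv rho x)
       - 3/2 * ((F x * F x) * J x)"
  have X: "SS1 Z ?X"
    by (intro SS1_add SS1_diff SS1_scale SS1_mult SS_intros SS_profile)
  have "2 * space_int Z (\<lambda>x. w1 x * w1t x + w2 x * w2t x) = space_int Z (\<lambda>x. 2 * (w1 x * w1t x + w2 x * w2t x))"
    unfolding space_int_def integral_mult_right_zero ..
  also have "\<dots> = space_int Z (deriv ?X) + 1/4 * ip Z (deriv (deriv F)) (deriv rho) - 3/2 * ip Z (\<lambda>x. F x * deriv F x) J
      - 3/2 * ip Z J Ft + 9/8 * ip Z (\<lambda>x. F x * rho x) Ft + 9/16 * ip Z (\<lambda>x. F x * F x) rt"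
    unfolding energy_density_identity ip_def space_int_def
    using X[unfolded SS1_def]
      SS_integrable_mult[OF SS_deriv[OF SS_deriv[OF SS_F]] SS_deriv[OF SS_rho]]
      SS_integrable_mult[OF SS_mult[OF SS_F SS_deriv[OF SS_F]] SS_J]
      SS_integrable_mult[OF SS_J SS_Ft]
      SS_integrable_mult[OF SS_mult[OF SS_F SS_rho] SS_Ft]
      SS_integrable_mult[OF SS_mult[OF SS_F SS_F] SS_rt]
    by simp
  also have "space_int Z (deriv ?X) = 0" by (rule SS1_int_deriv[OF X])
  also have "ip Z (deriv (deriv F)) (deriv rho) = be * hs Z (deriv rho)"
    unfolding F_def deriv_Aop[OF SS_rho] deriv_Aop[OF SS_deriv[OF SS_rho]] ip_commute[of Z _ "deriv rho"]
    by (rule ip_Aop_deriv_self[OF SS_deriv[OF SS_rho]])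
  also have "ip Z J Ft = - 2 * (be * hs Z J) + ip Z Y (Aop Z al (- be) J)"
    unfolding Ft_def rt_eq Aop_linear[OF SS_deriv[OF SS_J] SS_Y]
    by (simp only: ip_add_right[OF SS_scale[OF SS_Aop[OF SS_deriv[OF SS_J]]] SS_scale[OF SS_Aop[OF SS_Y]] SS_J]
        ip_scale_right ip_Aop_deriv_self[OF SS_J] ip_Aop[OF SS_J SS_Y] ip_commute[of Z Y])
  also have "ip Z (\<lambda>x. F x * rho x) Ft = 2 * ip Z (deriv (\<lambda>x. F x * rho x)) (Aop Z al be J) + ip Z (\<lambda>x. F x * rho x) (Aop Z al be Y)"
    unfolding Ft_def rt_eq Aop_linear[OF SS_deriv[OF SS_J] SS_Y]
    unfolding ip_add_right[OF SS_scale[OF SS_Aop[OF SS_deriv[OF SS_J]]] SS_scale[OF SS_Aop[OF SS_Y]] SS_mult[OF SS_F SS_rho]] ip_scale_right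
    unfolding ip_by_parts[OF SS_mult[OF SS_F SS_rho] SS_Aop[OF SS_J]] deriv_Aop[OF SS_J] by simp
  also have "ip Z (\<lambda>x. F x * F x) rt = 4 * ip Z (\<lambda>x. F x * deriv F x) J + ip Z (\<lambda>x. F x * F x) Y"
  proof -
    have "ip Z (\<lambda>x. F x * F x) (deriv J) = - ip Z (deriv (\<lambda>x. F x * F x)) J"
      using ip_by_parts[OF SS_mult[OF SS_F SS_F] SS_J] by simp
    also have "deriv (\<lambda>x. F x * F x) = (\<lambda>x. 2 * (F x * deriv F x))"
      unfolding deriv_SS_mult[OF SS_F SS_F] by auto
    finally have "ip Z (\<lambda>x. F x * F x) (deriv J) = - 2 * ip Z (\<lambda>x. F x * deriv F x) J"
      unfolding ip_scale_left by simp
    then show ?thesis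
      unfolding rt_eq
      by (simp only: ip_add_right[OF SS_scale[OF SS_deriv[OF SS_J]] SS_scale[OF SS_Y] SS_mult[OF SS_F SS_F]] ip_scale_right)
  qed
  finally show ?thesis unfolding sextic_def octic_def by (simp add: add_divide_distrib diff_divide_distrib)
qed

end

section \<open>Inequalities between mass and energies\<close>

lemma space_int_mono:
  assumes "integrable (space_measure Z) f" "integrable (space_measure Z) g" "\<And>x. f x \<le> g x"
  shows "space_int Z f \<le> space_int Z g"
  unfolding space_int_def using assms by (intro integral_mono)

lemma Cauchy_Schwarz_plane: "a * c + b * d \<le> sqrt (a\<^sup>2 + b\<^sup>2) * sqrt (c\<^sup>2 + (d::real)\<^sup>2)"
proof -
  have "(a * c + b * d)\<^sup>2 \<le> (a\<^sup>2 + b\<^sup>2) * (c\<^sup>2 + d\<^sup>2)"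
    using zero_le_power2[of "a * d - b * c"] by (simp add: power2_eq_square algebra_simps)
  then show ?thesis unfolding real_sqrt_mult[symmetric] by (rule real_le_rsqrt)
qed

lemma fluct_integrable:
  assumes "SS Z f" "integrable (space_measure Z) f"
  shows "integrable (space_measure Z) (\<lambda>x. f x - smean Z f)"
proof (cases Z)
  case Circle
  then have "integrable (space_measure Z) (\<lambda>x. smean Z f)"
    using finite_measure.integrable_const[OF finite_circle_measure] by simp
  then show ?thesis by (rule Bochner_Integration.integrable_diff[OF assms(2)])
qed (use assms in \<open>simp add: smean_def\<close>)

lemma nrm_mult_le:
  assumes f: "SS Z f" and g: "SS Z g" and B: "\<And>x. \<bar>f x\<bar> \<le> B"
  shows "nrm Z (\<lambda>x. f x * g x) \<le> B * nrm Z g"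
proof (rule power2_le_imp_le)
  have B0: "B \<ge> 0" using B[of 0] by linarith
  have "(nrm Z (\<lambda>x. f x * g x))\<^sup>2 \<le> space_int Z (\<lambda>x. B\<^sup>2 * (g x)\<^sup>2)"
    unfolding nrm_square
  proof (rule space_int_mono)
    show "integrable (space_measure Z) (\<lambda>x. (f x * g x)\<^sup>2)" by (intro tame_square_integrable SS_tame SS_mult f g)
    show "integrable (space_measure Z) (\<lambda>x. B\<^sup>2 * (g x)\<^sup>2)" using tame_square_integrable[OF SS_tame[OF g]] by simp
    show "(f x * g x)\<^sup>2 \<le> B\<^sup>2 * (g x)\<^sup>2" for x
      unfolding power_mult_distrib using B[of x] B0 by (intro mult_right_mono abs_le_square_iff[THEN iffD1]) auto
  qed
  also have "\<dots> = (B * nrm Z g)\<^sup>2" by (simp add: power_mult_distrib nrm_square) (simp add: space_int_def)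
  finally show "(nrm Z (\<lambda>x. f x * g x))\<^sup>2 \<le> (B * nrm Z g)\<^sup>2" .
  show "0 \<le> B * nrm Z g" using B0 by simp
qed

lemma nrm_scale: "nrm Z (\<lambda>x. c * f x) = \<bar>c\<bar> * nrm Z f"
  by (simp add: nrm_def space_int_def power_mult_distrib real_sqrt_mult)

lemma nrm_triangle:
  assumes f: "SS Z f" and g: "SS Z g"
  shows "nrm Z (\<lambda>x. f x + g x) \<le> nrm Z f + nrm Z g"
proof (rule power2_le_imp_le)
  have "(nrm Z (\<lambda>x. f x + g x))\<^sup>2 = ip Z (\<lambda>x. f x + g x) (\<lambda>x. f x + g x)"
    unfolding nrm_square ip_def by (simp add: power2_eq_square)
  also have "\<dots> = ip Z f f + 2 * ip Z f g + ip Z g g"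
    by (simp only: ip_add_left[OF f g SS_add[OF f g]] ip_add_right[OF f g f] ip_add_right[OF f g g] ip_commute[of Z g f])
  also have "\<dots> \<le> (nrm Z f)\<^sup>2 + 2 * (nrm Z f * nrm Z g) + (nrm Z g)\<^sup>2"
    using ip_le[OF f g] unfolding nrm_square ip_def by (simp add: power2_eq_square)
  finally show "(nrm Z (\<lambda>x. f x + g x))\<^sup>2 \<le> (nrm Z f + nrm Z g)\<^sup>2" by (simp add: power2_sum)
qed simp

lemma gauge_constant_le:
  fixes L m :: real
  assumes "L \<ge> 0"
  shows "2 + 9/8 * (9 * L\<^sup>2 * m ^ 4) \<le> (2 + 4 * L)\<^sup>2 * (1 + m\<^sup>2)\<^sup>2"
proof -
  have "2 + 9/8 * (9 * L\<^sup>2 * m ^ 4) \<le> (4 + 16 * L\<^sup>2) * (1 + m ^ 4)"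
    using mult_nonneg_nonneg[of "L\<^sup>2" "m^4"] by (simp add: algebra_simps)
  also have "\<dots> \<le> (2 + 4 * L)\<^sup>2 * (1 + m\<^sup>2)\<^sup>2"
  proof (rule mult_mono)
    show "4 + 16 * L\<^sup>2 \<le> (2 + 4 * L)\<^sup>2" using assms by (simp add: power2_eq_square algebra_simps)
    show "1 + m ^ 4 \<le> (1 + m\<^sup>2)\<^sup>2" by (simp add: power2_eq_square power4_eq_xxxx algebra_simps)
  qed auto
  finally show ?thesis .
qed

text \<open>
  The weight of the mass in the energy. On the circle u_x does not control the mean of u, and the
  mass is added; on the line the estimates are stated in terms of u_x only.
\<close>

definition kap :: "domain \<Rightarrow> real" where
  "kap Z = (if Z = Circle then 1 else 0)"

context profile
begin

definition L :: real where "L = \<bar>al\<bar> + \<bar>be\<bar>"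
definition m :: real where "m = sqrt ((nrm Z p)\<^sup>2 + (nrm Z q)\<^sup>2)"
text \<open>
  Applied to (w1, w2) this is the gauged energy, and to the components of u_x the energy that the
  theorem bounds.
\<close>

definition EN :: "(real \<Rightarrow> real) \<Rightarrow> (real \<Rightarrow> real) \<Rightarrow> real" where
  "EN v1 v2 = sqrt ((nrm Z v1)\<^sup>2 + (nrm Z v2)\<^sup>2 + kap Z * m\<^sup>2)"
definition r :: "real \<Rightarrow> real" where "r x = rho x - smean Z rho"
definition S :: real where "S = nrm Z r * nrm Z (deriv rho)"

lemma m_nonneg: "m \<ge> 0" by (simp add: m_def)
lemma L_nonneg: "L \<ge> 0" by (simp add: L_def)
lemma m_square: "m\<^sup>2 = (nrm Z p)\<^sup>2 + (nrm Z q)\<^sup>2" by (simp add: m_def)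
lemma kap_nonneg: "kap Z \<ge> 0" by (simp add: kap_def)
lemma rho_nonneg: "rho x \<ge> 0" by (simp add: rho_def)
lemma EN_nonneg: "EN v1 v2 \<ge> 0" using kap_nonneg by (simp add: EN_def)
lemma EN_square: "(EN v1 v2)\<^sup>2 = (nrm Z v1)\<^sup>2 + (nrm Z v2)\<^sup>2 + kap Z * m\<^sup>2" using kap_nonneg by (simp add: EN_def)

lemma mass_rho: "space_int Z rho = m\<^sup>2"
  unfolding m_square nrm_square rho_def[abs_def] space_int_def
  using SS_integrable_mult[OF p p] SS_integrable_mult[OF q q] by (simp add: power2_eq_square)

lemma rho_integrable: "integrable (space_measure Z) rho"
  using SS1_rho by (simp add: SS1_def)

lemma SS_r: "SS Z r" unfolding r_def[abs_def] by (rule SS_fluct[OF SS_rho])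

lemma deriv_r: "deriv r = deriv rho" unfolding r_def[abs_def] by (rule deriv_fluct[OF SS_rho])

lemma smean_rho: "0 \<le> smean Z rho" "smean Z rho \<le> kap Z * m\<^sup>2" "Z = Line \<Longrightarrow> smean Z rho = 0"
proof -
  have le: "m\<^sup>2 / (2 * pi) \<le> m\<^sup>2"
    using pi_gt3 by (intro divide_le_eq[THEN iffD2]) (auto simp: mult_le_cancel_left1)
  have "smean Z rho = (if Z = Line then 0 else m\<^sup>2 / (2 * pi))"
    unfolding mass_rho[symmetric] by (cases Z) (simp_all only: smean_def domain.case simp_thms if_True if_False domain.distinct)
  then show "0 \<le> smean Z rho" "smean Z rho \<le> kap Z * m\<^sup>2" "Z = Line \<Longrightarrow> smean Z rho = 0"
    using le by (auto simp: kap_def) (metis domain.exhaust)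
qed

lemma kap_m_le_EN: "kap Z * m \<le> EN v1 v2"
proof (cases Z)
  case Circle
  then have "m\<^sup>2 \<le> (EN v1 v2)\<^sup>2" unfolding EN_square by (simp add: kap_def)
  then have "m \<le> EN v1 v2" by (rule power2_le_imp_le[OF _ EN_nonneg])
  then show ?thesis using Circle by (simp add: kap_def)
next
  case Line
  then have "kap Z = 0" by (simp add: kap_def)
  then show ?thesis using EN_nonneg by simp
qed

lemma smean_rho_le: "smean Z rho \<le> m * EN v1 v2"
  using smean_rho(2) mult_left_mono[OF kap_m_le_EN m_nonneg, of v1 v2] by (simp add: power2_eq_square mult_ac)

context
  fixes v1 v2 :: "real \<Rightarrow> real"
  assumes v: "SS Z v1" "SS Z v2" and grad: "\<And>x. deriv rho x = 2 * (p x * v1 x + q x * v2 x)"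
begin

lemma L1_deriv_rho_le: "space_int Z (\<lambda>x. \<bar>deriv rho x\<bar>) \<le> 2 * (m * EN v1 v2)"
proof -
  have i: "integrable (space_measure Z) (\<lambda>x. \<bar>p x * v1 x\<bar>)" "integrable (space_measure Z) (\<lambda>x. \<bar>q x * v2 x\<bar>)"
    using SS_integrable_mult[OF p v(1)] SS_integrable_mult[OF q v(2)] by auto
  have "space_int Z (\<lambda>x. \<bar>deriv rho x\<bar>) \<le> space_int Z (\<lambda>x. 2 * (\<bar>p x * v1 x\<bar> + \<bar>q x * v2 x\<bar>))"
  proof (rule space_int_mono)
    show "integrable (space_measure Z) (\<lambda>x. \<bar>deriv rho x\<bar>)" using SS1_rho by (simp add: SS1_def)
    show "\<bar>deriv rho x\<bar> \<le> 2 * (\<bar>p x * v1 x\<bar> + \<bar>q x * v2 x\<bar>)" for x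
      unfolding grad abs_mult[of 2] using abs_triangle_ineq[of "p x * v1 x" "q x * v2 x"] by simp
  qed (use i in simp)
  also have "\<dots> = 2 * (space_int Z (\<lambda>x. \<bar>p x * v1 x\<bar>) + space_int Z (\<lambda>x. \<bar>q x * v2 x\<bar>))"
    unfolding space_int_def using i by simp
  also have "\<dots> \<le> 2 * (nrm Z p * nrm Z v1 + nrm Z q * nrm Z v2)"
    using SS_Cauchy_Schwarz[OF p v(1)] SS_Cauchy_Schwarz[OF q v(2)] by simp
  also have "\<dots> \<le> 2 * (m * sqrt ((nrm Z v1)\<^sup>2 + (nrm Z v2)\<^sup>2))"
    unfolding m_def by (rule mult_left_mono[OF Cauchy_Schwarz_plane]) simp
  also have "\<dots> \<le> 2 * (m * EN v1 v2)"
    unfolding EN_def using m_nonneg kap_nonneg by (intro mult_left_mono real_sqrt_le_mono) auto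
  finally show ?thesis .
qed

lemma rho_sup_le: "rho x \<le> 3 * m * EN v1 v2"
proof -
  have "\<bar>r x\<bar> \<le> space_int Z (\<lambda>x. \<bar>deriv r x\<bar>)"
  proof (rule sup_le_L1_deriv[OF SS_DERIV[OF SS_r] SS_continuous[OF SS_deriv[OF SS_r]]])
    show "integrable (space_measure Z) r" unfolding r_def[abs_def] by (rule fluct_integrable[OF SS_rho rho_integrable])
    show "integrable (space_measure Z) (deriv r)" unfolding deriv_r using SS1_rho by (simp add: SS1_def)
    show "r (x + 2 * pi) = r x" if "Z = Circle" for x using SS_periodic[of r] SS_r that by simp
    show "\<exists>x. r x = 0" if "Z = Circle" unfolding r_def using fluct_has_zero[of rho] SS_rho that by simp
  qed
  then have "rho x \<le> smean Z rho + 2 * (m * EN v1 v2)"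
    using L1_deriv_rho_le unfolding deriv_r r_def by linarith
  then show ?thesis using smean_rho_le[of v1 v2] by simp
qed

lemma nrm_rho_le: "(nrm Z rho)\<^sup>2 \<le> 3 * m ^ 3 * EN v1 v2"
proof -
  have "(nrm Z rho)\<^sup>2 \<le> space_int Z (\<lambda>x. (3 * m * EN v1 v2) * rho x)"
    unfolding nrm_square
  proof (rule space_int_mono)
    show "integrable (space_measure Z) (\<lambda>x. (rho x)\<^sup>2)" by (intro tame_square_integrable SS_tame SS_rho)
    show "(rho x)\<^sup>2 \<le> 3 * m * EN v1 v2 * rho x" for x
      unfolding power2_eq_square by (intro mult_right_mono rho_sup_le rho_nonneg)
  qed (use rho_integrable in simp)
  also have "\<dots> = (3 * m * EN v1 v2) * m\<^sup>2" using mass_rho by (simp add: space_int_def)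
  finally show ?thesis by (simp add: power2_eq_square power3_eq_cube mult_ac)
qed

lemma nrm_deriv_rho_le: "(nrm Z (deriv rho))\<^sup>2 \<le> 12 * m * (EN v1 v2) ^ 3"
proof -
  have i: "integrable (space_measure Z) (\<lambda>x. v1 x * v1 x)" "integrable (space_measure Z) (\<lambda>x. v2 x * v2 x)"
    using SS_integrable_mult[OF v(1) v(1)] SS_integrable_mult[OF v(2) v(2)] by auto
  have "(nrm Z (deriv rho))\<^sup>2 \<le> space_int Z (\<lambda>x. 4 * (3 * m * EN v1 v2) * (v1 x * v1 x + v2 x * v2 x))"
    unfolding nrm_square
  proof (rule space_int_mono)
    show "integrable (space_measure Z) (\<lambda>x. (deriv rho x)\<^sup>2)" by (intro tame_square_integrable SS_tame SS_deriv SS_rho)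
    show "(deriv rho x)\<^sup>2 \<le> 4 * (3 * m * EN v1 v2) * (v1 x * v1 x + v2 x * v2 x)" for x
    proof -
      have "(deriv rho x)\<^sup>2 = 4 * (p x * v1 x + q x * v2 x)\<^sup>2" unfolding grad by (simp only: power_mult_distrib) simp
      also have "(p x * v1 x + q x * v2 x)\<^sup>2 \<le> rho x * (v1 x * v1 x + v2 x * v2 x)"
        unfolding rho_def using zero_le_power2[of "p x * v2 x - q x * v1 x"] by (simp add: power2_eq_square algebra_simps)
      also have "\<dots> \<le> (3 * m * EN v1 v2) * (v1 x * v1 x + v2 x * v2 x)"
        by (intro mult_right_mono rho_sup_le) auto
      finally show ?thesis by simp
    qed
  qed (use i in auto)
  also have "\<dots> = 4 * (3 * m * EN v1 v2) * ((nrm Z v1)\<^sup>2 + (nrm Z v2)\<^sup>2)"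
    unfolding nrm_square using i by (simp add: space_int_def power2_eq_square)
  also have "\<dots> \<le> 4 * (3 * m * EN v1 v2) * (EN v1 v2)\<^sup>2"
    unfolding EN_square using m_nonneg EN_nonneg kap_nonneg by (intro mult_left_mono) auto
  finally show ?thesis by (simp add: power2_eq_square power3_eq_cube mult_ac)
qed

lemma S_le_mass_energy: "S \<le> 6 * m\<^sup>2 * (EN v1 v2)\<^sup>2"
proof (rule power2_le_imp_le)
  have "S\<^sup>2 = (nrm Z r)\<^sup>2 * (nrm Z (deriv rho))\<^sup>2" by (simp add: S_def power_mult_distrib)
  also have "\<dots> \<le> (3 * m ^ 3 * EN v1 v2) * (12 * m * (EN v1 v2) ^ 3)"
  proof (intro mult_mono nrm_deriv_rho_le order_trans[OF _ nrm_rho_le])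
    show "(nrm Z r)\<^sup>2 \<le> (nrm Z rho)\<^sup>2"
      unfolding r_def[abs_def] by (intro power_mono nrm_fluct_le SS_rho) auto
  qed (use m_nonneg EN_nonneg in auto)
  also have "\<dots> = (6 * m\<^sup>2 * (EN v1 v2)\<^sup>2)\<^sup>2" by (simp add: power2_eq_square power3_eq_cube)
  finally show "S\<^sup>2 \<le> (6 * m\<^sup>2 * (EN v1 v2)\<^sup>2)\<^sup>2" .
qed simp

lemma F_square_rho_le: "ip Z (\<lambda>x. F x * F x) rho \<le> 9 * L\<^sup>2 * m ^ 4 * (EN v1 v2)\<^sup>2"
proof -
  have iF: "integrable (space_measure Z) (\<lambda>x. F x * F x)" by (rule SS_integrable_mult[OF SS_F SS_F])
  have "ip Z (\<lambda>x. F x * F x) rho \<le> space_int Z (\<lambda>x. (3 * m * EN v1 v2) * (F x * F x))"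
    unfolding ip_def
  proof (rule space_int_mono)
    show "integrable (space_measure Z) (\<lambda>x. F x * F x * rho x)" by (intro SS_integrable_mult SS_mult SS_F SS_rho)
    show "F x * F x * rho x \<le> 3 * m * EN v1 v2 * (F x * F x)" for x
      using mult_right_mono[OF rho_sup_le[of x], of "F x * F x"] by (simp add: mult_ac)
  qed (use iF in simp)
  also have "\<dots> = (3 * m * EN v1 v2) * (nrm Z F)\<^sup>2" unfolding nrm_square by (simp add: space_int_def power2_eq_square)
  also have "\<dots> \<le> (3 * m * EN v1 v2) * (L\<^sup>2 * (3 * m ^ 3 * EN v1 v2))"
  proof (intro mult_left_mono)
    have "(nrm Z F)\<^sup>2 \<le> (L * nrm Z rho)\<^sup>2"
      unfolding F_def L_def by (intro power_mono nrm_Aop_le SS_rho) auto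
    also have "\<dots> \<le> L\<^sup>2 * (3 * m ^ 3 * EN v1 v2)"
      unfolding power_mult_distrib by (intro mult_left_mono nrm_rho_le) auto
    finally show "(nrm Z F)\<^sup>2 \<le> L\<^sup>2 * (3 * m ^ 3 * EN v1 v2)" .
  qed (use m_nonneg EN_nonneg in auto)
  also have "\<dots> = 9 * L\<^sup>2 * m ^ 4 * (EN v1 v2)\<^sup>2" by (simp add: power2_eq_square power3_eq_cube power4_eq_xxxx)
  finally show ?thesis .
qed

end

text \<open>
  The gauge rotates u: it adds an imaginary multiple of u, which is invisible in the derivative of
  |u|^2. Hence the bounds on rho hold with either energy.
\<close>

lemma grad_w: "deriv rho x = 2 * (p x * w1 x + q x * w2 x)"
  unfolding deriv_rho w1_def w2_def by (simp add: algebra_simps)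

lemma grad_u: "deriv rho x = 2 * (p x * deriv p x + q x * deriv q x)"
  unfolding deriv_rho ..

abbreviation "E \<equiv> EN w1 w2"
abbreviation "E1 \<equiv> EN (deriv p) (deriv q)"

lemma gauge_compare:
  assumes "SS Z f" "SS Z g" "SS Z k" "\<And>x. f x = g x + c * (F x * k x)" "c\<^sup>2 = 9/16"
  shows "(nrm Z f)\<^sup>2 \<le> 2 * (nrm Z g)\<^sup>2 + 9/8 * space_int Z (\<lambda>x. (F x * k x)\<^sup>2)"
proof -
  have i: "integrable (space_measure Z) (\<lambda>x. (g x)\<^sup>2)" "integrable (space_measure Z) (\<lambda>x. (F x * k x)\<^sup>2)"
    by (intro tame_square_integrable SS_tame SS_mult SS_F assms)+
  have "(nrm Z f)\<^sup>2 \<le> space_int Z (\<lambda>x. 2 * (g x)\<^sup>2 + 9/8 * (F x * k x)\<^sup>2)"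
    unfolding nrm_square
  proof (rule space_int_mono)
    show "integrable (space_measure Z) (\<lambda>x. (f x)\<^sup>2)" by (intro tame_square_integrable SS_tame assms)
    show "(f x)\<^sup>2 \<le> 2 * (g x)\<^sup>2 + 9/8 * (F x * k x)\<^sup>2" for x
      using norm_add_square_le[of "g x" "c * (F x * k x)"] assms(4)[of x] assms(5)
      unfolding real_norm_def power2_abs power_mult_distrib by (simp add: mult_ac)
  qed (use i in simp)
  also have "\<dots> = 2 * (nrm Z g)\<^sup>2 + 9/8 * space_int Z (\<lambda>x. (F x * k x)\<^sup>2)"
    unfolding nrm_square space_int_def using i by simp
  finally show ?thesis .
qed

lemma F_square_split: "space_int Z (\<lambda>x. (F x * p x)\<^sup>2) + space_int Z (\<lambda>x. (F x * q x)\<^sup>2) = ip Z (\<lambda>x. F x * F x) rho"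
proof -
  have i: "integrable (space_measure Z) (\<lambda>x. (F x * p x)\<^sup>2)" "integrable (space_measure Z) (\<lambda>x. (F x * q x)\<^sup>2)"
    by (intro tame_square_integrable SS_tame SS_mult SS_F p q)+
  have "ip Z (\<lambda>x. F x * F x) rho = space_int Z (\<lambda>x. (F x * p x)\<^sup>2 + (F x * q x)\<^sup>2)"
    unfolding ip_def rho_def by (simp add: power2_eq_square algebra_simps)
  then show ?thesis unfolding space_int_def using i by simp
qed

text \<open>
  By F_square_rho_le the gauge term is at most a multiple of L m^2 times the energy, in which either
  energy may appear. Using the gauged one bounds the plain energy without any smallness of the mass;
  E_le is the same argument with the roles exchanged.
\<close>

lemma E1_le: "E1 \<le> (2 + 4 * L) * (1 + m\<^sup>2) * E"
proof (rule power2_le_imp_le)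
  have "(nrm Z (deriv p))\<^sup>2 \<le> 2 * (nrm Z w1)\<^sup>2 + 9/8 * space_int Z (\<lambda>x. (F x * q x)\<^sup>2)"
    by (rule gauge_compare[where c="-3/4", OF SS_deriv[OF p] SS_w1 q]) (simp_all add: w1_def power2_eq_square)
  moreover have "(nrm Z (deriv q))\<^sup>2 \<le> 2 * (nrm Z w2)\<^sup>2 + 9/8 * space_int Z (\<lambda>x. (F x * p x)\<^sup>2)"
    by (rule gauge_compare[where c="3/4", OF SS_deriv[OF q] SS_w2 p]) (simp_all add: w2_def power2_eq_square)
  ultimately have "E1\<^sup>2 \<le> 2 * E\<^sup>2 + 9/8 * ip Z (\<lambda>x. F x * F x) rho"
    using mult_nonneg_nonneg[OF kap_nonneg zero_le_power2[of m]]
    unfolding EN_square F_square_split[symmetric] distrib_left by simp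
  also have "\<dots> \<le> 2 * E\<^sup>2 + 9/8 * (9 * L\<^sup>2 * m ^ 4 * E\<^sup>2)"
    using F_square_rho_le[OF SS_w1 SS_w2 grad_w] by simp
  also have "\<dots> \<le> ((2 + 4 * L) * (1 + m\<^sup>2) * E)\<^sup>2"
  proof -
    have eq: "2 * E\<^sup>2 + 9/8 * (9 * L\<^sup>2 * m ^ 4 * E\<^sup>2) = (2 + 9/8 * (9 * L\<^sup>2 * m ^ 4)) * E\<^sup>2"
      by (simp add: algebra_simps)
    note gauge_constant_le[OF L_nonneg, of m]
    then have "(2 + 9/8 * (9 * L\<^sup>2 * m ^ 4)) * E\<^sup>2 \<le> (2 + 4 * L)\<^sup>2 * (1 + m\<^sup>2)\<^sup>2 * E\<^sup>2"
      by (rule mult_right_mono) simp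
    then show ?thesis unfolding power_mult_distrib eq .
  qed
  finally show "E1\<^sup>2 \<le> ((2 + 4 * L) * (1 + m\<^sup>2) * E)\<^sup>2" .
qed (use L_nonneg EN_nonneg in simp)

lemma E_le: "E \<le> (2 + 4 * L) * (1 + m\<^sup>2) * E1"
proof (rule power2_le_imp_le)
  have "(nrm Z w1)\<^sup>2 \<le> 2 * (nrm Z (deriv p))\<^sup>2 + 9/8 * space_int Z (\<lambda>x. (F x * q x)\<^sup>2)"
    by (rule gauge_compare[where c="3/4", OF SS_w1 SS_deriv[OF p] q]) (simp_all add: w1_def power2_eq_square)
  moreover have "(nrm Z w2)\<^sup>2 \<le> 2 * (nrm Z (deriv q))\<^sup>2 + 9/8 * space_int Z (\<lambda>x. (F x * p x)\<^sup>2)"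
    by (rule gauge_compare[where c="-3/4", OF SS_w2 SS_deriv[OF q] p]) (simp_all add: w2_def power2_eq_square)
  ultimately have "E\<^sup>2 \<le> 2 * E1\<^sup>2 + 9/8 * ip Z (\<lambda>x. F x * F x) rho"
    using mult_nonneg_nonneg[OF kap_nonneg zero_le_power2[of m]]
    unfolding EN_square F_square_split[symmetric] distrib_left by simp
  also have "\<dots> \<le> 2 * E1\<^sup>2 + 9/8 * (9 * L\<^sup>2 * m ^ 4 * E1\<^sup>2)"
    using F_square_rho_le[OF SS_deriv[OF p] SS_deriv[OF q] grad_u] by simp
  also have "\<dots> \<le> ((2 + 4 * L) * (1 + m\<^sup>2) * E1)\<^sup>2"
  proof -
    have eq: "2 * E1\<^sup>2 + 9/8 * (9 * L\<^sup>2 * m ^ 4 * E1\<^sup>2) = (2 + 9/8 * (9 * L\<^sup>2 * m ^ 4)) * E1\<^sup>2"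
      by (simp add: algebra_simps)
    note gauge_constant_le[OF L_nonneg, of m]
    then have "(2 + 9/8 * (9 * L\<^sup>2 * m ^ 4)) * E1\<^sup>2 \<le> (2 + 4 * L)\<^sup>2 * (1 + m\<^sup>2)\<^sup>2 * E1\<^sup>2"
      by (rule mult_right_mono) simp
    then show ?thesis unfolding power_mult_distrib eq .
  qed
  finally show "E\<^sup>2 \<le> ((2 + 4 * L) * (1 + m\<^sup>2) * E1)\<^sup>2" .
qed (use L_nonneg EN_nonneg in simp)

section \<open>Interpolated bounds on density and current\<close>

text \<open>
  The three half-derivative norms: a for rho, whose square times be is the rate of change of the
  mass, and b for rho_x and d for J, which the dissipation of energy controls.
\<close>

definition a :: real where "a = sqrt (hs Z rho)"
definition b :: real where "b = sqrt (hs Z (deriv rho))"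
definition d :: real where "d = sqrt (hs Z J)"
definition j :: "real \<Rightarrow> real" where "j x = J x - smean Z J"

lemma abd_nonneg: "a \<ge> 0" "b \<ge> 0" "d \<ge> 0"
  unfolding a_def b_def d_def by (simp_all add: hs_nonneg SS_rho SS_J SS_deriv)

lemma abd_square: "a\<^sup>2 = hs Z rho" "b\<^sup>2 = hs Z (deriv rho)" "d\<^sup>2 = hs Z J"
  unfolding a_def b_def d_def by (simp_all add: hs_nonneg SS_rho SS_J SS_deriv)

lemma SS_j: "SS Z j" unfolding j_def[abs_def] by (rule SS_fluct[OF SS_J])

lemma abs_rho: "space_int Z (\<lambda>x. \<bar>rho x\<bar>) = m\<^sup>2"
  using mass_rho rho_nonneg by simp

lemma nrm_r_le: "(nrm Z r)\<^sup>2 \<le> 2 * m\<^sup>2 * a"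
  using fluct_interpolation[OF SS_rho rho_integrable] unfolding abs_rho r_def[abs_def] a_def .

lemma nrm_deriv_rho_le_half: "(nrm Z (deriv rho))\<^sup>2 \<le> a * b"
  using nrm_deriv_le[OF SS_rho] unfolding a_def b_def .

lemma a_le: "a\<^sup>2 \<le> 2 * m\<^sup>2 * b"
  using half_norm_interpolation[OF SS_rho rho_integrable] unfolding abs_rho abd_square b_def .

lemma S_square_le: "S\<^sup>2 \<le> 2 * m\<^sup>2 * a\<^sup>2 * b"
proof -
  have "S\<^sup>2 = (nrm Z r)\<^sup>2 * (nrm Z (deriv rho))\<^sup>2" by (simp add: S_def power_mult_distrib)
  also have "\<dots> \<le> (2 * m\<^sup>2 * a) * (a * b)"
    by (intro mult_mono nrm_r_le nrm_deriv_rho_le_half) (use abd_nonneg in auto)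
  finally show ?thesis by (simp add: power2_eq_square mult_ac)
qed

lemma S_nonneg: "S \<ge> 0" by (simp add: S_def)

lemma S_le: "S \<le> 6 * m\<^sup>2 * E\<^sup>2"
  by (rule S_le_mass_energy[OF SS_w1 SS_w2 grad_w])

text \<open>
  The product of S_le and S_square_le; in it a and E occur to the same power, as weighted_Young
  requires.
\<close>

lemma S_cube_le: "S ^ 3 \<le> 12 * m ^ 4 * E\<^sup>2 * a\<^sup>2 * b"
proof -
  have "S ^ 3 = S * S\<^sup>2" by (simp add: power2_eq_square power3_eq_cube)
  also have "\<dots> \<le> (6 * m\<^sup>2 * E\<^sup>2) * (2 * m\<^sup>2 * a\<^sup>2 * b)"
    by (intro mult_mono S_le S_square_le) auto
  finally show ?thesis by (simp add: power2_eq_square power4_eq_xxxx mult_ac)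
qed

lemma L1_J_le: "space_int Z (\<lambda>x. \<bar>J x\<bar>) \<le> m * E1"
proof -
  have i: "integrable (space_measure Z) (\<lambda>x. \<bar>p x * deriv q x\<bar>)" "integrable (space_measure Z) (\<lambda>x. \<bar>q x * deriv p x\<bar>)"
    using SS_integrable_mult[OF p SS_deriv[OF q]] SS_integrable_mult[OF q SS_deriv[OF p]] by auto
  have "space_int Z (\<lambda>x. \<bar>J x\<bar>) \<le> space_int Z (\<lambda>x. \<bar>p x * deriv q x\<bar> + \<bar>q x * deriv p x\<bar>)"
  proof (rule space_int_mono)
    show "integrable (space_measure Z) (\<lambda>x. \<bar>J x\<bar>)" using SS1_J by (simp add: SS1_def)
  qed (use i in \<open>auto simp: J_def intro: abs_triangle_ineq4\<close>)
  also have "\<dots> = space_int Z (\<lambda>x. \<bar>p x * deriv q x\<bar>) + space_int Z (\<lambda>x. \<bar>q x * deriv p x\<bar>)"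
    unfolding space_int_def using i by simp
  also have "\<dots> \<le> nrm Z p * nrm Z (deriv q) + nrm Z q * nrm Z (deriv p)"
    by (intro add_mono SS_Cauchy_Schwarz SS_deriv p q)
  also have "\<dots> \<le> m * sqrt ((nrm Z (deriv q))\<^sup>2 + (nrm Z (deriv p))\<^sup>2)"
    unfolding m_def by (rule Cauchy_Schwarz_plane)
  also have "\<dots> \<le> m * E1"
    unfolding EN_def using m_nonneg kap_nonneg by (intro mult_left_mono real_sqrt_le_mono) auto
  finally show ?thesis .
qed

lemma nrm_j_le: "(nrm Z j)\<^sup>2 \<le> 2 * (m * E1) * d"
proof -
  have "integrable (space_measure Z) J" using SS1_J by (simp add: SS1_def)
  then have "(nrm Z j)\<^sup>2 \<le> 2 * space_int Z (\<lambda>x. \<bar>J x\<bar>) * d"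
    using fluct_interpolation[OF SS_J] unfolding j_def[abs_def] d_def by blast
  also have "\<dots> \<le> 2 * (m * E1) * d"
    using L1_J_le abd_nonneg by (intro mult_right_mono) auto
  finally show ?thesis .
qed

lemma smean_J_le: "\<bar>smean Z J\<bar> \<le> kap Z * (m * E1)"
proof (cases Z)
  case Circle
  have nn: "0 \<le> m * E1" using m_nonneg EN_nonneg by simp
  have "\<bar>space_int Z J\<bar> \<le> m * E1" using SS_abs_int_le[of Z J] L1_J_le by linarith
  then have "\<bar>space_int Z J\<bar> / (2 * pi) \<le> m * E1 / (2 * pi)" by (rule divide_right_mono) simp
  also have "\<dots> \<le> m * E1" using nn pi_gt3 by (simp add: divide_le_eq mult_le_cancel_left1)
  finally show ?thesis using Circle by (simp add: smean_def kap_def)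
qed (simp add: smean_def kap_def)

lemma smean_J_le': "\<bar>smean Z J\<bar> \<le> (2 + 4 * L) * (1 + m\<^sup>2) * E\<^sup>2"
proof -
  have "\<bar>smean Z J\<bar> \<le> (kap Z * m) * E1" using smean_J_le by (simp add: mult.assoc)
  also have "\<dots> \<le> E * ((2 + 4 * L) * (1 + m\<^sup>2) * E)"
    using kap_m_le_EN E1_le EN_nonneg by (intro mult_mono) auto
  finally show ?thesis by (simp add: power2_eq_square mult_ac)
qed

text \<open>
  On the circle the mean of rho is at most the square of m and the fluctuation is at most its
  half-derivative norm a; on the line the mean is 0.
\<close>

lemma smean_fluct: "smean Z rho * nrm Z r \<le> m\<^sup>2 * a"
proof (cases Z)
  case Line
  then show ?thesis using smean_rho(3) abd_nonneg by simp
next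
  case Circle
  have "(nrm Z r)\<^sup>2 \<le> a\<^sup>2"
    using fluct_le_half_norm_circle[of rho] SS_rho Circle unfolding abd_square r_def[abs_def] by simp
  then have "nrm Z r \<le> a" using abd_nonneg power2_le_imp_le by blast
  then show ?thesis using smean_rho Circle abd_nonneg by (intro mult_mono) (auto simp: kap_def)
qed

end

section \<open>Bounding the sextic and octic terms\<close>

lemma space_int_Hil_circle: "SS Circle f \<Longrightarrow> space_int Circle (Hil Circle f) = 0"
  using ip_Hil[of Circle f "\<lambda>x. 1"] by (simp add: SS_const_circle Hil_const_circle ip_def space_int_def)

lemma SS_integrable_circle:
  assumes "SS Circle f"
  shows "integrable (space_measure Circle) f"
  using SS_integrable_mult[OF assms SS_const_circle[of 1]] by simp

lemma space_int_Aop_circle: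
  assumes f: "SS Circle f"
  shows "space_int Circle (Aop Circle al be f) = al * space_int Circle f"
proof -
  have "space_int Circle (Aop Circle al be f) = al * space_int Circle f + be * space_int Circle (Hil Circle f)"
    unfolding Aop_def[abs_def] space_int_def
    using SS_integrable_circle[OF f] SS_integrable_circle[OF SS_Hil[OF f]] by simp
  then show ?thesis using space_int_Hil_circle[OF f] by simp
qed

lemma smean_Aop: "SS Z f \<Longrightarrow> smean Z (Aop Z al be f) = al * smean Z f"
  by (cases Z) (auto simp: smean_def space_int_Aop_circle)

text \<open>
  Young's inequality for a product with total degree 2n in y and s, with the powers of the weight q
  >= 1 tracked; in the application q^2 = 1 + m^2, y = a E is the factor to be kept and s^2 the
  dissipation. The exponent u balances the two regimes: below the threshold the weights are absorbed
  in s, above it in y.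
\<close>

lemma weighted_Young:
  fixes P0 eps :: real and n k l e u :: nat
  assumes P0: "P0 > 0" and eps: "eps > 0" and n: "n \<ge> 1" and k: "k \<ge> 1" and kl: "k + l = 2 * n"
    and eu: "e \<le> k * u" "e + l * u \<le> 6 * n"
  shows "\<exists>K>0. \<forall>x y s q. x \<ge> 0 \<longrightarrow> y \<ge> 0 \<longrightarrow> s \<ge> 0 \<longrightarrow> q \<ge> 1 \<longrightarrow>
     x ^ n \<le> P0 * q ^ e * y ^ k * s ^ l \<longrightarrow> x \<le> eps * s\<^sup>2 + K * q ^ 6 * y\<^sup>2"
proof -
  define th where "th = min 1 (eps ^ n / P0)"
  have th: "th > 0" "th \<le> 1" "th \<le> eps ^ n / P0" using P0 eps by (auto simp: th_def)
  define K where "K = max 1 (P0 / th ^ l)"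
  have K: "K \<ge> 1" "P0 / th ^ l \<le> K" by (auto simp: K_def)
  have "P0 * th ^ k \<le> P0 * th" using th k P0 power_decreasing[of 1 k th] by simp
  also have "\<dots> \<le> eps ^ n" using th(3) P0 by (simp add: field_simps)
  finally have thk: "P0 * th ^ k \<le> eps ^ n" .
  have main: "x \<le> eps * s\<^sup>2 + K * q ^ 6 * y\<^sup>2"
    if x: "x \<ge> 0" and y: "y \<ge> 0" and s: "s \<ge> 0" and q: "q \<ge> 1" and le: "x ^ n \<le> P0 * q ^ e * y ^ k * s ^ l" for x y s q :: real
  \<comment> \<open>th is so small that the first regime costs at most eps, and K pays for its powers in the second\<close>
  proof (cases "y * q ^ u \<le> th * s")
    case True
    have "q ^ e * y ^ k \<le> q ^ (k * u) * y ^ k"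
      using q y eu by (intro mult_right_mono power_increasing) auto
    also have "\<dots> = (y * q ^ u) ^ k" by (simp add: power_mult_distrib power_mult[symmetric] mult.commute)
    also have "\<dots> \<le> (th * s) ^ k" using True q y by (intro power_mono) auto
    finally have "P0 * (q ^ e * y ^ k) * s ^ l \<le> P0 * (th * s) ^ k * s ^ l"
      using P0 s by (intro mult_right_mono mult_left_mono) auto
    then have "x ^ n \<le> (P0 * th ^ k) * s ^ (k + l)"
      using le by (simp add: power_mult_distrib power_add mult_ac)
    also have "\<dots> \<le> eps ^ n * s ^ (k + l)" using thk s by (intro mult_right_mono) auto
    also have "\<dots> = (eps * s\<^sup>2) ^ n" unfolding kl by (simp add: power_mult_distrib power_mult)
    finally have "x \<le> eps * s\<^sup>2" using eps by (intro power_mono_iff[THEN iffD1, of x _ n]) (use x n in auto)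
    then show ?thesis using K(1) q y by (simp add: add_increasing2)
  next
    case False
    have "th * s \<le> y * q ^ u" using False by simp
    then have "s ^ l \<le> (y * q ^ u / th) ^ l" using s th by (intro power_mono) (auto simp: field_simps)
    then have "P0 * q ^ e * y ^ k * s ^ l \<le> P0 * q ^ e * y ^ k * (y * q ^ u / th) ^ l"
      using P0 q y by (intro mult_left_mono) auto
    also have "\<dots> = (P0 / th ^ l) * q ^ (e + l * u) * y ^ (k + l)"
      by (simp add: power_mult_distrib power_divide power_add power_mult[symmetric] mult_ac)
    also have "\<dots> \<le> K * q ^ (6 * n) * y ^ (k + l)"
      using K q y eu P0 th by (intro mult_right_mono mult_mono power_increasing) auto
    also have "\<dots> \<le> K ^ n * q ^ (6 * n) * y ^ (k + l)"
      using K(1) q y n self_le_power[of K n] by (intro mult_right_mono) auto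
    also have "\<dots> = (K * q ^ 6 * y\<^sup>2) ^ n" unfolding kl by (simp add: power_mult_distrib power_mult)
    finally have "x ^ n \<le> (K * q ^ 6 * y\<^sup>2) ^ n" using le by linarith
    then have "x \<le> K * q ^ 6 * y\<^sup>2" using K(1) q y by (intro power_mono_iff[THEN iffD1, of x _ n]) (use x n in auto)
    then show ?thesis using eps s by (simp add: add_increasing)
  qed
  show ?thesis using main K(1) by (intro exI[of _ K]) auto
qed

lemma sextic_arithmetic:
  fixes X Y :: real
  assumes "\<bar>A1\<bar> \<le> X" "\<bar>A2\<bar> \<le> X" "\<bar>A3\<bar> \<le> X" "\<bar>A4\<bar> \<le> X" "\<bar>A5\<bar> \<le> X" "\<bar>A6\<bar> \<le> Y"
  shows "\<bar>3/4 * A1 + 9/4 * (A2 + A3) - 3/2 * (A6 + (2 * A4 + A5))\<bar> \<le> 10 * X + 10 * Y"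
proof -
  have b: "A1 \<le> X" "- X \<le> A1" "A2 \<le> X" "- X \<le> A2" "A3 \<le> X" "- X \<le> A3" "A4 \<le> X" "- X \<le> A4"
    "A5 \<le> X" "- X \<le> A5" "A6 \<le> Y" "- Y \<le> A6"
    using assms by linarith+
  show ?thesis by (rule abs_leI) (use b in argo)+
qed

lemma octic_arithmetic:
  fixes X Y :: real
  assumes "\<bar>A\<bar> \<le> X" "\<bar>B\<bar> \<le> Y"
  shows "\<bar>9/8 * A + 9/16 * B\<bar> \<le> 9/8 * X + 9/16 * Y"
proof -
  have b: "A \<le> X" "- X \<le> A" "B \<le> Y" "- Y \<le> B" using assms by linarith+
  show ?thesis by (rule abs_leI) (use b in argo)+
qed

context profile
begin

definition c :: real where "c = smean Z rho"
text \<open>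
  The fluctuation of F: its mean on the circle is al c, since the Hilbert transform removes means.
\<close>

definition fl :: "real \<Rightarrow> real" where "fl x = F x - al * c"
definition sr :: real where "sr = sqrt (2 * S)"

lemma c_nonneg: "c \<ge> 0" unfolding c_def by (rule smean_rho)
lemma c_line: "Z = Line \<Longrightarrow> c = 0" unfolding c_def by (rule smean_rho)
lemma sr_nonneg: "sr \<ge> 0" by (simp add: sr_def S_nonneg)
lemma sr_square: "sr\<^sup>2 = 2 * S" by (simp add: sr_def S_nonneg)
lemma al_le: "\<bar>al\<bar> \<le> L" "\<bar>be\<bar> \<le> L" by (simp_all add: L_def)

lemma fl_Aop: "fl = Aop Z al be r"
  unfolding fl_def[abs_def] F_def Aop_def[abs_def] r_def[abs_def] c_def Hil_fluct[OF SS_rho]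
  by (auto simp: algebra_simps)

lemma SS_fl: "SS Z fl" unfolding fl_Aop by (rule SS_Aop[OF SS_r])

lemma deriv_fl: "deriv fl = deriv F"
  unfolding fl_def[abs_def] by (rule deriv_fluct[OF SS_F])

lemma nrm_fl: "nrm Z fl \<le> L * nrm Z r"
  unfolding fl_Aop L_def by (rule nrm_Aop_le[OF SS_r])

lemma nrm_deriv_F: "nrm Z (deriv F) \<le> L * nrm Z (deriv rho)"
  unfolding F_def deriv_Aop[OF SS_rho] L_def by (rule nrm_Aop_le[OF SS_deriv[OF SS_rho]])

lemma hs_r: "sqrt (hs Z r) = a"
  unfolding r_def[abs_def] hs_fluct[OF SS_rho] a_def ..

lemma hs_fl: "sqrt (hs Z fl) \<le> L * a"
  unfolding fl_Aop L_def hs_r[symmetric] by (rule hs_Aop_le[OF SS_r])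

lemma hs_j: "sqrt (hs Z j) = d"
  unfolding j_def[abs_def] hs_fluct[OF SS_J] d_def ..

lemma r_sup: "\<bar>r x\<bar> \<le> sr"
proof -
  have "(r x)\<^sup>2 \<le> 2 * S" using fluct_sup_bound[OF SS_rho, of x] by (simp add: r_def[abs_def] S_def)
  then show ?thesis unfolding sr_def by (rule real_le_rsqrt[of "\<bar>r x\<bar>", simplified])
qed

lemma fl_sup: "\<bar>fl x\<bar> \<le> L * sr"
proof -
  have eq: "fl = (\<lambda>x. F x - smean Z F)" unfolding fl_def[abs_def] c_def F_def smean_Aop[OF SS_rho] ..
  have "(fl x)\<^sup>2 \<le> 2 * (nrm Z fl * nrm Z (deriv F))"
    using fluct_sup_bound[OF SS_F, of x] unfolding eq[symmetric] fun_cong[OF eq[symmetric], of x] .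
  also have "\<dots> \<le> 2 * ((L * nrm Z r) * (L * nrm Z (deriv rho)))"
    using nrm_fl nrm_deriv_F L_nonneg by (intro mult_left_mono mult_mono) auto
  also have "\<dots> = (L * sr)\<^sup>2" unfolding power_mult_distrib sr_square by (simp add: S_def power2_eq_square)
  finally show ?thesis using L_nonneg sr_nonneg abs_le_square_iff[of "fl x" "L * sr"] by simp
qed

lemma deriv_F_rho: "deriv (\<lambda>x. F x * rho x) = (\<lambda>x. deriv F x * rho x + F x * deriv rho x)"
  by (rule deriv_SS_mult[OF SS_F SS_rho])

lemma ip_J_split:
  assumes "integrable (space_measure Z) f" "SS Z f"
  shows "ip Z f J = smean Z J * space_int Z f + ip Z f j"
proof -
  have "f x * J x = smean Z J * f x + f x * j x" for x by (simp add: j_def algebra_simps)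
  then show ?thesis unfolding ip_def space_int_def using assms(1) SS_integrable_mult[OF assms(2) SS_j] by simp
qed

lemma ip_Aop_J_split:
  assumes "integrable (space_measure Z) f" "SS Z f"
  shows "ip Z f (Aop Z al b' J) = al * smean Z J * space_int Z f + ip Z f (Aop Z al b' j)"
proof -
  have "Aop Z al b' J x = al * smean Z J + Aop Z al b' j x" for x
    using Hil_fluct[OF SS_J] by (simp add: Aop_def j_def[abs_def] algebra_simps)
  then have "f x * Aop Z al b' J x = al * smean Z J * f x + f x * Aop Z al b' j x" for x by (simp add: algebra_simps)
  then show ?thesis unfolding ip_def space_int_def using assms(1) SS_integrable_mult[OF assms(2) SS_Aop[OF SS_j]] by simp
qed

lemma half_F: "SS Z G \<Longrightarrow> \<bar>ip Z (deriv F) G\<bar> \<le> L * a * sqrt (hs Z G)"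
  using half_norm_duality_deriv[of Z G fl] mult_right_mono[OF hs_fl, of "sqrt (hs Z G)"] SS_fl hs_nonneg[of Z G]
  unfolding deriv_fl ip_def by (simp add: mult.commute)

lemma half_rho: "SS Z G \<Longrightarrow> \<bar>ip Z (deriv rho) G\<bar> \<le> a * sqrt (hs Z G)"
  using half_norm_duality_deriv[of Z G rho] SS_rho
  unfolding a_def ip_def by (simp add: mult.commute)

lemma prod_bound:
  assumes "SS Z k" "SS Z g" "SS Z G" "\<And>x. \<bar>k x\<bar> \<le> B" "nrm Z g \<le> N"
  shows "\<bar>ip Z (\<lambda>x. k x * g x) G\<bar> \<le> B * N * nrm Z G"
proof -
  have B: "B \<ge> 0" using assms(4)[of 0] by linarith
  have "\<bar>ip Z (\<lambda>x. k x * g x) G\<bar> \<le> nrm Z (\<lambda>x. k x * g x) * nrm Z G" by (intro ip_le SS_mult assms)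
  also have "\<dots> \<le> (B * nrm Z g) * nrm Z G" by (intro mult_right_mono nrm_mult_le assms) auto
  also have "\<dots> \<le> (B * N) * nrm Z G" using B assms(5) by (intro mult_right_mono mult_left_mono) auto
  finally show ?thesis .
qed

text \<open>
  The part with a constant coefficient c is bounded by duality of half derivatives, because rho and
  J then carry one derivative together; in the fluctuating part one factor is taken in the supremum
  norm and the other two in L2.
\<close>

lemma trilinear_bounds:
  assumes G: "SS Z G" and hG: "sqrt (hs Z G) \<le> g * d" and nG: "nrm Z G \<le> g * nrm Z j" and g: "g \<ge> 0"
  defines "X \<equiv> c * a * d + sr * nrm Z (deriv rho) * nrm Z j"
  shows "\<bar>ip Z (\<lambda>x. c * deriv F x + r x * deriv F x) G\<bar> \<le> L * g * X"
    and "\<bar>ip Z (\<lambda>x. (al * c) * deriv rho x + fl x * deriv rho x) G\<bar> \<le> L * g * X"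
    and "\<bar>ip Z (\<lambda>x. (al * c) * deriv F x + fl x * deriv F x) G\<bar> \<le> L * L * g * X"
proof -
  note dF = SS_deriv[OF SS_F] and dr = SS_deriv[OF SS_rho]
  let ?N = "nrm Z (deriv rho)"
  have hF: "\<bar>ip Z (deriv F) G\<bar> \<le> L * a * (g * d)"
    using half_F[OF G] mult_left_mono[OF hG, of "L * a"] L_nonneg abd_nonneg by fastforce
  have hR: "\<bar>ip Z (deriv rho) G\<bar> \<le> a * (g * d)"
    using half_rho[OF G] mult_left_mono[OF hG, of a] abd_nonneg by fastforce
  have pr: "\<bar>ip Z (\<lambda>x. r x * deriv F x) G\<bar> \<le> sr * (L * ?N) * (g * nrm Z j)"
    by (rule order_trans[OF prod_bound[OF SS_r dF G r_sup nrm_deriv_F]])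
      (use nG sr_nonneg L_nonneg in \<open>intro mult_left_mono mult_nonneg_nonneg; simp\<close>)
  have pf: "\<bar>ip Z (\<lambda>x. fl x * deriv rho x) G\<bar> \<le> (L * sr) * ?N * (g * nrm Z j)"
    by (rule order_trans[OF prod_bound[OF SS_fl dr G fl_sup order.refl]])
      (use nG sr_nonneg L_nonneg in \<open>intro mult_left_mono mult_nonneg_nonneg; simp\<close>)
  have pF: "\<bar>ip Z (\<lambda>x. fl x * deriv F x) G\<bar> \<le> (L * sr) * (L * ?N) * (g * nrm Z j)"
    by (rule order_trans[OF prod_bound[OF SS_fl dF G fl_sup nrm_deriv_F]])
      (use nG sr_nonneg L_nonneg in \<open>intro mult_left_mono mult_nonneg_nonneg; simp\<close>)
  have tri: "\<bar>u * P + Q\<bar> \<le> \<bar>u\<bar> * A + B" if "\<bar>P\<bar> \<le> A" "\<bar>Q\<bar> \<le> B" for u P Q A B :: real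
    using mult_left_mono[OF that(1), of "\<bar>u\<bar>"] that(2) abs_triangle_ineq[of "u * P" Q] by (simp add: abs_mult)
  have alc: "\<bar>al * c\<bar> \<le> L * c" using al_le(1) c_nonneg by (simp add: abs_mult mult_right_mono)
  show "\<bar>ip Z (\<lambda>x. c * deriv F x + r x * deriv F x) G\<bar> \<le> L * g * X"
    unfolding ip_add_left[OF SS_scale[OF dF] SS_mult[OF SS_r dF] G] ip_scale_left
    by (rule order_trans[OF tri[OF hF pr]]) (use c_nonneg in \<open>simp add: X_def algebra_simps\<close>)
  have "\<bar>ip Z (\<lambda>x. (al * c) * deriv rho x + fl x * deriv rho x) G\<bar> \<le> \<bar>al * c\<bar> * (a * (g * d)) + (L * sr) * ?N * (g * nrm Z j)"
    unfolding ip_add_left[OF SS_scale[OF dr] SS_mult[OF SS_fl dr] G] ip_scale_left by (rule tri[OF hR pf])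
  also have "\<dots> \<le> (L * c) * (a * (g * d)) + (L * sr) * ?N * (g * nrm Z j)"
    using alc abd_nonneg g sr_nonneg by (intro add_mono mult_right_mono) auto
  finally show "\<bar>ip Z (\<lambda>x. (al * c) * deriv rho x + fl x * deriv rho x) G\<bar> \<le> L * g * X"
    by (simp add: X_def algebra_simps)
  have "\<bar>ip Z (\<lambda>x. (al * c) * deriv F x + fl x * deriv F x) G\<bar> \<le> \<bar>al * c\<bar> * (L * a * (g * d)) + (L * sr) * (L * ?N) * (g * nrm Z j)"
    unfolding ip_add_left[OF SS_scale[OF dF] SS_mult[OF SS_fl dF] G] ip_scale_left by (rule tri[OF hF pF])
  also have "\<dots> \<le> (L * c) * (L * a * (g * d)) + (L * sr) * (L * ?N) * (g * nrm Z j)"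
    using alc abd_nonneg g L_nonneg sr_nonneg by (intro add_mono mult_right_mono) auto
  finally show "\<bar>ip Z (\<lambda>x. (al * c) * deriv F x + fl x * deriv F x) G\<bar> \<le> L * L * g * X"
    by (simp add: X_def algebra_simps)
qed

text \<open>
  Splitting rho, F and J into means and fluctuations. The mean of J pairs with total derivatives
  except in the term with Y, whose integral is be a^2; this accounts for the last summand.
\<close>

lemma sextic_le: "\<bar>sextic\<bar> \<le> 10 * L\<^sup>2 * (c * a * d + sr * nrm Z (deriv rho) * nrm Z j + \<bar>smean Z J\<bar> * a\<^sup>2)"
proof -
  let ?X = "c * a * d + sr * nrm Z (deriv rho) * nrm Z j"
  note dF = SS_deriv[OF SS_F] and dr = SS_deriv[OF SS_rho]
  have X0: "?X \<ge> 0" using c_nonneg abd_nonneg sr_nonneg by simp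
  have FF: "ip Z (\<lambda>x. F x * deriv F x) J = ip Z (\<lambda>x. (al * c) * deriv F x + fl x * deriv F x) j"
  proof -
    have "ip Z F (deriv F) = 0" using ip_deriv_self[OF SS_F] by (simp add: ip_commute)
    then have "space_int Z (\<lambda>x. F x * deriv F x) = 0" by (simp add: ip_def)
    moreover have "(\<lambda>x. F x * deriv F x) = (\<lambda>x. (al * c) * deriv F x + fl x * deriv F x)"
      by (auto simp: fl_def algebra_simps)
    ultimately show ?thesis using ip_J_split[OF SS_integrable_mult[OF SS_F dF] SS_mult[OF SS_F dF]] by simp
  qed
  have R1: "SS1 Z (\<lambda>x. F x * rho x)" by (rule SS1_mult[OF SS_F SS_rho])
  have FR: "ip Z (deriv (\<lambda>x. F x * rho x)) (Aop Z al be J) =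
      ip Z (\<lambda>x. c * deriv F x + r x * deriv F x) (Aop Z al be j) + ip Z (\<lambda>x. (al * c) * deriv rho x + fl x * deriv rho x) (Aop Z al be j)"
  proof -
    have "deriv (\<lambda>x. F x * rho x) = (\<lambda>x. (c * deriv F x + r x * deriv F x) + ((al * c) * deriv rho x + fl x * deriv rho x))"
      unfolding deriv_F_rho by (auto simp: fl_def r_def c_def algebra_simps)
    then have "ip Z (deriv (\<lambda>x. F x * rho x)) (Aop Z al be j) =
      ip Z (\<lambda>x. c * deriv F x + r x * deriv F x) (Aop Z al be j) + ip Z (\<lambda>x. (al * c) * deriv rho x + fl x * deriv rho x) (Aop Z al be j)"
      by (simp only: ip_add_left[OF SS_add[OF SS_scale[OF dF] SS_mult[OF SS_r dF]] SS_add[OF SS_scale[OF dr] SS_mult[OF SS_fl dr]] SS_Aop[OF SS_j]])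
    moreover have "ip Z (deriv (\<lambda>x. F x * rho x)) (Aop Z al be J) = ip Z (deriv (\<lambda>x. F x * rho x)) (Aop Z al be j)"
      using ip_Aop_J_split[of "deriv (\<lambda>x. F x * rho x)" be] R1 SS1_int_deriv[OF R1] SS_deriv by (simp add: SS1_def)
    ultimately show ?thesis by simp
  qed
  have YY: "ip Z Y (Aop Z al (- be) J) = al * smean Z J * (be * a\<^sup>2)
      + (2 * ip Z (\<lambda>x. c * deriv F x + r x * deriv F x) (Aop Z al (- be) j) + ip Z (\<lambda>x. (al * c) * deriv rho x + fl x * deriv rho x) (Aop Z al (- be) j))"
  proof -
    have "Y = (\<lambda>x. 2 * (c * deriv F x + r x * deriv F x) + ((al * c) * deriv rho x + fl x * deriv rho x))"
      unfolding Y_def[abs_def] by (auto simp: fl_def r_def c_def algebra_simps)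
    then have "ip Z Y (Aop Z al (- be) j) = 2 * ip Z (\<lambda>x. c * deriv F x + r x * deriv F x) (Aop Z al (- be) j) + ip Z (\<lambda>x. (al * c) * deriv rho x + fl x * deriv rho x) (Aop Z al (- be) j)"
      by (simp only: ip_add_left[OF SS_scale[OF SS_add[OF SS_scale[OF dF] SS_mult[OF SS_r dF]]] SS_add[OF SS_scale[OF dr] SS_mult[OF SS_fl dr]] SS_Aop[OF SS_j]] ip_scale_left)
    then show ?thesis using ip_Aop_J_split[OF SS1_rt(2) SS_Y, of "- be"] int_Y by (simp add: abd_square)
  qed
  have hA: "sqrt (hs Z (Aop Z al b' j)) \<le> L * d" "nrm Z (Aop Z al b' j) \<le> L * nrm Z j" if "\<bar>b'\<bar> = \<bar>be\<bar>" for b'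
    using hs_Aop_le[OF SS_j, of al b'] nrm_Aop_le[OF SS_j, of al b'] that by (simp_all add: hs_j L_def)
  have b1: "\<bar>ip Z (\<lambda>x. (al * c) * deriv F x + fl x * deriv F x) j\<bar> \<le> L\<^sup>2 * ?X"
    using trilinear_bounds(3)[OF SS_j, of 1] hs_j by (simp add: power2_eq_square)
  have b2: "\<bar>ip Z (\<lambda>x. c * deriv F x + r x * deriv F x) (Aop Z al b' j)\<bar> \<le> L\<^sup>2 * ?X"
      "\<bar>ip Z (\<lambda>x. (al * c) * deriv rho x + fl x * deriv rho x) (Aop Z al b' j)\<bar> \<le> L\<^sup>2 * ?X" if "\<bar>b'\<bar> = \<bar>be\<bar>" for b'
    using trilinear_bounds(1,2)[OF SS_Aop[OF SS_j] hA[OF that] L_nonneg] by (simp_all add: power2_eq_square)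
  have b3: "\<bar>al * smean Z J * (be * a\<^sup>2)\<bar> \<le> L\<^sup>2 * (\<bar>smean Z J\<bar> * a\<^sup>2)"
  proof -
    have "\<bar>al\<bar> * \<bar>be\<bar> \<le> L\<^sup>2" unfolding power2_eq_square using al_le L_nonneg by (intro mult_mono) auto
    then have "(\<bar>al\<bar> * \<bar>be\<bar>) * (\<bar>smean Z J\<bar> * a\<^sup>2) \<le> L\<^sup>2 * (\<bar>smean Z J\<bar> * a\<^sup>2)" by (intro mult_right_mono) auto
    then show ?thesis by (simp add: abs_mult mult_ac)
  qed
  have L0: "0 \<le> L\<^sup>2 * ?X" "0 \<le> L\<^sup>2 * (\<bar>smean Z J\<bar> * a\<^sup>2)" using X0 by (auto intro!: mult_nonneg_nonneg)
  have "\<bar>sextic\<bar> \<le> 10 * (L\<^sup>2 * ?X) + 10 * (L\<^sup>2 * (\<bar>smean Z J\<bar> * a\<^sup>2))"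
    unfolding sextic_def FF FR YY
    by (rule sextic_arithmetic[OF b1 b2(1)[of be] b2(2)[of be] b2(1)[of "- be"] b2(2)[of "- be"] b3]) simp_all
  then show ?thesis by (simp add: algebra_simps)
qed

text \<open>
  Up to powers of L, the functions rho and F are bounded by M = c + sr. The constant parts of their
  products pair with Y and rho_x through a^2 or as total derivatives, and every remaining integral
  contains a fluctuation and a derivative of rho, which together give S.
\<close>

lemma octic_le: "\<bar>octic\<bar> \<le> 32 * L ^ 3 * (c\<^sup>2 * a\<^sup>2 + c\<^sup>2 * S + S\<^sup>2)"
proof -
  note dF = SS_deriv[OF SS_F] and dr = SS_deriv[OF SS_rho]
  define M where "M = c + sr"
  have M: "M \<ge> 0" "c \<le> M" "sr \<le> M" using c_nonneg sr_nonneg by (auto simp: M_def)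
  have rho_M: "\<bar>rho x\<bar> \<le> M" for x using r_sup[of x] rho_nonneg[of x] by (auto simp: M_def r_def c_def)
  have F_M: "\<bar>F x\<bar> \<le> L * M" for x
  proof -
    have "\<bar>F x\<bar> \<le> \<bar>al\<bar> * c + \<bar>fl x\<bar>" using abs_triangle_ineq[of "al * c" "fl x"] c_nonneg by (simp add: fl_def abs_mult)
    also have "\<dots> \<le> L * c + L * sr" using fl_sup[of x] al_le(1) c_nonneg by (intro add_mono mult_right_mono) auto
    finally show ?thesis by (simp add: M_def distrib_left)
  qed
  have LM: "0 \<le> L * M" using L_nonneg M by simp
  let ?N = "nrm Z (deriv rho)" and ?R = "nrm Z r"
  define k where "k x = F x * r x + c * fl x" for x
  have SSk: "SS Z k" unfolding k_def[abs_def] by (intro SS_add SS_mult SS_scale SS_F SS_r SS_fl)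
  have nk: "nrm Z k \<le> 2 * (L * M) * ?R"
  proof -
    have "nrm Z k \<le> nrm Z (\<lambda>x. F x * r x) + nrm Z (\<lambda>x. c * fl x)"
      unfolding k_def[abs_def] by (intro nrm_triangle SS_mult SS_scale SS_F SS_r SS_fl)
    also have "\<dots> \<le> (L * M) * ?R + M * (L * ?R)"
      unfolding nrm_scale using c_nonneg M nrm_fl
      by (intro add_mono nrm_mult_le SS_F SS_r F_M mult_mono) auto
    finally show ?thesis by (simp add: mult_ac)
  qed
  have nY: "nrm Z Y \<le> 3 * (L * M) * ?N"
  proof -
    have "nrm Z Y \<le> nrm Z (\<lambda>x. 2 * (deriv F x * rho x)) + nrm Z (\<lambda>x. F x * deriv rho x)"
      unfolding Y_def[abs_def] by (intro nrm_triangle SS_mult SS_scale SS_F SS_rho dF dr)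
    also have "nrm Z (\<lambda>x. 2 * (deriv F x * rho x)) = 2 * nrm Z (\<lambda>x. rho x * deriv F x)"
      unfolding nrm_scale by (simp add: mult.commute)
    also have "nrm Z (\<lambda>x. rho x * deriv F x) \<le> M * (L * ?N)"
      using nrm_mult_le[OF SS_rho dF rho_M] mult_left_mono[OF nrm_deriv_F M(1)] by linarith
    also have "nrm Z (\<lambda>x. F x * deriv rho x) \<le> (L * M) * ?N"
      by (rule nrm_mult_le[OF SS_F dr F_M])
    finally show ?thesis by (simp add: mult_ac)
  qed
  have first: "\<bar>ip Z (\<lambda>x. F x * rho x) (Aop Z al be Y)\<bar> \<le> L ^ 3 * (c\<^sup>2 * a\<^sup>2) + 6 * L ^ 3 * (M\<^sup>2 * S)"
  proof -
    have Frho: "F x * rho x = al * c\<^sup>2 + k x" for x by (simp add: k_def fl_def r_def c_def power2_eq_square algebra_simps)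
    have "ip Z (\<lambda>x. F x * rho x) (Aop Z al be Y) = al * al * c\<^sup>2 * (be * a\<^sup>2) + ip Z k (Aop Z al be Y)"
    proof (cases Z)
      case Line
      then show ?thesis using c_line[OF Line] Frho by (simp add: ip_def)
    next
      case Circle
      have Yc: "SS Circle Y" using SS_Y Circle by simp
      have i: "integrable (space_measure Z) (Aop Z al be Y)" using SS_integrable_circle[OF SS_Aop[OF Yc]] Circle by simp
      have "ip Z (\<lambda>x. F x * rho x) (Aop Z al be Y) = al * c\<^sup>2 * space_int Z (Aop Z al be Y) + ip Z k (Aop Z al be Y)"
        unfolding ip_def space_int_def Frho distrib_right using i SS_integrable_mult[OF SSk SS_Aop[OF SS_Y]] by simp
      also have "space_int Z (Aop Z al be Y) = al * space_int Z Y"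
        using space_int_Aop_circle[OF Yc, of al be] Circle by simp
      also have "space_int Z Y = be * a\<^sup>2" unfolding int_Y abd_square ..
      finally show ?thesis by (simp add: mult_ac)
    qed
    moreover have "\<bar>al * al * c\<^sup>2 * (be * a\<^sup>2)\<bar> \<le> L ^ 3 * (c\<^sup>2 * a\<^sup>2)"
    proof -
      have "\<bar>al\<bar> * \<bar>al\<bar> * \<bar>be\<bar> \<le> L * L * L" using al_le L_nonneg by (intro mult_mono) auto
      then have "(\<bar>al\<bar> * \<bar>al\<bar> * \<bar>be\<bar>) * (c\<^sup>2 * a\<^sup>2) \<le> (L * L * L) * (c\<^sup>2 * a\<^sup>2)" by (intro mult_right_mono) auto
      then show ?thesis by (simp add: abs_mult power3_eq_cube mult_ac)
    qed
    moreover have "\<bar>ip Z k (Aop Z al be Y)\<bar> \<le> 6 * L ^ 3 * (M\<^sup>2 * S)"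
    proof -
      have "\<bar>ip Z k (Aop Z al be Y)\<bar> \<le> nrm Z k * nrm Z (Aop Z al be Y)" by (intro ip_le SSk SS_Aop SS_Y)
      also have "\<dots> \<le> (2 * (L * M) * ?R) * (L * (3 * (L * M) * ?N))"
      proof (intro mult_mono nk)
        show "nrm Z (Aop Z al be Y) \<le> L * (3 * (L * M) * ?N)"
          using nrm_Aop_le[OF SS_Y, of al be] mult_left_mono[OF nY L_nonneg] unfolding L_def by linarith
      qed (use LM in auto)
      also have "\<dots> = 6 * L ^ 3 * (M\<^sup>2 * S)" by (simp add: S_def power2_eq_square power3_eq_cube mult_ac)
      finally show ?thesis .
    qed
    ultimately show ?thesis by linarith
  qed
  have second: "\<bar>ip Z (\<lambda>x. F x * F x) Y\<bar> \<le> L ^ 3 * (M\<^sup>2 * S)"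
  proof -
    define F3 where "F3 x = F x * (F x * F x)" for x
    have SSF3: "SS Z F3" unfolding F3_def[abs_def] by (intro SS_mult SS_F)
    have dF3: "deriv F3 = (\<lambda>x. 3 * (F x * F x * deriv F x))"
      unfolding F3_def[abs_def]
      by (intro ext DERIV_imp_deriv) (auto intro!: derivative_eq_intros DERIVs simp: algebra_simps)
    have FFY: "F x * F x * Y x = 2/3 * (deriv F3 x * rho x) + F3 x * deriv rho x" for x
      unfolding dF3 F3_def Y_def by (simp add: algebra_simps)
    have i: "integrable (space_measure Z) (\<lambda>x. deriv F3 x * rho x)" "integrable (space_measure Z) (\<lambda>x. F3 x * deriv rho x)"
      by (intro SS_integrable_mult SS_deriv SSF3 SS_rho)+
    have "ip Z (\<lambda>x. F x * F x) Y = 2/3 * ip Z (deriv F3) rho + ip Z F3 (deriv rho)"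
      unfolding ip_def FFY space_int_def using i by simp
    also have "\<dots> = 1/3 * ip Z F3 (deriv rho)" using ip_by_parts[OF SSF3 SS_rho] by simp
    finally have eq: "ip Z (\<lambda>x. F x * F x) Y = 1/3 * ip Z F3 (deriv rho)" .
    let ?g = "al * c"
    have dri: "integrable (space_measure Z) (deriv rho)" using SS1_rho by (simp add: SS1_def)
    have eq2: "ip Z F3 (deriv rho) = space_int Z (\<lambda>x. F3 x * deriv rho x - ?g ^ 3 * deriv rho x)"
      unfolding ip_def space_int_def using i(2) dri SS1_int_deriv[OF SS1_rho] by (simp add: space_int_def)
    have "\<bar>ip Z F3 (deriv rho)\<bar> \<le> space_int Z (\<lambda>x. 3 * (L * M)\<^sup>2 * \<bar>fl x * deriv rho x\<bar>)"
      unfolding eq2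
    proof (rule order_trans[OF SS_abs_int_le space_int_mono])
      show "integrable (space_measure Z) (\<lambda>x. \<bar>F3 x * deriv rho x - ?g ^ 3 * deriv rho x\<bar>)" using i(2) dri by simp
      show "integrable (space_measure Z) (\<lambda>x. 3 * (L * M)\<^sup>2 * \<bar>fl x * deriv rho x\<bar>)"
        using SS_integrable_mult[OF SS_fl dr] by auto
      show "\<bar>F3 x * deriv rho x - ?g ^ 3 * deriv rho x\<bar> \<le> 3 * (L * M)\<^sup>2 * \<bar>fl x * deriv rho x\<bar>" for x
      proof -
        have g: "\<bar>?g\<bar> \<le> L * M" unfolding abs_mult using al_le c_nonneg M L_nonneg by (intro mult_mono) auto
        have "\<bar>F x * F x + F x * ?g + ?g * ?g\<bar> \<le> \<bar>F x\<bar> * \<bar>F x\<bar> + \<bar>F x\<bar> * \<bar>?g\<bar> + \<bar>?g\<bar> * \<bar>?g\<bar>"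
          unfolding abs_mult[symmetric]
          using abs_triangle_ineq[of "F x * F x + F x * ?g" "?g * ?g"] abs_triangle_ineq[of "F x * F x" "F x * ?g"] by argo
        also have "\<dots> \<le> (L * M) * (L * M) + (L * M) * (L * M) + (L * M) * (L * M)"
          by (intro add_mono mult_mono F_M g LM) auto
        finally have u: "\<bar>F x * F x + F x * ?g + ?g * ?g\<bar> \<le> 3 * (L * M)\<^sup>2" by (simp add: power2_eq_square mult_ac)
        have "F3 x * deriv rho x - ?g ^ 3 * deriv rho x = (F x * F x + F x * ?g + ?g * ?g) * (fl x * deriv rho x)"
          by (simp add: F3_def fl_def power3_eq_cube algebra_simps)
        then show ?thesis unfolding abs_mult[of "F x * F x + F x * ?g + ?g * ?g"] using u by (simp add: abs_mult mult_right_mono)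
      qed
    qed
    also have "\<dots> = 3 * (L * M)\<^sup>2 * space_int Z (\<lambda>x. \<bar>fl x * deriv rho x\<bar>)" by (simp add: space_int_def)
    also have "\<dots> \<le> 3 * (L * M)\<^sup>2 * ((L * ?R) * ?N)"
    proof (rule mult_left_mono)
      show "space_int Z (\<lambda>x. \<bar>fl x * deriv rho x\<bar>) \<le> (L * ?R) * ?N"
        using SS_Cauchy_Schwarz[OF SS_fl dr] mult_right_mono[OF nrm_fl, of ?N] by simp
    qed simp
    also have "\<dots> = 3 * (L ^ 3 * (M\<^sup>2 * S))" by (simp add: S_def power2_eq_square power3_eq_cube mult_ac)
    finally show ?thesis unfolding eq by simp
  qed
  have M2: "M\<^sup>2 \<le> 2 * c\<^sup>2 + 4 * S"
    using norm_add_square_le[of c sr] unfolding real_norm_def power2_abs sr_square by (simp add: M_def)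
  have L3: "L ^ 3 \<ge> 0" using L_nonneg by simp
  have "\<bar>octic\<bar> \<le> 9/8 * (L ^ 3 * (c\<^sup>2 * a\<^sup>2) + 6 * L ^ 3 * (M\<^sup>2 * S)) + 9/16 * (L ^ 3 * (M\<^sup>2 * S))"
    unfolding octic_def by (rule octic_arithmetic[OF first second])
  also have "\<dots> \<le> 2 * (L ^ 3 * (c\<^sup>2 * a\<^sup>2)) + 8 * (L ^ 3 * (M\<^sup>2 * S))"
  proof -
    have key: "9/8 * (u + 6 * v) + 9/16 * v \<le> 2 * u + 8 * v" if "u \<ge> 0" "v \<ge> 0" for u v :: real
      using that by argo
    have "0 \<le> L ^ 3 * (c\<^sup>2 * a\<^sup>2)" "0 \<le> L ^ 3 * (M\<^sup>2 * S)" using L3 S_nonneg by simp_all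
    from key[OF this] show ?thesis by (simp only: mult.assoc)
  qed
  also have "\<dots> \<le> 2 * (L ^ 3 * (c\<^sup>2 * a\<^sup>2)) + 8 * (L ^ 3 * ((2 * c\<^sup>2 + 4 * S) * S))"
    using M2 S_nonneg L3 by (intro add_left_mono mult_left_mono mult_right_mono) auto
  also have "\<dots> \<le> 32 * L ^ 3 * (c\<^sup>2 * a\<^sup>2 + c\<^sup>2 * S + S\<^sup>2)"
  proof -
    have nn: "0 \<le> L ^ 3 * (c\<^sup>2 * a\<^sup>2)" "0 \<le> L ^ 3 * (c\<^sup>2 * S)" using L3 S_nonneg by simp_all
    have e1: "2 * (L ^ 3 * (c\<^sup>2 * a\<^sup>2)) + 8 * (L ^ 3 * ((2 * c\<^sup>2 + 4 * S) * S))
      = 2 * (L ^ 3 * (c\<^sup>2 * a\<^sup>2)) + 16 * (L ^ 3 * (c\<^sup>2 * S)) + 32 * (L ^ 3 * S\<^sup>2)"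
      by (simp add: algebra_simps power2_eq_square)
    have e2: "32 * L ^ 3 * (c\<^sup>2 * a\<^sup>2 + c\<^sup>2 * S + S\<^sup>2)
      = 32 * (L ^ 3 * (c\<^sup>2 * a\<^sup>2)) + 32 * (L ^ 3 * (c\<^sup>2 * S)) + 32 * (L ^ 3 * S\<^sup>2)"
      by (simp add: algebra_simps)
    show ?thesis unfolding e1 e2 using nn by argo
  qed
  finally show ?thesis .
qed

end

context profile
begin

section \<open>Dissipation of the gauged energy\<close>

definition Q :: real where "Q = sqrt (1 + m\<^sup>2)"
definition s :: real where "s = sqrt (b\<^sup>2 + d\<^sup>2)"

lemma Q_square: "Q\<^sup>2 = 1 + m\<^sup>2" unfolding Q_def by simp
lemma Q_ge: "Q \<ge> 1" "m \<le> Q" unfolding Q_def by (auto intro: real_le_rsqrt)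
lemma s_nonneg: "s \<ge> 0" by (simp add: s_def)
lemma s_square: "s\<^sup>2 = b\<^sup>2 + d\<^sup>2" by (simp add: s_def)
lemma s_ge: "b \<le> s" "d \<le> s" unfolding s_def by (auto intro: real_le_rsqrt)
lemma y_nonneg: "0 \<le> a * E" using abd_nonneg EN_nonneg by simp

lemma mean_half_norms_le: "(c * a * d) ^ 1 \<le> 1 * Q ^ 1 * (a * E) ^ 1 * s ^ 1"
proof -
  have "c * a * d \<le> (m * E) * a * d"
    unfolding c_def using smean_rho_le[of w1 w2] abd_nonneg by (intro mult_right_mono) auto
  also have "\<dots> = m * (a * E) * d" by simp
  also have "\<dots> \<le> Q * (a * E) * s"
    using Q_ge s_ge y_nonneg abd_nonneg m_nonneg
    by (intro mult_mono[OF mult_right_mono]) auto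
  finally show ?thesis by simp
qed

lemma fluctuation_product_le: "(sr * nrm Z (deriv rho) * nrm Z j) ^ 6 \<le> (768 * (2 + 4 * L) ^ 3) * Q ^ 13 * (a * E) ^ 5 * s ^ 7"
proof -
  let ?C = "2 + 4 * L"
  have C: "?C \<ge> 0" using L_nonneg by simp
  have "(sr * nrm Z (deriv rho) * nrm Z j) ^ 6 = ((sr\<^sup>2 * (nrm Z (deriv rho))\<^sup>2) * (nrm Z j)\<^sup>2) ^ 3"
    by (simp add: power_mult_distrib power_mult[symmetric])
  also have "\<dots> \<le> ((2 * S) * (a * b) * (2 * (m * E1) * d)) ^ 3"
    unfolding sr_square using nrm_deriv_rho_le_half nrm_j_le S_nonneg abd_nonneg
    by (intro power_mono mult_mono) auto
  also have "\<dots> = 64 * S ^ 3 * (a * b) ^ 3 * (m * E1 * d) ^ 3" by (simp add: power_mult_distrib)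
  also have "\<dots> \<le> 64 * (12 * m ^ 4 * E\<^sup>2 * a\<^sup>2 * b) * (a * b) ^ 3 * (m * (?C * Q\<^sup>2 * E) * d) ^ 3"
  proof (intro mult_mono power_mono order.refl S_cube_le)
    show "E1 \<le> ?C * Q\<^sup>2 * E" unfolding Q_square by (rule E1_le)
  qed (use abd_nonneg m_nonneg EN_nonneg S_nonneg L_nonneg in auto)
  also have "\<dots> = 768 * ?C ^ 3 * (m ^ 7 * Q ^ 6) * (a * E) ^ 5 * (b ^ 4 * d ^ 3)"
    by (simp add: power_mult_distrib eval_nat_numeral mult_ac)
  also have "\<dots> \<le> 768 * ?C ^ 3 * (Q ^ 7 * Q ^ 6) * (a * E) ^ 5 * (s ^ 4 * s ^ 3)"
    using Q_ge s_ge abd_nonneg m_nonneg y_nonneg C s_nonneg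
    by (intro mult_mono power_mono order.refl) auto
  finally show ?thesis by (simp add: power_add[symmetric])
qed

lemma kap_c: "c\<^sup>2 * m ^ 4 \<le> m ^ 5 * E ^ 3"
proof -
  have "c \<le> kap Z * m\<^sup>2" unfolding c_def by (rule smean_rho)
  then have "c\<^sup>2 \<le> (kap Z * m\<^sup>2)\<^sup>2" using c_nonneg by (intro power_mono)
  then have "c\<^sup>2 * m ^ 4 \<le> (kap Z * m\<^sup>2)\<^sup>2 * m ^ 4" by (rule mult_right_mono) simp
  also have "\<dots> = m ^ 5 * (kap Z * m) ^ 3" by (simp add: kap_def power2_eq_square eval_nat_numeral)
  also have "\<dots> \<le> m ^ 5 * E ^ 3"
    using kap_m_le_EN kap_nonneg m_nonneg by (intro mult_left_mono power_mono) auto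
  finally show ?thesis .
qed

lemma mean_fluctuation_le: "(c\<^sup>2 * S) ^ 2 \<le> 1 * Q ^ 5 * (a * E) ^ 3 * s ^ 1"
proof -
  have "(c\<^sup>2 * S) ^ 2 = c\<^sup>2 * (c * nrm Z r)\<^sup>2 * (nrm Z (deriv rho))\<^sup>2"
    by (simp add: S_def power2_eq_square)
  also have "\<dots> \<le> c\<^sup>2 * (m\<^sup>2 * a)\<^sup>2 * (a * b)"
  proof (rule mult_mono[OF mult_left_mono nrm_deriv_rho_le_half])
    show "(c * nrm Z r)\<^sup>2 \<le> (m\<^sup>2 * a)\<^sup>2"
      using smean_fluct c_nonneg by (intro power_mono) (auto simp: c_def)
  qed auto
  also have "\<dots> = (c\<^sup>2 * m ^ 4) * a ^ 3 * b" by (simp add: power2_eq_square eval_nat_numeral)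
  also have "\<dots> \<le> (m ^ 5 * E ^ 3) * a ^ 3 * b"
    using kap_c abd_nonneg by (intro mult_right_mono) auto
  also have "\<dots> = m ^ 5 * (a * E) ^ 3 * b" by (simp add: power_mult_distrib)
  also have "\<dots> \<le> Q ^ 5 * (a * E) ^ 3 * s"
    using Q_ge s_ge abd_nonneg m_nonneg y_nonneg by (intro mult_mono power_mono order.refl) auto
  finally show ?thesis by simp
qed

lemma fluctuation_square_le: "(S\<^sup>2) ^ 3 \<le> 144 * Q ^ 8 * (a * E) ^ 4 * s ^ 2"
proof -
  have "(S\<^sup>2) ^ 3 = (S ^ 3)\<^sup>2" by (simp add: power_mult[symmetric])
  also have "\<dots> \<le> (12 * m ^ 4 * E\<^sup>2 * a\<^sup>2 * b)\<^sup>2" using S_cube_le S_nonneg by (intro power_mono) auto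
  also have "\<dots> = 144 * m ^ 8 * (a * E) ^ 4 * b ^ 2" by (simp add: power_mult_distrib power_mult[symmetric])
  also have "\<dots> \<le> 144 * Q ^ 8 * (a * E) ^ 4 * s ^ 2"
    using Q_ge s_ge abd_nonneg m_nonneg y_nonneg by (intro mult_mono power_mono order.refl) auto
  finally show ?thesis .
qed

lemma momentum_mean_le: "\<bar>smean Z J\<bar> * a\<^sup>2 \<le> (2 + 4 * L) * Q ^ 6 * (a * E)\<^sup>2"
proof -
  have "\<bar>smean Z J\<bar> * a\<^sup>2 \<le> ((2 + 4 * L) * Q ^ 2 * E\<^sup>2) * a\<^sup>2"
    unfolding Q_square by (intro mult_right_mono smean_J_le') auto
  also have "\<dots> \<le> ((2 + 4 * L) * Q ^ 6 * E\<^sup>2) * a\<^sup>2"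
    using Q_ge L_nonneg by (intro mult_right_mono mult_left_mono power_increasing) auto
  finally show ?thesis by (simp add: power_mult_distrib mult_ac)
qed

lemma mean_square_le: "c\<^sup>2 * a\<^sup>2 \<le> Q ^ 6 * (a * E)\<^sup>2"
proof -
  have "c\<^sup>2 * a\<^sup>2 \<le> (m * E)\<^sup>2 * a\<^sup>2"
    unfolding c_def using smean_rho_le smean_rho(1) by (intro mult_right_mono power_mono) auto
  also have "\<dots> = m\<^sup>2 * (a * E)\<^sup>2" by (simp add: power_mult_distrib)
  also have "\<dots> \<le> Q\<^sup>2 * (a * E)\<^sup>2"
    using Q_ge m_nonneg by (intro mult_right_mono power_mono) auto
  also have "\<dots> \<le> Q ^ 6 * (a * E)\<^sup>2"
    using Q_ge by (intro mult_right_mono power_increasing) auto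
  finally show ?thesis .
qed

end

definition dissipation_constant :: "real \<Rightarrow> real \<Rightarrow> real \<Rightarrow> bool" where
  "dissipation_constant al be K \<longleftrightarrow> K > 0 \<and> (\<forall>Z p q. profile Z p q \<longrightarrow>
    2 * space_int Z (\<lambda>x. profile.w1 Z al be p q x * profile.w1t Z al be p q x + profile.w2 Z al be p q x * profile.w2t Z al be p q x)
      + kap Z * (be * hs Z (profile.rho p q))
    \<le> be / 8 * hs Z (deriv (profile.rho p q))
      + K * (1 + (profile.m Z p q)\<^sup>2) ^ 3 * (profile.EN Z p q (profile.w1 Z al be p q) (profile.w2 Z al be p q))\<^sup>2 * hs Z (profile.rho p q))"

text \<open>
  Of the six monomials left by sextic_le and octic_le two already contain (a E)^2; the other four
  are put in the form required by weighted_Young, with y = a E, s^2 = b^2 + d^2 and q^2 = 1 + m^2.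
  The value of eps makes their remainders add up to half of the dissipation (be/4) b^2, while 3 be
  d^2 more than pays for those in d.
\<close>

theorem energy_dissipation:
  fixes al be :: real
  assumes be: "be < 0"
  shows "\<exists>K. dissipation_constant al be K"
proof -
  define L where outer_L: "L = \<bar>al\<bar> + \<bar>be\<bar>"
  have L: "L > 0" using be by (simp add: outer_L)
  define A where "A = 10 * L\<^sup>2 + 32 * L ^ 3"
  have A: "A > 0" "10 * L\<^sup>2 \<le> A" "32 * L ^ 3 \<le> A" using L by (auto simp: A_def add_pos_pos)
  define eps where "eps = - be / (32 * A)"
  have eps: "eps > 0" using be A(1) divide_neg_pos[of be "32 * A"] by (simp add: eps_def)
  obtain K1 where K1: "K1 > 0" "\<And>x y s q. x \<ge> 0 \<Longrightarrow> y \<ge> 0 \<Longrightarrow> s \<ge> 0 \<Longrightarrow> q \<ge> 1 \<Longrightarrow> x ^ 1 \<le> 1 * q ^ 1 * y ^ 1 * s ^ 1 \<Longrightarrow> x \<le> eps * s\<^sup>2 + K1 * q ^ 6 * y\<^sup>2"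
    using weighted_Young[OF zero_less_one eps, of 1 1 1 1 1] by auto
  have P0: "768 * (2 + 4 * L) ^ 3 > 0" using L by (simp add: add_pos_pos)
  obtain K2 where K2: "K2 > 0" "\<And>x y s q. x \<ge> 0 \<Longrightarrow> y \<ge> 0 \<Longrightarrow> s \<ge> 0 \<Longrightarrow> q \<ge> 1 \<Longrightarrow> x ^ 6 \<le> (768 * (2 + 4 * L) ^ 3) * q ^ 13 * y ^ 5 * s ^ 7 \<Longrightarrow> x \<le> eps * s\<^sup>2 + K2 * q ^ 6 * y\<^sup>2"
    using weighted_Young[OF P0 eps, of 6 5 7 13 3] by auto
  obtain K3 where K3: "K3 > 0" "\<And>x y s q. x \<ge> 0 \<Longrightarrow> y \<ge> 0 \<Longrightarrow> s \<ge> 0 \<Longrightarrow> q \<ge> 1 \<Longrightarrow> x ^ 2 \<le> 1 * q ^ 5 * y ^ 3 * s ^ 1 \<Longrightarrow> x \<le> eps * s\<^sup>2 + K3 * q ^ 6 * y\<^sup>2"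
    using weighted_Young[OF zero_less_one eps, of 2 3 1 5 2] by auto
  have P4: "(144::real) > 0" by simp
  obtain K4 where K4: "K4 > 0" "\<And>x y s q. x \<ge> 0 \<Longrightarrow> y \<ge> 0 \<Longrightarrow> s \<ge> 0 \<Longrightarrow> q \<ge> 1 \<Longrightarrow> x ^ 3 \<le> 144 * q ^ 8 * y ^ 4 * s ^ 2 \<Longrightarrow> x \<le> eps * s\<^sup>2 + K4 * q ^ 6 * y\<^sup>2"
    using weighted_Young[OF P4 eps, of 3 4 2 8 2] by auto
  define K where "K = A * (K1 + K2 + K3 + K4 + (2 + 4 * L) + 1)"
  have K: "K > 0" using A L K1 K2 K3 K4 by (simp add: K_def)
  show ?thesis
    unfolding dissipation_constant_def
  proof (intro exI[of _ K] conjI K allI impI)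
    fix Z p q assume "profile Z p q"
    then interpret profile Z al be p q .
    have LL: "local.L = L" by (simp add: L_def outer_L)
    let ?R = "Q ^ 6 * (a * E)\<^sup>2"
    have y1: "c * a * d \<le> eps * s\<^sup>2 + K1 * Q ^ 6 * (a * E)\<^sup>2"
      by (rule K1(2)[OF _ y_nonneg s_nonneg Q_ge(1) mean_half_norms_le]) (use c_nonneg abd_nonneg in simp)
    have y2: "sr * nrm Z (deriv rho) * nrm Z j \<le> eps * s\<^sup>2 + K2 * Q ^ 6 * (a * E)\<^sup>2"
      by (rule K2(2)[OF _ y_nonneg s_nonneg Q_ge(1) fluctuation_product_le[unfolded LL]]) (use sr_nonneg in simp)
    have y3: "c\<^sup>2 * S \<le> eps * s\<^sup>2 + K3 * Q ^ 6 * (a * E)\<^sup>2"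
      by (rule K3(2)[OF _ y_nonneg s_nonneg Q_ge(1) mean_fluctuation_le]) (use S_nonneg in simp)
    have y4: "S\<^sup>2 \<le> eps * s\<^sup>2 + K4 * Q ^ 6 * (a * E)\<^sup>2"
      by (rule K4(2)[OF _ y_nonneg s_nonneg Q_ge(1) fluctuation_square_le]) simp
    note y5 = momentum_mean_le[unfolded LL] and y6 = mean_square_le
    have n: "0 \<le> c * a * d + sr * nrm Z (deriv rho) * nrm Z j + \<bar>smean Z J\<bar> * a\<^sup>2" "0 \<le> c\<^sup>2 * a\<^sup>2 + c\<^sup>2 * S + S\<^sup>2"
      using c_nonneg abd_nonneg sr_nonneg S_nonneg by (auto intro!: add_nonneg_nonneg)
    have "\<bar>sextic\<bar> + \<bar>octic\<bar> \<le> 10 * L\<^sup>2 * (c * a * d + sr * nrm Z (deriv rho) * nrm Z j + \<bar>smean Z J\<bar> * a\<^sup>2) + 32 * L ^ 3 * (c\<^sup>2 * a\<^sup>2 + c\<^sup>2 * S + S\<^sup>2)"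
      using sextic_le octic_le unfolding LL by (rule add_mono)
    also have "\<dots> \<le> A * (c * a * d + sr * nrm Z (deriv rho) * nrm Z j + \<bar>smean Z J\<bar> * a\<^sup>2) + A * (c\<^sup>2 * a\<^sup>2 + c\<^sup>2 * S + S\<^sup>2)"
      using A n by (intro add_mono mult_right_mono) auto
    also have "\<dots> = A * (c * a * d + sr * nrm Z (deriv rho) * nrm Z j + \<bar>smean Z J\<bar> * a\<^sup>2 + (c\<^sup>2 * a\<^sup>2 + c\<^sup>2 * S + S\<^sup>2))"
      by (rule distrib_left[symmetric])
    also have "\<dots> \<le> A * (4 * (eps * s\<^sup>2) + (K1 + K2 + K3 + K4 + (2 + 4 * L) + 1) * ?R)"
    proof (rule mult_left_mono)
      have e: "(K1 + K2 + K3 + K4 + (2 + 4 * L) + 1) * ?R = K1 * Q ^ 6 * (a * E)\<^sup>2 + K2 * Q ^ 6 * (a * E)\<^sup>2 + K3 * Q ^ 6 * (a * E)\<^sup>2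
          + K4 * Q ^ 6 * (a * E)\<^sup>2 + (2 + 4 * L) * Q ^ 6 * (a * E)\<^sup>2 + Q ^ 6 * (a * E)\<^sup>2"
        by (simp only: distrib_right mult.assoc mult_1)
      show "c * a * d + sr * nrm Z (deriv rho) * nrm Z j + \<bar>smean Z J\<bar> * a\<^sup>2 + (c\<^sup>2 * a\<^sup>2 + c\<^sup>2 * S + S\<^sup>2)
        \<le> 4 * (eps * s\<^sup>2) + (K1 + K2 + K3 + K4 + (2 + 4 * L) + 1) * ?R"
        unfolding e using y1 y2 y3 y4 y5 y6 by argo
    qed (use A in simp)
    also have "\<dots> = - be / 8 * s\<^sup>2 + K * ?R"
    proof -
      have "4 * (A * eps) = - be / 8" using A(1) by (simp add: eps_def)
      then have "A * (4 * (eps * s\<^sup>2)) = - be / 8 * s\<^sup>2" by (metis mult.assoc mult.left_commute)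
      then show ?thesis by (simp only: K_def mult.assoc distrib_left[of A "4 * (eps * s\<^sup>2)"])
    qed
    finally have TT: "\<bar>sextic\<bar> + \<bar>octic\<bar> \<le> - be / 8 * (b\<^sup>2 + d\<^sup>2) + K * ?R" unfolding s_square .
    have R: "?R = (1 + m\<^sup>2) ^ 3 * E\<^sup>2 * a\<^sup>2"
    proof -
      have "Q ^ 6 = (Q\<^sup>2) ^ 3" by (simp add: power_mult[symmetric])
      then show ?thesis by (simp add: Q_square power_mult_distrib mult_ac)
    qed
    have neg: "be * d\<^sup>2 \<le> 0" "be * b\<^sup>2 \<le> 0" "kap Z * (be * a\<^sup>2) \<le> 0"
      using be kap_nonneg by (auto simp: mult_le_0_iff)
    have "2 * space_int Z (\<lambda>x. w1 x * w1t x + w2 x * w2t x) + kap Z * (be * a\<^sup>2) \<le> be / 8 * b\<^sup>2 + K * ?R"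
      unfolding energy_identity abd_square[symmetric]
      using TT neg by (simp add: algebra_simps abs_le_iff)
    then show "2 * space_int Z (\<lambda>x. w1 x * w1t x + w2 x * w2t x) + kap Z * (be * hs Z rho)
      \<le> be / 8 * hs Z (deriv rho) + K * (1 + m\<^sup>2) ^ 3 * E\<^sup>2 * hs Z rho"
      unfolding R abd_square[symmetric] by (simp add: mult.assoc)
  qed
qed

section \<open>Curves differentiable in the first-order Sobolev norm\<close>

definition H1_norm :: "domain \<Rightarrow> (real \<Rightarrow> real) \<Rightarrow> real" where
  "H1_norm Z f = nrm Z f + nrm Z (deriv f)"

lemma H1_norm_nonneg [simp]: "H1_norm Z f \<ge> 0"
  by (simp add: H1_norm_def)

lemma nrm_le_H1_norm: "nrm Z f \<le> H1_norm Z f" "nrm Z (deriv f) \<le> H1_norm Z f"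
  by (simp_all add: H1_norm_def)

lemma H1_norm_scale: "SS Z f \<Longrightarrow> H1_norm Z (\<lambda>x. c * f x) = \<bar>c\<bar> * H1_norm Z f"
  by (simp add: H1_norm_def deriv_SS_scale nrm_scale distrib_left)

lemma H1_norm_add_le:
  assumes f: "SS Z f" and g: "SS Z g"
  shows "H1_norm Z (\<lambda>x. f x + g x) \<le> H1_norm Z f + H1_norm Z g"
  unfolding H1_norm_def deriv_SS_add[OF f g]
  using nrm_triangle[OF f g] nrm_triangle[OF SS_deriv[OF f] SS_deriv[OF g]] by argo

lemma sup_le_H1_norm:
  assumes f: "SS Z f"
  shows "\<bar>f x\<bar> \<le> H1_norm Z f"
proof (rule power2_le_imp_le)
  have i: "integrable (space_measure Z) (\<lambda>x. f x * f x)" "integrable (space_measure Z) (\<lambda>x. 2 * (f x * deriv f x))"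
    using SS_integrable_mult[OF f f] SS_integrable_mult[OF f SS_deriv[OF f]] by auto
  have d: "((\<lambda>x. f x * f x) has_real_derivative 2 * (f x * deriv f x)) (at x)" for x
    using SS_DERIV[OF f] by (auto intro!: derivative_eq_intros)
  have "\<bar>f x * f x\<bar> \<le> space_int Z (\<lambda>x. \<bar>f x * f x\<bar>) + space_int Z (\<lambda>x. \<bar>2 * (f x * deriv f x)\<bar>)"
  proof (rule sup_le_L1[OF d _ i])
    show "continuous_on UNIV (\<lambda>x. 2 * (f x * deriv f x))"
      using SS_continuous[OF f] SS_continuous[OF SS_deriv[OF f]] by (intro continuous_intros)
    show "f (x + 2 * pi) * f (x + 2 * pi) = f x * f x" if "Z = Circle" for x
      using SS_periodic[of f x] f that by simp
  qed
  also have "\<dots> \<le> nrm Z f * nrm Z f + 2 * (nrm Z f * nrm Z (deriv f))"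
  proof (rule add_mono)
    show "space_int Z (\<lambda>x. \<bar>f x * f x\<bar>) \<le> nrm Z f * nrm Z f" by (rule SS_Cauchy_Schwarz[OF f f])
    have "space_int Z (\<lambda>x. \<bar>2 * (f x * deriv f x)\<bar>) = 2 * space_int Z (\<lambda>x. \<bar>f x * deriv f x\<bar>)"
      unfolding space_int_def by (simp add: abs_mult)
    then show "space_int Z (\<lambda>x. \<bar>2 * (f x * deriv f x)\<bar>) \<le> 2 * (nrm Z f * nrm Z (deriv f))"
      using SS_Cauchy_Schwarz[OF f SS_deriv[OF f]] by simp
  qed
  also have "\<dots> \<le> (H1_norm Z f)\<^sup>2" unfolding H1_norm_def by (simp add: power2_eq_square algebra_simps)
  finally show "\<bar>f x\<bar>\<^sup>2 \<le> (H1_norm Z f)\<^sup>2" by (simp add: power2_eq_square abs_mult)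
qed simp

text \<open>
  In dimension one this norm controls the supremum, which makes it submultiplicative up to a
  constant; hence the product rule below.
\<close>

lemma H1_norm_mult_le:
  assumes f: "SS Z f" and g: "SS Z g"
  shows "H1_norm Z (\<lambda>x. f x * g x) \<le> 3 * (H1_norm Z f * H1_norm Z g)"
proof -
  note d = SS_deriv[OF f] SS_deriv[OF g]
  have m: "nrm Z (\<lambda>x. k x * l x) \<le> H1_norm Z k * nrm Z l" if "SS Z k" "SS Z l" for k l
    by (rule nrm_mult_le) (use that sup_le_H1_norm in auto)
  have "nrm Z (\<lambda>x. deriv f x * g x + f x * deriv g x) \<le> nrm Z (\<lambda>x. g x * deriv f x) + nrm Z (\<lambda>x. f x * deriv g x)"
    using nrm_triangle[OF SS_mult[OF g d(1)] SS_mult[OF f d(2)]] by (simp add: mult.commute)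
  also have "\<dots> \<le> H1_norm Z g * nrm Z (deriv f) + H1_norm Z f * nrm Z (deriv g)"
    by (intro add_mono m f g d)
  also have "\<dots> \<le> H1_norm Z g * H1_norm Z f + H1_norm Z f * H1_norm Z g"
    by (intro add_mono mult_left_mono nrm_le_H1_norm) auto
  finally have 1: "nrm Z (\<lambda>x. deriv f x * g x + f x * deriv g x) \<le> 2 * (H1_norm Z f * H1_norm Z g)" by (simp add: mult.commute)
  have 2: "nrm Z (\<lambda>x. f x * g x) \<le> H1_norm Z f * H1_norm Z g"
    by (rule order_trans[OF m[OF f g]]) (intro mult_left_mono nrm_le_H1_norm, simp)
  show ?thesis unfolding H1_norm_def[of Z "\<lambda>x. f x * g x"] deriv_SS_mult[OF f g] using 1 2 by argo
qed

lemma H1_norm_Hil_le: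
  assumes f: "SS Z f"
  shows "H1_norm Z (Hil Z f) \<le> H1_norm Z f"
  unfolding H1_norm_def deriv_Hil[OF f] nrm_def
  by (intro add_mono real_sqrt_le_mono Hil_norm_le f SS_deriv)

definition defect :: "(real \<Rightarrow> real \<Rightarrow> real) \<Rightarrow> (real \<Rightarrow> real) \<Rightarrow> real \<Rightarrow> real \<Rightarrow> real \<Rightarrow> real" where
  "defect f g t s x = (f s x - f t x) / (s - t) - g x"

text \<open>
  Differentiability within I, with values in the first-order Sobolev space, of a curve of smooth
  functions. The space is chosen because it is an algebra on which the Hilbert transform acts; the
  gauged derivatives w1 and w2 need p, q and their first derivatives as such curves.
\<close>

definition H1_deriv :: "domain \<Rightarrow> real set \<Rightarrow> real \<Rightarrow> (real \<Rightarrow> real \<Rightarrow> real) \<Rightarrow> (real \<Rightarrow> real) \<Rightarrow> bool" where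
  "H1_deriv Z I t f g \<longleftrightarrow> t \<in> I \<and> (\<forall>s\<in>I. SS Z (f s)) \<and> SS Z g \<and> ((\<lambda>s. H1_norm Z (defect f g t s)) \<longlongrightarrow> 0) (at t within I)"

lemma SS_divide: "SS Z f \<Longrightarrow> SS Z (\<lambda>x. f x / c)"
  using SS_scale[of Z f "1/c"] by simp

lemma SS_defect: "SS Z (f s) \<Longrightarrow> SS Z (f t) \<Longrightarrow> SS Z g \<Longrightarrow> SS Z (defect f g t s)"
  unfolding defect_def[abs_def] by (intro SS_diff SS_divide)

lemma H1_derivD:
  assumes "H1_deriv Z I t f g"
  shows "t \<in> I" "s \<in> I \<Longrightarrow> SS Z (f s)" "SS Z (f t)" "SS Z g" "((\<lambda>s. H1_norm Z (defect f g t s)) \<longlongrightarrow> 0) (at t within I)"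
    "s \<in> I \<Longrightarrow> SS Z (defect f g t s)"
  using assms unfolding H1_deriv_def by (auto intro!: SS_defect)

lemma eventually_within: "(\<And>s. s \<in> I \<Longrightarrow> s \<noteq> t \<Longrightarrow> P s) \<Longrightarrow> eventually P (at t within I)"
  for t :: real
  unfolding eventually_at by (auto intro!: exI[of _ 1])

lemma H1_derivI:
  assumes "t \<in> I" "\<And>s. s \<in> I \<Longrightarrow> SS Z (f s)" "SS Z g"
    and bound: "\<And>s. s \<in> I \<Longrightarrow> s \<noteq> t \<Longrightarrow> H1_norm Z (defect f g t s) \<le> B s"
    and lim: "(B \<longlongrightarrow> 0) (at t within I)"
  shows "H1_deriv Z I t f g"
  unfolding H1_deriv_def
proof (intro conjI ballI assms(1-3))
  show "((\<lambda>s. H1_norm Z (defect f g t s)) \<longlongrightarrow> 0) (at t within I)"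
  proof (rule tendsto_sandwich[OF _ _ tendsto_const lim])
    show "\<forall>\<^sub>F s in at t within I. 0 \<le> H1_norm Z (defect f g t s)" by simp
    show "\<forall>\<^sub>F s in at t within I. H1_norm Z (defect f g t s) \<le> B s" by (rule eventually_within) (rule bound)
  qed
qed

lemma H1_deriv_add:
  assumes f: "H1_deriv Z I t f f'" and g: "H1_deriv Z I t g g'"
  shows "H1_deriv Z I t (\<lambda>s x. f s x + g s x) (\<lambda>x. f' x + g' x)"
proof (rule H1_derivI)
  fix s assume s: "s \<in> I"
  have "defect (\<lambda>s x. f s x + g s x) (\<lambda>x. f' x + g' x) t s = (\<lambda>x. defect f f' t s x + defect g g' t s x)"
    by (auto simp: defect_def add_divide_distrib diff_divide_distrib)
  then show "H1_norm Z (defect (\<lambda>s x. f s x + g s x) (\<lambda>x. f' x + g' x) t s) \<le> H1_norm Z (defect f f' t s) + H1_norm Z (defect g g' t s)"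
    using H1_norm_add_le[OF H1_derivD(6)[OF f s] H1_derivD(6)[OF g s]] by simp
next
  show "((\<lambda>s. H1_norm Z (defect f f' t s) + H1_norm Z (defect g g' t s)) \<longlongrightarrow> 0) (at t within I)"
    using tendsto_add[OF H1_derivD(5)[OF f] H1_derivD(5)[OF g]] by simp
qed (use H1_derivD[OF f] H1_derivD[OF g] in \<open>auto intro!: SS_add\<close>)

lemma H1_deriv_scale:
  assumes f: "H1_deriv Z I t f f'"
  shows "H1_deriv Z I t (\<lambda>s x. c * f s x) (\<lambda>x. c * f' x)"
proof (rule H1_derivI)
  fix s assume s: "s \<in> I"
  have "defect (\<lambda>s x. c * f s x) (\<lambda>x. c * f' x) t s = (\<lambda>x. c * defect f f' t s x)"
    by (auto simp: defect_def algebra_simps diff_divide_distrib)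
  then show "H1_norm Z (defect (\<lambda>s x. c * f s x) (\<lambda>x. c * f' x) t s) \<le> \<bar>c\<bar> * H1_norm Z (defect f f' t s)"
    using H1_norm_scale[OF H1_derivD(6)[OF f s]] by simp
next
  show "((\<lambda>s. \<bar>c\<bar> * H1_norm Z (defect f f' t s)) \<longlongrightarrow> 0) (at t within I)"
    using tendsto_mult_left[OF H1_derivD(5)[OF f], of "\<bar>c\<bar>"] by simp
qed (use H1_derivD[OF f] in \<open>auto intro!: SS_scale\<close>)

lemma H1_deriv_diff:
  assumes f: "H1_deriv Z I t f f'" and g: "H1_deriv Z I t g g'"
  shows "H1_deriv Z I t (\<lambda>s x. f s x - g s x) (\<lambda>x. f' x - g' x)"
  using H1_deriv_add[OF f H1_deriv_scale[OF g, of "-1"]] by simp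

text \<open>
  With e, k the defects of the factors and d the time step, both factors are rewritten at time s as
  their value at t plus d times the quotient; the defect of the product is then a sum of terms
  containing e, k or d.
\<close>

lemma H1_deriv_mult:
  assumes f: "H1_deriv Z I t f f'" and g: "H1_deriv Z I t g g'"
  shows "H1_deriv Z I t (\<lambda>s x. f s x * g s x) (\<lambda>x. f' x * g t x + f t x * g' x)"
proof (rule H1_derivI)
  fix s assume s: "s \<in> I" "s \<noteq> t"
  define e k d where "e = defect f f' t s" and "k = defect g g' t s" and "d = s - t"
  have d: "d \<noteq> 0" using s by (simp add: d_def)
  note S = H1_derivD(6)[OF f s(1), folded e_def] H1_derivD(6)[OF g s(1), folded k_def] H1_derivD(3,4)[OF f] H1_derivD(3,4)[OF g]
  have fs: "f s x = f t x + d * (e x + f' x)" and gs: "g s x = g t x + d * (k x + g' x)" for x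
    using d by (simp_all add: e_def k_def defect_def d_def)
  have eq: "defect (\<lambda>s x. f s x * g s x) (\<lambda>x. f' x * g t x + f t x * g' x) t s
      = (\<lambda>x. (e x * g t x + f t x * k x) + d * ((e x + f' x) * (k x + g' x)))"
  proof
    fix x
    have "f s x * g s x - f t x * g t x = d * ((e x + f' x) * g t x + f t x * (k x + g' x) + d * ((e x + f' x) * (k x + g' x)))"
      unfolding fs gs by (simp add: algebra_simps)
    then have "(f s x * g s x - f t x * g t x) / d = (e x + f' x) * g t x + f t x * (k x + g' x) + d * ((e x + f' x) * (k x + g' x))"
      using d by simp
    then show "defect (\<lambda>s x. f s x * g s x) (\<lambda>x. f' x * g t x + f t x * g' x) t s x
      = (e x * g t x + f t x * k x) + d * ((e x + f' x) * (k x + g' x))"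
      unfolding defect_def d_def[symmetric] by (simp add: algebra_simps)
  qed
  have "H1_norm Z (defect (\<lambda>s x. f s x * g s x) (\<lambda>x. f' x * g t x + f t x * g' x) t s)
    \<le> (H1_norm Z (\<lambda>x. e x * g t x) + H1_norm Z (\<lambda>x. f t x * k x)) + H1_norm Z (\<lambda>x. d * ((e x + f' x) * (k x + g' x)))"
    unfolding eq
    by (rule order_trans[OF H1_norm_add_le add_right_mono[OF H1_norm_add_le]]) (intro SS_intros S)+
  also have "H1_norm Z (\<lambda>x. d * ((e x + f' x) * (k x + g' x))) = \<bar>d\<bar> * H1_norm Z (\<lambda>x. (e x + f' x) * (k x + g' x))"
    by (intro H1_norm_scale SS_intros S)
  also have "H1_norm Z (\<lambda>x. e x * g t x) + H1_norm Z (\<lambda>x. f t x * k x) + \<bar>d\<bar> * H1_norm Z (\<lambda>x. (e x + f' x) * (k x + g' x))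
    \<le> 3 * (H1_norm Z e * H1_norm Z (g t)) + 3 * (H1_norm Z (f t) * H1_norm Z k) + \<bar>d\<bar> * (3 * ((H1_norm Z e + H1_norm Z f') * (H1_norm Z k + H1_norm Z g')))"
  proof (intro add_mono mult_left_mono H1_norm_mult_le S)
    have "H1_norm Z (\<lambda>x. (e x + f' x) * (k x + g' x)) \<le> 3 * (H1_norm Z (\<lambda>x. e x + f' x) * H1_norm Z (\<lambda>x. k x + g' x))"
      by (intro H1_norm_mult_le SS_intros S)
    also have "\<dots> \<le> 3 * ((H1_norm Z e + H1_norm Z f') * (H1_norm Z k + H1_norm Z g'))"
      by (intro mult_left_mono mult_mono H1_norm_add_le S) (auto intro: add_nonneg_nonneg)
    finally show "H1_norm Z (\<lambda>x. (e x + f' x) * (k x + g' x)) \<le> 3 * ((H1_norm Z e + H1_norm Z f') * (H1_norm Z k + H1_norm Z g'))" .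
  qed simp
  finally show "H1_norm Z (defect (\<lambda>s x. f s x * g s x) (\<lambda>x. f' x * g t x + f t x * g' x) t s)
    \<le> 3 * (H1_norm Z (defect f f' t s) * H1_norm Z (g t)) + 3 * (H1_norm Z (f t) * H1_norm Z (defect g g' t s))
      + \<bar>s - t\<bar> * (3 * ((H1_norm Z (defect f f' t s) + H1_norm Z f') * (H1_norm Z (defect g g' t s) + H1_norm Z g')))"
    unfolding e_def k_def d_def .
next
  have "((\<lambda>s. 3 * (H1_norm Z (defect f f' t s) * H1_norm Z (g t)) + 3 * (H1_norm Z (f t) * H1_norm Z (defect g g' t s))
      + \<bar>s - t\<bar> * (3 * ((H1_norm Z (defect f f' t s) + H1_norm Z f') * (H1_norm Z (defect g g' t s) + H1_norm Z g'))))
    \<longlongrightarrow> 3 * (0 * H1_norm Z (g t)) + 3 * (H1_norm Z (f t) * 0) + \<bar>t - t\<bar> * (3 * ((0 + H1_norm Z f') * (0 + H1_norm Z g')))) (at t within I)"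
    by (intro tendsto_intros H1_derivD(5)[OF f] H1_derivD(5)[OF g])
  then show "((\<lambda>s. 3 * (H1_norm Z (defect f f' t s) * H1_norm Z (g t)) + 3 * (H1_norm Z (f t) * H1_norm Z (defect g g' t s))
      + \<bar>s - t\<bar> * (3 * ((H1_norm Z (defect f f' t s) + H1_norm Z f') * (H1_norm Z (defect g g' t s) + H1_norm Z g')))) \<longlongrightarrow> 0) (at t within I)" by simp
qed (use H1_derivD[OF f] H1_derivD[OF g] in \<open>auto intro!: SS_add SS_mult\<close>)

lemma H1_deriv_Hil:
  assumes f: "H1_deriv Z I t f f'"
  shows "H1_deriv Z I t (\<lambda>s. Hil Z (f s)) (Hil Z f')"
proof (rule H1_derivI)
  fix s assume s: "s \<in> I"
  have "defect f f' t s = (\<lambda>x. 1 * (1 / (s - t) * f s x + (- 1 / (s - t)) * f t x) + (- 1) * f' x)"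
    by (auto simp: defect_def diff_divide_distrib)
  moreover have "SS Z (\<lambda>x. 1 / (s - t) * f s x + (- 1 / (s - t)) * f t x)"
    by (intro SS_add SS_scale H1_derivD[OF f] s)
  ultimately have "Hil Z (defect f f' t s) = (\<lambda>x. 1 * (1 / (s - t) * Hil Z (f s) x + (- 1 / (s - t)) * Hil Z (f t) x) + (- 1) * Hil Z f' x)"
    using H1_derivD(2)[OF f s] H1_derivD(3,4)[OF f] by (simp only: Hil_linear)
  then have "defect (\<lambda>s. Hil Z (f s)) (Hil Z f') t s = Hil Z (defect f f' t s)"
    by (auto simp: defect_def diff_divide_distrib)
  then show "H1_norm Z (defect (\<lambda>s. Hil Z (f s)) (Hil Z f') t s) \<le> H1_norm Z (defect f f' t s)"
    using H1_norm_Hil_le[OF H1_derivD(6)[OF f s]] by simp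
qed (use H1_derivD[OF f] in \<open>auto intro!: SS_Hil\<close>)

lemma H1_deriv_Aop: "H1_deriv Z I t f f' \<Longrightarrow> H1_deriv Z I t (\<lambda>s. Aop Z al be (f s)) (Aop Z al be f')"
  unfolding Aop_def[abs_def] by (intro H1_deriv_add H1_deriv_scale H1_deriv_Hil)

lemma H1_deriv_pointwise:
  assumes f: "H1_deriv Z I t f f'"
  shows "((\<lambda>s. f s x) has_real_derivative f' x) (at t within I)"
  unfolding has_field_derivative_iff
proof (rule LIM_zero_cancel, rule tendsto_rabs_zero_cancel, rule tendsto_sandwich[OF _ _ tendsto_const H1_derivD(5)[OF f]])
  show "\<forall>\<^sub>F s in at t within I. \<bar>(f s x - f t x) / (s - t) - f' x\<bar> \<le> H1_norm Z (defect f f' t s)"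
    by (rule eventually_within) (use sup_le_H1_norm[OF H1_derivD(6)[OF f]] in \<open>simp add: defect_def\<close>)
qed simp

lemma H1_deriv_norm_square:
  assumes f: "H1_deriv Z I t f f'"
  shows "((\<lambda>s. (nrm Z (f s))\<^sup>2) has_real_derivative 2 * space_int Z (\<lambda>x. f t x * f' x)) (at t within I)"
  unfolding has_field_derivative_iff
proof (rule LIM_zero_cancel, rule tendsto_rabs_zero_cancel, rule tendsto_sandwich[OF _ _ tendsto_const])
  let ?e = "\<lambda>s. H1_norm Z (defect f f' t s)"
  show "\<forall>\<^sub>F s in at t within I. \<bar>((nrm Z (f s))\<^sup>2 - (nrm Z (f t))\<^sup>2) / (s - t) - 2 * space_int Z (\<lambda>x. f t x * f' x)\<bar>
     \<le> 2 * (H1_norm Z (f t) * ?e s) + \<bar>s - t\<bar> * (?e s + H1_norm Z f')\<^sup>2"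
  proof (rule eventually_within)
    fix s assume s: "s \<in> I" "s \<noteq> t"
    define e d where "e = defect f f' t s" and "d = s - t"
    have d: "d \<noteq> 0" using s by (simp add: d_def)
    note S = H1_derivD(6)[OF f s(1), folded e_def] H1_derivD(3,4)[OF f]
    have fs: "f s x = f t x + d * (e x + f' x)" for x
      using d by (simp add: e_def defect_def d_def)
    note v = SS_add[OF S(1,3)]
    note i = SS_integrable_mult[OF S(2) S(2)] SS_integrable_mult[OF S(2) v] SS_integrable_mult[OF v v]
      SS_integrable_mult[OF S(2) S(1)] SS_integrable_mult[OF S(2) S(3)]
    have "(nrm Z (f s))\<^sup>2 = space_int Z (\<lambda>x. f t x * f t x + (2 * d) * (f t x * (e x + f' x)) + d\<^sup>2 * ((e x + f' x) * (e x + f' x)))"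
      unfolding nrm_square fs by (rule arg_cong[where f="space_int Z"]) (auto simp: power2_eq_square algebra_simps)
    also have "\<dots> = (nrm Z (f t))\<^sup>2 + (2 * d) * space_int Z (\<lambda>x. f t x * (e x + f' x)) + d\<^sup>2 * (nrm Z (\<lambda>x. e x + f' x))\<^sup>2"
      unfolding nrm_square space_int_def using i by (simp add: power2_eq_square)
    also have "space_int Z (\<lambda>x. f t x * (e x + f' x)) = space_int Z (\<lambda>x. f t x * e x) + space_int Z (\<lambda>x. f t x * f' x)"
      unfolding space_int_def distrib_left using i by simp
    finally have "((nrm Z (f s))\<^sup>2 - (nrm Z (f t))\<^sup>2) / d - 2 * space_int Z (\<lambda>x. f t x * f' x)
      = 2 * space_int Z (\<lambda>x. f t x * e x) + d * (nrm Z (\<lambda>x. e x + f' x))\<^sup>2"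
      using d by (simp add: field_simps power2_eq_square)
    also have "\<bar>2 * space_int Z (\<lambda>x. f t x * e x) + d * (nrm Z (\<lambda>x. e x + f' x))\<^sup>2\<bar>
      \<le> 2 * \<bar>space_int Z (\<lambda>x. f t x * e x)\<bar> + \<bar>d\<bar> * (nrm Z (\<lambda>x. e x + f' x))\<^sup>2"
      by (rule order_trans[OF abs_triangle_ineq]) (simp add: abs_mult)
    also have "\<dots> \<le> 2 * (H1_norm Z (f t) * H1_norm Z e) + \<bar>d\<bar> * (H1_norm Z e + H1_norm Z f')\<^sup>2"
    proof (intro add_mono mult_left_mono power_mono)
      show "\<bar>space_int Z (\<lambda>x. f t x * e x)\<bar> \<le> H1_norm Z (f t) * H1_norm Z e"
        by (rule order_trans[OF SS_Cauchy_Schwarz'[OF S(2) S(1)]]) (intro mult_mono nrm_le_H1_norm, auto)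
      show "nrm Z (\<lambda>x. e x + f' x) \<le> H1_norm Z e + H1_norm Z f'"
        by (rule order_trans[OF nrm_le_H1_norm(1) H1_norm_add_le[OF S(1,3)]])
    qed auto
    finally show "\<bar>((nrm Z (f s))\<^sup>2 - (nrm Z (f t))\<^sup>2) / (s - t) - 2 * space_int Z (\<lambda>x. f t x * f' x)\<bar>
     \<le> 2 * (H1_norm Z (f t) * ?e s) + \<bar>s - t\<bar> * (?e s + H1_norm Z f')\<^sup>2" unfolding e_def d_def .
  qed
  have "((\<lambda>s. 2 * (H1_norm Z (f t) * ?e s) + \<bar>s - t\<bar> * (?e s + H1_norm Z f')\<^sup>2) \<longlongrightarrow> 2 * (H1_norm Z (f t) * 0) + \<bar>t - t\<bar> * (0 + H1_norm Z f')\<^sup>2) (at t within I)"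
    by (intro tendsto_intros H1_derivD(5)[OF f])
  then show "((\<lambda>s. 2 * (H1_norm Z (f t) * ?e s) + \<bar>s - t\<bar> * (?e s + H1_norm Z f')\<^sup>2) \<longlongrightarrow> 0) (at t within I)" by simp
qed simp

lemma H1_deriv_cong:
  assumes f: "H1_deriv Z I t f f'" and eq: "\<And>s. s \<in> I \<Longrightarrow> f s = k s" and eq': "f' = k'"
  shows "H1_deriv Z I t k k'"
proof (rule H1_derivI[OF _ _ _ _ H1_derivD(5)[OF f]])
  fix s assume s: "s \<in> I"
  then have "defect k k' t s = defect f f' t s"
    using eq[of s] eq[of t] eq' H1_derivD(1)[OF f] by (simp add: defect_def[abs_def])
  then show "H1_norm Z (defect k k' t s) \<le> H1_norm Z (defect f f' t s)" by simp
  show "SS Z (k s)" using H1_derivD(2)[OF f s] eq[OF s] by simp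
qed (use H1_derivD[OF f] eq' in auto)

section \<open>Curves in all Sobolev spaces\<close>

definition weighted_norm :: "domain \<Rightarrow> nat \<Rightarrow> (real \<Rightarrow> complex) \<Rightarrow> real" where
  "weighted_norm Z k g = sqrt (1 / (2 * pi) * (LINT \<xi>|freq_measure Z. (1 + \<xi>\<^sup>2) ^ k * (cmod (g \<xi>))\<^sup>2))"

lemma sobolev_inf_rapid:
  assumes "f \<in> sobolev_inf Z"
  shows "f \<in> L2 Z" "rapid Z (fourier Z f)"
proof -
  have s: "f \<in> sobolev Z (real k)" for k using assms by (auto simp: sobolev_inf_def)
  show L: "f \<in> L2 Z" using s[of 0] by (simp add: sobolev_def)
  show "rapid Z (fourier Z f)"
    unfolding rapid_def
    using fourier_measurable[OF L] s by (auto simp: sobolev_def powr_realpow)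
qed

lemma sobolev_norm_weighted_norm: "sobolev_norm Z (real k) f = weighted_norm Z k (fourier Z f)"
  unfolding sobolev_norm_def weighted_norm_def by (simp add: powr_realpow)

lemma rapid_lincomb:
  assumes g: "rapid Z g" and h: "rapid Z h"
  shows "rapid Z (\<lambda>\<xi>. a * g \<xi> + b * h \<xi>)"
  unfolding rapid_def
proof (intro conjI allI)
  have [measurable]: "g \<in> borel_measurable (freq_measure Z)" "h \<in> borel_measurable (freq_measure Z)"
    using rapid_measurable g h by auto
  show m: "(\<lambda>\<xi>. a * g \<xi> + b * h \<xi>) \<in> borel_measurable (freq_measure Z)" by measurable
  fix k
  show "integrable (freq_measure Z) (\<lambda>\<xi>. (1 + \<xi>\<^sup>2) ^ k * (cmod (a * g \<xi> + b * h \<xi>))\<^sup>2)"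
  proof (rule Bochner_Integration.integrable_bound)
    show "integrable (freq_measure Z) (\<lambda>\<xi>. 2 * (cmod a)\<^sup>2 * ((1 + \<xi>\<^sup>2) ^ k * (cmod (g \<xi>))\<^sup>2) + 2 * (cmod b)\<^sup>2 * ((1 + \<xi>\<^sup>2) ^ k * (cmod (h \<xi>))\<^sup>2))"
      using g h unfolding rapid_def by auto
    show "(\<lambda>\<xi>. (1 + \<xi>\<^sup>2) ^ k * (cmod (a * g \<xi> + b * h \<xi>))\<^sup>2) \<in> borel_measurable (freq_measure Z)"
      using m freq_poly_measurable[of k Z] by measurable
    show "AE \<xi> in freq_measure Z. norm ((1 + \<xi>\<^sup>2) ^ k * (cmod (a * g \<xi> + b * h \<xi>))\<^sup>2)
        \<le> norm (2 * (cmod a)\<^sup>2 * ((1 + \<xi>\<^sup>2) ^ k * (cmod (g \<xi>))\<^sup>2) + 2 * (cmod b)\<^sup>2 * ((1 + \<xi>\<^sup>2) ^ k * (cmod (h \<xi>))\<^sup>2))"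
    proof (rule AE_I2)
      fix \<xi>
      have "(cmod (a * g \<xi> + b * h \<xi>))\<^sup>2 \<le> 2 * (cmod a * cmod (g \<xi>))\<^sup>2 + 2 * (cmod b * cmod (h \<xi>))\<^sup>2"
        using norm_add_square_le[of "a * g \<xi>" "b * h \<xi>"] by (simp add: norm_mult)
      then have "(1 + \<xi>\<^sup>2) ^ k * (cmod (a * g \<xi> + b * h \<xi>))\<^sup>2
          \<le> (1 + \<xi>\<^sup>2) ^ k * (2 * (cmod a * cmod (g \<xi>))\<^sup>2 + 2 * (cmod b * cmod (h \<xi>))\<^sup>2)"
        by (rule mult_left_mono) simp
      also have "\<dots> = 2 * (cmod a)\<^sup>2 * ((1 + \<xi>\<^sup>2) ^ k * (cmod (g \<xi>))\<^sup>2) + 2 * (cmod b)\<^sup>2 * ((1 + \<xi>\<^sup>2) ^ k * (cmod (h \<xi>))\<^sup>2)"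
        by (simp add: power_mult_distrib algebra_simps)
      finally show "norm ((1 + \<xi>\<^sup>2) ^ k * (cmod (a * g \<xi> + b * h \<xi>))\<^sup>2)
        \<le> norm (2 * (cmod a)\<^sup>2 * ((1 + \<xi>\<^sup>2) ^ k * (cmod (g \<xi>))\<^sup>2) + 2 * (cmod b)\<^sup>2 * ((1 + \<xi>\<^sup>2) ^ k * (cmod (h \<xi>))\<^sup>2))"
        by simp
    qed
  qed
qed

lemma inv_ft_lincomb:
  assumes g: "integrable (freq_measure Z) g" and h: "integrable (freq_measure Z) h"
  shows "inv_ft Z (\<lambda>\<xi>. a * g \<xi> + b * h \<xi>) x = a * inv_ft Z g x + b * inv_ft Z h x"
proof -
  have "(LINT \<xi>|freq_measure Z. (a * g \<xi> + b * h \<xi>) * cis (\<xi> * x)) = (LINT \<xi>|freq_measure Z. a * (g \<xi> * cis (\<xi> * x)) + b * (h \<xi> * cis (\<xi> * x)))"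
    by (simp add: algebra_simps)
  also have "\<dots> = a * (LINT \<xi>|freq_measure Z. g \<xi> * cis (\<xi> * x)) + b * (LINT \<xi>|freq_measure Z. h \<xi> * cis (\<xi> * x))"
    using integrable_mult_cis[OF g] integrable_mult_cis[OF h] by simp
  finally show ?thesis by (simp add: inv_ft_def distrib_left mult_ac)
qed

lemma inv_ft_scale: "inv_ft Z (\<lambda>\<xi>. a * g \<xi>) x = a * inv_ft Z g x"
  by (simp add: inv_ft_def mult.assoc)

lemma Im_inv_ft: "Im (inv_ft Z g x) = Re (inv_ft Z (\<lambda>\<xi>. - \<i> * g \<xi>) x)"
  by (simp only: inv_ft_scale) simp

lemma rapid_scale: "rapid Z g \<Longrightarrow> rapid Z (\<lambda>\<xi>. a * g \<xi>)"
  using rapid_lincomb[of Z g g a 0] by simp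

lemma L2_norm_Re_Im:
  assumes "SS Z a" "SS Z b" and f: "\<And>x. f x = Complex (a x) (b x)"
  shows "(L2_norm Z f)\<^sup>2 = (nrm Z a)\<^sup>2 + (nrm Z b)\<^sup>2"
proof -
  have "(LINT x|space_measure Z. (cmod (f x))\<^sup>2) = (LINT x|space_measure Z. (a x)\<^sup>2 + (b x)\<^sup>2)"
    unfolding f cmod_power2 by simp
  also have "\<dots> = space_int Z (\<lambda>x. (a x)\<^sup>2) + space_int Z (\<lambda>x. (b x)\<^sup>2)"
    unfolding space_int_def
    by (rule Bochner_Integration.integral_add) (intro tame_square_integrable SS_tame assms)+
  finally show ?thesis by (simp add: L2_norm_def nrm_square space_int_nonneg)
qed

lemma L2_norm_inv_ft:
  assumes g: "rapid Z g"
  shows "L2_norm Z (inv_ft Z g) = weighted_norm Z 0 g"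
proof -
  note inv = rapid_fourier_inversion[OF g]
  have "sqrt (2 * pi) * L2_norm Z (inv_ft Z g) = l2 (freq_measure Z) (fourier Z (inv_ft Z g))"
    unfolding L2_norm_l2 by (rule Plancherel[OF inv(1), symmetric])
  also have "\<dots> = l2 (freq_measure Z) g"
    by (rule l2_cong_AE[OF inv(2) fourier_measurable[OF inv(1)] rapid_measurable[OF g]])
  also have "\<dots> = sqrt (2 * pi) * weighted_norm Z 0 g"
    by (simp add: l2_def weighted_norm_def real_sqrt_divide)
  finally show ?thesis by simp
qed

lemma rapid_Im_SS: "rapid Z g \<Longrightarrow> SS Z (\<lambda>x. Im (inv_ft Z g x))"
  unfolding Im_inv_ft by (intro rapid_Re_SS rapid_scale)

lemma nrm_Re_inv_ft_le:
  assumes g: "rapid Z g"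
  shows "nrm Z (\<lambda>x. Re (inv_ft Z g x)) \<le> weighted_norm Z 0 g"
proof (rule power2_le_imp_le)
  have "(L2_norm Z (inv_ft Z g))\<^sup>2 = (nrm Z (\<lambda>x. Re (inv_ft Z g x)))\<^sup>2 + (nrm Z (\<lambda>x. Im (inv_ft Z g x)))\<^sup>2"
    by (rule L2_norm_Re_Im[OF rapid_Re_SS[OF g] rapid_Im_SS[OF g]]) simp
  then show "(nrm Z (\<lambda>x. Re (inv_ft Z g x)))\<^sup>2 \<le> (weighted_norm Z 0 g)\<^sup>2"
    using L2_norm_inv_ft[OF g] by simp
qed (simp add: weighted_norm_def)

lemma weighted_norm_mono:
  assumes g: "rapid Z g" and h: "rapid Z h" and le: "\<And>\<xi>. (1 + \<xi>\<^sup>2) ^ j * (cmod (h \<xi>))\<^sup>2 \<le> (1 + \<xi>\<^sup>2) ^ k * (cmod (g \<xi>))\<^sup>2"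
  shows "weighted_norm Z j h \<le> weighted_norm Z k g"
  unfolding weighted_norm_def
  by (intro real_sqrt_le_mono mult_left_mono integral_mono le) (use g h in \<open>auto simp: rapid_def\<close>)

lemma H1_norm_Re_inv_ft_le:
  assumes g: "rapid Z g"
  shows "H1_norm Z (\<lambda>x. Re (inv_ft Z g x)) \<le> 2 * weighted_norm Z 1 g"
    "H1_norm Z (deriv (\<lambda>x. Re (inv_ft Z g x))) \<le> 2 * weighted_norm Z 2 g"
proof -
  let ?g1 = "\<lambda>\<xi>. \<i> * of_real \<xi> * g \<xi>"
  let ?g2 = "\<lambda>\<xi>. \<i> * of_real \<xi> * (\<i> * of_real \<xi> * g \<xi>)"
  note g1 = rapid_times_freq[OF g]
  note g2 = rapid_times_freq[OF g1]
  have sq: "\<xi>\<^sup>2 \<le> 1 + \<xi>\<^sup>2" for \<xi> :: real by simp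
  have a: "weighted_norm Z 0 g \<le> weighted_norm Z 1 g"
    by (rule weighted_norm_mono[OF g g]) (use mult_right_mono[OF one_plus_square_pos(4)] in auto)
  have b: "weighted_norm Z 0 ?g1 \<le> weighted_norm Z 1 g"
    by (rule weighted_norm_mono[OF g g1]) (auto simp: norm_mult power_mult_distrib intro!: mult_right_mono)
  have c: "weighted_norm Z 0 ?g1 \<le> weighted_norm Z 2 g"
  proof (rule weighted_norm_mono[OF g g1])
    fix \<xi> :: real
    have "\<xi>\<^sup>2 \<le> (1 + \<xi>\<^sup>2)\<^sup>2" using one_plus_square_pos(4)[of \<xi>] self_le_power[of "1 + \<xi>\<^sup>2" 2] by simp
    from mult_right_mono[OF this, of "(cmod (g \<xi>))\<^sup>2"]
    show "(1 + \<xi>\<^sup>2) ^ 0 * (cmod (\<i> * of_real \<xi> * g \<xi>))\<^sup>2 \<le> (1 + \<xi>\<^sup>2) ^ 2 * (cmod (g \<xi>))\<^sup>2"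
      by (simp add: norm_mult power_mult_distrib)
  qed
  have d: "weighted_norm Z 0 ?g2 \<le> weighted_norm Z 2 g"
  proof (rule weighted_norm_mono[OF g g2])
    fix \<xi> :: real
    have "(\<xi>\<^sup>2)\<^sup>2 \<le> (1 + \<xi>\<^sup>2)\<^sup>2" by (rule power_mono) auto
    from mult_right_mono[OF this, of "(cmod (g \<xi>))\<^sup>2"]
    show "(1 + \<xi>\<^sup>2) ^ 0 * (cmod (\<i> * of_real \<xi> * (\<i> * of_real \<xi> * g \<xi>)))\<^sup>2 \<le> (1 + \<xi>\<^sup>2) ^ 2 * (cmod (g \<xi>))\<^sup>2"
      by (simp add: norm_mult power_mult_distrib power2_eq_square mult_ac)
  qed
  show "H1_norm Z (\<lambda>x. Re (inv_ft Z g x)) \<le> 2 * weighted_norm Z 1 g"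
    unfolding H1_norm_def deriv_rapid_Re[OF g]
    using nrm_Re_inv_ft_le[OF g] nrm_Re_inv_ft_le[OF g1] a b by argo
  show "H1_norm Z (deriv (\<lambda>x. Re (inv_ft Z g x))) \<le> 2 * weighted_norm Z 2 g"
    unfolding H1_norm_def deriv_rapid_Re[OF g] deriv_rapid_Re[OF g1]
    using nrm_Re_inv_ft_le[OF g1] nrm_Re_inv_ft_le[OF g2] c d by argo
qed

lemma weighted_norm_one_le_two: "rapid Z g \<Longrightarrow> weighted_norm Z 1 g \<le> weighted_norm Z 2 g"
  by (rule weighted_norm_mono) (auto intro!: mult_right_mono power_increasing[of 1 2, simplified])

lemma weighted_norm_cong_AE:
  assumes "AE \<xi> in freq_measure Z. g \<xi> = h \<xi>" "g \<in> borel_measurable (freq_measure Z)" "h \<in> borel_measurable (freq_measure Z)"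
  shows "weighted_norm Z k g = weighted_norm Z k h"
proof -
  note [measurable] = assms(2,3) freq_poly_measurable[of k Z]
  have "(LINT \<xi>|freq_measure Z. (1 + \<xi>\<^sup>2) ^ k * (cmod (g \<xi>))\<^sup>2) = (LINT \<xi>|freq_measure Z. (1 + \<xi>\<^sup>2) ^ k * (cmod (h \<xi>))\<^sup>2)"
  proof (rule integral_cong_AE)
    show "AE \<xi> in freq_measure Z. (1 + \<xi>\<^sup>2) ^ k * (cmod (g \<xi>))\<^sup>2 = (1 + \<xi>\<^sup>2) ^ k * (cmod (h \<xi>))\<^sup>2"
      using assms(1) by eventually_elim simp
  qed measurable
  then show ?thesis by (simp only: weighted_norm_def)
qed

text \<open>
  The constant c extracts the real part (c = 1) or the imaginary part (c = -i). Passing from the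
  curve to the inverse transform of its Fourier transform replaces every member by its smooth
  representative, since membership in the Sobolev spaces does not see null sets.
\<close>

lemma Sobolev_curve_H1_deriv:
  fixes w :: "real \<Rightarrow> real \<Rightarrow> complex" and c :: complex
  assumes t: "t \<in> I" and w: "\<And>s. s \<in> I \<Longrightarrow> w s \<in> sobolev_inf Z" and v: "v \<in> sobolev_inf Z"
    and lim: "((\<lambda>s. sobolev_norm Z 2 (\<lambda>x. (w s x - w t x) / complex_of_real (s - t) - v x)) \<longlongrightarrow> 0) (at t within I)"
  defines "f \<equiv> \<lambda>s x. Re (c * inv_ft Z (fourier Z (w s)) x)" and "g \<equiv> \<lambda>x. Re (c * inv_ft Z (fourier Z v) x)"
  shows "H1_deriv Z I t f g" "H1_deriv Z I t (\<lambda>s. deriv (f s)) (deriv g)"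
proof -
  define G where "G s \<xi> = 1 * ((1 / of_real (s - t)) * fourier Z (w s) \<xi> + (- (1 / of_real (s - t))) * fourier Z (w t) \<xi>) + (- 1) * fourier Z v \<xi>" for s \<xi>
  define N where "N s = sobolev_norm Z 2 (\<lambda>x. (w s x - w t x) / complex_of_real (s - t) - v x)" for s
  note R = sobolev_inf_rapid(2)[OF w] sobolev_inf_rapid(2)[OF v]
  have f: "f s = (\<lambda>x. Re (inv_ft Z (\<lambda>\<xi>. c * fourier Z (w s) \<xi>) x))" for s
    unfolding f_def by (simp only: inv_ft_scale)
  have g: "g = (\<lambda>x. Re (inv_ft Z (\<lambda>\<xi>. c * fourier Z v \<xi>) x))"
    unfolding g_def by (simp only: inv_ft_scale)
  have SSf: "SS Z (f s)" if "s \<in> I" for s unfolding f by (intro rapid_Re_SS rapid_scale R that)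
  have SSg: "SS Z g" unfolding g by (intro rapid_Re_SS rapid_scale R)
  have RG: "rapid Z (G s)" if "s \<in> I" for s
    unfolding G_def[abs_def] by (intro rapid_lincomb R that t)
  have RcG: "rapid Z (\<lambda>\<xi>. c * G s \<xi>)" if "s \<in> I" for s by (intro rapid_scale RG that)
  have def: "defect f g t s = (\<lambda>x. Re (inv_ft Z (\<lambda>\<xi>. c * G s \<xi>) x))" if s: "s \<in> I" for s
  proof
    fix x
    have "inv_ft Z (\<lambda>\<xi>. c * G s \<xi>) x = c * (1 * ((1 / of_real (s - t)) * inv_ft Z (fourier Z (w s)) x + (- (1 / of_real (s - t))) * inv_ft Z (fourier Z (w t)) x) + (- 1) * inv_ft Z (fourier Z v) x)"
      unfolding inv_ft_scale G_def
      by ((subst inv_ft_lincomb; (intro rapid_integrable rapid_lincomb R s t)?)+, rule refl)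
    also have "\<dots> = (c * inv_ft Z (fourier Z (w s)) x - c * inv_ft Z (fourier Z (w t)) x) / of_real (s - t) - c * inv_ft Z (fourier Z v) x"
      by (simp add: algebra_simps diff_divide_distrib)
    finally show "defect f g t s x = Re (inv_ft Z (\<lambda>\<xi>. c * G s \<xi>) x)"
      by (simp add: defect_def f_def g_def)
  qed
  have SobG: "weighted_norm Z 2 (\<lambda>\<xi>. c * G s \<xi>) = cmod c * N s" if s: "s \<in> I" for s
  proof -
    let ?k = "1 / complex_of_real (s - t)"
    let ?h = "\<lambda>x. ?k * w s x + (- ?k) * w t x"
    note L = sobolev_inf_rapid(1)[OF w[OF s]] sobolev_inf_rapid(1)[OF w[OF t]] sobolev_inf_rapid(1)[OF v]
    have e: "(\<lambda>x. (w s x - w t x) / complex_of_real (s - t) - v x) = (\<lambda>x. 1 * ?h x + (- 1) * v x)"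
      by (auto simp: diff_divide_distrib)
    have AE: "AE \<xi> in freq_measure Z. fourier Z (\<lambda>x. 1 * ?h x + (- 1) * v x) \<xi> = G s \<xi>"
      using fourier_linear[OF L2_add[OF L(1,2), of ?k "- ?k"] L(3), of 1 "- 1"] fourier_linear[OF L(1,2), of ?k "- ?k"]
      by eventually_elim (simp add: G_def)
    have "N s = weighted_norm Z 2 (G s)"
      unfolding N_def e using sobolev_norm_weighted_norm[of Z 2 "\<lambda>x. 1 * ?h x + (- 1) * v x"]
        weighted_norm_cong_AE[OF AE fourier_measurable[OF L2_add[OF L2_add[OF L(1,2)] L(3)]] rapid_measurable[OF RG[OF s]], of 2]
      by (simp only: of_nat_numeral)
    moreover have "weighted_norm Z 2 (\<lambda>\<xi>. c * G s \<xi>) = cmod c * weighted_norm Z 2 (G s)"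
    proof -
      have "(LINT \<xi>|freq_measure Z. (1 + \<xi>\<^sup>2)\<^sup>2 * (cmod (c * G s \<xi>))\<^sup>2) = (cmod c)\<^sup>2 * (LINT \<xi>|freq_measure Z. (1 + \<xi>\<^sup>2)\<^sup>2 * (cmod (G s \<xi>))\<^sup>2)"
        by (simp add: norm_mult power_mult_distrib mult_ac flip: integral_mult_right_zero)
      then show ?thesis by (simp add: weighted_norm_def real_sqrt_mult real_sqrt_divide)
    qed
    ultimately show ?thesis by simp
  qed
  have lim': "((\<lambda>s. 2 * (cmod c * N s)) \<longlongrightarrow> 0) (at t within I)"
    using tendsto_mult_left[OF lim, of "2 * cmod c"] by (simp add: N_def mult.assoc)
  show "H1_deriv Z I t f g"
  proof (rule H1_derivI[OF t SSf SSg _ lim'])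
    fix s assume s: "s \<in> I"
    show "H1_norm Z (defect f g t s) \<le> 2 * (cmod c * N s)"
      unfolding def[OF s] SobG[OF s, symmetric]
      using H1_norm_Re_inv_ft_le(1)[OF RcG[OF s]] weighted_norm_one_le_two[OF RcG[OF s]] by argo
  qed
  show "H1_deriv Z I t (\<lambda>s. deriv (f s)) (deriv g)"
  proof (rule H1_derivI[OF t SS_deriv[OF SSf] SS_deriv[OF SSg] _ lim'])
    fix s assume s: "s \<in> I"
    have "deriv (defect f g t s) = defect (\<lambda>s. deriv (f s)) (deriv g) t s"
    proof -
      have "defect f g t s = (\<lambda>x. (1 / (s - t)) * (f s x - f t x) - g x)" by (auto simp: defect_def)
      then have "deriv (defect f g t s) = (\<lambda>x. (1 / (s - t)) * (deriv (f s) x - deriv (f t) x) - deriv g x)"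
        by (simp only: deriv_SS_diff[OF SS_scale[OF SS_diff[OF SSf[OF s] SSf[OF t]]] SSg]
            deriv_SS_scale[OF SS_diff[OF SSf[OF s] SSf[OF t]]] deriv_SS_diff[OF SSf[OF s] SSf[OF t]])
      then show ?thesis by (auto simp: defect_def)
    qed
    then show "H1_norm Z (defect (\<lambda>s. deriv (f s)) (deriv g) t s) \<le> 2 * (cmod c * N s)"
      using H1_norm_Re_inv_ft_le(2)[OF RcG[OF s]] unfolding def[OF s] SobG[OF s, symmetric] by simp
  qed
qed

section \<open>Smooth solutions\<close>

lemma dx_Re_Im:
  assumes "SS Z a" "SS Z b" and f: "\<And>x. f x = Complex (a x) (b x)"
  shows "(f has_vector_derivative Complex (deriv a x) (deriv b x)) (at x)" "dx f x = Complex (deriv a x) (deriv b x)"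
proof -
  show *: "(f has_vector_derivative Complex (deriv a x) (deriv b x)) (at x)"
    unfolding has_vector_derivative_complex_iff f using SS_DERIV assms by auto
  then show "dx f x = Complex (deriv a x) (deriv b x)" unfolding dx_def by (rule vector_derivative_at)
qed

lemma sobolev_inf_continuous:
  assumes u: "u \<in> sobolev_inf Z" and cont: "continuous_on UNIV u"
  shows "inv_ft Z (fourier Z u) = u" "SS Z (\<lambda>x. Re (u x))" "SS Z (\<lambda>x. Im (u x))"
proof -
  note R = sobolev_inf_rapid[OF u]
  show *: "inv_ft Z (fourier Z u) = u" by (rule inv_ft_fourier[OF R(1) cont rapid_integrable[OF R(2)]])
  show "SS Z (\<lambda>x. Re (u x))" "SS Z (\<lambda>x. Im (u x))"
    using rapid_Re_SS[OF R(2)] rapid_Im_SS[OF R(2)] unfolding * by auto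
qed

locale solution =
  fixes Z :: domain and al be T :: real and phi :: "real \<Rightarrow> complex" and u :: "real \<Rightarrow> real \<Rightarrow> complex"
  assumes T: "T > 0" and sol: "smooth_solution Z al be T phi u"
begin

definition p :: "real \<Rightarrow> real \<Rightarrow> real" where "p t x = Re (u t x)"
definition q :: "real \<Rightarrow> real \<Rightarrow> real" where "q t x = Im (u t x)"

lemma u_Complex: "u t x = Complex (p t x) (q t x)"
  by (simp add: p_def q_def)

lemma u_sobolev: "t \<in> {0..T} \<Longrightarrow> u t \<in> sobolev_inf Z"
  using sol unfolding smooth_solution_def smooth_curve_def by blast

lemma u_continuous: "t \<in> {0..T} \<Longrightarrow> continuous_on UNIV (u t)"
  using sol unfolding smooth_solution_def
  by (intro continuous_at_imp_continuous_on ballI differentiable_imp_continuous_within) auto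

lemmas u_inv_ft = sobolev_inf_continuous(1)[OF u_sobolev u_continuous]

lemma SS_p: "t \<in> {0..T} \<Longrightarrow> SS Z (p t)" and SS_q: "t \<in> {0..T} \<Longrightarrow> SS Z (q t)"
  using sobolev_inf_continuous(2,3)[OF u_sobolev u_continuous] unfolding p_def[abs_def] q_def[abs_def] by auto

lemma profile_at: "t \<in> {0..T} \<Longrightarrow> profile Z (p t) (q t)"
  by (rule profile.intro[OF SS_p SS_q])

lemma at_within_nontrivial: "t \<in> {0..T} \<Longrightarrow> at t within {0..T} \<noteq> bot"
  using T by (simp add: at_within_Icc_at_right trivial_limit_within islimpt_Icc)

lemma time_derivatives:
  assumes t: "t \<in> {0..T}"
  shows "\<exists>f g. H1_deriv Z {0..T} t p f \<and> H1_deriv Z {0..T} t (\<lambda>s. deriv (p s)) (deriv f)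
    \<and> H1_deriv Z {0..T} t q g \<and> H1_deriv Z {0..T} t (\<lambda>s. deriv (q s)) (deriv g)"
proof -
  obtain w :: "nat \<Rightarrow> real \<Rightarrow> real \<Rightarrow> complex" where w: "w 0 = u" "\<And>k t. t \<in> {0..T} \<Longrightarrow> w k t \<in> sobolev_inf Z"
    "\<And>k t s. t \<in> {0..T} \<Longrightarrow> s \<ge> 0 \<Longrightarrow> ((\<lambda>t'. sobolev_norm Z s
            (\<lambda>x. (w k t' x - w k t x) / complex_of_real (t' - t) - w (Suc k) t x)) \<longlongrightarrow> 0) (at t within {0..T})"
    using sol unfolding smooth_solution_def smooth_curve_def by blast
  have lim: "((\<lambda>s. sobolev_norm Z 2 (\<lambda>x. (u s x - u t x) / complex_of_real (s - t) - w 1 t x)) \<longlongrightarrow> 0) (at t within {0..T})"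
    using w(3)[OF t, of 2 0] unfolding w(1) by simp
  have eq: "H1_deriv Z {0..T} t k f \<longleftrightarrow> H1_deriv Z {0..T} t l f" if "\<And>s. s \<in> {0..T} \<Longrightarrow> k s = l s" for k l f
    using H1_deriv_cong[of Z "{0..T}" t k f l f] H1_deriv_cong[of Z "{0..T}" t l f k f] that by auto
  have P: "(\<lambda>x. Re (1 * inv_ft Z (fourier Z (u s)) x)) = p s" "(\<lambda>x. Re (- \<i> * inv_ft Z (fourier Z (u s)) x)) = q s" if "s \<in> {0..T}" for s
    unfolding u_inv_ft[OF that that] by (auto simp: p_def q_def)
  note D = Sobolev_curve_H1_deriv[OF t u_sobolev w(2)[OF t, of 1] lim]
  have "H1_deriv Z {0..T} t p (\<lambda>x. Re (1 * inv_ft Z (fourier Z (w 1 t)) x))"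
    by (rule H1_deriv_cong[OF D(1)[where c="1"]]) (assumption, simp only: P, rule refl)
  moreover have "H1_deriv Z {0..T} t (\<lambda>s. deriv (p s)) (deriv (\<lambda>x. Re (1 * inv_ft Z (fourier Z (w 1 t)) x)))"
    by (rule H1_deriv_cong[OF D(2)[where c="1"]]) (assumption, simp only: P, rule refl)
  moreover have "H1_deriv Z {0..T} t q (\<lambda>x. Re (- \<i> * inv_ft Z (fourier Z (w 1 t)) x))"
    by (rule H1_deriv_cong[OF D(1)[where c="- \<i>"]]) (assumption, simp only: P, rule refl)
  moreover have "H1_deriv Z {0..T} t (\<lambda>s. deriv (q s)) (deriv (\<lambda>x. Re (- \<i> * inv_ft Z (fourier Z (w 1 t)) x)))"
    by (rule H1_deriv_cong[OF D(2)[where c="- \<i>"]]) (assumption, simp only: P, rule refl)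
  ultimately show ?thesis by blast
qed

lemma density: "density_of (u t) x = complex_of_real ((p t x)\<^sup>2 + (q t x)\<^sup>2)"
  unfolding density_of_def cmod_power2 by (simp add: p_def q_def)

text \<open>
  The time derivative is read off from the pointwise equation, by uniqueness of the derivatives in x
  of u_x and of F u.
\<close>

lemma equation:
  assumes t: "t \<in> {0..T}"
  shows "((\<lambda>s. p s x) has_real_derivative profile.pt Z al be (p t) (q t) x) (at t within {0..T})"
    "((\<lambda>s. q s x) has_real_derivative profile.qt Z al be (p t) (q t) x) (at t within {0..T})"
proof -
  interpret profile Z al be "p t" "q t" by (rule profile_at[OF t])
  obtain ut uxx P Q where
    d: "((\<lambda>t'. u t' x) has_vector_derivative ut) (at t within {0..T})"
      "(dx (u t) has_vector_derivative uxx) (at x)"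
      "((\<lambda>y. density_of (u t) y * u t y) has_vector_derivative P) (at x)"
      "((\<lambda>y. hilbert Z (density_of (u t)) y * u t y) has_vector_derivative Q) (at x)"
    and eq: "ut - \<i> * uxx = complex_of_real al * P + complex_of_real be * Q"
    using sol t unfolding smooth_solution_def by blast
  note DD = SS_deriv[OF SS_p[OF t]] SS_deriv[OF SS_q[OF t]]
  have "(dx (u t) has_vector_derivative Complex (deriv (deriv (p t)) x) (deriv (deriv (q t)) x)) (at x)"
    by (rule dx_Re_Im(1)[OF DD dx_Re_Im(2)[OF SS_p[OF t] SS_q[OF t] u_Complex]])
  then have uxx: "uxx = Complex (deriv (deriv (p t)) x) (deriv (deriv (q t)) x)"
    using d(2) by (rule vector_derivative_unique_at[rotated])
  have dens: "density_of (u t) = cs rho"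
    unfolding density[abs_def] rho_def by (auto simp: power2_eq_square)
  have nl: "((\<lambda>y. complex_of_real al * (density_of (u t) y * u t y) + complex_of_real be * (hilbert Z (density_of (u t)) y * u t y))
      has_vector_derivative complex_of_real al * P + complex_of_real be * Q) (at x)"
    by (intro derivative_intros d)
  have nl_eq: "(\<lambda>y. complex_of_real al * (density_of (u t) y * u t y) + complex_of_real be * (hilbert Z (density_of (u t)) y * u t y))
      = (\<lambda>y. Complex (F y * p t y) (F y * q t y))"
    unfolding dens hilbert_real[OF SS_rho] F_def Aop_def
    by (auto simp: u_Complex complex_eq_iff algebra_simps)
  have "((\<lambda>y. Complex (F y * p t y) (F y * q t y)) has_vector_derivative
      Complex (deriv (\<lambda>y. F y * p t y) x) (deriv (\<lambda>y. F y * q t y) x)) (at x)"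
    by (rule dx_Re_Im(1)[where Z=Z]) (auto intro!: SS_mult SS_F SS_p SS_q t)
  then have "complex_of_real al * P + complex_of_real be * Q = Complex (deriv (\<lambda>y. F y * p t y) x) (deriv (\<lambda>y. F y * q t y) x)"
    by (rule vector_derivative_unique_at[OF nl[unfolded nl_eq]])
  then have "ut = Complex (pt x) (qt x)"
    using eq unfolding uxx deriv_SS_mult[OF SS_F SS_p[OF t]] deriv_SS_mult[OF SS_F SS_q[OF t]]
    by (simp add: complex_eq_iff pt_def qt_def)
  then show "((\<lambda>s. p s x) has_real_derivative pt x) (at t within {0..T})"
    "((\<lambda>s. q s x) has_real_derivative qt x) (at t within {0..T})"
    using d(1) unfolding has_vector_derivative_complex_iff by (simp_all add: p_def q_def)
qed

text \<open>
  The derivative in the Sobolev norm exists by smoothness of the curve, but is only known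
  abstractly; it is identified with the expression given by the equation because both are pointwise
  time derivatives, which are unique within an interval of positive length.
\<close>

lemma curves:
  assumes t: "t \<in> {0..T}"
  shows "H1_deriv Z {0..T} t p (profile.pt Z al be (p t) (q t))"
    "H1_deriv Z {0..T} t q (profile.qt Z al be (p t) (q t))"
    "H1_deriv Z {0..T} t (\<lambda>s. deriv (p s)) (deriv (profile.pt Z al be (p t) (q t)))"
    "H1_deriv Z {0..T} t (\<lambda>s. deriv (q s)) (deriv (profile.qt Z al be (p t) (q t)))"
proof -
  obtain f g where fg: "H1_deriv Z {0..T} t p f" "H1_deriv Z {0..T} t (\<lambda>s. deriv (p s)) (deriv f)"
    "H1_deriv Z {0..T} t q g" "H1_deriv Z {0..T} t (\<lambda>s. deriv (q s)) (deriv g)"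
    using time_derivatives[OF t] by blast
  have uniq: "a = b" if "(k has_real_derivative a) (at t within {0..T})" "(k has_real_derivative b) (at t within {0..T})" for k a b
    using vector_derivative_unique_within[OF at_within_nontrivial[OF t]] that
    unfolding has_real_derivative_iff_has_vector_derivative by metis
  have "f = profile.pt Z al be (p t) (q t)" "g = profile.qt Z al be (p t) (q t)"
    using uniq[OF H1_deriv_pointwise[OF fg(1)] equation(1)[OF t]] uniq[OF H1_deriv_pointwise[OF fg(3)] equation(2)[OF t]] by auto
  then show "H1_deriv Z {0..T} t p (profile.pt Z al be (p t) (q t))"
    "H1_deriv Z {0..T} t q (profile.qt Z al be (p t) (q t))"
    "H1_deriv Z {0..T} t (\<lambda>s. deriv (p s)) (deriv (profile.pt Z al be (p t) (q t)))"
    "H1_deriv Z {0..T} t (\<lambda>s. deriv (q s)) (deriv (profile.qt Z al be (p t) (q t)))"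
    using fg by auto
qed

definition mass :: "real \<Rightarrow> real" where "mass t = (profile.m Z (p t) (q t))\<^sup>2"
definition rho_half :: "real \<Rightarrow> real" where "rho_half t = hs Z (profile.rho (p t) (q t))"
definition drho_half :: "real \<Rightarrow> real" where "drho_half t = hs Z (deriv (profile.rho (p t) (q t)))"
definition W1 :: "real \<Rightarrow> real \<Rightarrow> real" where "W1 t = profile.w1 Z al be (p t) (q t)"
definition W2 :: "real \<Rightarrow> real \<Rightarrow> real" where "W2 t = profile.w2 Z al be (p t) (q t)"
definition gauged_energy :: "real \<Rightarrow> real" where "gauged_energy t = (profile.EN Z (p t) (q t) (W1 t) (W2 t))\<^sup>2"

lemma mass_deriv:
  assumes t: "t \<in> {0..T}"
  shows "(mass has_real_derivative be * rho_half t) (at t within {0..T})"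
proof -
  interpret profile Z al be "p t" "q t" by (rule profile_at[OF t])
  have eq: "mass s = (nrm Z (p s))\<^sup>2 + (nrm Z (q s))\<^sup>2" if "s \<in> {0..T}" for s
    unfolding mass_def by (rule profile.m_square[OF profile_at[OF that]])
  have "((\<lambda>s. (nrm Z (p s))\<^sup>2 + (nrm Z (q s))\<^sup>2) has_real_derivative
      2 * space_int Z (\<lambda>x. p t x * pt x) + 2 * space_int Z (\<lambda>x. q t x * qt x)) (at t within {0..T})"
    by (intro DERIV_add H1_deriv_norm_square curves t)
  also have "2 * space_int Z (\<lambda>x. p t x * pt x) + 2 * space_int Z (\<lambda>x. q t x * qt x) = space_int Z rt"
    unfolding space_int_def rt_def[abs_def]
    using SS_integrable_mult[OF SS_p[OF t] SS_pt] SS_integrable_mult[OF SS_q[OF t] SS_qt] by simp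
  also have "\<dots> = be * rho_half t" unfolding mass_identity rho_half_def ..
  finally show ?thesis
    by (rule has_field_derivative_transform_within[OF _ zero_less_one t]) (simp add: eq)
qed

lemma W_curves:
  assumes t: "t \<in> {0..T}"
  shows "H1_deriv Z {0..T} t W1 (profile.w1t Z al be (p t) (q t))" (is ?A)
    "H1_deriv Z {0..T} t W2 (profile.w2t Z al be (p t) (q t))" (is ?B)
proof -
  interpret profile Z al be "p t" "q t" by (rule profile_at[OF t])
  define R where "R s x = p s x * p s x + q s x * q s x" for s x
  have R: "R s = profile.rho (p s) (q s)" if "s \<in> {0..T}" for s
    unfolding R_def[abs_def] profile.rho_def[OF profile_at[OF that], abs_def] ..
  have Rd: "H1_deriv Z {0..T} t R rt"
    unfolding R_def[abs_def]
    by (rule H1_deriv_cong[OF H1_deriv_add[OF H1_deriv_mult[OF curves(1)[OF t] curves(1)[OF t]] H1_deriv_mult[OF curves(2)[OF t] curves(2)[OF t]]]])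
      (auto simp: rt_def)
  note Fd = H1_deriv_Aop[OF Rd, of al be]
  have F': "Aop Z al be (R t) = F" unfolding R[OF t] F_def ..
  have "H1_deriv Z {0..T} t (\<lambda>s x. deriv (p s) x + 3/4 * (Aop Z al be (R s) x * q s x))
      (\<lambda>x. deriv pt x + 3/4 * (Aop Z al be rt x * q t x + Aop Z al be (R t) x * qt x))"
    by (intro H1_deriv_add H1_deriv_scale H1_deriv_mult Fd curves t)
  then show ?A
    by (rule H1_deriv_cong) (auto simp: W1_def R profile.w1_def[OF profile_at] profile.F_def[OF profile_at] w1t_def Ft_def F')
  have "H1_deriv Z {0..T} t (\<lambda>s x. deriv (q s) x - 3/4 * (Aop Z al be (R s) x * p s x))
      (\<lambda>x. deriv qt x - 3/4 * (Aop Z al be rt x * p t x + Aop Z al be (R t) x * pt x))"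
    by (intro H1_deriv_diff H1_deriv_scale H1_deriv_mult Fd curves t)
  then show ?B
    by (rule H1_deriv_cong) (auto simp: W2_def R profile.w2_def[OF profile_at] profile.F_def[OF profile_at] w2t_def Ft_def F')
qed

lemma gauged_energy_deriv:
  assumes t: "t \<in> {0..T}"
  shows "(gauged_energy has_real_derivative
    2 * space_int Z (\<lambda>x. profile.w1 Z al be (p t) (q t) x * profile.w1t Z al be (p t) (q t) x
       + profile.w2 Z al be (p t) (q t) x * profile.w2t Z al be (p t) (q t) x) + kap Z * (be * rho_half t)) (at t within {0..T})"
proof -
  interpret profile Z al be "p t" "q t" by (rule profile_at[OF t])
  have eq: "gauged_energy s = (nrm Z (W1 s))\<^sup>2 + (nrm Z (W2 s))\<^sup>2 + kap Z * mass s" if "s \<in> {0..T}" for s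
    unfolding gauged_energy_def mass_def by (rule profile.EN_square[OF profile_at[OF that]])
  have "((\<lambda>s. (nrm Z (W1 s))\<^sup>2 + (nrm Z (W2 s))\<^sup>2 + kap Z * mass s) has_real_derivative
      2 * space_int Z (\<lambda>x. W1 t x * w1t x) + 2 * space_int Z (\<lambda>x. W2 t x * w2t x) + kap Z * (be * rho_half t)) (at t within {0..T})"
    by (intro DERIV_add DERIV_cmult H1_deriv_norm_square W_curves mass_deriv t)
  also have "2 * space_int Z (\<lambda>x. W1 t x * w1t x) + 2 * space_int Z (\<lambda>x. W2 t x * w2t x)
      = 2 * space_int Z (\<lambda>x. w1 x * w1t x + w2 x * w2t x)"
    unfolding space_int_def W1_def W2_def
    using SS_integrable_mult[OF SS_w1 H1_derivD(4)[OF W_curves(1)[OF t]]] SS_integrable_mult[OF SS_w2 H1_derivD(4)[OF W_curves(2)[OF t]]] by simp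
  finally show ?thesis
    by (rule has_field_derivative_transform_within[OF _ zero_less_one t]) (simp add: eq)
qed

end

section \<open>Integrating the differential inequalities\<close>

lemma has_integral_of_derivative:
  assumes "\<And>s. s \<in> {0..T} \<Longrightarrow> (G has_real_derivative g s) (at s within {0..T})" and t: "t \<in> {0..T}"
  shows "(g has_integral G t - G 0) {0..t}"
proof (rule fundamental_theorem_of_calculus)
  fix s assume "s \<in> {0..t}"
  then have "(G has_real_derivative g s) (at s within {0..t})"
    using t by (intro has_field_derivative_subset[OF assms(1)]) auto
  then show "(G has_vector_derivative g s) (at s within {0..t})"
    by (simp add: has_real_derivative_iff_has_vector_derivative)
qed (use t in auto)

lemma nondecreasing_of_derivative:
  assumes "\<And>s. s \<in> {0..T} \<Longrightarrow> (G has_real_derivative g s) (at s within {0..T})" and t: "t \<in> {0..T}"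
    and "\<And>s. s \<in> {0..T} \<Longrightarrow> g s \<ge> 0"
  shows "G 0 \<le> G t"
  using has_integral_nonneg[OF has_integral_of_derivative[OF assms(1) t]] assms(3) t by simp

lemma nonincreasing_of_derivative:
  assumes "\<And>s. s \<in> {0..T} \<Longrightarrow> (G has_real_derivative g s) (at s within {0..T})" and t: "t \<in> {0..T}"
    and "\<And>s. s \<in> {0..T} \<Longrightarrow> g s \<le> 0"
  shows "G t \<le> G 0"
  using nondecreasing_of_derivative[of T "\<lambda>s. - G s" "\<lambda>s. - g s" t] assms by (auto intro: DERIV_minus)

text \<open>
  The derivative g is an integrable majorant of B, and its integral is given by the fundamental
  theorem of calculus.
\<close>

lemma nn_integral_le_of_derivative:
  assumes d: "\<And>s. s \<in> {0..T} \<Longrightarrow> (G has_real_derivative g s) (at s within {0..T})" and t: "t \<in> {0..T}"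
    and B: "\<And>s. s \<in> {0..T} \<Longrightarrow> 0 \<le> B s" "\<And>s. s \<in> {0..T} \<Longrightarrow> B s \<le> g s"
  shows "(\<integral>\<^sup>+s\<in>{0..t}. ennreal (B s) \<partial>lborel) \<le> ennreal (G t - G 0)"
proof -
  have g0: "0 \<le> g s" if "s \<in> {0..t}" for s
    using B(1)[of s] B(2)[of s] that t by auto
  have "(\<integral>\<^sup>+s\<in>{0..t}. ennreal (B s) \<partial>lborel) \<le> (\<integral>\<^sup>+s. ennreal (indicator {0..t} s * g s) \<partial>lborel)"
    by (rule nn_integral_mono) (use B(2) t in \<open>auto split: split_indicator intro!: ennreal_leI\<close>)
  also have "\<dots> = ennreal (G t - G 0)"
    by (rule nn_integral_has_integral_lebesgue[OF g0 has_integral_of_derivative[OF d t]])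
  finally show ?thesis .
qed

text \<open>
  The factor exp (k m / c) turns the growth term into the derivative of the mass, so that G = E exp
  (k m / c) satisfies G' <= - c B / 8. The first three conclusions follow by integration. For the
  last, 2 sqrt B <= l B + 1 / l for every l > 0 makes m exp (c s / l - 8 l G) nondecreasing in s,
  and l is chosen at the end.
\<close>

lemma dissipative_system_bounds:
  fixes m E A B e :: "real \<Rightarrow> real"
  assumes c: "c > 0" and K: "K \<ge> 0" and t: "t \<in> {0..T}"
    and dm: "\<And>s. s \<in> {0..T} \<Longrightarrow> (m has_real_derivative - c * A s) (at s within {0..T})"
    and dE: "\<And>s. s \<in> {0..T} \<Longrightarrow> (E has_real_derivative e s) (at s within {0..T})"
    and e: "\<And>s. s \<in> {0..T} \<Longrightarrow> e s \<le> - c / 8 * B s + K * (1 + m s) ^ 3 * E s * A s"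
    and nn: "\<And>s. s \<in> {0..T} \<Longrightarrow> 0 \<le> m s" "\<And>s. s \<in> {0..T} \<Longrightarrow> 0 \<le> E s" "\<And>s. s \<in> {0..T} \<Longrightarrow> 0 \<le> A s" "\<And>s. s \<in> {0..T} \<Longrightarrow> 0 \<le> B s"
    and AB: "\<And>s. s \<in> {0..T} \<Longrightarrow> A s \<le> 2 * m s * sqrt (B s)"
  defines "G0 \<equiv> E 0 * exp (K * (1 + m 0) ^ 3 * m 0 / c)"
  shows "m t \<le> m 0" "E t \<le> G0"
    "(\<integral>\<^sup>+s\<in>{0..t}. ennreal (B s) \<partial>lborel) \<le> ennreal (8 / c * G0)"
    "m 0 * exp (- (2 * sqrt (8 * c * t * G0))) \<le> m t"
proof -
  have z: "0 \<in> {0..T}" using t by auto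
  have mle: "m s \<le> m 0" if "s \<in> {0..T}" for s
    by (rule nonincreasing_of_derivative[OF dm that]) (use c nn(3) in \<open>auto simp: mult_le_0_iff\<close>)
  show "m t \<le> m 0" by (rule mle[OF t])
  define k where "k = K * (1 + m 0) ^ 3"
  have k: "k \<ge> 0" using K nn(1)[OF z] by (simp add: k_def)
  define G where "G s = E s * exp (k / c * m s)" for s
  define g where "g s = exp (k / c * m s) * (e s - k * E s * A s)" for s
  have dG: "(G has_real_derivative g s) (at s within {0..T})" if s: "s \<in> {0..T}" for s
    unfolding G_def[abs_def] g_def
    by (rule derivative_eq_intros dE[OF s] dm[OF s] refl)+ (use c in \<open>simp add: field_simps\<close>)
  have gB: "g s \<le> - c / 8 * B s" if s: "s \<in> {0..T}" for s
  proof -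
    have "K * (1 + m s) ^ 3 * (E s * A s) \<le> k * (E s * A s)"
      unfolding k_def using K nn[OF s] mle[OF s] by (intro mult_right_mono mult_left_mono power_mono) auto
    then have i: "e s - k * E s * A s \<le> - c / 8 * B s" using e[OF s] by (simp add: mult.assoc)
    have neg: "- c / 8 * B s \<le> 0" using c nn(4)[OF s] by (simp add: mult_le_0_iff)
    have x: "exp (k / c * m s) \<ge> 1" using k c nn(1)[OF s] by simp
    have "g s \<le> exp (k / c * m s) * (- c / 8 * B s)" unfolding g_def by (rule mult_left_mono[OF i]) simp
    also have "\<dots> \<le> 1 * (- c / 8 * B s)" by (rule mult_right_mono_neg[OF x neg])
    finally show ?thesis by simp
  qed
  have gneg: "g s \<le> 0" if s: "s \<in> {0..T}" for s
    using gB[OF s] c nn(4)[OF s] mult_nonneg_nonneg[of c "B s"] by (simp add: order_trans)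
  have G0: "G 0 = G0" by (simp add: G_def G0_def k_def)
  have Gt: "G s \<le> G0" if "s \<in> {0..T}" for s
    using nonincreasing_of_derivative[OF dG that gneg] G0 by simp
  have EG: "E s \<le> G s" if s: "s \<in> {0..T}" for s
  proof -
    have "exp (k / c * m s) \<ge> 1" using k c nn(1)[OF s] by simp
    from mult_left_mono[OF this nn(2)[OF s]] show ?thesis by (simp add: G_def)
  qed
  show "E t \<le> G0" using EG[OF t] Gt[OF t] by simp
  have Gnn: "0 \<le> G s" if "s \<in> {0..T}" for s using EG[OF that] nn(2)[OF that] by simp
  have G00: "0 \<le> G0" using Gnn[OF z] G0 by simp
  have "(\<integral>\<^sup>+s\<in>{0..t}. ennreal (B s) \<partial>lborel) \<le> ennreal (- (8 / c) * G t - - (8 / c) * G 0)"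
  proof (rule nn_integral_le_of_derivative[OF DERIV_cmult[OF dG] t nn(4)])
    fix s assume s: "s \<in> {0..T}"
    have "(8 / c) * (c / 8 * B s) \<le> (8 / c) * (- g s)" using gB[OF s] c by (intro mult_left_mono) auto
    then show "B s \<le> - (8 / c) * g s" using c by simp
  qed
  also have "\<dots> \<le> ennreal (8 / c * G0)"
    using Gnn[OF t] c by (intro ennreal_leI) (simp add: G0)
  finally show "(\<integral>\<^sup>+s\<in>{0..t}. ennreal (B s) \<partial>lborel) \<le> ennreal (8 / c * G0)" .
  have decay: "m 0 * exp (- (8 * l * G0 + c / l * t)) \<le> m t" if l: "l > 0" for l
  proof -
    define h where "h s = c / l * s - 8 * l * G s" for s
    have dh: "(h has_real_derivative c / l - 8 * l * g s) (at s within {0..T})" if "s \<in> {0..T}" for s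
      unfolding h_def[abs_def] by (rule derivative_eq_intros dG[OF that] refl)+ simp
    have "m 0 * exp (h 0) \<le> m t * exp (h t)"
    proof (rule nondecreasing_of_derivative[OF _ t])
      fix s assume s: "s \<in> {0..T}"
      show "((\<lambda>s. m s * exp (h s)) has_real_derivative exp (h s) * (m s * (c / l - 8 * l * g s) - c * A s)) (at s within {0..T})"
        by (rule derivative_eq_intros dh[OF s] dm[OF s] refl)+ (simp add: algebra_simps)
      have sq: "2 * sqrt (B s) \<le> l * B s + 1 / l"
      proof -
        have "0 \<le> (l * sqrt (B s) - 1)\<^sup>2 / l" using l by simp
        also have "\<dots> = l * (sqrt (B s))\<^sup>2 - 2 * sqrt (B s) + 1 / l"
          using l by (simp add: power2_eq_square field_simps)
        also have "(sqrt (B s))\<^sup>2 = B s" using nn(4)[OF s] by simp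
        finally show ?thesis by simp
      qed
      have "c * A s \<le> c * (m s * (2 * sqrt (B s)))" using AB[OF s] c by (intro mult_left_mono) auto
      also have "\<dots> \<le> c * (m s * (l * B s + 1 / l))"
        using sq c nn(1)[OF s] by (intro mult_left_mono) auto
      also have "\<dots> = m s * (c / l + l * (c * B s))" by (simp add: algebra_simps)
      also have "\<dots> \<le> m s * (c / l - 8 * l * g s)"
      proof (rule mult_left_mono[OF _ nn(1)[OF s]])
        have "l * (c * B s) \<le> l * (- 8 * g s)" using gB[OF s] l by (intro mult_left_mono) auto
        then show "c / l + l * (c * B s) \<le> c / l - 8 * l * g s" by simp
      qed
      finally show "0 \<le> exp (h s) * (m s * (c / l - 8 * l * g s) - c * A s)" by simp
    qed
    moreover have "exp (h t - h 0) \<le> exp (8 * l * G0 + c / l * t)"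
      using Gnn[OF t] l by (simp add: h_def G0)
    then have "m t * exp (h t - h 0) \<le> m t * exp (8 * l * G0 + c / l * t)"
      using nn(1)[OF t] by (rule mult_left_mono)
    moreover have "(m 0 * exp (h 0)) * exp (- h 0) \<le> (m t * exp (h t)) * exp (- h 0)"
      if "m 0 * exp (h 0) \<le> m t * exp (h t)" using that by (rule mult_right_mono) simp
    ultimately have "m 0 \<le> m t * exp (8 * l * G0 + c / l * t)"
      by (simp add: mult.assoc exp_add[symmetric])
    then have "m 0 * exp (- (8 * l * G0 + c / l * t)) \<le> m t * exp (8 * l * G0 + c / l * t) * exp (- (8 * l * G0 + c / l * t))"
      by (rule mult_right_mono) simp
    then show ?thesis by (simp only: mult.assoc exp_add[symmetric] add.right_inverse exp_zero mult_1_right)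
  qed
  show "m 0 * exp (- (2 * sqrt (8 * c * t * G0))) \<le> m t"
  proof (cases "t = 0")
    case True
    then show ?thesis by simp
  next
    case t0: False
    then have tp: "t > 0" using t by auto
    show ?thesis
    proof (cases "G0 = 0")
      case True
      have "m 0 \<le> m t"
      proof (rule field_le_mult_one_interval)
        fix z :: real assume zz: "0 < z" "z < 1"
        \<comment> \<open>without dissipation only c t / l remains, and it tends to 0 as l grows\<close>
        define l where "l = c * t / (1 - z)"
        have l: "l > 0" using zz c tp by (simp add: l_def)
        have cl: "c / l * t = 1 - z" using zz c tp by (simp add: l_def)
        have "z * m 0 \<le> exp (- (1 - z)) * m 0"
          using exp_ge_add_one_self[of "- (1 - z)"] nn(1)[OF z] by (intro mult_right_mono) auto
        also have "\<dots> \<le> m t" using decay[OF l] True cl by (simp add: mult.commute)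
        finally show "z * m 0 \<le> m t" .
      qed
      then show ?thesis using True by simp
    next
      case False
      then have Gp: "G0 > 0" using G00 by simp
      \<comment> \<open>the minimiser of 8 l G0 + c t / l, at which both summands are equal\<close>
      define l where "l = sqrt (c * t) / sqrt (8 * G0)"
      have l: "l > 0" using c tp Gp by (simp add: l_def)
      have "8 * l * G0 = (sqrt (8 * G0) * sqrt (8 * G0)) * (sqrt (c * t) / sqrt (8 * G0))" using Gp by (simp add: l_def)
      also have "\<dots> = sqrt (8 * G0) * sqrt (c * t)" using Gp by (simp add: field_simps)
      finally have 1: "8 * l * G0 = sqrt (8 * c * t * G0)" by (simp add: real_sqrt_mult mult_ac)
      have "c / l * t = (sqrt (c * t) * sqrt (c * t)) / l" using c tp by simp
      also have "\<dots> = sqrt (8 * G0) * sqrt (c * t)" using c tp Gp by (simp add: l_def field_simps)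
      finally have 2: "c / l * t = sqrt (8 * c * t * G0)" by (simp add: real_sqrt_mult mult_ac)
      show ?thesis using decay[OF l] unfolding 1 2 by simp
    qed
  qed
qed

text \<open>
  On the circle the data are measured in the first-order Sobolev norm; this identifies it with the
  energy at time 0.
\<close>

lemma weighted_norm_one_inv_ft:
  assumes g: "rapid Z g"
  shows "(weighted_norm Z 1 g)\<^sup>2 = (L2_norm Z (inv_ft Z g))\<^sup>2 + (L2_norm Z (dx (inv_ft Z g)))\<^sup>2"
proof -
  note g1 = rapid_times_freq[OF g]
  have "dx (inv_ft Z g) = inv_ft Z (\<lambda>\<xi>. \<i> * of_real \<xi> * g \<xi>)"
    unfolding dx_def[abs_def] using vector_derivative_at[OF rapid_inv_ft_derivative[OF g]] by auto
  then have e: "(L2_norm Z (dx (inv_ft Z g)))\<^sup>2 = 1 / (2 * pi) * (LINT \<xi>|freq_measure Z. \<xi>\<^sup>2 * (cmod (g \<xi>))\<^sup>2)"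
    using L2_norm_inv_ft[OF g1] by (simp add: weighted_norm_def norm_mult power_mult_distrib)
  have i: "integrable (freq_measure Z) (\<lambda>\<xi>. (cmod (g \<xi>))\<^sup>2)" "integrable (freq_measure Z) (\<lambda>\<xi>. \<xi>\<^sup>2 * (cmod (g \<xi>))\<^sup>2)"
    using rapid_square_integrable[OF g] rapid_square_integrable[OF g1]
    by (simp_all add: square_integrable_def norm_mult power_mult_distrib)
  have "(LINT \<xi>|freq_measure Z. (1 + \<xi>\<^sup>2) ^ 1 * (cmod (g \<xi>))\<^sup>2)
     = (LINT \<xi>|freq_measure Z. (cmod (g \<xi>))\<^sup>2) + (LINT \<xi>|freq_measure Z. \<xi>\<^sup>2 * (cmod (g \<xi>))\<^sup>2)"
    using i by (simp add: distrib_right)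
  then have "(weighted_norm Z 1 g)\<^sup>2 = 1 / (2 * pi) * ((LINT \<xi>|freq_measure Z. (cmod (g \<xi>))\<^sup>2) + (LINT \<xi>|freq_measure Z. \<xi>\<^sup>2 * (cmod (g \<xi>))\<^sup>2))"
    by (simp add: weighted_norm_def)
  then show ?thesis using L2_norm_inv_ft[OF g] unfolding e by (simp add: weighted_norm_def add_divide_distrib)
qed

context solution
begin

lemma phi: "phi = u 0" using sol by (simp add: smooth_solution_def)
lemma zero_time: "0 \<in> {0..T}" using T by simp

lemma mass_L2_norm: "t \<in> {0..T} \<Longrightarrow> (L2_norm Z (u t))\<^sup>2 = mass t"
  unfolding mass_def profile.m_square[OF profile_at]
  by (rule L2_norm_Re_Im[OF SS_p SS_q u_Complex]) auto

lemma L2_norm_dx: "t \<in> {0..T} \<Longrightarrow> (L2_norm Z (dx (u t)))\<^sup>2 = (nrm Z (deriv (p t)))\<^sup>2 + (nrm Z (deriv (q t)))\<^sup>2"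
  by (rule L2_norm_Re_Im[OF SS_deriv[OF SS_p] SS_deriv[OF SS_q] dx_Re_Im(2)[OF SS_p SS_q u_Complex]]) auto

lemma data_norm_energy: "(data_norm Z phi)\<^sup>2 = (profile.EN Z (p 0) (q 0) (deriv (p 0)) (deriv (q 0)))\<^sup>2"
proof -
  have *: "(profile.EN Z (p 0) (q 0) (deriv (p 0)) (deriv (q 0)))\<^sup>2 = (L2_norm Z (dx phi))\<^sup>2 + kap Z * (L2_norm Z phi)\<^sup>2"
    unfolding profile.EN_square[OF profile_at[OF zero_time]] phi L2_norm_dx[OF zero_time] mass_L2_norm[OF zero_time] mass_def ..
  show ?thesis
  proof (cases Z)
    case Line
    then show ?thesis unfolding * by (simp add: data_norm_def kap_def)
  next
    case Circle
    have "(sobolev_norm Circle 1 phi)\<^sup>2 = (weighted_norm Circle 1 (fourier Circle phi))\<^sup>2"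
      using sobolev_norm_weighted_norm[of Circle 1 phi] by simp
    also have "\<dots> = (L2_norm Circle phi)\<^sup>2 + (L2_norm Circle (dx phi))\<^sup>2"
      using weighted_norm_one_inv_ft[OF sobolev_inf_rapid(2)[OF u_sobolev[OF zero_time]]]
      unfolding u_inv_ft[OF zero_time zero_time] unfolding phi Circle .
    finally show ?thesis unfolding * using Circle by (simp add: data_norm_def kap_def)
  qed
qed

lemma half_derivative_norm:
  assumes t: "t \<in> {0..T}"
  shows "(L2_norm Z (D_half Z (dx (density_of (u t)))))\<^sup>2 = drho_half t"
proof -
  interpret profile Z al be "p t" "q t" by (rule profile_at[OF t])
  have dens: "density_of (u t) x = Complex (rho x) 0" for x
    unfolding density rho_def by (simp add: power2_eq_square complex_eq_iff)
  have "dx (density_of (u t)) x = cs (deriv rho) x" for x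
  proof -
    have z: "((\<lambda>_. 0) has_real_derivative 0) (at x)" by simp
    have "(density_of (u t) has_vector_derivative Complex (deriv rho x) 0) (at x)"
      unfolding has_vector_derivative_complex_iff dens using SS_DERIV[OF SS_rho] by simp
    then show ?thesis unfolding dx_def by (simp add: vector_derivative_at complex_eq_iff)
  qed
  then have "dx (density_of (u t)) = cs (deriv rho)" by auto
  then show ?thesis using D_half_norm[OF SS_deriv[OF SS_rho]] by (simp add: drho_half_def)
qed

text \<open>
  The bounds of dissipative_system_bounds with both energies compared at times 0 and t; powers of 1
  + m^2 become sums of powers of the norm of the data at the cost of a numerical factor.
\<close>

theorem a_priori_bounds:
  assumes be: "be < 0" and t: "t \<in> {0..T}" and diss: "dissipation_constant al be K"
    and C: "C \<ge> 8 * K / (- be)" "C \<ge> 32 * (2 + 4 * (\<bar>al\<bar> + \<bar>be\<bar>))\<^sup>2 / (- be)" "C \<ge> 16 * (2 + 4 * (\<bar>al\<bar> + \<bar>be\<bar>)) ^ 4"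
      "C \<ge> 2 * sqrt (8 * - be) * (2 + 4 * (\<bar>al\<bar> + \<bar>be\<bar>))"
  shows "(\<integral>\<^sup>+t'\<in>{0..t}. ennreal ((L2_norm Z (D_half Z (dx (density_of (u t')))))\<^sup>2) \<partial>lborel)
         \<le> ennreal (C * (1 + L2_norm Z phi ^ 4) * (data_norm Z phi)\<^sup>2 * exp (C * (1 + L2_norm Z phi ^ 6) * (L2_norm Z phi)\<^sup>2)) \<and>
       (L2_norm Z (dx (u t)))\<^sup>2
         \<le> C * (1 + L2_norm Z phi ^ 8) * (data_norm Z phi)\<^sup>2 * exp (C * (1 + L2_norm Z phi ^ 6) * (L2_norm Z phi)\<^sup>2) \<and>
       (L2_norm Z (u t))\<^sup>2
         \<ge> (L2_norm Z phi)\<^sup>2 * exp (- (C * sqrt t * (1 + (L2_norm Z phi)\<^sup>2) * data_norm Z phi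
              * exp (C * (1 + L2_norm Z phi ^ 6) * (L2_norm Z phi)\<^sup>2)))"
proof -
  define c where c_eq: "c = - be"
  have c: "c > 0" using be by (simp add: c_eq)
  have K: "K > 0" using diss by (simp add: dissipation_constant_def)
  define C1 where "C1 = 2 + 4 * (\<bar>al\<bar> + \<bar>be\<bar>)"
  have C1: "C1 \<ge> 0" by (simp add: C1_def)
  define N M D where "N = L2_norm Z phi" and "M = N\<^sup>2" and "D = data_norm Z phi"
  have N0: "N \<ge> 0" by (simp add: N_def L2_norm_def)
  have M0: "M \<ge> 0" by (simp add: M_def)
  have D0: "D \<ge> 0" by (auto simp: D_def data_norm_def L2_norm_def sobolev_norm_def split: domain.split)
  have mm0: "mass 0 = M" using mass_L2_norm[OF zero_time] by (simp add: M_def N_def phi)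
  define G0 where "G0 = gauged_energy 0 * exp (K * (1 + mass 0) ^ 3 * mass 0 / c)"
  define e where "e s = 2 * space_int Z (\<lambda>x. profile.w1 Z al be (p s) (q s) x * profile.w1t Z al be (p s) (q s) x
       + profile.w2 Z al be (p s) (q s) x * profile.w2t Z al be (p s) (q s) x) + kap Z * (be * rho_half s)" for s
  have sys: "(mass has_real_derivative - c * rho_half s) (at s within {0..T})"
    "(gauged_energy has_real_derivative e s) (at s within {0..T})"
    "e s \<le> - c / 8 * drho_half s + K * (1 + mass s) ^ 3 * gauged_energy s * rho_half s"
    "0 \<le> mass s" "0 \<le> gauged_energy s" "0 \<le> rho_half s" "0 \<le> drho_half s" "rho_half s \<le> 2 * mass s * sqrt (drho_half s)"
    if s: "s \<in> {0..T}" for s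
  proof -
    interpret profile Z al be "p s" "q s" by (rule profile_at[OF s])
    show "(mass has_real_derivative - c * rho_half s) (at s within {0..T})" using mass_deriv[OF s] by (simp add: c_eq)
    show "(gauged_energy has_real_derivative e s) (at s within {0..T})" using gauged_energy_deriv[OF s] by (simp add: e_def)
    show "e s \<le> - c / 8 * drho_half s + K * (1 + mass s) ^ 3 * gauged_energy s * rho_half s"
      using conjunct2[OF diss[unfolded dissipation_constant_def], rule_format, OF profile_at[OF s]]
      by (simp add: e_def c_eq rho_half_def drho_half_def mass_def gauged_energy_def W1_def W2_def)
    show "0 \<le> mass s" "0 \<le> gauged_energy s" by (simp_all add: mass_def gauged_energy_def)
    show "0 \<le> rho_half s" "0 \<le> drho_half s" unfolding rho_half_def drho_half_def by (intro hs_nonneg SS_deriv SS_rho)+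
    show "rho_half s \<le> 2 * mass s * sqrt (drho_half s)"
      using a_le unfolding abd_square b_def by (simp add: rho_half_def drho_half_def mass_def)
  qed
  note bounds = dissipative_system_bounds[OF c less_imp_le[OF K] t sys, folded G0_def]
  define X where "X = K * (1 + M) ^ 3 * M / c"
  define Y where "Y = exp (C * (1 + N ^ 6) * M)"
  have C0: "C \<ge> 0" using C(3) order_trans[OF _ C(3), of 0] by simp
  have Y1: "Y \<ge> 1" unfolding Y_def using C0 N0 M0 by simp
  have XY: "exp X \<le> Y"
  proof -
    have "X = (K / c * M) * (1 + M) ^ 3" by (simp add: X_def)
    also have "\<dots> \<le> (K / c * M) * (2 ^ 3 * (1 + M ^ 3))"
      using K c M0 by (intro mult_left_mono one_plus_power_le) auto
    also have "\<dots> = (8 * K / c) * ((1 + N ^ 6) * M)" by (simp add: M_def power_mult[symmetric])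
    also have "\<dots> \<le> C * ((1 + N ^ 6) * M)"
      using C(1) M0 N0 by (intro mult_right_mono) (auto simp: c_eq)
    finally show ?thesis by (simp add: Y_def mult.assoc)
  qed
  have EE0: "gauged_energy 0 \<le> C1\<^sup>2 * (1 + M)\<^sup>2 * D\<^sup>2"
  proof -
    interpret profile Z al be "p 0" "q 0" by (rule profile_at[OF zero_time])
    have "(EN w1 w2)\<^sup>2 \<le> ((2 + 4 * L) * (1 + m\<^sup>2) * EN (deriv (p 0)) (deriv (q 0)))\<^sup>2"
      using E_le EN_nonneg by (intro power_mono) auto
    also have "\<dots> = (2 + 4 * L)\<^sup>2 * (1 + m\<^sup>2)\<^sup>2 * (EN (deriv (p 0)) (deriv (q 0)))\<^sup>2" by (simp add: power_mult_distrib)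
    also have "\<dots> = C1\<^sup>2 * (1 + M)\<^sup>2 * D\<^sup>2"
      unfolding data_norm_energy[symmetric] D_def mm0[symmetric] mass_def C1_def L_def ..
    finally show ?thesis by (simp add: gauged_energy_def W1_def W2_def)
  qed
  have G0_le: "G0 \<le> C1\<^sup>2 * (1 + M)\<^sup>2 * D\<^sup>2 * exp X"
    unfolding G0_def mm0 X_def using EE0 by (intro mult_right_mono) auto
  have G0Y: "G0 \<le> C1\<^sup>2 * (1 + M)\<^sup>2 * D\<^sup>2 * Y"
    by (rule order_trans[OF G0_le]) (intro mult_left_mono XY, simp)
  have first: "(\<integral>\<^sup>+t'\<in>{0..t}. ennreal ((L2_norm Z (D_half Z (dx (density_of (u t')))))\<^sup>2) \<partial>lborel)
      \<le> ennreal (C * (1 + N ^ 4) * D\<^sup>2 * Y)"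
  proof -
    have "(\<integral>\<^sup>+t'\<in>{0..t}. ennreal ((L2_norm Z (D_half Z (dx (density_of (u t')))))\<^sup>2) \<partial>lborel)
       = (\<integral>\<^sup>+s\<in>{0..t}. ennreal (drho_half s) \<partial>lborel)"
      by (rule nn_integral_cong) (use t half_derivative_norm in \<open>auto split: split_indicator\<close>)
    also have "\<dots> \<le> ennreal (8 / c * G0)" by (rule bounds(3))
    also have "\<dots> \<le> ennreal (C * (1 + N ^ 4) * D\<^sup>2 * Y)"
    proof (rule ennreal_leI)
      have "8 / c * G0 \<le> 8 / c * (C1\<^sup>2 * (1 + M)\<^sup>2 * D\<^sup>2 * Y)" using G0Y c by (intro mult_left_mono) auto
      also have "\<dots> = (8 * C1\<^sup>2 / c * (D\<^sup>2 * Y)) * (1 + M)\<^sup>2" by simp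
      also have "\<dots> \<le> (8 * C1\<^sup>2 / c * (D\<^sup>2 * Y)) * (2\<^sup>2 * (1 + M\<^sup>2))"
        using c M0 Y1 by (intro mult_left_mono one_plus_power_le) auto
      also have "\<dots> = (32 * C1\<^sup>2 / c) * ((1 + N ^ 4) * (D\<^sup>2 * Y))" by (simp add: M_def power_mult[symmetric])
      also have "\<dots> \<le> C * ((1 + N ^ 4) * (D\<^sup>2 * Y))"
        using C(2) N0 Y1 by (intro mult_right_mono) (auto simp: c_eq C1_def)
      finally show "8 / c * G0 \<le> C * (1 + N ^ 4) * D\<^sup>2 * Y" by (simp add: mult.assoc)
    qed
    finally show ?thesis .
  qed
  have second: "(L2_norm Z (dx (u t)))\<^sup>2 \<le> C * (1 + N ^ 8) * D\<^sup>2 * Y"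
  proof -
    interpret profile Z al be "p t" "q t" by (rule profile_at[OF t])
    have "(L2_norm Z (dx (u t)))\<^sup>2 \<le> (EN (deriv (p t)) (deriv (q t)))\<^sup>2"
      unfolding L2_norm_dx[OF t] EN_square using kap_nonneg by simp
    also have "\<dots> \<le> ((2 + 4 * L) * (1 + m\<^sup>2) * EN w1 w2)\<^sup>2"
      using E1_le EN_nonneg by (intro power_mono) auto
    also have "\<dots> = C1\<^sup>2 * (1 + mass t)\<^sup>2 * gauged_energy t"
      unfolding C1_def L_def mass_def gauged_energy_def W1_def W2_def by (simp add: power_mult_distrib)
    also have "\<dots> \<le> C1\<^sup>2 * (1 + M)\<^sup>2 * (C1\<^sup>2 * (1 + M)\<^sup>2 * D\<^sup>2 * Y)"
    proof (intro mult_mono power_mono)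
      show "gauged_energy t \<le> C1\<^sup>2 * (1 + M)\<^sup>2 * D\<^sup>2 * Y" using bounds(2) G0Y by simp
      show "1 + mass t \<le> 1 + M" using bounds(1) mm0 by simp
    qed (use C1 in \<open>auto simp: mass_def gauged_energy_def\<close>)
    also have "\<dots> = (C1 ^ 4 * (D\<^sup>2 * Y)) * (1 + M) ^ 4" by (simp add: eval_nat_numeral)
    also have "\<dots> \<le> (C1 ^ 4 * (D\<^sup>2 * Y)) * (2 ^ 4 * (1 + M ^ 4))"
      using M0 Y1 C1 by (intro mult_left_mono one_plus_power_le) auto
    also have "\<dots> = (16 * C1 ^ 4) * ((1 + N ^ 8) * (D\<^sup>2 * Y))" by (simp add: M_def power_mult[symmetric])
    also have "\<dots> \<le> C * ((1 + N ^ 8) * (D\<^sup>2 * Y))"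
      using C(3) N0 Y1 by (intro mult_right_mono) (auto simp: C1_def)
    finally show ?thesis by (simp add: mult.assoc)
  qed
  have third: "(L2_norm Z (u t))\<^sup>2 \<ge> M * exp (- (C * sqrt t * (1 + M) * D * Y))"
  proof -
    have t0: "t \<ge> 0" using t by simp
    have "G0 \<le> (C1 * (1 + M) * D * Y)\<^sup>2"
    proof -
      have "C1\<^sup>2 * (1 + M)\<^sup>2 * D\<^sup>2 * Y \<le> C1\<^sup>2 * (1 + M)\<^sup>2 * D\<^sup>2 * Y\<^sup>2"
        using Y1 self_le_power[of Y 2] by (intro mult_left_mono) auto
      then show ?thesis using G0Y by (simp add: power_mult_distrib)
    qed
    then have "sqrt G0 \<le> C1 * (1 + M) * D * Y"
      using C1 M0 D0 Y1 by (intro real_le_lsqrt) auto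
    then have "(2 * sqrt (8 * c) * sqrt t) * sqrt G0 \<le> (2 * sqrt (8 * c) * sqrt t) * (C1 * (1 + M) * D * Y)"
      using c t0 by (intro mult_left_mono) auto
    also have "\<dots> = (2 * sqrt (8 * c) * C1) * (sqrt t * (1 + M) * D * Y)" by simp
    also have "\<dots> \<le> C * (sqrt t * (1 + M) * D * Y)"
      using C(4) t0 M0 D0 Y1 by (intro mult_right_mono) (auto simp: c_eq C1_def)
    finally have "2 * sqrt (8 * c * t * G0) \<le> C * sqrt t * (1 + M) * D * Y"
      by (simp add: real_sqrt_mult mult.assoc)
    then have "M * exp (- (C * sqrt t * (1 + M) * D * Y)) \<le> M * exp (- (2 * sqrt (8 * c * t * G0)))"
      using M0 by (intro mult_left_mono) auto
    also have "\<dots> \<le> mass t" using bounds(4) unfolding mm0 .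
    finally show ?thesis unfolding mass_L2_norm[OF t] .
  qed
  show ?thesis using first second third unfolding M_def N_def D_def Y_def by blast
qed

end

text \<open>
  The second summand of C dominates 1 / (- \<beta>), which makes C unbounded as \<beta> tends to 0.
\<close>

theorem proposition4p2:
  "\<exists>C :: real \<Rightarrow> real \<Rightarrow> real.
     (\<forall>\<alpha> \<beta>. \<beta> < 0 \<longrightarrow> C \<alpha> \<beta> > 0) \<and>
     (\<forall>\<alpha>. filterlim (C \<alpha>) at_top (at_left 0)) \<and>
     (\<forall>\<alpha> \<beta> Z T \<phi> u t. \<beta> < 0 \<longrightarrow> T > 0 \<longrightarrow> smooth_solution Z \<alpha> \<beta> T \<phi> u \<longrightarrow> t \<in> {0..T} \<longrightarrow>
       (\<integral>\<^sup>+t'\<in>{0..t}. ennreal ((L2_norm Z (D_half Z (dx (density_of (u t')))))\<^sup>2) \<partial>lborel)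
         \<le> ennreal (C \<alpha> \<beta> * (1 + L2_norm Z \<phi> ^ 4) * (data_norm Z \<phi>)\<^sup>2
              * exp (C \<alpha> \<beta> * (1 + L2_norm Z \<phi> ^ 6) * (L2_norm Z \<phi>)\<^sup>2)) \<and>
       (L2_norm Z (dx (u t)))\<^sup>2
         \<le> C \<alpha> \<beta> * (1 + L2_norm Z \<phi> ^ 8) * (data_norm Z \<phi>)\<^sup>2
              * exp (C \<alpha> \<beta> * (1 + L2_norm Z \<phi> ^ 6) * (L2_norm Z \<phi>)\<^sup>2) \<and>
       (L2_norm Z (u t))\<^sup>2
         \<ge> (L2_norm Z \<phi>)\<^sup>2 * exp (- (C \<alpha> \<beta> * sqrt t * (1 + (L2_norm Z \<phi>)\<^sup>2) * data_norm Z \<phi>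
              * exp (C \<alpha> \<beta> * (1 + L2_norm Z \<phi> ^ 6) * (L2_norm Z \<phi>)\<^sup>2))))"
proof -
  have "\<forall>al be. \<exists>K. be < 0 \<longrightarrow> dissipation_constant al be K"
    using energy_dissipation by blast
  then obtain K where K: "\<And>al be. be < 0 \<Longrightarrow> dissipation_constant al be (K al be)" by metis
  define C where "C al be = 8 * K al be / (- be) + 32 * (2 + 4 * (\<bar>al\<bar> + \<bar>be\<bar>))\<^sup>2 / (- be) + 16 * (2 + 4 * (\<bar>al\<bar> + \<bar>be\<bar>)) ^ 4
      + 2 * sqrt (8 * - be) * (2 + 4 * (\<bar>al\<bar> + \<bar>be\<bar>))" for al be
  have K0: "K al be > 0" if "be < 0" for al be using K[OF that] by (simp add: dissipation_constant_def)
  have parts: "8 * K al be / (- be) \<ge> 0" "32 * (2 + 4 * (\<bar>al\<bar> + \<bar>be\<bar>))\<^sup>2 / (- be) \<ge> 0" "16 * (2 + 4 * (\<bar>al\<bar> + \<bar>be\<bar>)) ^ 4 > 0"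
    "2 * sqrt (8 * - be) * (2 + 4 * (\<bar>al\<bar> + \<bar>be\<bar>)) \<ge> 0" if "be < 0" for al be
  proof -
    have "2 + 4 * (\<bar>al\<bar> + \<bar>be\<bar>) > 0" by (simp add: add_pos_nonneg)
    then show "16 * (2 + 4 * (\<bar>al\<bar> + \<bar>be\<bar>)) ^ 4 > 0" by simp
    show "8 * K al be / (- be) \<ge> 0" using that K0[OF that, of al] by (intro divide_nonneg_pos) auto
    show "32 * (2 + 4 * (\<bar>al\<bar> + \<bar>be\<bar>))\<^sup>2 / (- be) \<ge> 0" using that by (intro divide_nonneg_pos) auto
    show "2 * sqrt (8 * - be) * (2 + 4 * (\<bar>al\<bar> + \<bar>be\<bar>)) \<ge> 0" using that by (intro mult_nonneg_nonneg) auto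
  qed
  show ?thesis
  proof (intro exI[of _ C] conjI allI impI)
    show "C \<alpha> \<beta> > 0" if "\<beta> < 0" for \<alpha> \<beta>
      using parts[OF that, of \<alpha>] by (simp only: C_def)
    show "filterlim (C \<alpha>) at_top (at_left 0)" for \<alpha>
    proof (rule filterlim_at_top_mono)
      show "filterlim (\<lambda>\<beta>::real. 1 / (- \<beta>)) at_top (at_left 0)" by real_asymp
      have "1 / (- \<beta>) \<le> C \<alpha> \<beta>" if b: "\<beta> < 0" for \<beta>
      proof -
        have "(1::real) \<le> 32 * (2 + 4 * (\<bar>\<alpha>\<bar> + \<bar>\<beta>\<bar>))\<^sup>2"
        proof -
          have "(1::real) \<le> (2 + 4 * (\<bar>\<alpha>\<bar> + \<bar>\<beta>\<bar>))\<^sup>2" by (rule one_le_power) simp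
          then show ?thesis by argo
        qed
        then have "1 / (- \<beta>) \<le> 32 * (2 + 4 * (\<bar>\<alpha>\<bar> + \<bar>\<beta>\<bar>))\<^sup>2 / (- \<beta>)"
          using b by (intro divide_right_mono) auto
        then show ?thesis using parts[OF b, of \<alpha>] unfolding C_def by argo
      qed
      then show "\<forall>\<^sub>F \<beta> in at_left 0. 1 / (- \<beta>) \<le> C \<alpha> \<beta>"
        by (auto simp: eventually_at_filter)
    qed
    fix \<alpha> \<beta> T t :: real and Z \<phi> u
    assume H: "\<beta> < 0" "T > 0" "smooth_solution Z \<alpha> \<beta> T \<phi> u" "t \<in> {0..T}"
    interpret solution Z \<alpha> \<beta> T \<phi> u by (rule solution.intro[OF H(2,3)])
    have Cs: "C \<alpha> \<beta> \<ge> 8 * K \<alpha> \<beta> / (- \<beta>)" "C \<alpha> \<beta> \<ge> 32 * (2 + 4 * (\<bar>\<alpha>\<bar> + \<bar>\<beta>\<bar>))\<^sup>2 / (- \<beta>)" "C \<alpha> \<beta> \<ge> 16 * (2 + 4 * (\<bar>\<alpha>\<bar> + \<bar>\<beta>\<bar>)) ^ 4"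
      "C \<alpha> \<beta> \<ge> 2 * sqrt (8 * - \<beta>) * (2 + 4 * (\<bar>\<alpha>\<bar> + \<bar>\<beta>\<bar>))"
      using parts[OF H(1), of \<alpha>] unfolding C_def by argo+
    note fin = a_priori_bounds[OF H(1,4) K[OF H(1)] Cs]
    show "(\<integral>\<^sup>+t'\<in>{0..t}. ennreal ((L2_norm Z (D_half Z (dx (density_of (u t')))))\<^sup>2) \<partial>lborel)
         \<le> ennreal (C \<alpha> \<beta> * (1 + L2_norm Z \<phi> ^ 4) * (data_norm Z \<phi>)\<^sup>2
              * exp (C \<alpha> \<beta> * (1 + L2_norm Z \<phi> ^ 6) * (L2_norm Z \<phi>)\<^sup>2))"
      using fin by blast
    show "(L2_norm Z (dx (u t)))\<^sup>2
         \<le> C \<alpha> \<beta> * (1 + L2_norm Z \<phi> ^ 8) * (data_norm Z \<phi>)\<^sup>2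
              * exp (C \<alpha> \<beta> * (1 + L2_norm Z \<phi> ^ 6) * (L2_norm Z \<phi>)\<^sup>2)" using fin by blast
    show "(L2_norm Z (u t))\<^sup>2
         \<ge> (L2_norm Z \<phi>)\<^sup>2 * exp (- (C \<alpha> \<beta> * sqrt t * (1 + (L2_norm Z \<phi>)\<^sup>2) * data_norm Z \<phi>
              * exp (C \<alpha> \<beta> * (1 + L2_norm Z \<phi> ^ 6) * (L2_norm Z \<phi>)\<^sup>2)))" using fin by blast
  qed
qed

end
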